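(* The only nonempty acyclic sets $\mathcal A(\mathcal K(i,j))$ of the line bundles $\mathcal K(i,j)$, $i,j\in\mathbb Z$, on $S$ are: \[ \begin{aligned} \mathcal A(\mathcal K(1,-2))&=\{[0,0]\}\\ \mathcal A(\mathcal K(1,-1))&=\{[0,3],[2,0],[3,2]\}\\ \mathcal A(\mathcal K(1,0))&=\{[0,0],[0,1],[0,2],[1,4],[2,3],[3,0],[4,0]\}\\ \mathcal A(\mathcal K(1,1))&=\{[0,0],[1,2],[2,1],[2,2],[3,3],[3,4],[4,3]\}\\ \mathcal A(\mathcal K(1,2))&=\{[0,0],[0,3],[0,4],[1,0],[2,0],[3,2],[4,1]\}\\ \mathcal A(\mathcal K(1,3))&=\{[0,2],[2,3],[3,0]\}\\ \mathcal A(\mathcal K(1,4))&=\{[0,0]\}\\ \mathcal A(\mathcal K(-1,1))&=\{[0,0]\}\\ \mathcal A(\mathcal K(0,1))&=\{[0,0],[3,3],[3,4],[4,3]\}\\ \mathcal A(\mathcal K(2,1))&=\{[0,0],[1,2],[2,1],[2,2]\}\\ \mathcal A(\mathcal K(3,1))&=\{[0,0]\}. \end{aligned} \]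
   Context: Work over $\mathbb C$; $\zeta_5$ is a primitive 5th root of unity. Let $G=(\mathbb Z/5)^2=\mathbb Z/5\cdot e_1\oplus\mathbb Z/5\cdot e_2$. For $i,j\in\mathbb Z/5$, $[i,j]$ denotes the character $e_1\mapsto\zeta_5^i$, $e_2\mapsto\zeta_5^j$ of $G$; for a $G$-linearized line bundle $L$, $L[i,j]$ denotes $L$ with linearization twisted by this character. Let $C$ and $C'$ be two copies of the Fermat quintic $X^5+Y^5+Z^5=0$ in $\mathbb P^2$. $G$ acts on $C$ by $e_1(X:Y:Z)=(\zeta_5X:Y:Z)$, $e_2(X:Y:Z)=(X:\zeta_5Y:Z)$, and on $C'$ by $e_1(X:Y:Z)=(\zeta_5^2X:\zeta_5^4Y:Z)$, $e_2(X:Y:Z)=(\zeta_5X:\zeta_5^3Y:Z)$. Cohomology groups of linearized bundles are $G$-representations via pullback; $\mathcal O_C(1)$ is linearized so that the sections $X,Y,Z$ have characters $[1,0],[0,1],[0,0]$, and $\mathcal O_{C'}(1)$ so that $X,Y,Z$ have characters $[2,1],[4,3],[0,0]$. The diagonal $G$-action on $T=C\times C'$ is free; $S=T/G$ is the Beauville surface. Line bundles on $S$ are identified with $G$-linearized line bundles on $T$ via pullback. With $p_1,p_2$ the projections of $T$, set $\mathcal O(i,j)=p_1^*\mathcal O_C(i)\otimes p_2^*\mathcal O_{C'}(j)$ and $\mathcal K(i,j)=\mathcal O(i,j)[3i+3j,\,3i+2j]$ for $i,j\in\mathbb Z$. For a $G$-linearized line bundle $L$ on $T$, the acyclic set $\mathcal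 A(L)$ is the set of characters $\chi\in\mathrm{Hom}(G,\mathbb C^* )$ that do not occur in the $G$-representation $\bigoplus_kH^k(T,L)$. (Equivalently, $L(\chi)$, viewed on $S$, has $H^*(S,L(\chi))=0$ if and only if $-\chi\in\mathcal A(L)$.) *)

theory Defs
  imports "HOL-Analysis.Analysis"
begin

section \<open>The group and its characters\<close>

text \<open>The numeral type \<^typ>\<open>5\<close> is the ring of integers modulo 5, so this type, with
  componentwise addition, is the group \<open>(\<int>/5)\<^sup>2\<close> with \<open>e\<^sub>1 = (1, 0)\<close>, \<open>e\<^sub>2 = (0, 1)\<close>.\<close>

type_synonym grp = "5 \<times> 5"

definition primitive_root5 :: "complex \<Rightarrow> bool" where
  "primitive_root5 \<zeta> \<longleftrightarrow> \<zeta> ^ 5 = 1 \<and> (\<forall>k\<in>{1..<5}. \<zeta> ^ k \<noteq> 1)"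

text \<open>\<^const>\<open>Rep_bit1\<close> gives the representative of a residue class in \<open>{0..4}\<close>.\<close>

definition rpow :: "complex \<Rightarrow> 5 \<Rightarrow> complex" where
  "rpow \<zeta> k = \<zeta> ^ nat (Rep_bit1 k)"

definition characters :: "(grp \<Rightarrow> complex) set" where
  "characters = {\<psi>. (\<forall>g. \<psi> g \<noteq> 0) \<and> (\<forall>g h. \<psi> (g + h) = \<psi> g * \<psi> h)}"

text \<open>\<open>chr \<zeta> (i, j)\<close> is the character written \<open>[i, j]\<close>.\<close>

definition chr :: "complex \<Rightarrow> 5 \<times> 5 \<Rightarrow> grp \<Rightarrow> complex" where
  "chr \<zeta> = (\<lambda>(i, j) (a, b). rpow \<zeta> (i * a + j * b))"

section \<open>The surface \<open>T\<close>, its group action and its Zariski topology\<close>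

text \<open>A point of the projective plane is the set of all its homogeneous coordinate vectors.\<close>

definition pt :: "complex^3 \<Rightarrow> (complex^3) set" where
  "pt v = {c *s v | c. c \<noteq> 0}"

definition fermat :: "(complex^3) set set" where
  "fermat = {pt v | v. v \<noteq> 0 \<and> (v$1)^5 + (v$2)^5 + (v$3)^5 = 0}"

type_synonym point = "(complex^3) set \<times> (complex^3) set"

definition T :: "point set" where
  "T = fermat \<times> fermat"

definition act1 :: "complex \<Rightarrow> grp \<Rightarrow> complex^3 \<Rightarrow> complex^3" where
  "act1 \<zeta> = (\<lambda>(a, b) v. vector [rpow \<zeta> a * v$1, rpow \<zeta> b * v$2, v$3])"

definition act2 :: "complex \<Rightarrow> grp \<Rightarrow> complex^3 \<Rightarrow> complex^3" where
  "act2 \<zeta> = (\<lambda>(a, b) w. vector [rpow \<zeta> (2 * a + b) * w$1, rpow \<zeta> (4 * a + 3 * b) * w$2, w$3])"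

definition actT :: "complex \<Rightarrow> grp \<Rightarrow> point \<Rightarrow> point" where
  "actT \<zeta> g = (\<lambda>(P, Q). (act1 \<zeta> g ` P, act2 \<zeta> g ` Q))"

type_synonym cfun = "complex^3 \<Rightarrow> complex^3 \<Rightarrow> complex"

definition exps :: "nat \<Rightarrow> (3 \<Rightarrow> nat) set" where
  "exps n = {\<alpha>. (\<Sum>k\<in>UNIV. \<alpha> k) = n}"

definition monom3 :: "(3 \<Rightarrow> nat) \<Rightarrow> complex^3 \<Rightarrow> complex" where
  "monom3 \<alpha> v = (\<Prod>k\<in>UNIV. (v$k) ^ \<alpha> k)"

text \<open>Bihomogeneous polynomials of bidegree \<open>(m, n)\<close>, as functions of the homogeneous
  coordinates of the two factors.\<close>

definition bihom :: "nat \<Rightarrow> nat \<Rightarrow> cfun set" where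
  "bihom m n = {\<lambda>v w. \<Sum>\<alpha>\<in>exps m. \<Sum>\<beta>\<in>exps n. c \<alpha> \<beta> * monom3 \<alpha> v * monom3 \<beta> w | c. True}"

definition zopen :: "point set \<Rightarrow> bool" where
  "zopen U \<longleftrightarrow> (\<exists>A \<subseteq> (\<Union>m n. bihom m n).
     U = {(pt v, pt w) | v w. (pt v, pt w) \<in> T \<and> (\<exists>f\<in>A. f v w \<noteq> 0)})"

section \<open>Linearized sheaves\<close>

text \<open>A section over \<open>U\<close> of a line bundle on \<open>T\<close> is encoded as a function of homogeneous
  coordinates, that is, as a function on the cone over \<open>U\<close>, extended by 0 to all pairs of vectors.
  The linearization is given by the pullback maps from sections over \<open>U\<close> to sections over
  \<open>g\<^sup>-\<^sup>1 U\<close>.\<close>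

record lin_sheaf =
  sect :: "point set \<Rightarrow> cfun set"
  pull :: "grp \<Rightarrow> cfun \<Rightarrow> cfun"

definition restr :: "point set \<Rightarrow> cfun \<Rightarrow> cfun" where
  "restr U s = (\<lambda>v w. if (pt v, pt w) \<in> U then s v w else 0)"

text \<open>Sections of \<open>\<O>(i, j)\<close>: locally quotients of bihomogeneous polynomials, of total bidegree
  \<open>(i, j)\<close>.\<close>

definition O_sect :: "int \<Rightarrow> int \<Rightarrow> point set \<Rightarrow> cfun set" where
  "O_sect i j U = {s. restr U s = s \<and>
     (\<forall>x\<in>U. \<exists>V m n m' n'. \<exists>p\<in>bihom m n. \<exists>q\<in>bihom m' n'.
        zopen V \<and> x \<in> V \<and> V \<subseteq> U \<and> int m - int m' = i \<and> int n - int n' = j \<and>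
        (\<forall>v w. (pt v, pt w) \<in> V \<longrightarrow> q v w \<noteq> 0 \<and> s v w = p v w / q v w))}"

text \<open>Pulling back along the lifts \<^const>\<open>act1\<close>, \<^const>\<open>act2\<close> of the actions to homogeneous
  coordinates gives the sections \<open>X, Y, Z\<close> the characters \<open>[1,0], [0,1], [0,0]\<close> on the first
  factor and \<open>[2,1], [4,3], [0,0]\<close> on the second.\<close>

definition O_bundle :: "complex \<Rightarrow> int \<Rightarrow> int \<Rightarrow> lin_sheaf" where
  "O_bundle \<zeta> i j = \<lparr>sect = O_sect i j, pull = (\<lambda>g s v w. s (act1 \<zeta> g v) (act2 \<zeta> g w))\<rparr>"

definition twist :: "lin_sheaf \<Rightarrow> (grp \<Rightarrow> complex) \<Rightarrow> lin_sheaf" where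
  "twist L \<psi> = L\<lparr>pull := (\<lambda>g s v w. \<psi> g * pull L g s v w)\<rparr>"

definition K :: "complex \<Rightarrow> int \<Rightarrow> int \<Rightarrow> lin_sheaf" where
  "K \<zeta> i j = twist (O_bundle \<zeta> i j) (chr \<zeta> (of_int (3*i + 3*j), of_int (3*i + 2*j)))"

section \<open>Cohomology\<close>

text \<open>\<open>H\<^sup>k(T, L)\<close> is Cech cohomology in the Zariski topology, the colimit over all open covers
  under refinement (as in Serre's FAC); for coherent sheaves on a variety this is sheaf cohomology.
  A cover is a set of open sets; a \<open>k\<close>-cochain assigns to each list of \<open>k + 1\<close> members of the cover
  a section over their intersection, and its values on other lists are irrelevant.  An element of
  the colimit is represented by a cover and a cocycle on it.\<close>

type_synonym cochain = "point set list \<Rightarrow> cfun"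

definition open_cover :: "point set set \<Rightarrow> bool" where
  "open_cover \<U> \<longleftrightarrow> (\<forall>U\<in>\<U>. zopen U) \<and> \<Union>\<U> = T"

definition simplices :: "point set set \<Rightarrow> nat \<Rightarrow> point set list set" where
  "simplices \<U> k = {xs. length xs = Suc k \<and> set xs \<subseteq> \<U>}"

definition cochains :: "lin_sheaf \<Rightarrow> point set set \<Rightarrow> nat \<Rightarrow> cochain set" where
  "cochains L \<U> k = {c. \<forall>xs\<in>simplices \<U> k. c xs \<in> sect L (\<Inter>(set xs))}"

definition delta :: "cochain \<Rightarrow> cochain" where
  "delta c xs = restr (\<Inter>(set xs))
     (\<lambda>v w. \<Sum>l<length xs. (-1)^l * c (take l xs @ drop (Suc l) xs) v w)"

definition cocycles :: "lin_sheaf \<Rightarrow> point set set \<Rightarrow> nat \<Rightarrow> cochain set" where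
  "cocycles L \<U> k = {c\<in>cochains L \<U> k. \<forall>xs\<in>simplices \<U> (Suc k). delta c xs = (\<lambda>v w. 0)}"

definition coboundaries :: "lin_sheaf \<Rightarrow> point set set \<Rightarrow> nat \<Rightarrow> cochain set" where
  "coboundaries L \<U> k = (case k of
      0 \<Rightarrow> {c. \<forall>xs\<in>simplices \<U> 0. c xs = (\<lambda>v w. 0)}
    | Suc k' \<Rightarrow> {c. \<exists>b\<in>cochains L \<U> k'. \<forall>xs\<in>simplices \<U> k. c xs = delta b xs})"

definition refinement :: "point set set \<Rightarrow> point set set \<Rightarrow> (point set \<Rightarrow> point set) \<Rightarrow> bool" where
  "refinement \<W> \<U> \<tau> \<longleftrightarrow> (\<forall>W\<in>\<W>. \<tau> W \<in> \<U> \<and> W \<subseteq> \<tau> W)"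

definition refine :: "(point set \<Rightarrow> point set) \<Rightarrow> cochain \<Rightarrow> cochain" where
  "refine \<tau> c xs = restr (\<Inter>(set xs)) (c (map \<tau> xs))"

text \<open>Two cocycles on two covers represent the same class if their restrictions to some common
  refinement are cohomologous.\<close>

definition same_class ::
  "lin_sheaf \<Rightarrow> nat \<Rightarrow> point set set \<Rightarrow> cochain \<Rightarrow> point set set \<Rightarrow> cochain \<Rightarrow> bool" where
  "same_class L k \<U> c \<V> d \<longleftrightarrow> (\<exists>\<W> \<sigma> \<tau>. open_cover \<W> \<and> refinement \<W> \<U> \<sigma> \<and> refinement \<W> \<V> \<tau> \<and>
     (\<lambda>xs v w. refine \<sigma> c xs v w - refine \<tau> d xs v w) \<in> coboundaries L \<W> k)"

text \<open>The pullback \<open>g\<^sup>* c\<close> lives on the cover by the sets \<open>g\<^sup>-\<^sup>1 U\<close>.\<close>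

definition pull_cover :: "complex \<Rightarrow> grp \<Rightarrow> point set set \<Rightarrow> point set set" where
  "pull_cover \<zeta> g \<U> = (\<lambda>U. actT \<zeta> (- g) ` U) ` \<U>"

definition pull_cochain :: "complex \<Rightarrow> lin_sheaf \<Rightarrow> grp \<Rightarrow> cochain \<Rightarrow> cochain" where
  "pull_cochain \<zeta> L g c xs = pull L g (c (map (\<lambda>V. actT \<zeta> g ` V) xs))"

text \<open>\<open>\<psi>\<close> occurs in \<open>H\<^sup>k(T, L)\<close>: there is a nonzero class on which every \<open>g\<close> acts as \<open>\<psi> g\<close>.\<close>

definition occurs :: "complex \<Rightarrow> lin_sheaf \<Rightarrow> nat \<Rightarrow> (grp \<Rightarrow> complex) \<Rightarrow> bool" where
  "occurs \<zeta> L k \<psi> \<longleftrightarrow> (\<exists>\<U> c. open_cover \<U> \<and> c \<in> cocycles L \<U> k \<and>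
     \<not> same_class L k \<U> c \<U> (\<lambda>xs v w. 0) \<and>
     (\<forall>g. same_class L k (pull_cover \<zeta> g \<U>) (pull_cochain \<zeta> L g c)
            \<U> (\<lambda>xs v w. \<psi> g * c xs v w)))"

text \<open>A character occurs in the direct sum of the \<open>H\<^sup>k(T, L)\<close> iff it occurs in one of them.\<close>

definition acyclic_set :: "complex \<Rightarrow> lin_sheaf \<Rightarrow> (grp \<Rightarrow> complex) set" where
  "acyclic_set \<zeta> L = {\<psi>\<in>characters. \<not> (\<exists>k. occurs \<zeta> L k \<psi>)}"

end

theory Submission
  imports Defs "HOL-Computational_Algebra.Fundamental_Theorem_Algebra"
begin

text \<open>Let \<open>E\<close> be the product of an affine open set \<open>X \<noteq> 0\<close> or \<open>Y \<noteq> 0\<close> of the first Fermat curve with one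
  of the second.  These four sets cover \<open>T\<close> and are stable under the group.  By the Nullstellensatz the
  equations of any finite cover generate the unit ideal on an affine set \<open>E\<close>, so the Cech complex of
  the cover is exact over \<open>E\<close> in positive degrees, and a double complex compares it with the Cech
  complex of the four sets.  Averaging over the group, this can be done inside one isotypic
  component.  Sections over intersections of the four sets have a unique expansion in the monomials
  \<open>X\<^sup>p Y\<^sup>q Z\<^sup>c X'\<^sup>p\<^sup>' Y'\<^sup>q\<^sup>' Z'\<^sup>c\<^sup>'\<close> with \<open>0 \<le> c, c' \<le> 4\<close>, and a monomial contributes to cohomology if and only if
  \<open>p, q\<close> have the same sign and \<open>p', q'\<close> have the same sign.  A weight with residues \<open>a, b\<close> of \<open>p, q\<close> modulo 5 is
  thus realized in degree \<open>i\<close> unless \<open>i < a + b < i + 6\<close>.  Outside a bounded window of degrees every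
  character is hit; inside it the claim is a finite computation.\<close>

text \<open>Refinement only makes covers finer, so a class given on an arbitrary cover cannot be
  moved to the four-set cover. This forces two separate arguments. To exclude a character, the cover
  is refined to a finite group-stable cover by principal open sets, each inside one of the four
  sets, and the double complex is run there. To realize a character, a monomial cocycle on the four
  sets must survive every refinement: a primitive on a fine cover would express the monomial by
  sections with fewer poles, against linear independence. The bounds in the residue condition come
  from 0 \<le> c \<le> 4. If p, q \<ge> 0, then p + q \<ge> a + b, hence a + b \<le> i; if p, q < 0,
  then p + q \<le> a + b - 10, hence i + 6 \<le> a + b. As a + b lies between 0 and 8, every residue
  pair is realized as soon as i \<ge> 8 or i \<le> -6, which is where the window comes from.\<close>

definition fcone :: "(complex^3) set" where
  "fcone = {v. v \<noteq> 0 \<and> (v$1)^5 + (v$2)^5 + (v$3)^5 = 0}"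

lemma pt_self: "v \<in> pt v"
  unfolding pt_def by (auto intro!: exI[of _ 1])

lemma pt_eq_scale: "pt v = pt u \<Longrightarrow> \<exists>c. c \<noteq> 0 \<and> v = c *s u"
  using pt_self[of v] unfolding pt_def by auto

lemma fcone_scale: "c \<noteq> 0 \<Longrightarrow> c *s v \<in> fcone \<longleftrightarrow> v \<in> fcone"
proof -
  assume c: "c \<noteq> 0"
  have "(c * v$1)^5 + (c * v$2)^5 + (c * v$3)^5 = c^5 * ((v$1)^5 + (v$2)^5 + (v$3)^5)"
    by (simp add: power_mult_distrib algebra_simps)
  with c show ?thesis by (auto simp: fcone_def)
qed

lemma pt_in_fermat: "pt v \<in> fermat \<longleftrightarrow> v \<in> fcone"
proof
  assume "pt v \<in> fermat"
  then obtain u where u: "u \<in> fcone" "pt v = pt u" by (auto simp: fermat_def fcone_def)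
  from pt_eq_scale[OF u(2)] u(1) show "v \<in> fcone" using fcone_scale by auto
qed (auto simp: fermat_def fcone_def)

lemma in_T: "(pt v, pt w) \<in> T \<longleftrightarrow> v \<in> fcone \<and> w \<in> fcone"
  by (simp add: T_def pt_in_fermat)

lemma T_cases:
  assumes "x \<in> T"
  obtains v w where "x = (pt v, pt w)" "v \<in> fcone" "w \<in> fcone"
  using assms by (auto simp: T_def fermat_def fcone_def)

lemma T_subset_eqI:
  assumes "U \<subseteq> T" "V \<subseteq> T"
    and "\<And>v w. v \<in> fcone \<Longrightarrow> w \<in> fcone \<Longrightarrow> (pt v, pt w) \<in> U \<longleftrightarrow> (pt v, pt w) \<in> V"
  shows "U = V"
proof -
  have "x \<in> U \<longleftrightarrow> x \<in> V" if "x \<in> T" for x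
    using that by (rule T_cases) (use assms(3) in auto)
  with assms(1,2) show ?thesis by blast
qed

text \<open>The point (0:0:1) is not on the Fermat curve. Hence two charts cover each curve, and
  each factor contributes a two-term complex only.\<close>

lemma fcone_coord: "v \<in> fcone \<Longrightarrow> v$1 \<noteq> 0 \<or> v$2 \<noteq> 0"
proof (rule ccontr)
  assume v: "v \<in> fcone" and "\<not> ?thesis"
  hence "v$1 = 0" "v$2 = 0" by auto
  with v have "v = 0" unfolding vec_eq_iff forall_3 by (simp add: fcone_def)
  with v show False by (simp add: fcone_def)
qed

subsection \<open>Bihomogeneous polynomials\<close>

lemma finite_exps [simp]: "finite (exps n)"
proof -
  have "exps n \<subseteq> PiE UNIV (\<lambda>_. {..n})"
    by (auto simp: exps_def intro: member_le_sum)
  thus ?thesis by (rule finite_subset) (simp add: finite_PiE)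
qed

lemma bihom_zero: "(\<lambda>v w. 0) \<in> bihom m n"
  unfolding bihom_def by (rule CollectI, rule exI[of _ "\<lambda>_ _. 0"]) simp

lemma bihom_add: "f \<in> bihom m n \<Longrightarrow> g \<in> bihom m n \<Longrightarrow> (\<lambda>v w. f v w + g v w) \<in> bihom m n"
proof -
  assume "f \<in> bihom m n" "g \<in> bihom m n"
  then obtain c d where
    "f = (\<lambda>v w. \<Sum>\<alpha>\<in>exps m. \<Sum>\<beta>\<in>exps n. c \<alpha> \<beta> * monom3 \<alpha> v * monom3 \<beta> w)"
    "g = (\<lambda>v w. \<Sum>\<alpha>\<in>exps m. \<Sum>\<beta>\<in>exps n. d \<alpha> \<beta> * monom3 \<alpha> v * monom3 \<beta> w)"
    unfolding bihom_def by auto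
  thus ?thesis unfolding bihom_def
    by (intro CollectI exI[of _ "\<lambda>\<alpha> \<beta>. c \<alpha> \<beta> + d \<alpha> \<beta>"]) (simp add: algebra_simps sum.distrib)
qed

lemma bihom_cmult: "f \<in> bihom m n \<Longrightarrow> (\<lambda>v w. a * f v w) \<in> bihom m n"
proof -
  assume "f \<in> bihom m n"
  then obtain c where
    "f = (\<lambda>v w. \<Sum>\<alpha>\<in>exps m. \<Sum>\<beta>\<in>exps n. c \<alpha> \<beta> * monom3 \<alpha> v * monom3 \<beta> w)"
    unfolding bihom_def by auto
  thus ?thesis unfolding bihom_def
    by (intro CollectI exI[of _ "\<lambda>\<alpha> \<beta>. a * c \<alpha> \<beta>"]) (simp add: sum_distrib_left mult.assoc)
qed

lemma bihom_sum:
  "(\<And>x. x \<in> X \<Longrightarrow> f x \<in> bihom m n) \<Longrightarrow> (\<lambda>v w. \<Sum>x\<in>X. f x v w) \<in> bihom m n"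
  by (induction X rule: infinite_finite_induct) (auto intro: bihom_zero bihom_add)

lemma bihom_monom:
  assumes "\<alpha> \<in> exps m" "\<beta> \<in> exps n"
  shows "(\<lambda>v w. monom3 \<alpha> v * monom3 \<beta> w) \<in> bihom m n"
proof -
  have inner: "(\<Sum>\<beta>'\<in>exps n. (if \<alpha>' = \<alpha> \<and> \<beta>' = \<beta> then 1 else 0) * monom3 \<alpha>' v * monom3 \<beta>' w)
      = (if \<alpha>' = \<alpha> then monom3 \<alpha> v * monom3 \<beta> w else 0)" for \<alpha>' v w
  proof (cases "\<alpha>' = \<alpha>")
    case True
    have "(\<Sum>\<beta>'\<in>exps n. (if \<alpha>' = \<alpha> \<and> \<beta>' = \<beta> then 1 else 0) * monom3 \<alpha>' v * monom3 \<beta>' w)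
      = (\<Sum>\<beta>'\<in>exps n. if \<beta>' = \<beta> then monom3 \<alpha> v * monom3 \<beta> w else 0)"
      by (intro sum.cong) (simp_all add: True)
    thus ?thesis using assms True by simp
  qed simp
  have "(\<Sum>\<alpha>'\<in>exps m. \<Sum>\<beta>'\<in>exps n. (if \<alpha>' = \<alpha> \<and> \<beta>' = \<beta> then 1 else 0) * monom3 \<alpha>' v * monom3 \<beta>' w)
      = monom3 \<alpha> v * monom3 \<beta> w" for v w
    unfolding inner using assms by simp
  hence "(\<lambda>v w. monom3 \<alpha> v * monom3 \<beta> w) = (\<lambda>v w. \<Sum>\<alpha>'\<in>exps m. \<Sum>\<beta>'\<in>exps n.
      (if \<alpha>' = \<alpha> \<and> \<beta>' = \<beta> then 1 else 0) * monom3 \<alpha>' v * monom3 \<beta>' w)" by simp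
  thus ?thesis unfolding bihom_def
    by (intro CollectI exI[of _ "\<lambda>\<alpha>' \<beta>'. if \<alpha>' = \<alpha> \<and> \<beta>' = \<beta> then 1 else 0"] conjI TrueI)
qed

lemma monom3_mult: "monom3 \<alpha> v * monom3 \<beta> v = monom3 (\<lambda>k. \<alpha> k + \<beta> k) v"
  by (simp add: monom3_def power_add prod.distrib)

lemma exps_add: "\<alpha> \<in> exps m \<Longrightarrow> \<beta> \<in> exps n \<Longrightarrow> (\<lambda>k. \<alpha> k + \<beta> k) \<in> exps (m + n)"
  by (simp add: exps_def sum.distrib)

lemma bihom_mult:
  assumes "f \<in> bihom m n" "g \<in> bihom m' n'"
  shows "(\<lambda>v w. f v w * g v w) \<in> bihom (m + m') (n + n')"
proof -
  from assms obtain c d where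
    f: "f = (\<lambda>v w. \<Sum>\<alpha>\<in>exps m. \<Sum>\<beta>\<in>exps n. c \<alpha> \<beta> * monom3 \<alpha> v * monom3 \<beta> w)" and
    g: "g = (\<lambda>v w. \<Sum>\<alpha>\<in>exps m'. \<Sum>\<beta>\<in>exps n'. d \<alpha> \<beta> * monom3 \<alpha> v * monom3 \<beta> w)"
    unfolding bihom_def by auto
  have "f v w * g v w = (\<Sum>\<alpha>\<in>exps m. \<Sum>\<alpha>'\<in>exps m'. \<Sum>\<beta>\<in>exps n. \<Sum>\<beta>'\<in>exps n'.
      (c \<alpha> \<beta> * d \<alpha>' \<beta>') * (monom3 (\<lambda>k. \<alpha> k + \<alpha>' k) v * monom3 (\<lambda>k. \<beta> k + \<beta>' k) w))" for v w
    unfolding f g sum_product monom3_mult[symmetric] by (intro sum.cong refl) (simp add: mult_ac)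
  thus ?thesis
    by (auto intro!: bihom_sum bihom_cmult bihom_monom exps_add)
qed

lemma bihom_const: "(\<lambda>v w. a) \<in> bihom 0 0"
proof -
  have "(\<lambda>v w. monom3 (\<lambda>_. 0) v * monom3 (\<lambda>_. 0) w) \<in> bihom 0 0"
    by (rule bihom_monom) (auto simp: exps_def)
  from bihom_cmult[OF this, of a] show ?thesis by (simp add: monom3_def)
qed

lemma monom3_single: "monom3 (\<lambda>l. if l = k then 1 else 0) v = v $ k"
proof -
  have "monom3 (\<lambda>l. if l = k then 1 else 0) v = (\<Prod>l\<in>UNIV. if l = k then v $ l else 1)"
    unfolding monom3_def by (intro prod.cong) auto
  thus ?thesis by simp
qed

lemma bihom_coord1: "(\<lambda>v w. v $ k) \<in> bihom 1 0"
proof -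
  have "(\<lambda>v w. monom3 (\<lambda>l. if l = k then 1 else 0) v * monom3 (\<lambda>_. 0) w) \<in> bihom 1 0"
    by (rule bihom_monom) (auto simp: exps_def)
  thus ?thesis unfolding monom3_single by (simp add: monom3_def)
qed

lemma bihom_coord2: "(\<lambda>v w. w $ k) \<in> bihom 0 1"
proof -
  have "(\<lambda>v w. monom3 (\<lambda>_. 0) v * monom3 (\<lambda>l. if l = k then 1 else 0) w) \<in> bihom 0 1"
    by (rule bihom_monom) (auto simp: exps_def)
  thus ?thesis unfolding monom3_single by (simp add: monom3_def)
qed

lemma bihom_power: "f \<in> bihom m n \<Longrightarrow> (\<lambda>v w. f v w ^ N) \<in> bihom (N * m) (N * n)"
  by (induction N) (auto intro: bihom_const bihom_mult)

lemma monom3_scale: "\<alpha> \<in> exps m \<Longrightarrow> monom3 \<alpha> (a *s v) = a ^ m * monom3 \<alpha> v"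
  by (auto simp: monom3_def exps_def power_mult_distrib prod.distrib power_sum)

lemma bihom_homogeneous:
  assumes "f \<in> bihom m n"
  shows "f (a *s v) (b *s w) = a ^ m * b ^ n * f v w"
proof -
  from assms obtain c where
    f: "f = (\<lambda>v w. \<Sum>\<alpha>\<in>exps m. \<Sum>\<beta>\<in>exps n. c \<alpha> \<beta> * monom3 \<alpha> v * monom3 \<beta> w)"
    unfolding bihom_def by auto
  show ?thesis unfolding f sum_distrib_left
    by (intro sum.cong refl) (simp add: monom3_scale)
qed

text \<open>The Nullstellensatz speaks about all pairs of vectors, while pairs with v = 0 or w = 0
  are no points of \<open>T\<close>. Positive bidegree settles these pairs; this is why positivity
  of both degrees recurs below.\<close>

lemma bihom_vanish:
  assumes "f \<in> bihom m n" "m > 0" "n > 0" "v = 0 \<or> w = 0"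
  shows "f v w = 0"
proof -
  have "f (0 *s v) w = 0" using bihom_homogeneous[OF assms(1), of 0 v 1 w] assms(2) by simp
  moreover have "f v (0 *s w) = 0" using bihom_homogeneous[OF assms(1), of 1 v 0 w] assms(3) by simp
  ultimately show ?thesis using assms(4) by auto
qed

subsection \<open>Principal open sets\<close>

definition D :: "cfun \<Rightarrow> point set" where
  "D f = {(pt v, pt w) | v w. v \<in> fcone \<and> w \<in> fcone \<and> f v w \<noteq> 0}"

lemma D_subset_T: "D f \<subseteq> T"
  by (auto simp: D_def in_T)

text \<open>Bihomogeneity makes nonvanishing independent of the chosen coordinate vectors; for a
  general function only one direction would hold.\<close>

lemma in_D:
  assumes "f \<in> bihom m n"
  shows "(pt v, pt w) \<in> D f \<longleftrightarrow> v \<in> fcone \<and> w \<in> fcone \<and> f v w \<noteq> 0"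
proof
  assume "(pt v, pt w) \<in> D f"
  then obtain v' w' where *: "pt v = pt v'" "pt w = pt w'" "v' \<in> fcone" "w' \<in> fcone" "f v' w' \<noteq> 0"
    by (auto simp: D_def)
  obtain a where a: "a \<noteq> 0" "v = a *s v'" using pt_eq_scale[OF *(1)] by blast
  obtain b where b: "b \<noteq> 0" "w = b *s w'" using pt_eq_scale[OF *(2)] by blast
  show "v \<in> fcone \<and> w \<in> fcone \<and> f v w \<noteq> 0"
    using a b * fcone_scale by (auto simp: bihom_homogeneous[OF assms])
qed (auto simp: D_def)

lemma zopen_iff: "zopen U \<longleftrightarrow> (\<exists>A \<subseteq> (\<Union>m n. bihom m n). U = (\<Union>f\<in>A. D f))"
proof -
  have "{(pt v, pt w) | v w. (pt v, pt w) \<in> T \<and> (\<exists>f\<in>A. f v w \<noteq> 0)} = (\<Union>f\<in>A. D f)" for A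
    by (auto simp: D_def in_T)
  thus ?thesis unfolding zopen_def by simp
qed

lemma zopen_D: "f \<in> bihom m n \<Longrightarrow> zopen (D f)"
  unfolding zopen_iff by (intro exI[of _ "{f}"]) auto

lemma zopen_subset_T: "zopen U \<Longrightarrow> U \<subseteq> T"
  using D_subset_T unfolding zopen_iff by blast

lemma zopen_Union:
  assumes "\<And>U. U \<in> \<U> \<Longrightarrow> zopen U"
  shows "zopen (\<Union>\<U>)"
proof -
  from assms obtain A where A: "\<And>U. U \<in> \<U> \<Longrightarrow> A U \<subseteq> (\<Union>m n. bihom m n) \<and> U = (\<Union>f\<in>A U. D f)"
    unfolding zopen_iff by metis
  hence "\<Union>\<U> = (\<Union>f\<in>\<Union>(A ` \<U>). D f)" by auto
  moreover have "\<Union>(A ` \<U>) \<subseteq> (\<Union>m n. bihom m n)" using A by blast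
  ultimately show ?thesis unfolding zopen_iff by blast
qed

lemma D_mult:
  assumes "f \<in> bihom m n" "g \<in> bihom m' n'"
  shows "D (\<lambda>v w. f v w * g v w) = D f \<inter> D g"
  by (rule T_subset_eqI)
     (use D_subset_T in \<open>auto simp: in_D[OF assms(1)] in_D[OF assms(2)] in_D[OF bihom_mult[OF assms]]\<close>)

lemma zopen_Int:
  assumes "zopen U" "zopen V"
  shows "zopen (U \<inter> V)"
proof -
  from assms obtain A B where A: "A \<subseteq> (\<Union>m n. bihom m n)" "U = (\<Union>f\<in>A. D f)"
    and B: "B \<subseteq> (\<Union>m n. bihom m n)" "V = (\<Union>f\<in>B. D f)"
    unfolding zopen_iff by auto
  have "U \<inter> V = \<Union>((\<lambda>(f, g). D f \<inter> D g) ` (A \<times> B))" unfolding A B by auto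
  moreover have *: "zopen (D f \<inter> D g)" if fg: "f \<in> A" "g \<in> B" for f g
  proof -
    from fg A B obtain m n m' n' where "f \<in> bihom m n" "g \<in> bihom m' n'" by blast
    from this zopen_D[OF bihom_mult[OF this]]
    have "zopen (D (\<lambda>v w. f v w * g v w))" by simp
    with fg show ?thesis using D_mult \<open>f \<in> bihom m n\<close> \<open>g \<in> bihom m' n'\<close> by simp
  qed
  moreover have "zopen (\<Union>((\<lambda>(f, g). D f \<inter> D g) ` (A \<times> B)))"
    by (rule zopen_Union) (use * in auto)
  ultimately show ?thesis by simp
qed

lemma D_one: "D (\<lambda>v w. 1) = T"
  by (rule T_subset_eqI) (auto simp: in_D[OF bihom_const] in_T D_subset_T[THEN subsetD])

lemma zopen_T: "zopen T"
  using zopen_D[OF bihom_const[of 1]] by (simp add: D_one)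

lemma zopen_Inter: "finite \<U> \<Longrightarrow> \<U> \<noteq> {} \<Longrightarrow> (\<And>U. U \<in> \<U> \<Longrightarrow> zopen U) \<Longrightarrow> zopen (\<Inter>\<U>)"
  by (induction \<U> rule: finite_ne_induct) (auto intro: zopen_Int)

lemma zopen_nbhd:
  assumes "zopen U" "x \<in> U"
  obtains f m n where "f \<in> bihom m n" "x \<in> D f" "D f \<subseteq> U"
  using assms unfolding zopen_iff by blast

subsection \<open>The group action\<close>

lemma Rep5_bounds: "0 \<le> Rep_bit1 (k::5)" "Rep_bit1 (k::5) < 5"
  using Rep_bit1[of k] by auto

lemma Rep5_add: "Rep_bit1 ((a::5) + b) = (Rep_bit1 a + Rep_bit1 b) mod 5"
  unfolding plus_bit1_def Abs_bit1'_def using bit1.Rep_Abs_mod[where 'a=2] by simp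

lemma rpow_add:
  assumes "primitive_root5 \<zeta>"
  shows "rpow \<zeta> (a + b) = rpow \<zeta> a * rpow \<zeta> b"
proof -
  have z: "\<zeta> ^ 5 = 1" using assms by (simp add: primitive_root5_def)
  have m: "\<zeta> ^ (k mod 5) = \<zeta> ^ k" for k
  proof -
    have "\<zeta> ^ k = \<zeta> ^ (5 * (k div 5) + k mod 5)" by simp
    also have "\<dots> = \<zeta> ^ (k mod 5)" unfolding power_add power_mult z by simp
    finally show ?thesis by simp
  qed
  have "nat (Rep_bit1 (a + b)) = (nat (Rep_bit1 a) + nat (Rep_bit1 b)) mod 5"
    using Rep5_bounds[of a] Rep5_bounds[of b] unfolding Rep5_add
    by (simp add: nat_mod_distrib nat_add_distrib)
  thus ?thesis unfolding rpow_def by (simp add: m power_add)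
qed

lemma rpow_0 [simp]: "rpow \<zeta> 0 = 1"
  by (simp add: rpow_def bit1.Rep_0)

lemma rpow_nonzero: "primitive_root5 \<zeta> \<Longrightarrow> rpow \<zeta> a \<noteq> 0"
  by (auto simp: rpow_def primitive_root5_def)

lemma act1_nth [simp]:
  "act1 \<zeta> g v $ 1 = rpow \<zeta> (fst g) * v$1" "act1 \<zeta> g v $ 2 = rpow \<zeta> (snd g) * v$2"
  "act1 \<zeta> g v $ 3 = v$3"
  by (simp_all add: act1_def split_beta)

lemma act2_nth [simp]:
  "act2 \<zeta> g v $ 1 = rpow \<zeta> (2 * fst g + snd g) * v$1"
  "act2 \<zeta> g v $ 2 = rpow \<zeta> (4 * fst g + 3 * snd g) * v$2" "act2 \<zeta> g v $ 3 = v$3"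
  by (simp_all add: act2_def split_beta)

lemma act1_scale: "act1 \<zeta> g (c *s v) = c *s act1 \<zeta> g v"
  unfolding vec_eq_iff forall_3 by simp

lemma act2_scale: "act2 \<zeta> g (c *s v) = c *s act2 \<zeta> g v"
  unfolding vec_eq_iff forall_3 by simp

lemma act1_add: "primitive_root5 \<zeta> \<Longrightarrow> act1 \<zeta> g (act1 \<zeta> h v) = act1 \<zeta> (g + h) v"
  unfolding vec_eq_iff forall_3 by (simp add: rpow_add)

lemma act2_add: "primitive_root5 \<zeta> \<Longrightarrow> act2 \<zeta> g (act2 \<zeta> h v) = act2 \<zeta> (g + h) v"
  unfolding vec_eq_iff forall_3 by (simp add: rpow_add distrib_left mult_ac)

lemma act1_0 [simp]: "act1 \<zeta> 0 v = v"
  unfolding vec_eq_iff forall_3 by simp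

lemma act2_0 [simp]: "act2 \<zeta> 0 v = v"
  unfolding vec_eq_iff forall_3 by simp

lemma act1_pt: "act1 \<zeta> g ` pt v = pt (act1 \<zeta> g v)"
  unfolding pt_def by (auto simp: act1_scale image_iff) (metis act1_scale)

lemma act2_pt: "act2 \<zeta> g ` pt v = pt (act2 \<zeta> g v)"
  unfolding pt_def by (auto simp: act2_scale image_iff) (metis act2_scale)

lemma actT_pt [simp]: "actT \<zeta> g (pt v, pt w) = (pt (act1 \<zeta> g v), pt (act2 \<zeta> g w))"
  by (simp add: actT_def act1_pt act2_pt)

lemma actT_add: "primitive_root5 \<zeta> \<Longrightarrow> actT \<zeta> g (actT \<zeta> h x) = actT \<zeta> (g + h) x"
  by (auto simp: actT_def split_beta image_image act1_add act2_add)

lemma actT_0 [simp]: "actT \<zeta> 0 x = x"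
  by (simp add: actT_def split_beta)

lemma in_actT_image: "primitive_root5 \<zeta> \<Longrightarrow> x \<in> actT \<zeta> g ` U \<longleftrightarrow> actT \<zeta> (- g) x \<in> U"
  by (auto simp: actT_add image_iff intro!: bexI[of _ "actT \<zeta> (- g) x"])

lemma rpow_pow5: "primitive_root5 \<zeta> \<Longrightarrow> rpow \<zeta> a ^ 5 = 1"
  unfolding rpow_def primitive_root5_def by (simp add: power_mult[symmetric] mult.commute[of _ 5] power_mult)

lemma act1_cone: "primitive_root5 \<zeta> \<Longrightarrow> act1 \<zeta> g v \<in> fcone \<longleftrightarrow> v \<in> fcone"
  unfolding fcone_def vec_eq_iff forall_3 by (simp add: power_mult_distrib rpow_pow5 rpow_nonzero)

lemma act2_cone: "primitive_root5 \<zeta> \<Longrightarrow> act2 \<zeta> g v \<in> fcone \<longleftrightarrow> v \<in> fcone"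
  unfolding fcone_def vec_eq_iff forall_3 by (simp add: power_mult_distrib rpow_pow5 rpow_nonzero)

lemma monom3_3: "monom3 \<alpha> v = v$1 ^ \<alpha> 1 * v$2 ^ \<alpha> 2 * v$3 ^ \<alpha> 3"
  unfolding monom3_def UNIV_3 by (simp add: mult.assoc)

lemma bihom_act:
  assumes "f \<in> bihom m n"
  shows "(\<lambda>v w. f (act1 \<zeta> g v) (act2 \<zeta> g w)) \<in> bihom m n"
proof -
  from assms obtain c where
    f: "f = (\<lambda>v w. \<Sum>\<alpha>\<in>exps m. \<Sum>\<beta>\<in>exps n. c \<alpha> \<beta> * monom3 \<alpha> v * monom3 \<beta> w)"
    unfolding bihom_def by auto
  define d where "d \<alpha> \<beta> = c \<alpha> \<beta> * (rpow \<zeta> (fst g) ^ \<alpha> 1 * rpow \<zeta> (snd g) ^ \<alpha> 2) *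
     (rpow \<zeta> (2 * fst g + snd g) ^ \<beta> 1 * rpow \<zeta> (4 * fst g + 3 * snd g) ^ \<beta> 2)" for \<alpha> \<beta>
  have "c \<alpha> \<beta> * monom3 \<alpha> (act1 \<zeta> g v) * monom3 \<beta> (act2 \<zeta> g w) = d \<alpha> \<beta> * monom3 \<alpha> v * monom3 \<beta> w" for \<alpha> \<beta> v w
    by (simp add: monom3_3 d_def power_mult_distrib mult_ac)
  thus ?thesis unfolding f bihom_def by auto
qed

lemma D_act:
  assumes "primitive_root5 \<zeta>" "f \<in> bihom m n"
  shows "actT \<zeta> g ` D f = D (\<lambda>v w. f (act1 \<zeta> (- g) v) (act2 \<zeta> (- g) w))"
proof (rule T_subset_eqI)
  show "actT \<zeta> g ` D f \<subseteq> T"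
    by (auto simp: D_def in_T act1_cone act2_cone assms)
qed (auto simp: D_subset_T in_actT_image in_D[OF assms(2)] in_D[OF bihom_act[OF assms(2)]]
      assms act1_cone act2_cone D_subset_T[THEN subsetD])

lemma zopen_act:
  assumes "primitive_root5 \<zeta>" "zopen U"
  shows "zopen (actT \<zeta> g ` U)"
proof -
  from assms(2) obtain A where A: "A \<subseteq> (\<Union>m n. bihom m n)" "U = (\<Union>f\<in>A. D f)"
    unfolding zopen_iff by auto
  have "actT \<zeta> g ` U = \<Union>((\<lambda>f. actT \<zeta> g ` D f) ` A)" unfolding A by auto
  moreover have *: "zopen (actT \<zeta> g ` D f)" if "f \<in> A" for f
  proof -
    from that A(1) obtain m n where "f \<in> bihom m n" by blast
    thus ?thesis using D_act[OF assms(1)] zopen_D[OF bihom_act] by simp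
  qed
  moreover have "zopen (\<Union>((\<lambda>f. actT \<zeta> g ` D f) ` A))"
    by (rule zopen_Union) (use * in auto)
  ultimately show ?thesis by simp
qed

subsection \<open>A Nullstellensatz\<close>

text \<open>Elimination, one equation at a time: an unknown k with nonzero coefficient in the
  equation b is solved for, and substituting it into the other equations gives the coefficients
  \<open>a'\<close>. Here \<beta> indexes equations and i indexes unknowns.\<close>

lemma homogeneous_system_nontrivial:
  fixes a :: "'i \<Rightarrow> 'b \<Rightarrow> complex"
  assumes "finite B" "finite I" "card B < card I"
  shows "\<exists>c. (\<exists>i\<in>I. c i \<noteq> 0) \<and> (\<forall>\<beta>\<in>B. (\<Sum>i\<in>I. c i * a i \<beta>) = 0)"
  using assms
proof (induction B arbitrary: I a rule: finite_induct)
  case empty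
  hence "I \<noteq> {}" by auto
  thus ?case by (intro exI[of _ "\<lambda>_. 1"]) auto
next
  case (insert b B)
  show ?case
  proof (cases "\<forall>i\<in>I. a i b = 0")
    case True
    from insert.IH[of I a] insert.prems insert.hyps obtain c where
      "\<exists>i\<in>I. c i \<noteq> 0" "\<forall>\<beta>\<in>B. (\<Sum>i\<in>I. c i * a i \<beta>) = 0" by auto
    with True show ?thesis by (intro exI[of _ c]) auto
  next
    case False
    then obtain k where k: "k \<in> I" "a k b \<noteq> 0" by auto
    define a' where "a' i \<beta> = a i \<beta> - a i b / a k b * a k \<beta>" for i \<beta>
    have "card B < card (I - {k})" using insert.prems insert.hyps k by simp
    with insert.IH[of "I - {k}" a'] insert.prems obtain c where
      c: "\<exists>i\<in>I - {k}. c i \<noteq> 0" "\<And>\<beta>. \<beta> \<in> B \<Longrightarrow> (\<Sum>i\<in>I - {k}. c i * a' i \<beta>) = 0"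
      by blast
    define c' where "c' = c(k := - (\<Sum>i\<in>I - {k}. c i * a i b) / a k b)"
    have e: "(\<Sum>i\<in>I. c' i * a i \<beta>) = (\<Sum>i\<in>I - {k}. c i * a' i \<beta>)" for \<beta>
    proof -
      have "(\<Sum>i\<in>I. c' i * a i \<beta>) = c' k * a k \<beta> + (\<Sum>i\<in>I - {k}. c' i * a i \<beta>)"
        by (rule sum.remove) (use insert.prems k in auto)
      also have "(\<Sum>i\<in>I - {k}. c' i * a i \<beta>) = (\<Sum>i\<in>I - {k}. c i * a i \<beta>)"
        by (intro sum.cong) (auto simp: c'_def)
      also have "c' k * a k \<beta> = - (\<Sum>i\<in>I - {k}. c i * (a i b / a k b * a k \<beta>))"
        by (simp add: c'_def sum_distrib_right sum_divide_distrib mult.assoc)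
      finally show ?thesis by (simp add: a'_def right_diff_distrib sum_subtractf)
    qed
    have "a' i b = 0" for i using k by (simp add: a'_def)
    hence "\<forall>\<beta>\<in>insert b B. (\<Sum>i\<in>I. c' i * a i \<beta>) = 0" using c(2) e by auto
    moreover have "\<exists>i\<in>I. c' i \<noteq> 0" using c(1) by (auto simp: c'_def)
    ultimately show ?thesis by blast
  qed
qed

text \<open>What is kept of a polynomial ring over the complex numbers is countable dimension: every
  element lies in one of countably many finite-dimensional spans. Against the uncountability of the
  field this is enough for the Nullstellensatz. Elements are functions, so ideals are ideals of
  functions.\<close>

locale function_algebra =
  fixes P :: "('a \<Rightarrow> complex) set" and B :: "nat \<Rightarrow> 'b set" and e :: "'b \<Rightarrow> 'a \<Rightarrow> complex"
  assumes P_const: "(\<lambda>_. c) \<in> P"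
    and P_add: "p \<in> P \<Longrightarrow> q \<in> P \<Longrightarrow> (\<lambda>z. p z + q z) \<in> P"
    and P_mult: "p \<in> P \<Longrightarrow> q \<in> P \<Longrightarrow> (\<lambda>z. p z * q z) \<in> P"
    and fin_B: "finite (B d)"
    and P_exhaust: "p \<in> P \<Longrightarrow> \<exists>d c. \<forall>z. p z = (\<Sum>\<beta>\<in>B d. c \<beta> * e \<beta> z)"
begin

definition idl :: "('a \<Rightarrow> complex) set \<Rightarrow> bool" where
  "idl I \<longleftrightarrow> I \<subseteq> P \<and> (\<lambda>_. 0) \<in> I \<and> (\<forall>p\<in>I. \<forall>q\<in>I. (\<lambda>z. p z + q z) \<in> I) \<and>
     (\<forall>p\<in>I. \<forall>q\<in>P. (\<lambda>z. q z * p z) \<in> I)"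

text \<open>The ideal I + (x - l): the value l is imposed on the coordinate x.\<close>

definition adj :: "('a \<Rightarrow> complex) set \<Rightarrow> ('a \<Rightarrow> complex) \<Rightarrow> complex \<Rightarrow> ('a \<Rightarrow> complex) set" where
  "adj I x l = {\<lambda>z. a z + b z * (x z - l) | a b. a \<in> I \<and> b \<in> P}"

lemma P_prod: "(\<And>i. i \<in> X \<Longrightarrow> p i \<in> P) \<Longrightarrow> (\<lambda>z. \<Prod>i\<in>X. p i z) \<in> P"
  by (induction X rule: infinite_finite_induct) (auto intro: P_const P_mult)

lemma P_power: "p \<in> P \<Longrightarrow> (\<lambda>z. p z ^ n) \<in> P"
  by (induction n) (auto intro: P_const P_mult)

lemma P_shift: "p \<in> P \<Longrightarrow> (\<lambda>z. p z - l) \<in> P"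
  using P_add[OF _ P_const[of "- l"], of p] by simp

lemma idl_add: "idl I \<Longrightarrow> p \<in> I \<Longrightarrow> q \<in> I \<Longrightarrow> (\<lambda>z. p z + q z) \<in> I"
  and idl_mult: "idl I \<Longrightarrow> p \<in> I \<Longrightarrow> q \<in> P \<Longrightarrow> (\<lambda>z. q z * p z) \<in> I"
  unfolding idl_def by auto

lemma idl_sum: "idl I \<Longrightarrow> (\<And>i. i \<in> X \<Longrightarrow> p i \<in> I) \<Longrightarrow> (\<lambda>z. \<Sum>i\<in>X. p i z) \<in> I"
  by (induction X rule: infinite_finite_induct) (auto simp: idl_def)

lemma idl_adj:
  assumes "idl I" "x \<in> P"
  shows "idl (adj I x l)" "I \<subseteq> adj I x l" "(\<lambda>z. x z - l) \<in> adj I x l"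
proof -
  have I: "I \<subseteq> P" "(\<lambda>_. 0) \<in> I" "\<And>p q. p \<in> I \<Longrightarrow> q \<in> I \<Longrightarrow> (\<lambda>z. p z + q z) \<in> I"
    "\<And>p q. p \<in> I \<Longrightarrow> q \<in> P \<Longrightarrow> (\<lambda>z. q z * p z) \<in> I"
    using assms(1) unfolding idl_def by auto
  have mem: "(\<lambda>z. a z + b z * (x z - l)) \<in> adj I x l" if "a \<in> I" "b \<in> P" for a b
    using that unfolding adj_def by blast
  show sub: "I \<subseteq> adj I x l" using mem[OF _ P_const[of 0]] by auto
  show "(\<lambda>z. x z - l) \<in> adj I x l" using mem[OF I(2) P_const[of 1]] by simp
  show "idl (adj I x l)" unfolding idl_def
  proof (intro conjI ballI)
    show "adj I x l \<subseteq> P" using I(1) P_add P_mult P_shift assms(2) unfolding adj_def by fast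
    show "(\<lambda>_. 0) \<in> adj I x l" using sub I(2) by blast
  next
    fix p q assume "p \<in> adj I x l" "q \<in> adj I x l"
    then obtain a b a' b' where *: "a \<in> I" "b \<in> P" "a' \<in> I" "b' \<in> P"
      "p = (\<lambda>z. a z + b z * (x z - l))" "q = (\<lambda>z. a' z + b' z * (x z - l))"
      unfolding adj_def by auto
    have "(\<lambda>z. p z + q z) = (\<lambda>z. (a z + a' z) + (b z + b' z) * (x z - l))"
      by (simp add: * algebra_simps)
    thus "(\<lambda>z. p z + q z) \<in> adj I x l" using mem[OF I(3)[OF *(1,3)] P_add[OF *(2,4)]] by simp
  next
    fix p q assume "p \<in> adj I x l" and q: "q \<in> P"
    then obtain a b where *: "a \<in> I" "b \<in> P" "p = (\<lambda>z. a z + b z * (x z - l))"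
      unfolding adj_def by auto
    have "(\<lambda>z. q z * p z) = (\<lambda>z. (q z * a z) + (q z * b z) * (x z - l))"
      by (simp add: * algebra_simps)
    thus "(\<lambda>z. q z * p z) \<in> adj I x l" using mem[OF I(4)[OF *(1) q] P_mult[OF q *(2)]] by simp
  qed
qed

text \<open>The linear factors of h are stripped off one by one, using that h splits over the
  complex numbers. If f^m (x - l) g lies in I and f^n = a + b (x - l) with a in I, then f^(m+n) g =
  (f^m g) a + b f^m (x - l) g lies in I.\<close>

lemma cancel_poly:
  assumes I: "idl I" and x: "x \<in> P" and f: "f \<in> P"
    and pow: "\<And>l. \<exists>n. (\<lambda>z. f z ^ n) \<in> adj I x l"
    and "h \<noteq> 0" "g \<in> P" "(\<lambda>z. poly h (x z) * g z) \<in> I"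
  shows "\<exists>n. (\<lambda>z. f z ^ n * g z) \<in> I"
  using assms(5-)
proof (induction "degree h" arbitrary: h g)
  case 0
  then obtain c where c: "h = [:c:]" "c \<noteq> 0" by (metis degree_eq_zeroE pCons_0_0)
  have "(\<lambda>z. inverse c * (poly h (x z) * g z)) \<in> I"
    using I 0(4) P_const[of "inverse c"] unfolding idl_def by auto
  thus ?case using c by (intro exI[of _ 0]) (simp add: mult.assoc[symmetric])
next
  case (Suc d)
  from Suc(2) have "\<not> constant (poly h)" by (simp add: constant_degree)
  then obtain l where "poly h l = 0" using fundamental_theorem_of_algebra by blast
  then obtain k where k: "h = [:-l, 1:] * k" using poly_eq_0_iff_dvd by (auto simp: dvd_def)
  with Suc(3) have k0: "k \<noteq> 0" by auto
  hence "degree h = Suc (degree k)" unfolding k by (subst degree_mult_eq) auto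
  hence d: "d = degree k" using Suc(2) by simp
  have g': "(\<lambda>z. (x z - l) * g z) \<in> P" using P_mult[OF P_shift[OF x] Suc(4)] .
  have "(\<lambda>z. poly k (x z) * ((x z - l) * g z)) \<in> I" using Suc(5) by (simp add: k algebra_simps)
  from Suc(1)[OF d k0 g' this] obtain m where m: "(\<lambda>z. f z ^ m * ((x z - l) * g z)) \<in> I" ..
  obtain n where "(\<lambda>z. f z ^ n) \<in> adj I x l" using pow by blast
  then obtain a b where ab: "a \<in> I" "b \<in> P" "\<And>z. f z ^ n = a z + b z * (x z - l)"
    unfolding adj_def by (auto simp: fun_eq_iff)
  have "f z ^ (m + n) * g z = (f z ^ m * g z) * a z + b z * (f z ^ m * ((x z - l) * g z))" for z
    by (simp add: power_add ab(3) algebra_simps)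
  moreover have "(\<lambda>z. (f z ^ m * g z) * a z + b z * (f z ^ m * ((x z - l) * g z))) \<in> I"
    by (intro idl_add[OF I] idl_mult[OF I] ab(1,2) m P_mult[OF P_power[OF f] Suc(4)])
  ultimately show ?case by (intro exI[of _ "m + n"]) simp
qed

text \<open>If every l failed, there would be relations f^n = a + b (x - l) for all l, so that b is
  f^n / (x - l) modulo I. Uncountably many such fractions cannot be independent in a space of
  countable dimension. A linear dependence among them, with denominators cleared, puts h(x) f^n into
  I for some polynomial h \<noteq> 0, and \<open>cancel_poly\<close> then puts a power of f into
  I.\<close>

lemma adjoin_value:
  assumes I: "idl I" and x: "x \<in> P" and f: "f \<in> P" and nf: "\<And>n. (\<lambda>z. f z ^ n) \<notin> I"
  shows "\<exists>l. \<forall>n. (\<lambda>z. f z ^ n) \<notin> adj I x l"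
proof (rule ccontr)
  assume "\<not> ?thesis"
  hence pow: "\<And>l. \<exists>n. (\<lambda>z. f z ^ n) \<in> adj I x l" by auto
  have "\<exists>n a b d c. a \<in> I \<and> b \<in> P \<and> (\<forall>z. f z ^ n = a z + b z * (x z - l)) \<and>
      (\<forall>z. b z = (\<Sum>\<beta>\<in>B d. c \<beta> * e \<beta> z))" (is "\<exists>n a b d c. ?Q l n a b d c") for l
  proof -
    obtain n a b where "a \<in> I" "b \<in> P" "\<forall>z. f z ^ n = a z + b z * (x z - l)"
      using pow[of l] unfolding adj_def by (auto simp: fun_eq_iff)
    thus ?thesis using P_exhaust[of b] by blast
  qed
  hence "\<forall>l. \<exists>n a b d c. ?Q l n a b d c" by blast
  hence "\<exists>n a b d c. \<forall>l. ?Q l (n l) (a l) (b l) (d l) (c l)" unfolding choice_iff .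
  then obtain n a b d c where nab: "\<And>l. a l \<in> I" "\<And>l. b l \<in> P"
    "\<And>l z. f z ^ n l = a l z + b l z * (x z - l)" "\<And>l z. b l z = (\<Sum>\<beta>\<in>B (d l). c l \<beta> * e \<beta> z)"
    by blast
  \<comment> \<open>There are uncountably many l but only countably many pairs of an exponent n and
    a size d.\<close>
  have "\<exists>k. infinite {l. (n l, d l) = k}"
  proof (rule ccontr)
    assume "\<not> ?thesis"
    hence "countable (\<Union>k\<in>(UNIV :: (nat \<times> nat) set). {l. (n l, d l) = k})"
      by (intro countable_UN) (auto intro: countable_finite)
    moreover have "(\<Union>k\<in>(UNIV :: (nat \<times> nat) set). {l. (n l, d l) = k}) = (UNIV :: complex set)" by auto
    ultimately show False using uncountable_UNIV_complex by simp
  qed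
  then obtain n0 d0 where inf: "infinite {l. n l = n0 \<and> d l = d0}" by auto
  obtain L where L: "finite L" "card L = Suc (card (B d0))" "L \<subseteq> {l. n l = n0 \<and> d l = d0}"
    using infinite_arbitrarily_large[OF inf] by blast
  from homogeneous_system_nontrivial[OF fin_B[of d0] L(1), of c] L(2) obtain \<gamma> where
    \<gamma>: "\<exists>l\<in>L. \<gamma> l \<noteq> 0" "\<And>\<beta>. \<beta> \<in> B d0 \<Longrightarrow> (\<Sum>l\<in>L. \<gamma> l * c l \<beta>) = 0" by auto
  have b0: "(\<Sum>l\<in>L. \<gamma> l * b l z) = 0" for z
  proof -
    have "(\<Sum>l\<in>L. \<gamma> l * b l z) = (\<Sum>l\<in>L. \<Sum>\<beta>\<in>B d0. \<gamma> l * c l \<beta> * e \<beta> z)"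
      using L(3) by (intro sum.cong refl) (auto simp: nab(4) sum_distrib_left mult.assoc)
    also have "\<dots> = (\<Sum>\<beta>\<in>B d0. (\<Sum>l\<in>L. \<gamma> l * c l \<beta>) * e \<beta> z)"
      by (subst sum.swap) (simp add: sum_distrib_right)
    also have "\<dots> = 0" using \<gamma>(2) by simp
    finally show ?thesis .
  qed
  \<comment> \<open>The numerator of the sum of the fractions \<gamma> l / (x - l). At a point l
    with \<gamma> l \<noteq> 0 only the term of l survives, which is why h is not zero.\<close>
  define h where "h = (\<Sum>l\<in>L. smult (\<gamma> l) (\<Prod>k\<in>L - {l}. [:-k, 1:]))"
  have h: "poly h t = (\<Sum>l\<in>L. \<gamma> l * (\<Prod>k\<in>L - {l}. (t - k)))" for t
    unfolding h_def by (simp add: poly_sum poly_prod)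
  have h0: "h \<noteq> 0"
  proof -
    obtain l where l: "l \<in> L" "\<gamma> l \<noteq> 0" using \<gamma>(1) by auto
    have "poly h l = \<gamma> l * (\<Prod>k\<in>L - {l}. (l - k)) + (\<Sum>i\<in>L - {l}. \<gamma> i * (\<Prod>k\<in>L - {i}. (l - k)))"
      unfolding h by (rule sum.remove) (use L l in auto)
    also have "(\<Sum>i\<in>L - {l}. \<gamma> i * (\<Prod>k\<in>L - {i}. (l - k))) = 0"
      using L l by (intro sum.neutral) (auto intro!: prod_zero bexI[of _ l])
    finally have "poly h l \<noteq> 0" using l L by simp
    thus ?thesis by auto
  qed
  have "(\<lambda>z. poly h (x z) * f z ^ n0) = (\<lambda>z. \<Sum>l\<in>L. (\<gamma> l * (\<Prod>k\<in>L - {l}. (x z - k))) * a l z)"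
  proof
    fix z
    have "poly h (x z) * f z ^ n0 = (\<Sum>l\<in>L. (\<gamma> l * (\<Prod>k\<in>L - {l}. (x z - k))) * f z ^ n0)"
      by (simp add: h sum_distrib_right)
    also have "\<dots> = (\<Sum>l\<in>L. (\<gamma> l * (\<Prod>k\<in>L - {l}. (x z - k))) * a l z + \<gamma> l * b l z * (\<Prod>k\<in>L. x z - k))"
    proof (intro sum.cong refl)
      fix l assume l: "l \<in> L"
      hence "f z ^ n0 = a l z + b l z * (x z - l)" using nab(3)[of z l] L(3) by auto
      moreover have "(\<Prod>k\<in>L. x z - k) = (x z - l) * (\<Prod>k\<in>L - {l}. (x z - k))"
        by (rule prod.remove) (use L l in auto)
      ultimately show "(\<gamma> l * (\<Prod>k\<in>L - {l}. (x z - k))) * f z ^ n0 =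
          (\<gamma> l * (\<Prod>k\<in>L - {l}. (x z - k))) * a l z + \<gamma> l * b l z * (\<Prod>k\<in>L. x z - k)"
        by (simp only:) (simp only: algebra_simps)
    qed
    also have "\<dots> = (\<Sum>l\<in>L. (\<gamma> l * (\<Prod>k\<in>L - {l}. (x z - k))) * a l z) + (\<Sum>l\<in>L. \<gamma> l * b l z) * (\<Prod>k\<in>L. x z - k)"
      by (simp add: sum.distrib sum_distrib_right)
    finally show "poly h (x z) * f z ^ n0 = (\<Sum>l\<in>L. (\<gamma> l * (\<Prod>k\<in>L - {l}. (x z - k))) * a l z)"
      by (simp add: b0)
  qed
  also have "\<dots> \<in> I"
  proof (rule idl_sum[OF I])
    fix l assume "l \<in> L"
    have "(\<lambda>z. \<gamma> l * (\<Prod>k\<in>L - {l}. (x z - k))) \<in> P"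
      by (intro P_mult P_const P_prod P_shift x)
    thus "(\<lambda>z. (\<gamma> l * (\<Prod>k\<in>L - {l}. (x z - k))) * a l z) \<in> I"
      by (rule idl_mult[OF I nab(1)])
  qed
  finally have "(\<lambda>z. poly h (x z) * f z ^ n0) \<in> I" .
  from cancel_poly[OF I x f pow h0 P_power[OF f] this] obtain m where
    "(\<lambda>z. f z ^ m * f z ^ n0) \<in> I" by blast
  with nf[of "m + n0"] show False by (simp add: power_add)
qed

lemma adjoin_values:
  assumes "idl I" "f \<in> P" "\<And>n. (\<lambda>z. f z ^ n) \<notin> I" "set xs \<subseteq> P"
  shows "\<exists>J. idl J \<and> I \<subseteq> J \<and> (\<forall>n. (\<lambda>z. f z ^ n) \<notin> J) \<and> (\<forall>x\<in>set xs. \<exists>l. (\<lambda>z. x z - l) \<in> J)"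
  using assms(4)
proof (induction xs)
  case Nil
  thus ?case using assms by auto
next
  case (Cons x xs)
  then obtain J where J: "idl J" "I \<subseteq> J" "\<forall>n. (\<lambda>z. f z ^ n) \<notin> J" "\<forall>x\<in>set xs. \<exists>l. (\<lambda>z. x z - l) \<in> J"
    by auto
  from Cons.prems have x: "x \<in> P" by simp
  obtain l where l: "\<forall>n. (\<lambda>z. f z ^ n) \<notin> adj J x l"
    using adjoin_value[OF J(1) x assms(2)] J(3) by blast
  show ?case
  proof (intro exI[of _ "adj J x l"] conjI ballI)
    fix y assume "y \<in> set (x # xs)"
    hence "y = x \<or> (\<exists>l'. (\<lambda>z. y z - l') \<in> J)" using J(4) by auto
    thus "\<exists>l'. (\<lambda>z. y z - l') \<in> adj J x l" using idl_adj(2,3)[OF J(1) x, of l] by blast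
  qed (use idl_adj[OF J(1) x, of l] l J in auto)
qed

end

section \<open>Polynomial functions of two coordinate vectors\<close>

inductive_set pol :: "((complex^3) \<times> (complex^3) \<Rightarrow> complex) set" where
  const: "(\<lambda>_. c) \<in> pol"
| coord1: "(\<lambda>z. fst z $ k) \<in> pol"
| coord2: "(\<lambda>z. snd z $ k) \<in> pol"
| add: "p \<in> pol \<Longrightarrow> q \<in> pol \<Longrightarrow> (\<lambda>z. p z + q z) \<in> pol"
| mult: "p \<in> pol \<Longrightarrow> q \<in> pol \<Longrightarrow> (\<lambda>z. p z * q z) \<in> pol"

lemma pol_sum: "(\<And>i. i \<in> X \<Longrightarrow> p i \<in> pol) \<Longrightarrow> (\<lambda>z. \<Sum>i\<in>X. p i z) \<in> pol"
  by (induction X rule: infinite_finite_induct) (auto intro: pol.const pol.add)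

lemma pol_prod: "(\<And>i. i \<in> X \<Longrightarrow> p i \<in> pol) \<Longrightarrow> (\<lambda>z. \<Prod>i\<in>X. p i z) \<in> pol"
  by (induction X rule: infinite_finite_induct) (auto intro: pol.const pol.mult)

lemma pol_power: "p \<in> pol \<Longrightarrow> (\<lambda>z. p z ^ n) \<in> pol"
  by (induction n) (auto intro: pol.const pol.mult)

lemma bihom_pol: "f \<in> bihom m n \<Longrightarrow> (\<lambda>z. f (fst z) (snd z)) \<in> pol"
  unfolding bihom_def monom3_def
  by (auto intro!: pol_sum pol_prod pol_power pol.const pol.coord1 pol.coord2 pol.mult)

text \<open>A bidegree cannot be read off a function, because 0 lies in every
  \<open>bihom m n\<close>. So each summand carries its bidegree along; the same bidegree may occur
  several times.\<close>

definition bsum :: "(nat \<times> nat \<times> cfun) list \<Rightarrow> (complex^3) \<times> (complex^3) \<Rightarrow> complex" where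
  "bsum xs z = (\<Sum>(m, n, f)\<leftarrow>xs. f (fst z) (snd z))"

definition bsum_ok :: "(nat \<times> nat \<times> cfun) list \<Rightarrow> bool" where
  "bsum_ok xs \<longleftrightarrow> (\<forall>(m, n, f)\<in>set xs. f \<in> bihom m n)"

lemma bsum_mult:
  assumes "bsum_ok xs" "bsum_ok ys"
  shows "\<exists>zs. bsum_ok zs \<and> (\<forall>z. bsum zs z = bsum xs z * bsum ys z)"
  using assms(1)
proof (induction xs)
  case Nil
  show ?case by (intro exI[of _ "[]"]) (auto simp: bsum_def bsum_ok_def)
next
  case (Cons x xs)
  obtain m n f where x: "x = (m, n, f)" by (cases x)
  from Cons obtain zs where zs: "bsum_ok zs" "\<And>z. bsum zs z = bsum xs z * bsum ys z"
    by (auto simp: bsum_ok_def)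
  define us where "us = map (\<lambda>(m', n', g). (m + m', n + n', \<lambda>v w. f v w * g v w)) ys"
  have "bsum us z = f (fst z) (snd z) * bsum ys z" for z
    unfolding us_def bsum_def by (induction ys) (auto simp: distrib_left)
  moreover have "bsum_ok us" using assms(2) Cons.prems
    by (auto simp: bsum_ok_def us_def x intro!: bihom_mult)
  ultimately show ?case using zs
    by (intro exI[of _ "us @ zs"]) (auto simp: bsum_def bsum_ok_def x distrib_right)
qed

lemma pol_bsum: "p \<in> pol \<Longrightarrow> \<exists>xs. bsum_ok xs \<and> (\<forall>z. p z = bsum xs z)"
proof (induction rule: pol.induct)
  case (const c)
  show ?case by (intro exI[of _ "[(0, 0, \<lambda>v w. c)]"]) (auto simp: bsum_def bsum_ok_def bihom_const)
next
  case (coord1 k)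
  show ?case by (intro exI[of _ "[(1, 0, \<lambda>v w. v $ k)]"]) (auto simp: bsum_def bsum_ok_def bihom_coord1[simplified])
next
  case (coord2 k)
  show ?case by (intro exI[of _ "[(0, 1, \<lambda>v w. w $ k)]"]) (auto simp: bsum_def bsum_ok_def bihom_coord2[simplified])
next
  case (add p q)
  then obtain xs ys where "bsum_ok xs" "\<forall>z. p z = bsum xs z" "bsum_ok ys" "\<forall>z. q z = bsum ys z" by auto
  thus ?case by (intro exI[of _ "xs @ ys"]) (auto simp: bsum_def bsum_ok_def)
next
  case (mult p q)
  thus ?case using bsum_mult by metis
qed

lemma pol_components:
  assumes "p \<in> pol"
  shows "\<exists>(K::nat) m n f. (\<forall>k<K. f k \<in> bihom (m k) (n k)) \<and> (\<forall>v w. p (v, w) = (\<Sum>k<K. f k v w))"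
proof -
  from pol_bsum[OF assms] obtain xs where xs: "bsum_ok xs" "\<forall>z. p z = bsum xs z" by blast
  define m where "m k = fst (xs ! k)" for k
  define n where "n k = fst (snd (xs ! k))" for k
  define f where "f k = snd (snd (xs ! k))" for k
  have "f k \<in> bihom (m k) (n k)" if "k < length xs" for k
    using xs(1) that nth_mem[OF that] unfolding bsum_ok_def m_def n_def f_def by (auto simp: split_beta)
  moreover have "p (v, w) = (\<Sum>k<length xs. f k v w)" for v w
    unfolding xs(2)[rule_format] bsum_def f_def
    by (simp add: sum_list_sum_nth split_beta atLeast0LessThan)
  ultimately show ?thesis by blast
qed

text \<open>An increasing chain of finite sets of monomials, which serves as the exhaustion
  \<open>B\<close> of \<open>function_algebra\<close>.\<close>

definition monoms :: "nat \<Rightarrow> ((3 \<Rightarrow> nat) \<times> (3 \<Rightarrow> nat)) set" where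
  "monoms d = (\<Union>m<d. exps m) \<times> (\<Union>n<d. exps n)"

definition monom_ev :: "(3 \<Rightarrow> nat) \<times> (3 \<Rightarrow> nat) \<Rightarrow> (complex^3) \<times> (complex^3) \<Rightarrow> complex" where
  "monom_ev = (\<lambda>(\<alpha>, \<beta>) (v, w). monom3 \<alpha> v * monom3 \<beta> w)"

lemma finite_monoms: "finite (monoms d)"
  by (simp add: monoms_def)

lemma monoms_mono: "d \<le> d' \<Longrightarrow> monoms d \<subseteq> monoms d'"
  unfolding monoms_def by (fastforce dest: less_le_trans)

lemma bihom_monoms:
  assumes "f \<in> bihom m n"
  shows "\<exists>d c. \<forall>z. f (fst z) (snd z) = (\<Sum>\<beta>\<in>monoms d. c \<beta> * monom_ev \<beta> z)"
proof -
  from assms obtain c where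
    f: "f = (\<lambda>v w. \<Sum>\<alpha>\<in>exps m. \<Sum>\<beta>\<in>exps n. c \<alpha> \<beta> * monom3 \<alpha> v * monom3 \<beta> w)"
    unfolding bihom_def by auto
  let ?d = "Suc (max m n)"
  define c' where "c' = (\<lambda>\<beta>. if \<beta> \<in> exps m \<times> exps n then c (fst \<beta>) (snd \<beta>) else 0)"
  have sub: "exps m \<times> exps n \<subseteq> monoms ?d"
    unfolding monoms_def by (intro Sigma_mono UN_upper) auto
  have "f (fst z) (snd z) = (\<Sum>\<beta>\<in>monoms ?d. c' \<beta> * monom_ev \<beta> z)" for z
  proof -
    have "f (fst z) (snd z) = (\<Sum>\<beta>\<in>exps m \<times> exps n. c' \<beta> * monom_ev \<beta> z)"
      unfolding f sum.cartesian_product by (intro sum.cong) (auto simp: c'_def monom_ev_def split_beta)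
    also have "\<dots> = (\<Sum>\<beta>\<in>monoms ?d. c' \<beta> * monom_ev \<beta> z)"
      by (rule sum.mono_neutral_left[OF finite_monoms sub]) (auto simp: c'_def)
    finally show ?thesis .
  qed
  thus ?thesis by blast
qed

lemma monoms_add:
  assumes "\<forall>z. p z = (\<Sum>\<beta>\<in>monoms d. c \<beta> * monom_ev \<beta> z)" "\<forall>z. q z = (\<Sum>\<beta>\<in>monoms d'. c' \<beta> * monom_ev \<beta> z)"
  shows "\<exists>d c. \<forall>z. p z + q z = (\<Sum>\<beta>\<in>monoms d. c \<beta> * monom_ev \<beta> z)"
proof -
  let ?D = "max d d'"
  have ext: "(\<Sum>\<beta>\<in>monoms d. c \<beta> * monom_ev \<beta> z) =
     (\<Sum>\<beta>\<in>monoms ?D. (if \<beta> \<in> monoms d then c \<beta> else 0) * monom_ev \<beta> z)" if "d \<le> ?D" for d c z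
  proof -
    have "(\<Sum>\<beta>\<in>monoms d. c \<beta> * monom_ev \<beta> z) = (\<Sum>\<beta>\<in>monoms d. (if \<beta> \<in> monoms d then c \<beta> else 0) * monom_ev \<beta> z)"
      by simp
    also have "\<dots> = (\<Sum>\<beta>\<in>monoms ?D. (if \<beta> \<in> monoms d then c \<beta> else 0) * monom_ev \<beta> z)"
      by (rule sum.mono_neutral_left[OF finite_monoms monoms_mono[OF that]]) auto
    finally show ?thesis .
  qed
  show ?thesis
    by (rule exI[of _ ?D], rule exI[of _ "\<lambda>\<beta>. (if \<beta> \<in> monoms d then c \<beta> else 0) + (if \<beta> \<in> monoms d' then c' \<beta> else 0)"])
       (simp add: assms ext[of d, simplified] ext[of d', simplified] distrib_right sum.distrib)
qed

lemma pol_monoms: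
  assumes "p \<in> pol"
  shows "\<exists>d c. \<forall>z. p z = (\<Sum>\<beta>\<in>monoms d. c \<beta> * monom_ev \<beta> z)"
proof -
  from pol_bsum[OF assms] obtain xs where xs: "bsum_ok xs" "\<forall>z. p z = bsum xs z" by blast
  from xs(1) have "\<exists>d c. \<forall>z. bsum xs z = (\<Sum>\<beta>\<in>monoms d. c \<beta> * monom_ev \<beta> z)"
  proof (induction xs)
    case Nil
    show ?case by (intro exI[of _ 0] exI[of _ "\<lambda>_. 0"]) (simp add: bsum_def)
  next
    case (Cons x xs)
    obtain m n f where x: "x = (m, n, f)" by (cases x)
    from Cons obtain d c where "\<forall>z. bsum xs z = (\<Sum>\<beta>\<in>monoms d. c \<beta> * monom_ev \<beta> z)"
      by (auto simp: bsum_ok_def)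
    moreover from Cons.prems obtain d' c' where
      "\<forall>z. f (fst z) (snd z) = (\<Sum>\<beta>\<in>monoms d'. c' \<beta> * monom_ev \<beta> z)"
      using bihom_monoms[of f m n] by (auto simp: bsum_ok_def x)
    ultimately have "\<exists>d c. \<forall>z. f (fst z) (snd z) + bsum xs z = (\<Sum>\<beta>\<in>monoms d. c \<beta> * monom_ev \<beta> z)"
      by (intro monoms_add)
    thus ?case by (simp add: bsum_def x)
  qed
  thus ?thesis using xs(2) by simp
qed

interpretation pol: function_algebra pol monoms monom_ev
  by unfold_locales (rule pol.intros finite_monoms pol_monoms; assumption)+

text \<open>If no power of f lies in I, values for the six coordinates can be adjoined one after the
  other without losing this property. Modulo the resulting ideal J every polynomial is the constant
  given by its value at the point z0 of adjoined values. So z0 is a zero of I, hence of f, and then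
  f itself lies in J.\<close>

theorem nullstellensatz:
  assumes I: "pol.idl I" and f: "f \<in> pol"
    and van: "\<And>z. (\<And>p. p \<in> I \<Longrightarrow> p z = 0) \<Longrightarrow> f z = 0"
  shows "\<exists>n. (\<lambda>z. f z ^ n) \<in> I"
proof (rule ccontr)
  assume "\<not> ?thesis"
  hence nf: "\<And>n. (\<lambda>z. f z ^ n) \<notin> I" by auto
  define xs :: "((complex^3) \<times> (complex^3) \<Rightarrow> complex) list" where
    "xs = [\<lambda>z. fst z $ 1, \<lambda>z. fst z $ 2, \<lambda>z. fst z $ 3, \<lambda>z. snd z $ 1, \<lambda>z. snd z $ 2, \<lambda>z. snd z $ 3]"
  have "set xs \<subseteq> pol" by (auto simp: xs_def intro: pol.intros)
  from pol.adjoin_values[OF I f nf this] obtain J where J: "pol.idl J" "I \<subseteq> J"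
    "\<And>n. (\<lambda>z. f z ^ n) \<notin> J" "\<forall>x\<in>set xs. \<exists>l. (\<lambda>z. x z - l) \<in> J" by blast
  have "\<exists>l. (\<lambda>z. fst z $ k - l) \<in> J" "\<exists>l. (\<lambda>z. snd z $ k - l) \<in> J" for k
    using J(4) exhaust_3[of k] by (auto simp: xs_def)
  then obtain l l' where l: "\<And>k. (\<lambda>z. fst z $ k - l k) \<in> J" "\<And>k. (\<lambda>z. snd z $ k - l' k) \<in> J" by metis
  define z0 :: "(complex^3) \<times> (complex^3)" where "z0 = (\<chi> k. l k, \<chi> k. l' k)"
  have Ja: "(\<lambda>z. p z + q z) \<in> J" if "p \<in> J" "q \<in> J" for p q
    using J(1) that unfolding pol.idl_def by blast
  have Jm: "(\<lambda>z. q z * p z) \<in> J" if "p \<in> J" "q \<in> pol" for p q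
    using J(1) that unfolding pol.idl_def by blast
  have ev: "(\<lambda>z. p z - p z0) \<in> J" if "p \<in> pol" for p
    using that
  proof (induction rule: pol.induct)
    case (const c)
    thus ?case using J(1) by (simp add: pol.idl_def)
  next
    case (add p q)
    from Ja[OF add.IH] show ?case by (simp add: algebra_simps)
  next
    case (mult p q)
    have "(\<lambda>z. q z * (p z - p z0) + p z0 * (q z - q z0)) \<in> J"
      by (intro Ja Jm mult pol.const)
    thus ?case by (simp add: algebra_simps)
  qed (auto simp: z0_def l)
  \<comment> \<open>A nonzero value would be a nonzero constant in J, hence 1 = f^0 would lie in
    J.\<close>
  have "p z0 = 0" if p: "p \<in> I" for p
  proof (rule ccontr)
    assume p0: "p z0 \<noteq> 0"
    have pp: "p \<in> pol" using I p unfolding pol.idl_def by auto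
    have "(\<lambda>z. inverse (p z0) * p z + - inverse (p z0) * (p z - p z0)) \<in> J"
      by (intro Ja Jm pol.const ev pp) (use p J(2) in auto)
    moreover have "inverse (p z0) * p z + - inverse (p z0) * (p z - p z0) = f z ^ 0" for z
      using p0 by (simp add: algebra_simps)
    ultimately show False using J(3)[of 0] by simp
  qed
  from van[OF this] have "f z0 = 0" .
  with ev[OF f] J(3)[of 1] show False by simp
qed

text \<open>Two polynomials in t that agree at all nonzero t are equal. Applied to rescaled
  coordinate vectors, this extracts one bidegree from an identity that holds only on the cones,
  where functions do not determine polynomials.\<close>

lemma coeff_extract:
  fixes a :: "'x \<Rightarrow> complex"
  assumes "finite X" "\<And>t. t \<noteq> 0 \<Longrightarrow> (\<Sum>x\<in>X. t ^ m x * a x) = t ^ M * b"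
  shows "(\<Sum>x\<in>{x\<in>X. m x = M}. a x) = b"
proof -
  define p where "p = (\<Sum>x\<in>X. monom (a x) (m x)) - monom b M"
  have "poly p t = 0" if "t \<noteq> 0" for t
    using assms(2)[OF that] by (simp add: p_def poly_sum poly_monom mult.commute)
  hence "UNIV - {0} \<subseteq> {t. poly p t = 0}" by auto
  hence "infinite {t. poly p t = 0}" using infinite_UNIV_char_0 by (meson finite_Diff2 finite.emptyI finite.insertI rev_finite_subset)
  hence "p = 0" using poly_roots_finite by blast
  hence "coeff p M = 0" by simp
  thus ?thesis using assms(1) by (simp add: p_def coeff_sum sum.If_cases Int_def)
qed

lemma coeff_extract2:
  fixes a :: "'x \<Rightarrow> complex"
  assumes "finite X" "\<And>t u. t \<noteq> 0 \<Longrightarrow> u \<noteq> 0 \<Longrightarrow> (\<Sum>x\<in>X. t ^ m x * u ^ n x * a x) = t ^ M * u ^ N * b"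
  shows "(\<Sum>x\<in>{x\<in>X. m x = M \<and> n x = N}. a x) = b"
proof -
  have 1: "(\<Sum>x\<in>{x\<in>X. m x = M}. u ^ n x * a x) = u ^ N * b" if "u \<noteq> 0" for u
    by (rule coeff_extract) (use assms that in \<open>auto simp: mult.assoc\<close>)
  have "(\<Sum>x\<in>{x\<in>{x\<in>X. m x = M}. n x = N}. a x) = b"
    by (rule coeff_extract) (use assms(1) 1 in auto)
  thus ?thesis by (simp add: conj_assoc)
qed

text \<open>The homogeneous Nullstellensatz on \<open>T\<close>: if the equations in F have no
  common zero where q \<noteq> 0, a power of q is a combination of finitely many of them with
  bihomogeneous coefficients. The affine Nullstellensatz gives the combination with arbitrary
  polynomial coefficients; the components of the correct bidegree are then selected. Partitions of
  unity, compactness and the description of sections over affine sets all rest on this.\<close>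

lemma power_combination:
  fixes F :: "cfun set"
  assumes F: "\<And>h. h \<in> F \<Longrightarrow> h \<in> bihom (dm h) (dn h)" and q: "q \<in> bihom a b" and ab: "a > 0" "b > 0"
    and cov: "\<And>v w. v \<in> fcone \<Longrightarrow> w \<in> fcone \<Longrightarrow> q v w \<noteq> 0 \<Longrightarrow> \<exists>h\<in>F. h v w \<noteq> 0"
  obtains N G g where "finite G" "G \<subseteq> F"
    "\<And>h. h \<in> G \<Longrightarrow> dm h \<le> N * a \<and> dn h \<le> N * b \<and> g h \<in> bihom (N * a - dm h) (N * b - dn h)"
    "\<And>v w. v \<in> fcone \<Longrightarrow> w \<in> fcone \<Longrightarrow> q v w ^ N = (\<Sum>h\<in>G. g h v w * h v w)"
proof -
  define Fer where "Fer = (\<lambda>v::complex^3. (v$1)^5 + (v$2)^5 + (v$3)^5)"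
  \<comment> \<open>The ideal generated by F together with all polynomials that vanish on the two
    affine Fermat cones: the latter enter through the empty combination, and in particular both
    Fermat equations are in I.\<close>
  define I where "I = {p \<in> pol. \<exists>G g. finite G \<and> G \<subseteq> F \<and> (\<forall>h. g h \<in> pol) \<and>
     (\<forall>v w. Fer v = 0 \<longrightarrow> Fer w = 0 \<longrightarrow> p (v, w) = (\<Sum>h\<in>G. g h (v, w) * h v w))}"
  have idl: "pol.idl I" unfolding pol.idl_def
  proof (intro conjI ballI)
    show "I \<subseteq> pol" by (auto simp: I_def)
    show "(\<lambda>_. 0) \<in> I" unfolding I_def
      by (auto intro!: pol.const exI[of _ "{}"])
  next
    fix p1 p2 assume "p1 \<in> I" "p2 \<in> I"
    from \<open>p1 \<in> I\<close> obtain G1 g1 where 1: "p1 \<in> pol" "finite G1" "G1 \<subseteq> F" "\<And>h. g1 h \<in> pol"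
      "\<And>v w. Fer v = 0 \<Longrightarrow> Fer w = 0 \<Longrightarrow> p1 (v, w) = (\<Sum>h\<in>G1. g1 h (v, w) * h v w)"
      unfolding I_def by blast
    from \<open>p2 \<in> I\<close> obtain G2 g2 where 2: "p2 \<in> pol" "finite G2" "G2 \<subseteq> F" "\<And>h. g2 h \<in> pol"
      "\<And>v w. Fer v = 0 \<Longrightarrow> Fer w = 0 \<Longrightarrow> p2 (v, w) = (\<Sum>h\<in>G2. g2 h (v, w) * h v w)"
      unfolding I_def by blast
    note p = 1(1) 2(1) and G = 1(2-4) 2(2-4) and e = 1(5) 2(5)
    define g where "g h = (\<lambda>z. (if h \<in> G1 then g1 h z else 0) + (if h \<in> G2 then g2 h z else 0))" for h
    have "g h \<in> pol" for h unfolding g_def using G(3,6) by (intro pol.add) (cases "h \<in> G1"; cases "h \<in> G2"; simp add: pol.const)+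
    moreover have "p1 (v, w) + p2 (v, w) = (\<Sum>h\<in>G1 \<union> G2. g h (v, w) * h v w)" if "Fer v = 0" "Fer w = 0" for v w
    proof -
      have "(\<Sum>h\<in>G1. g1 h (v, w) * h v w) = (\<Sum>h\<in>G1 \<union> G2. (if h \<in> G1 then g1 h (v, w) else 0) * h v w)"
        by (rule sum.mono_neutral_cong_left) (use G in auto)
      moreover have "(\<Sum>h\<in>G2. g2 h (v, w) * h v w) = (\<Sum>h\<in>G1 \<union> G2. (if h \<in> G2 then g2 h (v, w) else 0) * h v w)"
        by (rule sum.mono_neutral_cong_left) (use G in auto)
      ultimately show ?thesis using e that by (simp add: g_def distrib_right sum.distrib)
    qed
    ultimately show "(\<lambda>z. p1 z + p2 z) \<in> I" unfolding I_def using G p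
      by (auto intro!: pol.add exI[of _ "G1 \<union> G2"] exI[of _ g])
  next
    fix p r assume "p \<in> I" and r: "r \<in> pol"
    then obtain G g where "p \<in> pol" "finite G" "G \<subseteq> F" "\<forall>h. g h \<in> pol"
      "\<forall>v w. Fer v = 0 \<longrightarrow> Fer w = 0 \<longrightarrow> p (v, w) = (\<Sum>h\<in>G. g h (v, w) * h v w)"
      unfolding I_def by auto
    thus "(\<lambda>z. r z * p z) \<in> I" unfolding I_def using r
      by (auto intro!: pol.mult exI[of _ G] exI[of _ "\<lambda>h z. r z * g h z"] simp: sum_distrib_left mult.assoc)
  qed
  have qp: "(\<lambda>z. q (fst z) (snd z)) \<in> pol" by (rule bihom_pol[OF q])
  have "\<exists>n. (\<lambda>z. q (fst z) (snd z) ^ n) \<in> I"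
  proof (rule nullstellensatz[OF idl qp])
    fix z assume z: "\<And>p. p \<in> I \<Longrightarrow> p z = 0"
    obtain v w where vw: "z = (v, w)" by (cases z)
    have "(\<lambda>z. Fer (fst z)) \<in> I" "(\<lambda>z. Fer (snd z)) \<in> I" unfolding I_def Fer_def
      by (auto intro!: pol.add pol_power pol.coord1 pol.coord2 pol.const exI[of _ "{}"])
    from this[THEN z] have fer: "Fer v = 0" "Fer w = 0" by (simp_all add: vw)
    have h0: "h v w = 0" if h: "h \<in> F" for h
    proof -
      have "(\<lambda>z. h (fst z) (snd z)) \<in> I" unfolding I_def
        using bihom_pol[OF F[OF h]] h
        by (auto intro!: exI[of _ "{h}"] exI[of _ "\<lambda>_ _. 1"] pol.const)
      from z[OF this] show ?thesis by (simp add: vw)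
    qed
    show "q (fst z) (snd z) = 0"
    \<comment> \<open>A zero vector gives no point of \<open>T\<close>, so the covering hypothesis
      says nothing there.\<close>
    proof (cases "v = 0 \<or> w = 0")
      case True
      thus ?thesis using bihom_vanish[OF q ab] by (simp add: vw)
    next
      case False
      with fer have "v \<in> fcone" "w \<in> fcone" by (auto simp: fcone_def Fer_def)
      with cov[of v w] h0 show ?thesis by (auto simp: vw)
    qed
  qed
  then obtain n where "(\<lambda>z. q (fst z) (snd z) ^ n) \<in> I" ..
  then obtain G g where G: "finite G" "G \<subseteq> F" "\<And>h. g h \<in> pol" and
    e': "\<And>v w. Fer v = 0 \<Longrightarrow> Fer w = 0 \<Longrightarrow> q (fst (v, w)) (snd (v, w)) ^ n = (\<Sum>h\<in>G. g h (v, w) * h v w)"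
    unfolding I_def by blast
  have e: "\<And>v w. Fer v = 0 \<Longrightarrow> Fer w = 0 \<Longrightarrow> q v w ^ n = (\<Sum>h\<in>G. g h (v, w) * h v w)"
    using e' by simp
  \<comment> \<open>Enlarged beyond the exponent n so that the subtractions of natural numbers in
    the bidegrees of the coefficients are exact.\<close>
  define N where "N = n + (\<Sum>h\<in>G. dm h + dn h)"
  have Nge: "dm h \<le> N * a \<and> dn h \<le> N * b" if "h \<in> G" for h
  proof -
    have "dm h + dn h \<le> N" using member_le_sum[OF that, of "\<lambda>h. dm h + dn h"] G(1) by (simp add: N_def)
    moreover have "N \<le> N * a" "N \<le> N * b" using ab by simp_all
    ultimately show ?thesis by linarith
  qed
  have "\<exists>(K::nat) m n f. (\<forall>k<K. f k \<in> bihom (m k) (n k)) \<and> (\<forall>v w. g h (v, w) = (\<Sum>k<K. f k v w))" for h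
    by (rule pol_components[OF G(3)])
  then obtain K m n' f where comp: "\<And>h k. k < (K h :: nat) \<Longrightarrow> f h k \<in> bihom (m h k) (n' h k)"
    "\<And>h v w. g h (v, w) = (\<Sum>k<K h. f h k v w)" by metis
  define r where "r = N - n"
  have Nr: "N = r + n" by (simp add: r_def N_def)
  \<comment> \<open>The components whose product with q^r and h has the bidegree of q^N.\<close>
  define S where "S h = {k. k < K h \<and> r * a + m h k + dm h = N * a \<and> r * b + n' h k + dn h = N * b}" for h
  define g' where "g' h = (\<lambda>v w. \<Sum>k\<in>S h. q v w ^ r * f h k v w)" for h
  show ?thesis
  proof (rule that[OF G(1,2)])
    fix h assume h: "h \<in> G"
    have "(\<lambda>v w. q v w ^ r * f h k v w) \<in> bihom (N * a - dm h) (N * b - dn h)" if k: "k \<in> S h" for k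
    proof -
      have "(\<lambda>v w. q v w ^ r * f h k v w) \<in> bihom (r * a + m h k) (r * b + n' h k)"
        using k by (intro bihom_mult bihom_power q comp) (auto simp: S_def)
      moreover have "r * a + m h k = N * a - dm h" "r * b + n' h k = N * b - dn h" using k by (auto simp: S_def)
      ultimately show ?thesis by simp
    qed
    hence "g' h \<in> bihom (N * a - dm h) (N * b - dn h)" unfolding g'_def by (rule bihom_sum)
    with Nge[OF h] show "dm h \<le> N * a \<and> dn h \<le> N * b \<and> g' h \<in> bihom (N * a - dm h) (N * b - dn h)" by simp
  next
    fix v w assume vw: "v \<in> fcone" "w \<in> fcone"
    define X where "X = (SIGMA h:G. {..<K h})"
    have fX: "finite X" using G(1) by (auto simp: X_def)
    have "(\<Sum>x\<in>{x\<in>X. r * a + m (fst x) (snd x) + dm (fst x) = N * a \<and> r * b + n' (fst x) (snd x) + dn (fst x) = N * b}.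
       q v w ^ r * f (fst x) (snd x) v w * fst x v w) = q v w ^ N"
    proof (rule coeff_extract2[OF fX])
      fix t u :: complex assume tu: "t \<noteq> 0" "u \<noteq> 0"
      hence c: "t *s v \<in> fcone" "u *s w \<in> fcone" using vw fcone_scale by auto
      hence fer: "Fer (t *s v) = 0" "Fer (u *s w) = 0" by (auto simp: fcone_def Fer_def)
      have "t ^ (N * a) * u ^ (N * b) * q v w ^ N = q (t *s v) (u *s w) ^ N"
        by (simp add: bihom_homogeneous[OF q] power_mult_distrib power_mult[symmetric] mult.commute[of N])
      also have "\<dots> = q (t *s v) (u *s w) ^ r * q (t *s v) (u *s w) ^ n" by (simp add: Nr power_add)
      also have "\<dots> = (\<Sum>h\<in>G. \<Sum>k<K h. q (t *s v) (u *s w) ^ r * f h k (t *s v) (u *s w) * h (t *s v) (u *s w))"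
        by (simp add: e[OF fer] comp(2) sum_distrib_left sum_distrib_right mult.assoc)
      also have "\<dots> = (\<Sum>x\<in>X. q (t *s v) (u *s w) ^ r * f (fst x) (snd x) (t *s v) (u *s w) * fst x (t *s v) (u *s w))"
        unfolding X_def using G(1) by (subst sum.Sigma) (auto simp: split_beta)
      also have "\<dots> = (\<Sum>x\<in>X. t ^ (r * a + m (fst x) (snd x) + dm (fst x)) * u ^ (r * b + n' (fst x) (snd x) + dn (fst x)) *
          (q v w ^ r * f (fst x) (snd x) v w * fst x v w))"
      proof (intro sum.cong refl)
        fix x assume "x \<in> X"
        then obtain h k where x: "x = (h, k)" "h \<in> G" "k < K h" by (auto simp: X_def)
        have hF: "h \<in> bihom (dm h) (dn h)" using F G(2) x(2) by auto
        show "q (t *s v) (u *s w) ^ r * f (fst x) (snd x) (t *s v) (u *s w) * fst x (t *s v) (u *s w) =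
          t ^ (r * a + m (fst x) (snd x) + dm (fst x)) * u ^ (r * b + n' (fst x) (snd x) + dn (fst x)) *
          (q v w ^ r * f (fst x) (snd x) v w * fst x v w)"
          by (simp add: x(1) bihom_homogeneous[OF q] bihom_homogeneous[OF hF] bihom_homogeneous[OF comp(1)[OF x(3)]]
              power_mult_distrib power_add power_mult[symmetric] mult.commute[of r])
      qed
      finally show "(\<Sum>x\<in>X. t ^ (r * a + m (fst x) (snd x) + dm (fst x)) * u ^ (r * b + n' (fst x) (snd x) + dn (fst x)) *
          (q v w ^ r * f (fst x) (snd x) v w * fst x v w)) = t ^ (N * a) * u ^ (N * b) * q v w ^ N" by simp
    qed
    moreover have "{x\<in>X. r * a + m (fst x) (snd x) + dm (fst x) = N * a \<and> r * b + n' (fst x) (snd x) + dn (fst x) = N * b} = (SIGMA h:G. S h)"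
      by (auto simp: X_def S_def)
    moreover have "finite (S h)" for h by (simp add: S_def)
    ultimately have "q v w ^ N = (\<Sum>h\<in>G. \<Sum>k\<in>S h. q v w ^ r * f h k v w * h v w)"
      using G(1) by (simp add: sum.Sigma split_beta)
    thus "q v w ^ N = (\<Sum>h\<in>G. g' h v w * h v w)" by (simp add: g'_def sum_distrib_right)
  qed
qed

subsection \<open>Sections of the line bundles\<close>

lemma restr_eq_iff: "restr U s = s \<longleftrightarrow> (\<forall>v w. (pt v, pt w) \<notin> U \<longrightarrow> s v w = 0)"
  by (auto simp: restr_def fun_eq_iff)

lemma restr_in [simp]: "(pt v, pt w) \<in> U \<Longrightarrow> restr U s v w = s v w"
  and restr_out [simp]: "(pt v, pt w) \<notin> U \<Longrightarrow> restr U s v w = 0"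
  by (simp_all add: restr_def)

lemma O_sect_outside: "s \<in> O_sect i j U \<Longrightarrow> (pt v, pt w) \<notin> U \<Longrightarrow> s v w = 0"
  unfolding O_sect_def restr_eq_iff by blast

lemma O_sectE:
  assumes "s \<in> O_sect i j U" "x \<in> U"
  obtains V m n m' n' p q where "p \<in> bihom m n" "q \<in> bihom m' n'" "zopen V" "x \<in> V" "V \<subseteq> U"
    "int m - int m' = i" "int n - int n' = j"
    "\<And>v w. (pt v, pt w) \<in> V \<Longrightarrow> q v w \<noteq> 0 \<and> s v w = p v w / q v w"
proof -
  have "\<exists>V m n m' n'. \<exists>p\<in>bihom m n. \<exists>q\<in>bihom m' n'. zopen V \<and> x \<in> V \<and> V \<subseteq> U \<and>
      int m - int m' = i \<and> int n - int n' = j \<and>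
      (\<forall>v w. (pt v, pt w) \<in> V \<longrightarrow> q v w \<noteq> 0 \<and> s v w = p v w / q v w)"
    using assms unfolding O_sect_def by simp
  then obtain V m n m' n' p q where "p \<in> bihom m n" "q \<in> bihom m' n'" "zopen V" "x \<in> V" "V \<subseteq> U"
    "int m - int m' = i" "int n - int n' = j"
    "\<forall>v w. (pt v, pt w) \<in> V \<longrightarrow> q v w \<noteq> 0 \<and> s v w = p v w / q v w" by blast
  thus ?thesis by (intro that[of p m n q m' n' V]) auto
qed

lemma O_sectI:
  assumes "\<And>v w. (pt v, pt w) \<notin> U \<Longrightarrow> s v w = 0"
    and "\<And>x. x \<in> U \<Longrightarrow> \<exists>V m n m' n' p q. p \<in> bihom m n \<and> q \<in> bihom m' n' \<and> zopen V \<and> x \<in> V \<and> V \<subseteq> U \<and>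
      int m - int m' = i \<and> int n - int n' = j \<and>
      (\<forall>v w. (pt v, pt w) \<in> V \<longrightarrow> q v w \<noteq> 0 \<and> s v w = p v w / q v w)"
  shows "s \<in> O_sect i j U"
  unfolding O_sect_def
proof (intro CollectI conjI ballI)
  show "restr U s = s" using assms(1) by (simp add: restr_eq_iff)
  fix x assume "x \<in> U"
  from assms(2)[OF this] show "\<exists>V m n m' n'. \<exists>p\<in>bihom m n. \<exists>q\<in>bihom m' n'. zopen V \<and> x \<in> V \<and> V \<subseteq> U \<and>
      int m - int m' = i \<and> int n - int n' = j \<and>
      (\<forall>v w. (pt v, pt w) \<in> V \<longrightarrow> q v w \<noteq> 0 \<and> s v w = p v w / q v w)" by blast
qed

lemma O_sect_local:
  assumes "\<And>v w. (pt v, pt w) \<notin> U \<Longrightarrow> s v w = 0"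
    and "\<And>x. x \<in> U \<Longrightarrow> \<exists>V s'. x \<in> V \<and> V \<subseteq> U \<and> s' \<in> O_sect i j V \<and>
      (\<forall>v w. (pt v, pt w) \<in> V \<longrightarrow> s v w = s' v w)"
  shows "s \<in> O_sect i j U"
proof (rule O_sectI[OF assms(1)])
  fix x assume "x \<in> U"
  from assms(2)[OF this] obtain V s' where V: "x \<in> V" "V \<subseteq> U" "s' \<in> O_sect i j V"
    "\<And>v w. (pt v, pt w) \<in> V \<Longrightarrow> s v w = s' v w" by blast
  from V(3,1) obtain W m n m' n' p q where *: "p \<in> bihom m n" "q \<in> bihom m' n'" "zopen W" "x \<in> W" "W \<subseteq> V"
    "int m - int m' = i" "int n - int n' = j"
    "\<And>v w. (pt v, pt w) \<in> W \<Longrightarrow> q v w \<noteq> 0 \<and> s' v w = p v w / q v w" by (rule O_sectE) blast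
  show "\<exists>V m n m' n' p q. p \<in> bihom m n \<and> q \<in> bihom m' n' \<and> zopen V \<and> x \<in> V \<and> V \<subseteq> U \<and>
      int m - int m' = i \<and> int n - int n' = j \<and>
      (\<forall>v w. (pt v, pt w) \<in> V \<longrightarrow> q v w \<noteq> 0 \<and> s v w = p v w / q v w)"
  proof (intro exI conjI)
    show "p \<in> bihom m n" "q \<in> bihom m' n'" "zopen W" by fact+
  qed (use *(4-8) V(2,4) in auto)
qed

lemma O_sect_quot:
  assumes "zopen U" "p \<in> bihom m n" "q \<in> bihom m' n'" "\<And>v w. (pt v, pt w) \<in> U \<Longrightarrow> q v w \<noteq> 0"
    and "i = int m - int m'" "j = int n - int n'"
  shows "restr U (\<lambda>v w. p v w / q v w) \<in> O_sect i j U"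
proof (rule O_sectI)
  fix x assume x: "x \<in> U"
  show "\<exists>V a b a' b' f g. f \<in> bihom a b \<and> g \<in> bihom a' b' \<and> zopen V \<and> x \<in> V \<and> V \<subseteq> U \<and>
      int a - int a' = i \<and> int b - int b' = j \<and>
      (\<forall>v w. (pt v, pt w) \<in> V \<longrightarrow> g v w \<noteq> 0 \<and> restr U (\<lambda>v w. p v w / q v w) v w = f v w / g v w)"
  proof (intro exI conjI)
    show "p \<in> bihom m n" "q \<in> bihom m' n'" "zopen U" by fact+
  qed (use assms x in auto)
qed auto

lemma O_sect_restrict:
  assumes "s \<in> O_sect i j U" "zopen V" "V \<subseteq> U"
  shows "restr V s \<in> O_sect i j V"
proof (rule O_sectI)
  fix x assume x: "x \<in> V"
  with assms(3) have "x \<in> U" by auto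
  from assms(1) this obtain W m n m' n' p q where *: "p \<in> bihom m n" "q \<in> bihom m' n'" "zopen W" "x \<in> W" "W \<subseteq> U"
    "int m - int m' = i" "int n - int n' = j"
    "\<And>v w. (pt v, pt w) \<in> W \<Longrightarrow> q v w \<noteq> 0 \<and> s v w = p v w / q v w" by (rule O_sectE) blast
  show "\<exists>W m n m' n' p q. p \<in> bihom m n \<and> q \<in> bihom m' n' \<and> zopen W \<and> x \<in> W \<and> W \<subseteq> V \<and>
      int m - int m' = i \<and> int n - int n' = j \<and>
      (\<forall>v w. (pt v, pt w) \<in> W \<longrightarrow> q v w \<noteq> 0 \<and> restr V s v w = p v w / q v w)"
  proof (intro exI conjI)
    show "p \<in> bihom m n" "q \<in> bihom m' n'" by fact+
    show "zopen (V \<inter> W)" by (rule zopen_Int[OF assms(2) *(3)])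
  qed (use * x in auto)
qed auto

lemma O_sect_mult_quot:
  assumes "s \<in> O_sect i j U" "f \<in> bihom a b" "g \<in> bihom a' b'" "\<And>v w. (pt v, pt w) \<in> U \<Longrightarrow> g v w \<noteq> 0"
    and "i' = i + int a - int a'" "j' = j + int b - int b'"
  shows "(\<lambda>v w. s v w * f v w / g v w) \<in> O_sect i' j' U"
proof (rule O_sectI)
  fix x assume x: "x \<in> U"
  from assms(1) this obtain W m n m' n' p q where *: "p \<in> bihom m n" "q \<in> bihom m' n'" "zopen W" "x \<in> W" "W \<subseteq> U"
    "int m - int m' = i" "int n - int n' = j"
    "\<And>v w. (pt v, pt w) \<in> W \<Longrightarrow> q v w \<noteq> 0 \<and> s v w = p v w / q v w" by (rule O_sectE) blast
  show "\<exists>W m n m' n' p q. p \<in> bihom m n \<and> q \<in> bihom m' n' \<and> zopen W \<and> x \<in> W \<and> W \<subseteq> U \<and>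
      int m - int m' = i' \<and> int n - int n' = j' \<and>
      (\<forall>v w. (pt v, pt w) \<in> W \<longrightarrow> q v w \<noteq> 0 \<and> s v w * f v w / g v w = p v w / q v w)"
  proof (intro exI conjI)
    show "(\<lambda>v w. p v w * f v w) \<in> bihom (m + a) (n + b)" "(\<lambda>v w. q v w * g v w) \<in> bihom (m' + a') (n' + b')"
      by (intro bihom_mult * assms)+
  qed (use * assms(4-6) in auto)
qed (simp add: O_sect_outside[OF assms(1)])

lemma O_sect_add:
  assumes "s \<in> O_sect i j U" "t \<in> O_sect i j U"
  shows "(\<lambda>v w. s v w + t v w) \<in> O_sect i j U"
proof (rule O_sectI)
  fix x assume x: "x \<in> U"
  from assms(1) this obtain W m n m' n' p q where *: "p \<in> bihom m n" "q \<in> bihom m' n'" "zopen W" "x \<in> W" "W \<subseteq> U"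
    "int m - int m' = i" "int n - int n' = j"
    "\<And>v w. (pt v, pt w) \<in> W \<Longrightarrow> q v w \<noteq> 0 \<and> s v w = p v w / q v w" by (rule O_sectE) blast
  from assms(2) x obtain V a b a' b' f g where **: "f \<in> bihom a b" "g \<in> bihom a' b'" "zopen V" "x \<in> V" "V \<subseteq> U"
    "int a - int a' = i" "int b - int b' = j"
    "\<And>v w. (pt v, pt w) \<in> V \<Longrightarrow> g v w \<noteq> 0 \<and> t v w = f v w / g v w" by (rule O_sectE) blast
  have e: "a + m' = m + a'" "b + n' = n + b'" using *(6,7) **(6,7) by linarith+
  show "\<exists>W m n m' n' p q. p \<in> bihom m n \<and> q \<in> bihom m' n' \<and> zopen W \<and> x \<in> W \<and> W \<subseteq> U \<and>
      int m - int m' = i \<and> int n - int n' = j \<and>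
      (\<forall>v w. (pt v, pt w) \<in> W \<longrightarrow> q v w \<noteq> 0 \<and> s v w + t v w = p v w / q v w)"
  proof (intro exI conjI)
    show "(\<lambda>v w. p v w * g v w + f v w * q v w) \<in> bihom (m + a') (n + b')"
      using bihom_add[OF bihom_mult[OF *(1) **(2)] bihom_mult[OF **(1) *(2), unfolded e]] .
    show "(\<lambda>v w. q v w * g v w) \<in> bihom (m' + a') (n' + b')"
      by (intro bihom_mult * **)
    show "zopen (W \<inter> V)" using * ** zopen_Int by auto
    show "\<forall>v w. (pt v, pt w) \<in> W \<inter> V \<longrightarrow> q v w * g v w \<noteq> 0 \<and>
      s v w + t v w = (p v w * g v w + f v w * q v w) / (q v w * g v w)"
      using *(8) **(8) by (auto simp: add_frac_eq)
  qed (use * ** in auto)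
qed (simp add: O_sect_outside[OF assms(1)] O_sect_outside[OF assms(2)])

lemma O_sect_cmult: "s \<in> O_sect i j U \<Longrightarrow> (\<lambda>v w. c * s v w) \<in> O_sect i j U"
  using O_sect_mult_quot[of s i j U "\<lambda>v w. c" 0 0 "\<lambda>v w. 1" 0 0 i j] bihom_const
  by (simp add: mult.commute)

lemma O_sect_uminus: "s \<in> O_sect i j U \<Longrightarrow> (\<lambda>v w. - s v w) \<in> O_sect i j U"
  using O_sect_cmult[of s i j U "-1"] by simp

lemma O_sect_diff: "s \<in> O_sect i j U \<Longrightarrow> t \<in> O_sect i j U \<Longrightarrow> (\<lambda>v w. s v w - t v w) \<in> O_sect i j U"
  using O_sect_add[OF _ O_sect_uminus, of s i j U t] by simp

text \<open>Even the zero section needs local fractions of bidegree (i, j). The denominator is a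
  product of powers of coordinates that are nonzero at x, with exponents so large that the degrees
  of the numerator are natural numbers.\<close>

lemma O_sect_zero:
  assumes "zopen U"
  shows "(\<lambda>v w. 0) \<in> O_sect i j U"
proof (rule O_sectI)
  fix x assume x: "x \<in> U"
  hence "x \<in> T" using zopen_subset_T[OF assms] by auto
  then obtain v w where vw: "x = (pt v, pt w)" "v \<in> fcone" "w \<in> fcone" by (rule T_cases)
  obtain k l where kl: "v $ k \<noteq> 0" "w $ l \<noteq> 0" using fcone_coord vw(2,3) by metis
  define a b where "a = nat (- i)" and "b = nat (- j)"
  define q where "q = (\<lambda>v w :: complex^3. (v $ k) ^ Suc a * (w $ l) ^ Suc b)"
  have q: "q \<in> bihom (Suc a) (Suc b)"
    unfolding q_def using bihom_mult[OF bihom_power[OF bihom_coord1, where N = "Suc a"] bihom_power[OF bihom_coord2, where N = "Suc b"]] by simp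
  show "\<exists>W m n m' n' p q. p \<in> bihom m n \<and> q \<in> bihom m' n' \<and> zopen W \<and> x \<in> W \<and> W \<subseteq> U \<and>
      int m - int m' = i \<and> int n - int n' = j \<and>
      (\<forall>v w. (pt v, pt w) \<in> W \<longrightarrow> q v w \<noteq> 0 \<and> 0 = p v w / q v w)"
  proof (intro exI conjI)
    show "(\<lambda>v w. 0) \<in> bihom (nat (i + 1 + a)) (nat (j + 1 + b))" by (rule bihom_zero)
    show "q \<in> bihom (Suc a) (Suc b)" by (rule q)
    show "zopen (U \<inter> D q)" by (intro zopen_Int assms zopen_D[OF q])
    show "x \<in> U \<inter> D q" using x vw kl by (auto simp: D_def q_def)
    show "\<forall>v w. (pt v, pt w) \<in> U \<inter> D q \<longrightarrow> q v w \<noteq> 0 \<and> 0 = 0 / q v w" by (auto simp: in_D[OF q])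
  qed (auto simp: a_def b_def)
qed simp

lemma O_sect_sum:
  assumes "zopen U" "\<And>x. x \<in> X \<Longrightarrow> s x \<in> O_sect i j U"
  shows "(\<lambda>v w. \<Sum>x\<in>X. s x v w) \<in> O_sect i j U"
  using assms(2) by (induction X rule: infinite_finite_induct) (auto intro: O_sect_zero O_sect_add assms(1))

lemma O_sect_act:
  assumes z: "primitive_root5 \<zeta>" and s: "s \<in> O_sect i j U"
  shows "(\<lambda>v w. s (act1 \<zeta> g v) (act2 \<zeta> g w)) \<in> O_sect i j (actT \<zeta> (- g) ` U)"
proof (rule O_sectI)
  fix v w assume "(pt v, pt w) \<notin> actT \<zeta> (- g) ` U"
  thus "s (act1 \<zeta> g v) (act2 \<zeta> g w) = 0" using s by (simp add: in_actT_image[OF z] O_sect_outside)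
next
  fix x assume x: "x \<in> actT \<zeta> (- g) ` U"
  hence "actT \<zeta> g x \<in> U" by (simp add: in_actT_image[OF z])
  from s this obtain W m n m' n' p q where *: "p \<in> bihom m n" "q \<in> bihom m' n'" "zopen W" "actT \<zeta> g x \<in> W" "W \<subseteq> U"
    "int m - int m' = i" "int n - int n' = j"
    "\<And>v w. (pt v, pt w) \<in> W \<Longrightarrow> q v w \<noteq> 0 \<and> s v w = p v w / q v w" by (rule O_sectE) blast
  show "\<exists>W m n m' n' p q. p \<in> bihom m n \<and> q \<in> bihom m' n' \<and> zopen W \<and> x \<in> W \<and> W \<subseteq> actT \<zeta> (- g) ` U \<and>
      int m - int m' = i \<and> int n - int n' = j \<and>
      (\<forall>v w. (pt v, pt w) \<in> W \<longrightarrow> q v w \<noteq> 0 \<and> s (act1 \<zeta> g v) (act2 \<zeta> g w) = p v w / q v w)"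
  proof (intro exI conjI)
    show "(\<lambda>v w. p (act1 \<zeta> g v) (act2 \<zeta> g w)) \<in> bihom m n"
      "(\<lambda>v w. q (act1 \<zeta> g v) (act2 \<zeta> g w)) \<in> bihom m' n'" by (intro bihom_act *)+
    show "zopen (actT \<zeta> (- g) ` W)" by (intro zopen_act[OF z] *)
  qed (use * in \<open>auto simp: in_actT_image[OF z]\<close>)
qed

text \<open>Collect all h for which s h is given by one polynomial on the whole cone. Locally such h
  exist, so on D q they have no common zero, and q^N is a combination of them; multiplying the
  combination by s yields a single numerator for the denominator q^N.\<close>

lemma O_sect_affine:
  assumes s: "s \<in> O_sect i j (D q)" and q: "q \<in> bihom a b" and ab: "a > 0" "b > 0"
  obtains N p m n where "N > 0" "p \<in> bihom m n" "int m = i + int (N * a)" "int n = j + int (N * b)"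
    "\<And>v w. v \<in> fcone \<Longrightarrow> w \<in> fcone \<Longrightarrow> s v w * q v w ^ N = p v w"
proof -
  define R where "R h P m n m' n' \<longleftrightarrow> P \<in> bihom m n \<and> h \<in> bihom m' n' \<and> int m - int m' = i \<and> int n - int n' = j \<and>
    (\<forall>v\<in>fcone. \<forall>w\<in>fcone. s v w * h v w = P v w)" for h P m n m' n'
  define F where "F = {h. \<exists>P m n m' n'. R h P m n m' n'}"
  hence "\<forall>h. \<exists>P m n m' n'. h \<in> F \<longrightarrow> R h P m n m' n'" by blast
  hence "\<exists>P m n m' n'. \<forall>h. h \<in> F \<longrightarrow> R h (P h) (m h) (n h) (m' h) (n' h)" unfolding choice_iff .
  then obtain P m n m' n' where R: "\<And>h. h \<in> F \<Longrightarrow> R h (P h) (m h) (n h) (m' h) (n' h)" by blast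
  have cov: "\<exists>h\<in>F. h v w \<noteq> 0" if vw: "v \<in> fcone" "w \<in> fcone" "q v w \<noteq> 0" for v w
  proof -
    have x: "(pt v, pt w) \<in> D q" using vw by (auto simp: D_def)
    from s x obtain V m n m' n' p r where *: "p \<in> bihom m n" "r \<in> bihom m' n'" "zopen V" "(pt v, pt w) \<in> V" "V \<subseteq> D q"
      "int m - int m' = i" "int n - int n' = j"
      "\<And>v w. (pt v, pt w) \<in> V \<Longrightarrow> r v w \<noteq> 0 \<and> s v w = p v w / r v w" by (rule O_sectE) blast
    from *(3,4) obtain g c d where g: "g \<in> bihom c d" "(pt v, pt w) \<in> D g" "D g \<subseteq> V" by (rule zopen_nbhd)
    \<comment> \<open>The factor g vanishes outside V, so the relation between s and the local
      fraction becomes true on the entire cone.\<close>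
    let ?h = "\<lambda>v w. r v w * g v w" and ?p = "\<lambda>v w. p v w * g v w"
    have "s v w * ?h v w = ?p v w" if c: "v \<in> fcone" "w \<in> fcone" for v w
    proof (cases "g v w = 0")
      case False
      with c g(3) have "(pt v, pt w) \<in> V" by (auto simp: D_def)
      from *(8)[OF this] show ?thesis by simp
    qed simp
    hence "R ?h ?p (m + c) (n + d) (m' + c) (n' + d)"
      unfolding R_def using bihom_mult[OF *(1) g(1)] bihom_mult[OF *(2) g(1)] *(6,7) by auto
    hence "?h \<in> F" unfolding F_def by blast
    moreover have "?h v w \<noteq> 0" using *(4,8) g(1,2) by (auto simp: in_D)
    ultimately show ?thesis by (intro bexI[of _ ?h])
  qed
  have Fb: "\<And>h. h \<in> F \<Longrightarrow> h \<in> bihom (m' h) (n' h)" using R by (auto simp: R_def)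
  obtain N G g where G: "finite G" "G \<subseteq> F"
    "\<And>h. h \<in> G \<Longrightarrow> m' h \<le> N * a \<and> n' h \<le> N * b \<and> g h \<in> bihom (N * a - m' h) (N * b - n' h)"
    "\<And>v w. v \<in> fcone \<Longrightarrow> w \<in> fcone \<Longrightarrow> q v w ^ N = (\<Sum>h\<in>G. g h v w * h v w)"
  proof (rule power_combination[of F m' n', OF Fb q ab cov], goal_cases)
    case (5 N G g)
    show ?case by (rule 5(1)[OF 5(2-5)])
  qed auto
  define M where "M = nat (i + int (N * a))"
  define M' where "M' = nat (j + int (N * b))"
  define p where "p = (\<lambda>v w. \<Sum>h\<in>G. g h v w * P h v w)"
  have GR: "R h (P h) (m h) (n h) (m' h) (n' h)" if "h \<in> G" for h using R G(2) that by auto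
  show ?thesis
  proof (cases "G = {}")
    case True
    \<comment> \<open>An empty G means that q vanishes on all pairs of cone vectors. No h is left to
      bound the degrees, so the exponent is chosen large enough to make both degrees of the zero
      numerator nonnegative.\<close>
    define K where "K = Suc (nat (- i) + nat (- j))"
    have "K \<le> K * a" "K \<le> K * b" using mult_le_mono2[of 1 a K] mult_le_mono2[of 1 b K] ab by simp_all
    hence "0 \<le> i + int (K * a)" "0 \<le> j + int (K * b)" unfolding K_def by linarith+
    moreover have "s v w * q v w ^ K = 0" if "v \<in> fcone" "w \<in> fcone" for v w
      using G(4)[OF that] True by (auto simp: K_def)
    ultimately show ?thesis
      by (intro that[of K "\<lambda>v w. 0" "nat (i + int (K * a))" "nat (j + int (K * b))"])
         (auto simp: K_def bihom_zero simp del: of_nat_mult)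
  next
    case False
    then obtain h0 where h0: "h0 \<in> G" by auto
    have deg: "N * a - m' h + m h = M" "N * b - n' h + n h = M'" if "h \<in> G" for h
      using GR[OF that] G(3)[OF that] unfolding M_def M'_def R_def by linarith+
    have pos: "int M = i + int (N * a)" "int M' = j + int (N * b)"
      using deg[OF h0] GR[OF h0] G(3)[OF h0] unfolding R_def by linarith+
    have p: "p \<in> bihom M M'" unfolding p_def
    proof (rule bihom_sum)
      fix h assume h: "h \<in> G"
      have "P h \<in> bihom (m h) (n h)" using GR[OF h] by (simp add: R_def)
      with G(3)[OF h] have "(\<lambda>v w. g h v w * P h v w) \<in> bihom (N * a - m' h + m h) (N * b - n' h + n h)"
        by (intro bihom_mult) auto
      thus "(\<lambda>v w. g h v w * P h v w) \<in> bihom M M'" by (simp add: deg[OF h])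
    qed
    have e: "s v w * q v w ^ N = p v w" if c: "v \<in> fcone" "w \<in> fcone" for v w
    proof -
      have "s v w * q v w ^ N = (\<Sum>h\<in>G. g h v w * (s v w * h v w))"
        by (simp add: G(4)[OF c] sum_distrib_left mult_ac)
      also have "\<dots> = p v w" unfolding p_def using GR c by (intro sum.cong refl) (auto simp: R_def)
      finally show ?thesis .
    qed
    show ?thesis
    \<comment> \<open>One extra factor q makes the exponent positive.\<close>
    proof (rule that[of "Suc N" "\<lambda>v w. p v w * q v w" "M + a" "M' + b"])
      show "(\<lambda>v w. p v w * q v w) \<in> bihom (M + a) (M' + b)" by (intro bihom_mult p q)
      show "int (M + a) = i + int (Suc N * a)" "int (M' + b) = j + int (Suc N * b)" using pos by auto
      show "s v w * q v w ^ Suc N = p v w * q v w" if "v \<in> fcone" "w \<in> fcone" for v w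
        using e[OF that] by (simp add: mult_ac)
    qed simp
  qed
qed

text \<open>A section over the part where f \<noteq> 0 is a fraction with denominator (q f)^N0, and
  multiplying by f^N with N \<ge> N0 removes its poles along f = 0. All larger N are allowed so that
  one exponent can serve finitely many sections.\<close>

lemma O_sect_extend:
  assumes q: "q \<in> bihom a b" "a > 0" "b > 0" and f: "f \<in> bihom c d"
    and s: "s \<in> O_sect i j (D q \<inter> D f)"
  shows "\<exists>N0. \<forall>N\<ge>N0. (\<lambda>v w. s v w * f v w ^ N) \<in> O_sect (i + int (N * c)) (j + int (N * d)) (D q)"
proof -
  have qf: "(\<lambda>v w. q v w * f v w) \<in> bihom (a + c) (b + d)" by (intro bihom_mult q f)
  have "s \<in> O_sect i j (D (\<lambda>v w. q v w * f v w))" using s by (simp add: D_mult[OF q(1) f])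
  then obtain N0 p m n where *: "N0 > 0" "p \<in> bihom m n" "int m = i + int (N0 * (a + c))" "int n = j + int (N0 * (b + d))"
    "\<And>v w. v \<in> fcone \<Longrightarrow> w \<in> fcone \<Longrightarrow> s v w * (q v w * f v w) ^ N0 = p v w"
    by (rule O_sect_affine[OF _ qf]) (use q in auto)
  have "(\<lambda>v w. s v w * f v w ^ N) \<in> O_sect (i + int (N * c)) (j + int (N * d)) (D q)" if N: "N \<ge> N0" for N
  proof -
    have r: "(\<lambda>v w. p v w * f v w ^ (N - N0)) \<in> bihom (m + (N - N0) * c) (n + (N - N0) * d)"
      by (intro bihom_mult bihom_power f *)
    have "restr (D q) (\<lambda>v w. (p v w * f v w ^ (N - N0)) / q v w ^ N0) \<in> O_sect (i + int (N * c)) (j + int (N * d)) (D q)"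
    proof (rule O_sect_quot[OF zopen_D[OF q(1)] r bihom_power[OF q(1)]])
      have "(N - N0) * c + N0 * c = N * c" "(N - N0) * d + N0 * d = N * d"
        using N by (simp_all add: add_mult_distrib[symmetric])
      thus "i + int (N * c) = int (m + (N - N0) * c) - int (N0 * a)"
        "j + int (N * d) = int (n + (N - N0) * d) - int (N0 * b)"
        using *(3,4) by (auto simp: algebra_simps simp flip: of_nat_mult of_nat_add)
    qed (auto simp: in_D[OF q(1)])
    also have "restr (D q) (\<lambda>v w. (p v w * f v w ^ (N - N0)) / q v w ^ N0) = (\<lambda>v w. s v w * f v w ^ N)"
    proof (intro ext)
      fix v w
      show "restr (D q) (\<lambda>v w. (p v w * f v w ^ (N - N0)) / q v w ^ N0) v w = s v w * f v w ^ N"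
      proof (cases "(pt v, pt w) \<in> D q")
        case True
        hence c: "v \<in> fcone" "w \<in> fcone" "q v w \<noteq> 0" by (auto simp: in_D[OF q(1)])
        have "p v w * f v w ^ (N - N0) = s v w * q v w ^ N0 * (f v w ^ N0 * f v w ^ (N - N0))"
          by (simp add: *(5)[OF c(1,2), symmetric] power_mult_distrib)
        also have "f v w ^ N0 * f v w ^ (N - N0) = f v w ^ N" using N by (simp add: power_add[symmetric])
        finally show ?thesis using True c(3) by simp
      qed (use O_sect_outside[OF s] in auto)
    qed
    finally show ?thesis .
  qed
  thus ?thesis by blast
qed

subsection \<open>Alternating sums over lists\<close>

text \<open>The Cech differential in recursive form: first the face without the head, then, with
  opposite sign, the faces that keep it. The identities needed for complexes become inductions on
  the list.\<close>

fun alt :: "('a list \<Rightarrow> complex) \<Rightarrow> 'a list \<Rightarrow> complex" where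
  "alt f [] = 0"
| "alt f (x # xs) = f xs - alt (\<lambda>ys. f (x # ys)) xs"

lemma alt_eq_sum: "(\<Sum>l<length xs. (-1)^l * f (take l xs @ drop (Suc l) xs)) = alt f xs"
proof (induction xs arbitrary: f)
  case (Cons x xs)
  have "(\<Sum>l<length (x # xs). (-1)^l * f (take l (x # xs) @ drop (Suc l) (x # xs)))
      = f xs + (\<Sum>l<length xs. - ((-1)^l * f (x # (take l xs @ drop (Suc l) xs))))"
    by (simp only: length_Cons sum.lessThan_Suc_shift) simp
  also have "\<dots> = f xs - alt (\<lambda>ys. f (x # ys)) xs"
    unfolding sum_negf Cons.IH[of "\<lambda>ys. f (x # ys)"] by simp
  finally show ?case by simp
qed simp

lemma alt_cong:
  "(\<And>ys. Suc (length ys) = length xs \<Longrightarrow> set ys \<subseteq> set xs \<Longrightarrow> f ys = g ys) \<Longrightarrow> alt f xs = alt g xs"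
proof (induction xs arbitrary: f g)
  case (Cons x xs)
  have "alt (\<lambda>ys. f (x # ys)) xs = alt (\<lambda>ys. g (x # ys)) xs"
    by (rule Cons.IH, rule Cons.prems) auto
  moreover have "f xs = g xs" by (rule Cons.prems) auto
  ultimately show ?case by simp
qed simp

lemma alt_add: "alt (\<lambda>ys. f ys + g ys) xs = alt f xs + alt g xs"
  by (induction xs arbitrary: f g) auto

lemma alt_cmult: "alt (\<lambda>ys. a * f ys) xs = a * alt f xs"
  by (induction xs arbitrary: f) (auto simp: right_diff_distrib)

lemma alt_zero [simp]: "alt (\<lambda>ys. 0) xs = 0"
  by (induction xs) auto

lemma alt_uminus: "alt (\<lambda>ys. - f ys) xs = - alt f xs"
  using alt_cmult[of "-1" f xs] by simp

lemma alt_diff: "alt (\<lambda>ys. f ys - g ys) xs = alt f xs - alt g xs"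
  using alt_add[of f "\<lambda>ys. - g ys" xs] by (simp add: alt_uminus)

lemma alt_sum: "alt (\<lambda>ys. \<Sum>x\<in>X. f x ys) xs = (\<Sum>x\<in>X. alt (f x) xs)"
  by (induction X rule: infinite_finite_induct) (auto simp: alt_add)

lemma alt_alt: "alt (alt f) xs = 0"
proof (induction xs arbitrary: f)
  case (Cons x xs)
  thus ?case by (simp add: alt_diff)
qed simp

lemma alt_map: "alt (\<lambda>ys. f (map \<tau> ys)) xs = alt f (map \<tau> xs)"
  by (induction xs arbitrary: f) auto

text \<open>The prism operator of simplicial topology: the signed sum of f over the lists that
  follow \<sigma> up to some entry, repeat that entry under \<tau>, and continue with \<tau>. It is
  the chain homotopy between the maps induced by two refinement functions.\<close>

fun prism :: "('a \<Rightarrow> 'b) \<Rightarrow> ('a \<Rightarrow> 'b) \<Rightarrow> ('b list \<Rightarrow> complex) \<Rightarrow> 'a list \<Rightarrow> complex" where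
  "prism \<sigma> \<tau> f [] = 0"
| "prism \<sigma> \<tau> f (x # xs) = f (\<sigma> x # \<tau> x # map \<tau> xs) - prism \<sigma> \<tau> (\<lambda>ys. f (\<sigma> x # ys)) xs"

lemma prism_diff: "prism \<sigma> \<tau> (\<lambda>ys. f ys - g ys) xs = prism \<sigma> \<tau> f xs - prism \<sigma> \<tau> g xs"
  by (induction xs arbitrary: f g) auto

lemma prism_homotopy:
  "alt (prism \<sigma> \<tau> f) xs + prism \<sigma> \<tau> (alt f) xs = f (map \<tau> xs) - f (map \<sigma> xs)"
proof (induction xs arbitrary: f)
  case (Cons x xs)
  from Cons[of "\<lambda>ys. f (\<sigma> x # ys)"] show ?case
    by (simp add: alt_diff prism_diff alt_map[of "\<lambda>zs. f (\<sigma> x # \<tau> x # zs)"] algebra_simps)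
qed simp

lemma prism_eq_0:
  "(\<And>ys. length ys = Suc (length xs) \<Longrightarrow> set ys \<subseteq> \<sigma> ` set xs \<union> \<tau> ` set xs \<Longrightarrow> f ys = 0) \<Longrightarrow> prism \<sigma> \<tau> f xs = 0"
proof (induction xs arbitrary: f)
  case (Cons x xs)
  have "prism \<sigma> \<tau> (\<lambda>ys. f (\<sigma> x # ys)) xs = 0"
    by (rule Cons.IH, rule Cons.prems) auto
  moreover have "f (\<sigma> x # \<tau> x # map \<tau> xs) = 0" by (rule Cons.prems) auto
  ultimately show ?case by simp
qed simp

lemma restr_zero [simp]: "restr V (\<lambda>v w. 0) = (\<lambda>v w. 0)"
  by (simp add: restr_def)

lemma restr_diff: "restr V (\<lambda>v w. f v w - g v w) = (\<lambda>v w. restr V f v w - restr V g v w)"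
  by (auto simp: restr_def fun_eq_iff)

lemma O_sect_alt:
  assumes "zopen V"
  shows "(\<And>ys. Suc (length ys) = length xs \<Longrightarrow> set ys \<subseteq> set xs \<Longrightarrow> restr V (c ys) \<in> O_sect i j V) \<Longrightarrow>
    restr V (\<lambda>v w. alt (\<lambda>ys. c ys v w) xs) \<in> O_sect i j V"
proof (induction xs arbitrary: c)
  case Nil
  show ?case by (simp add: O_sect_zero assms)
next
  case (Cons x xs)
  have "restr V (\<lambda>v w. alt (\<lambda>ys. c (x # ys) v w) xs) \<in> O_sect i j V"
    by (rule Cons.IH, rule Cons.prems) auto
  moreover have "restr V (c xs) \<in> O_sect i j V" by (rule Cons.prems) auto
  ultimately show ?case by (simp add: restr_diff O_sect_diff)
qed

lemma O_sect_prism: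
  assumes "zopen V"
  shows "(\<And>ys. length ys = Suc (length xs) \<Longrightarrow> set ys \<subseteq> \<sigma> ` set xs \<union> \<tau> ` set xs \<Longrightarrow> restr V (c ys) \<in> O_sect i j V) \<Longrightarrow>
    restr V (\<lambda>v w. prism \<sigma> \<tau> (\<lambda>ys. c ys v w) xs) \<in> O_sect i j V"
proof (induction xs arbitrary: c)
  case Nil
  show ?case by (simp add: O_sect_zero assms)
next
  case (Cons x xs)
  have "restr V (\<lambda>v w. prism \<sigma> \<tau> (\<lambda>ys. c (\<sigma> x # ys) v w) xs) \<in> O_sect i j V"
    by (rule Cons.IH, rule Cons.prems) auto
  moreover have "restr V (c (\<sigma> x # \<tau> x # map \<tau> xs)) \<in> O_sect i j V" by (rule Cons.prems) auto
  ultimately show ?case by (simp add: restr_diff O_sect_diff)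
qed

subsection \<open>Relative cochains\<close>

text \<open>The Cech cochains of the cover that W induces on E. Closedness and boundaries are tested
  pointwise on the intersections with E, so the same cochain can be examined over several sets E
  without restricting it each time.\<close>

definition cch :: "int \<Rightarrow> int \<Rightarrow> point set set \<Rightarrow> point set \<Rightarrow> nat \<Rightarrow> cochain set" where
  "cch i j W E k = {c. \<forall>xs\<in>simplices W k. c xs \<in> O_sect i j (\<Inter>(set xs) \<inter> E)}"

definition closedc :: "point set set \<Rightarrow> point set \<Rightarrow> nat \<Rightarrow> cochain \<Rightarrow> bool" where
  "closedc W E k c \<longleftrightarrow> (\<forall>xs\<in>simplices W (Suc k). \<forall>v w. (pt v, pt w) \<in> \<Inter>(set xs) \<inter> E \<longrightarrow>
     alt (\<lambda>ys. c ys v w) xs = 0)"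

definition bounds :: "point set set \<Rightarrow> point set \<Rightarrow> nat \<Rightarrow> cochain \<Rightarrow> cochain \<Rightarrow> bool" where
  "bounds W E k b c \<longleftrightarrow> (\<forall>xs\<in>simplices W k. \<forall>v w. (pt v, pt w) \<in> \<Inter>(set xs) \<inter> E \<longrightarrow>
     c xs v w = alt (\<lambda>ys. b ys v w) xs)"

lemma delta_alt: "delta c xs = restr (\<Inter>(set xs)) (\<lambda>v w. alt (\<lambda>ys. c ys v w) xs)"
  unfolding delta_def alt_eq_sum[symmetric] ..

lemma simplices_finite: "finite W \<Longrightarrow> finite (simplices W k)"
  using finite_lists_length_eq[of W "Suc k"] by (simp add: simplices_def conj_commute)

lemma simplices_ConsI: "U \<in> W \<Longrightarrow> xs \<in> simplices W k \<Longrightarrow> U # xs \<in> simplices W (Suc k)"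
  by (simp add: simplices_def)

lemma simplices_face:
  "xs \<in> simplices W (Suc k) \<Longrightarrow> Suc (length ys) = length xs \<Longrightarrow> set ys \<subseteq> set xs \<Longrightarrow> ys \<in> simplices W k"
  by (auto simp: simplices_def)

lemma simplices_open:
  assumes "\<And>U. U \<in> W \<Longrightarrow> zopen U" "xs \<in> simplices W k"
  shows "zopen (\<Inter>(set xs))"
  by (rule zopen_Inter) (use assms in \<open>auto simp: simplices_def\<close>)

text \<open>Principal sets given by equations of positive degree in both factors are affine open
  subsets of \<open>T\<close>.\<close>

locale affine_cover =
  fixes W :: "point set set"
  assumes fin: "finite W" and cov: "\<Union>W = T"
    and princ: "U \<in> W \<Longrightarrow> \<exists>f a b. f \<in> bihom a b \<and> a > 0 \<and> b > 0 \<and> U = D f"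
begin

lemma W_open: "U \<in> W \<Longrightarrow> zopen U"
  using princ zopen_D by blast

text \<open>The sheaf axiom: closedness on pairs of members says that the sections agree on
  overlaps. The glued section takes its value at a point from an arbitrarily selected member
  containing it.\<close>

lemma row_zero:
  assumes E: "E \<subseteq> T" and c: "c \<in> cch i j W E 0" "closedc W E 0 c"
  obtains s where "s \<in> O_sect i j E" "\<And>U v w. U \<in> W \<Longrightarrow> (pt v, pt w) \<in> U \<inter> E \<Longrightarrow> c [U] v w = s v w"
proof -
  define u where "u x = (SOME U. U \<in> W \<and> x \<in> U)" for x
  have u: "u x \<in> W \<and> x \<in> u x" if "x \<in> E" for x
    unfolding u_def by (rule someI_ex) (use that E cov in blast)
  define s where "s = (\<lambda>v w. if (pt v, pt w) \<in> E then c [u (pt v, pt w)] v w else 0)"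
  have eq: "c [U] v w = s v w" if "U \<in> W" "(pt v, pt w) \<in> U \<inter> E" for U v w
  proof -
    let ?U = "u (pt v, pt w)"
    have "[U, ?U] \<in> simplices W (Suc 0)" using that u by (auto simp: simplices_def)
    moreover have "(pt v, pt w) \<in> \<Inter>(set [U, ?U]) \<inter> E" using that u by auto
    ultimately have "alt (\<lambda>ys. c ys v w) [U, ?U] = 0" using c(2) unfolding closedc_def by blast
    thus ?thesis using that by (simp add: s_def)
  qed
  have "s \<in> O_sect i j E"
  proof (rule O_sect_local)
    fix x assume x: "x \<in> E"
    have "c [u x] \<in> O_sect i j (u x \<inter> E)"
      using c(1) u[OF x] unfolding cch_def by (auto simp: simplices_def dest: spec[of _ "[u x]"])
    thus "\<exists>V s'. x \<in> V \<and> V \<subseteq> E \<and> s' \<in> O_sect i j V \<and> (\<forall>v w. (pt v, pt w) \<in> V \<longrightarrow> s v w = s' v w)"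
      using eq u[OF x] x by (intro exI[of _ "u x \<inter> E"] exI[of _ "c [u x]"]) auto
  qed (auto simp: s_def)
  with eq show ?thesis using that by blast
qed

text \<open>The contracting homotopy comes from a partition of unity: the powers of the equations of the
  cover generate a power of the equation of the affine open set.\<close>

lemma row_exact:
  assumes e: "e \<in> bihom a b" "a > 0" "b > 0"
    and c: "c \<in> cch i j W (D e) (Suc k)" "closedc W (D e) (Suc k) c"
  shows "\<exists>b\<in>cch i j W (D e) k. bounds W (D e) (Suc k) b c"
proof -
  have "\<forall>U. \<exists>f m n. U \<in> W \<longrightarrow> f \<in> bihom m n \<and> m > 0 \<and> n > 0 \<and> U = D f" using princ by blast
  hence "\<exists>f m n. \<forall>U. U \<in> W \<longrightarrow> f U \<in> bihom (m U) (n U) \<and> m U > 0 \<and> n U > 0 \<and> U = D (f U)"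
    unfolding choice_iff .
  then obtain f m n where *: "\<forall>U. U \<in> W \<longrightarrow> f U \<in> bihom (m U) (n U) \<and> m U > 0 \<and> n U > 0 \<and> U = D (f U)"
    by (elim exE)
  have f: "f U \<in> bihom (m U) (n U)" "U = D (f U)" if "U \<in> W" for U using * that by auto
  have int: "\<exists>q a' b'. q \<in> bihom a' b' \<and> a' > 0 \<and> b' > 0 \<and> D q = \<Inter>(set xs) \<inter> D e" if "set xs \<subseteq> W" for xs
    using that
  proof (induction xs)
    case Nil
    show ?case using e by auto
  next
    case (Cons U xs)
    then obtain q a' b' where q: "q \<in> bihom a' b'" "a' > 0" "b' > 0" "D q = \<Inter>(set xs) \<inter> D e" by auto
    have U: "f U \<in> bihom (m U) (n U)" "D (f U) = U" using f Cons.prems by auto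
    show ?case
      using bihom_mult[OF q(1) U(1)] D_mult[OF q(1) U(1)] q(2-4) U(2)
      by (intro exI[of _ "\<lambda>v w. q v w * f U v w"] exI[of _ "a' + m U"] exI[of _ "b' + n U"]) auto
  qed
  have "\<exists>N0. \<forall>N\<ge>N0. (\<lambda>v w. c (U # xs) v w * f U v w ^ N) \<in>
      O_sect (i + int (N * m U)) (j + int (N * n U)) (\<Inter>(set xs) \<inter> D e)"
    if "U \<in> W" "xs \<in> simplices W k" for U xs
  proof -
    have "set xs \<subseteq> W" using that by (simp add: simplices_def)
    from int[OF this] obtain q a' b' where q: "q \<in> bihom a' b'" "a' > 0" "b' > 0" "D q = \<Inter>(set xs) \<inter> D e" by blast
    have "c (U # xs) \<in> O_sect i j (\<Inter>(set (U # xs)) \<inter> D e)"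
      using c(1) simplices_ConsI[OF that] unfolding cch_def by blast
    also have "\<Inter>(set (U # xs)) \<inter> D e = D q \<inter> D (f U)" using f(2)[OF that(1)] q(4) by auto
    finally show ?thesis using O_sect_extend[OF q(1-3) f(1)[OF that(1)]] by (simp add: q(4))
  qed
  hence "\<forall>x\<in>W \<times> simplices W k. \<exists>N0. \<forall>N\<ge>N0. (\<lambda>v w. c (fst x # snd x) v w * f (fst x) v w ^ N) \<in>
      O_sect (i + int (N * m (fst x))) (j + int (N * n (fst x))) (\<Inter>(set (snd x)) \<inter> D e)" by auto
  then obtain N0 where N0: "\<And>x N. x \<in> W \<times> simplices W k \<Longrightarrow> N \<ge> N0 x \<Longrightarrow>
     (\<lambda>v w. c (fst x # snd x) v w * f (fst x) v w ^ N) \<in>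
      O_sect (i + int (N * m (fst x))) (j + int (N * n (fst x))) (\<Inter>(set (snd x)) \<inter> D e)"
    unfolding bchoice_iff by blast
  \<comment> \<open>One exponent for all finitely many pairs of a member and a simplex. It is
    positive, so f^N \<noteq> 0 at a point places the point in the member D f.\<close>
  define N where "N = Suc (sum N0 (W \<times> simplices W k))"
  have ext: "(\<lambda>v w. c (U # xs) v w * f U v w ^ N) \<in>
      O_sect (i + int (N * m U)) (j + int (N * n U)) (\<Inter>(set xs) \<inter> D e)"
    if "U \<in> W" "xs \<in> simplices W k" for U xs
  proof -
    have "N0 (U, xs) \<le> sum N0 (W \<times> simplices W k)"
      by (rule member_le_sum) (use that fin simplices_finite[OF fin] in auto)
    thus ?thesis using N0[of "(U, xs)" N] that by (simp add: N_def)
  qed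
  define F where "F = (\<lambda>U v w. f U v w ^ N) ` W"
  define u where "u h = (SOME U. U \<in> W \<and> h = (\<lambda>v w. f U v w ^ N))" for h
  have u: "u h \<in> W" "h = (\<lambda>v w. f (u h) v w ^ N)" if "h \<in> F" for h
  proof -
    have "u h \<in> W \<and> h = (\<lambda>v w. f (u h) v w ^ N)"
      unfolding u_def by (rule someI_ex) (use that in \<open>auto simp: F_def\<close>)
    thus "u h \<in> W" "h = (\<lambda>v w. f (u h) v w ^ N)" by auto
  qed
  have Fb: "h \<in> bihom (N * m (u h)) (N * n (u h))" if "h \<in> F" for h
    by (subst u(2)[OF that], rule bihom_power, rule f(1)[OF u(1)[OF that]])
  have covF: "\<exists>h\<in>F. h v w \<noteq> 0" if vw: "v \<in> fcone" "w \<in> fcone" "e v w \<noteq> 0" for v w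
  proof -
    have "(pt v, pt w) \<in> \<Union>W" unfolding cov using vw by (simp add: in_T)
    then obtain U where U: "U \<in> W" "(pt v, pt w) \<in> U" by blast
    hence "(pt v, pt w) \<in> D (f U)" using f(2)[OF U(1)] by simp
    hence "f U v w \<noteq> 0" by (simp add: in_D[OF f(1)[OF U(1)]])
    thus ?thesis using U(1) unfolding F_def by auto
  qed
  obtain M G g where G: "finite G" "G \<subseteq> F"
    "\<And>h. h \<in> G \<Longrightarrow> N * m (u h) \<le> M * a \<and> N * n (u h) \<le> M * b \<and> g h \<in> bihom (M * a - N * m (u h)) (M * b - N * n (u h))"
    "\<And>v w. v \<in> fcone \<Longrightarrow> w \<in> fcone \<Longrightarrow> e v w ^ M = (\<Sum>h\<in>G. g h v w * h v w)"
  proof (rule power_combination[of F "\<lambda>h. N * m (u h)" "\<lambda>h. N * n (u h)", OF Fb e covF], goal_cases)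
    case (5 N G g)
    show ?case by (rule 5(1)[OF 5(2-5)])
  qed auto
  \<comment> \<open>The partition of unity is (g h) h / e^M. A term is regular on all of the
    intersection of xs, not only inside \<open>u h\<close>, because the factor h = f^N kills the
    poles of c along the boundary of \<open>u h\<close>.\<close>
  define B where "B xs = (\<lambda>v w. \<Sum>h\<in>G. c (u h # xs) v w * h v w * g h v w / e v w ^ M)" for xs
  have "B \<in> cch i j W (D e) k" unfolding cch_def
  proof (intro CollectI ballI)
    fix xs assume xs: "xs \<in> simplices W k"
    have op: "zopen (\<Inter>(set xs) \<inter> D e)"
      using zopen_Int[OF simplices_open[OF W_open xs] zopen_D[OF e(1)]] .
    show "B xs \<in> O_sect i j (\<Inter>(set xs) \<inter> D e)" unfolding B_def
    proof (rule O_sect_sum[OF op])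
      fix h assume h: "h \<in> G"
      hence hF: "h \<in> F" using G(2) by auto
      have "(\<lambda>v w. c (u h # xs) v w * h v w) \<in>
          O_sect (i + int (N * m (u h))) (j + int (N * n (u h))) (\<Inter>(set xs) \<inter> D e)"
        by (subst (2) u(2)[OF hF]) (rule ext[OF u(1)[OF hF] xs])
      thus "(\<lambda>v w. c (u h # xs) v w * h v w * g h v w / e v w ^ M) \<in> O_sect i j (\<Inter>(set xs) \<inter> D e)"
        using G(3)[OF h]
        by (intro O_sect_mult_quot[OF _ _ bihom_power[OF e(1), of M]]) (auto simp: in_D[OF e(1)])
    qed
  qed
  moreover have "bounds W (D e) (Suc k) B c" unfolding bounds_def
  proof (intro ballI allI impI)
    fix xs v w assume xs: "xs \<in> simplices W (Suc k)" and vw: "(pt v, pt w) \<in> \<Inter>(set xs) \<inter> D e"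
    have vw': "v \<in> fcone" "w \<in> fcone" "e v w \<noteq> 0" using vw by (auto simp: in_D[OF e(1)])
    \<comment> \<open>Where h is nonzero the point lies in \<open>u h\<close>, and closedness of c
      on the list \<open>u h # xs\<close> is the homotopy identity; elsewhere both sides
      vanish.\<close>
    have *: "h v w * alt (\<lambda>ys. c (u h # ys) v w) xs = h v w * c xs v w" if h: "h \<in> G" for h
    proof (cases "h v w = 0")
      case False
      have hF: "h \<in> F" using G(2) h by auto
      have "h v w = f (u h) v w ^ N" by (rule fun_cong[OF fun_cong[OF u(2)[OF hF]]])
      with False have "f (u h) v w \<noteq> 0" by (auto simp: N_def)
      hence "(pt v, pt w) \<in> D (f (u h))"
        unfolding in_D[OF f(1)[OF u(1)[OF hF]]] using vw' by blast
      hence "(pt v, pt w) \<in> u h" unfolding f(2)[OF u(1)[OF hF], symmetric] .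
      hence "(pt v, pt w) \<in> \<Inter>(set (u h # xs)) \<inter> D e" using vw by auto
      moreover have "u h # xs \<in> simplices W (Suc (Suc k))" by (rule simplices_ConsI[OF u(1)[OF hF] xs])
      ultimately have "alt (\<lambda>ys. c ys v w) (u h # xs) = 0" using c(2) unfolding closedc_def by blast
      thus ?thesis by simp
    qed simp
    have "alt (\<lambda>ys. B ys v w) xs = (\<Sum>h\<in>G. alt (\<lambda>ys. (h v w * g h v w / e v w ^ M) * c (u h # ys) v w) xs)"
      unfolding B_def alt_sum by (simp add: mult_ac)
    also have "\<dots> = (\<Sum>h\<in>G. (g h v w / e v w ^ M) * (h v w * alt (\<lambda>ys. c (u h # ys) v w) xs))"
      unfolding alt_cmult by (simp add: mult_ac)
    also have "\<dots> = (\<Sum>h\<in>G. (g h v w * h v w) * (c xs v w / e v w ^ M))"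
      using * by (intro sum.cong refl) simp
    also have "\<dots> = e v w ^ M * (c xs v w / e v w ^ M)"
      by (simp only: sum_distrib_right[symmetric] G(4)[OF vw'(1,2), symmetric])
    also have "\<dots> = c xs v w" using vw'(3) by simp
    finally show "c xs v w = alt (\<lambda>ys. B ys v w) xs" by simp
  qed
  ultimately show ?thesis by blast
qed

end

subsection \<open>Laurent monomials\<close>

type_synonym index = "(int \<times> int \<times> nat) \<times> (int \<times> int \<times> nat)"

definition mon3 :: "int \<times> int \<times> nat \<Rightarrow> complex^3 \<Rightarrow> complex" where
  "mon3 = (\<lambda>(p, q, c) v. v$1 powi p * v$2 powi q * (v$3) ^ c)"

definition mono2 :: "index \<Rightarrow> cfun" where
  "mono2 \<mu> v w = mon3 (fst \<mu>) v * mon3 (snd \<mu>) w"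

definition Lau :: "(index \<Rightarrow> complex) \<Rightarrow> cfun" where
  "Lau \<kappa> v w = (\<Sum>\<mu> | \<kappa> \<mu> \<noteq> 0. \<kappa> \<mu> * mono2 \<mu> v w)"

definition fsupp :: "(index \<Rightarrow> complex) \<Rightarrow> index set \<Rightarrow> bool" where
  "fsupp \<kappa> S \<longleftrightarrow> finite {\<mu>. \<kappa> \<mu> \<noteq> 0} \<and> {\<mu>. \<kappa> \<mu> \<noteq> 0} \<subseteq> S"

text \<open>The flags tell which of the first two coordinates may be inverted. The bound c \<le> 4
  fixes a normal form, since the fifth power of the third coordinate is a polynomial in the other
  two.\<close>

definition idx1 :: "bool \<Rightarrow> bool \<Rightarrow> int \<Rightarrow> (int \<times> int \<times> nat) set" where
  "idx1 x y i = {(p, q, c). p + q + int c = i \<and> c \<le> 4 \<and> (p < 0 \<longrightarrow> x) \<and> (q < 0 \<longrightarrow> y)}"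

definition Idx :: "bool \<Rightarrow> bool \<Rightarrow> bool \<Rightarrow> bool \<Rightarrow> int \<Rightarrow> int \<Rightarrow> index set" where
  "Idx x y x' y' i j = idx1 x y i \<times> idx1 x' y' j"

definition ee :: "bool \<Rightarrow> bool \<Rightarrow> bool \<Rightarrow> bool \<Rightarrow> cfun" where
  "ee x y x' y' = (\<lambda>v w. ((if x then v$1 else 1) * (if y then v$2 else 1)) * ((if x' then w$1 else 1) * (if y' then w$2 else 1)))"

text \<open>The four affine sets are the \<open>EE a (\<not> a) b (\<not> b)\<close>. More flags set
  to True mean smaller sets: all flags True is the intersection of the four, all flags False is
  \<open>T\<close>.\<close>

definition EE :: "bool \<Rightarrow> bool \<Rightarrow> bool \<Rightarrow> bool \<Rightarrow> point set" where
  "EE x y x' y' = D (ee x y x' y')"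

lemma ee_bihom: "ee x y x' y' \<in> bihom (of_bool x + of_bool y) (of_bool x' + of_bool y')"
proof -
  have 1: "(\<lambda>v w. if x then v $ k else 1) \<in> bihom (of_bool x) 0" for x k
    using bihom_coord1[of k] bihom_const[of 1] by (cases x) auto
  have 2: "(\<lambda>v w. if x then w $ k else 1) \<in> bihom 0 (of_bool x)" for x k
    using bihom_coord2[of k] bihom_const[of 1] by (cases x) auto
  show ?thesis unfolding ee_def
    using bihom_mult[OF bihom_mult[OF 1[of x 1] 1[of y 2]] bihom_mult[OF 2[of x' 1] 2[of y' 2]]] by simp
qed

lemma in_EE: "(pt v, pt w) \<in> EE x y x' y' \<longleftrightarrow> v \<in> fcone \<and> w \<in> fcone \<and>
   (x \<longrightarrow> v$1 \<noteq> 0) \<and> (y \<longrightarrow> v$2 \<noteq> 0) \<and> (x' \<longrightarrow> w$1 \<noteq> 0) \<and> (y' \<longrightarrow> w$2 \<noteq> 0)"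
  unfolding EE_def in_D[OF ee_bihom] by (auto simp: ee_def)

lemma EE_open: "zopen (EE x y x' y')"
  unfolding EE_def by (rule zopen_D[OF ee_bihom])

lemma EE_subset_T: "EE x y x' y' \<subseteq> T"
  unfolding EE_def by (rule D_subset_T)

lemma EE_act:
  assumes "primitive_root5 \<zeta>"
  shows "actT \<zeta> g ` EE x y x' y' = EE x y x' y'"
proof (rule T_subset_eqI)
  show "actT \<zeta> g ` EE x y x' y' \<subseteq> T" using zopen_subset_T[OF zopen_act[OF assms EE_open]] .
qed (auto simp: in_actT_image[OF assms] in_EE EE_subset_T[THEN subsetD] act1_cone[OF assms] act2_cone[OF assms] rpow_nonzero[OF assms])

lemma Lau_eq_sum:
  assumes "finite F" "{\<mu>. \<kappa> \<mu> \<noteq> 0} \<subseteq> F"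
  shows "Lau \<kappa> v w = (\<Sum>\<mu>\<in>F. \<kappa> \<mu> * mono2 \<mu> v w)"
  unfolding Lau_def by (rule sum.mono_neutral_left) (use assms in auto)

lemma fsupp_combine:
  assumes "fsupp \<kappa> S" "fsupp \<kappa>' S" "\<And>\<mu>. \<kappa> \<mu> = 0 \<Longrightarrow> \<kappa>' \<mu> = 0 \<Longrightarrow> h \<mu> = 0"
  shows "fsupp h S"
proof -
  have "{\<mu>. h \<mu> \<noteq> 0} \<subseteq> {\<mu>. \<kappa> \<mu> \<noteq> 0} \<union> {\<mu>. \<kappa>' \<mu> \<noteq> 0}" using assms(3) by blast
  with assms(1,2) show ?thesis unfolding fsupp_def
    by (meson finite_UnI finite_subset le_sup_iff order_trans)
qed

lemma fsupp_add: "fsupp \<kappa> S \<Longrightarrow> fsupp \<kappa>' S \<Longrightarrow> fsupp (\<lambda>\<mu>. \<kappa> \<mu> + \<kappa>' \<mu>) S"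
  by (rule fsupp_combine[of \<kappa> S \<kappa>']) auto

lemma fsupp_mult: "fsupp \<kappa> S \<Longrightarrow> fsupp (\<lambda>\<mu>. a \<mu> * \<kappa> \<mu>) S"
  by (rule fsupp_combine[of \<kappa> S \<kappa>]) auto

lemma fsupp_uminus: "fsupp \<kappa> S \<Longrightarrow> fsupp (\<lambda>\<mu>. - \<kappa> \<mu>) S"
  using fsupp_mult[of \<kappa> S "\<lambda>_. -1"] by simp

lemma fsupp_diff: "fsupp \<kappa> S \<Longrightarrow> fsupp \<kappa>' S \<Longrightarrow> fsupp (\<lambda>\<mu>. \<kappa> \<mu> - \<kappa>' \<mu>) S"
  using fsupp_add[OF _ fsupp_uminus, of \<kappa> S \<kappa>'] by simp

lemma fsupp_zero: "fsupp (\<lambda>\<mu>. 0) S"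
  by (simp add: fsupp_def)

lemma fsupp_mono: "fsupp \<kappa> S \<Longrightarrow> S \<subseteq> S' \<Longrightarrow> fsupp \<kappa> S'"
  unfolding fsupp_def by blast

lemma Lau_zero [simp]: "Lau (\<lambda>\<mu>. 0) v w = 0"
  by (simp add: Lau_def)

lemma Lau_add:
  assumes "fsupp \<kappa> S" "fsupp \<kappa>' S'"
  shows "Lau (\<lambda>\<mu>. \<kappa> \<mu> + \<kappa>' \<mu>) v w = Lau \<kappa> v w + Lau \<kappa>' v w"
proof -
  let ?F = "{\<mu>. \<kappa> \<mu> \<noteq> 0} \<union> {\<mu>. \<kappa>' \<mu> \<noteq> 0}"
  have F: "finite ?F" using assms by (simp add: fsupp_def)
  have "{\<mu>. \<kappa> \<mu> + \<kappa>' \<mu> \<noteq> 0} \<subseteq> ?F" by auto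
  thus ?thesis
    by (simp add: Lau_eq_sum[OF F, of "\<lambda>\<mu>. \<kappa> \<mu> + \<kappa>' \<mu>"] Lau_eq_sum[OF F, of \<kappa>] Lau_eq_sum[OF F, of \<kappa>'] distrib_right sum.distrib)
qed

lemma Lau_cmult:
  assumes "fsupp \<kappa> S"
  shows "Lau (\<lambda>\<mu>. a * \<kappa> \<mu>) v w = a * Lau \<kappa> v w"
proof -
  have F: "finite {\<mu>. \<kappa> \<mu> \<noteq> 0}" using assms by (simp add: fsupp_def)
  show ?thesis by (subst (1 2) Lau_eq_sum[OF F]) (auto simp: sum_distrib_left mult.assoc)
qed

lemma Lau_diff:
  assumes "fsupp \<kappa> S" "fsupp \<kappa>' S'"
  shows "Lau (\<lambda>\<mu>. \<kappa> \<mu> - \<kappa>' \<mu>) v w = Lau \<kappa> v w - Lau \<kappa>' v w"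
  using Lau_add[OF assms(1) fsupp_uminus[OF assms(2)], of v w] Lau_cmult[OF assms(2), of "-1" v w] by simp

lemma Lau_single: "Lau (\<lambda>\<mu>. if \<mu> = \<nu> then 1 else 0) = mono2 \<nu>"
  by (auto simp: Lau_def fun_eq_iff)

lemma mono2_section:
  assumes U: "zopen U" "U \<subseteq> EE x y x' y'" and \<mu>: "\<mu> \<in> Idx x y x' y' i j"
  shows "restr U (mono2 \<mu>) \<in> O_sect i j U"
proof -
  obtain p q c p' q' c' where e: "\<mu> = ((p, q, c), (p', q', c'))" by (metis surj_pair)
  have I: "p + q + int c = i" "p' + q' + int c' = j" "p < 0 \<Longrightarrow> x" "q < 0 \<Longrightarrow> y" "p' < 0 \<Longrightarrow> x'" "q' < 0 \<Longrightarrow> y'"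
    using \<mu> by (auto simp: e Idx_def idx1_def)
  define P where "P = (\<lambda>(v :: complex^3) (w :: complex^3). ((v$1) ^ nat p * (v$2) ^ nat q * (v$3) ^ c) * ((w$1) ^ nat p' * (w$2) ^ nat q' * (w$3) ^ c'))"
  define Q where "Q = (\<lambda>(v :: complex^3) (w :: complex^3). ((v$1) ^ nat (- p) * (v$2) ^ nat (- q)) * ((w$1) ^ nat (- p') * (w$2) ^ nat (- q')))"
  have 1: "(\<lambda>v w. (v $ k) ^ n) \<in> bihom n 0" for k n
    using bihom_power[OF bihom_coord1, where N = n] by simp
  have 2: "(\<lambda>v w. (w $ k) ^ n) \<in> bihom 0 n" for k n
    using bihom_power[OF bihom_coord2, where N = n] by simp
  have P: "P \<in> bihom (nat p + nat q + c) (nat p' + nat q' + c')" unfolding P_def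
    using bihom_mult[OF bihom_mult[OF bihom_mult[OF 1[of 1 "nat p"] 1[of 2 "nat q"]] 1[of 3 c]]
      bihom_mult[OF bihom_mult[OF 2[of 1 "nat p'"] 2[of 2 "nat q'"]] 2[of 3 c']]] by simp
  have Q: "Q \<in> bihom (nat (- p) + nat (- q)) (nat (- p') + nat (- q'))" unfolding Q_def
    using bihom_mult[OF bihom_mult[OF 1[of 1 "nat (- p)"] 1[of 2 "nat (- q)"]]
      bihom_mult[OF 2[of 1 "nat (- p')"] 2[of 2 "nat (- q')"]]] by simp
  have pw: "z powi n = z ^ nat n / z ^ nat (- n)" if "n < 0 \<Longrightarrow> z \<noteq> 0" for z :: complex and n
    by (cases "n \<ge> 0") (auto simp: power_int_def field_simps)
  have nz: "Q v w \<noteq> 0 \<and> mono2 \<mu> v w = P v w / Q v w" if "(pt v, pt w) \<in> U" for v w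
  proof -
    have "(pt v, pt w) \<in> EE x y x' y'" using that U(2) by blast
    hence nz: "p < 0 \<Longrightarrow> v$1 \<noteq> 0" "q < 0 \<Longrightarrow> v$2 \<noteq> 0" "p' < 0 \<Longrightarrow> w$1 \<noteq> 0" "q' < 0 \<Longrightarrow> w$2 \<noteq> 0"
      using I unfolding in_EE by blast+
    have "(v$1) ^ nat (- p) \<noteq> 0" "(v$2) ^ nat (- q) \<noteq> 0" "(w$1) ^ nat (- p') \<noteq> 0" "(w$2) ^ nat (- q') \<noteq> 0"
      using nz by auto
    hence "Q v w \<noteq> 0" by (simp add: Q_def)
    moreover have "mono2 \<mu> v w = P v w / Q v w"
      unfolding mono2_def mon3_def e P_def Q_def using pw nz by simp
    ultimately show ?thesis by simp
  qed
  have "restr U (\<lambda>v w. P v w / Q v w) \<in> O_sect i j U"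
    by (rule O_sect_quot[OF U(1) P Q]) (use nz I in auto)
  also have "restr U (\<lambda>v w. P v w / Q v w) = restr U (mono2 \<mu>)"
    using nz by (auto simp: restr_def fun_eq_iff)
  finally show ?thesis .
qed

lemma Lau_section:
  assumes U: "zopen U" "U \<subseteq> EE x y x' y'" and \<kappa>: "fsupp \<kappa> (Idx x y x' y' i j)"
  shows "restr U (Lau \<kappa>) \<in> O_sect i j U"
proof -
  have "(\<lambda>v w. \<Sum>\<mu> | \<kappa> \<mu> \<noteq> 0. \<kappa> \<mu> * restr U (mono2 \<mu>) v w) \<in> O_sect i j U"
    by (rule O_sect_sum[OF U(1)], rule O_sect_cmult, rule mono2_section[OF U])
       (use \<kappa> in \<open>auto simp: fsupp_def\<close>)
  also have "(\<lambda>v w. \<Sum>\<mu> | \<kappa> \<mu> \<noteq> 0. \<kappa> \<mu> * restr U (mono2 \<mu>) v w) = restr U (Lau \<kappa>)"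
    by (auto simp: restr_def fun_eq_iff Lau_def)
  finally show ?thesis .
qed

text \<open>Closed under multiplication, because the Fermat equation reduces the exponents of the third
  coordinates.\<close>

definition LS :: "bool \<Rightarrow> bool \<Rightarrow> bool \<Rightarrow> bool \<Rightarrow> int \<Rightarrow> int \<Rightarrow> cfun set" where
  "LS x y x' y' i j = {s. \<exists>\<kappa>. fsupp \<kappa> (Idx x y x' y' i j) \<and>
     (\<forall>v w. (pt v, pt w) \<in> EE x y x' y' \<longrightarrow> s v w = Lau \<kappa> v w)}"

lemma LS_add: "s \<in> LS x y x' y' i j \<Longrightarrow> t \<in> LS x y x' y' i j \<Longrightarrow> (\<lambda>v w. s v w + t v w) \<in> LS x y x' y' i j"
proof -
  assume "s \<in> LS x y x' y' i j" "t \<in> LS x y x' y' i j"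
  then obtain \<kappa> \<kappa>' where *: "fsupp \<kappa> (Idx x y x' y' i j)" "fsupp \<kappa>' (Idx x y x' y' i j)"
    "\<forall>v w. (pt v, pt w) \<in> EE x y x' y' \<longrightarrow> s v w = Lau \<kappa> v w"
    "\<forall>v w. (pt v, pt w) \<in> EE x y x' y' \<longrightarrow> t v w = Lau \<kappa>' v w" unfolding LS_def by blast
  show ?thesis unfolding LS_def
    by (intro CollectI exI[of _ "\<lambda>\<mu>. \<kappa> \<mu> + \<kappa>' \<mu>"] conjI fsupp_add *(1,2)) (use * in \<open>auto simp: Lau_add[OF *(1,2)]\<close>)
qed

lemma LS_cmult: "s \<in> LS x y x' y' i j \<Longrightarrow> (\<lambda>v w. a * s v w) \<in> LS x y x' y' i j"
proof -
  assume "s \<in> LS x y x' y' i j"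
  then obtain \<kappa> where *: "fsupp \<kappa> (Idx x y x' y' i j)"
    "\<forall>v w. (pt v, pt w) \<in> EE x y x' y' \<longrightarrow> s v w = Lau \<kappa> v w" unfolding LS_def by blast
  show ?thesis unfolding LS_def
    by (intro CollectI exI[of _ "\<lambda>\<mu>. a * \<kappa> \<mu>"] conjI fsupp_mult *(1)) (use * in \<open>auto simp: Lau_cmult[OF *(1)]\<close>)
qed

lemma LS_sum: "(\<And>a. a \<in> A \<Longrightarrow> s a \<in> LS x y x' y' i j) \<Longrightarrow> (\<lambda>v w. \<Sum>a\<in>A. s a v w) \<in> LS x y x' y' i j"
proof (induction A rule: infinite_finite_induct)
  case (insert a A)
  thus ?case by (auto intro: LS_add)
qed (auto simp: LS_def intro!: exI[of _ "\<lambda>\<mu>. 0"] fsupp_zero)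

lemma LS_cong:
  "s \<in> LS x y x' y' i j \<Longrightarrow> (\<And>v w. (pt v, pt w) \<in> EE x y x' y' \<Longrightarrow> t v w = s v w) \<Longrightarrow> t \<in> LS x y x' y' i j"
  unfolding LS_def by auto

text \<open>Replacing the fifth power of a third coordinate by minus the sum of the two others
  lowers c by 5 and raises p or q by 5. Exponents of invertible coordinates only grow, so no new
  poles arise, and c + c' decreases.\<close>

lemma LS_mono2:
  assumes "p + q + int c = i" "p' + q' + int c' = j" "p < 0 \<Longrightarrow> x" "q < 0 \<Longrightarrow> y" "p' < 0 \<Longrightarrow> x'" "q' < 0 \<Longrightarrow> y'"
  shows "mono2 ((p, q, c), (p', q', c')) \<in> LS x y x' y' i j"
  using assms
proof (induction "c + c'" arbitrary: p q c p' q' c' rule: less_induct)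
  case less
  have shift: "z powi (p + 5) = z powi p * z ^ 5" if "p < 0 \<Longrightarrow> z \<noteq> 0" for z :: complex and p
  proof -
    have "z powi (p + 5) = z powi p * z powi 5" by (rule power_int_add) (use that in auto)
    thus ?thesis by simp
  qed
  have fer: "(v$3)^5 = - ((v$1)^5) - (v$2)^5" if "v \<in> fcone" for v
    using that by (simp add: fcone_def eq_neg_iff_add_eq_0 algebra_simps)
  consider "c \<le> 4" "c' \<le> 4" | "c > 4" | "c' > 4" by linarith
  thus ?case
  proof cases
    case 1
    thus ?thesis unfolding LS_def using less.prems
      by (intro CollectI exI[of _ "\<lambda>\<mu>. if \<mu> = ((p, q, c), (p', q', c')) then 1 else 0"])
         (auto simp: Lau_single fsupp_def Idx_def idx1_def)
  next
    case 2
    define d where "d = c - 5"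
    have c: "c = d + 5" using 2 by (simp add: d_def)
    have "mono2 ((p + 5, q, d), (p', q', c')) \<in> LS x y x' y' i j"
      "mono2 ((p, q + 5, d), (p', q', c')) \<in> LS x y x' y' i j"
      by (rule less.hyps; use less.prems c in force)+
    hence "(\<lambda>v w. (-1) * mono2 ((p + 5, q, d), (p', q', c')) v w + (-1) * mono2 ((p, q + 5, d), (p', q', c')) v w) \<in> LS x y x' y' i j"
      by (intro LS_add LS_cmult)
    thus ?thesis
    proof (rule LS_cong)
      fix v w assume "(pt v, pt w) \<in> EE x y x' y'"
      hence *: "v \<in> fcone" "p < 0 \<Longrightarrow> v$1 \<noteq> 0" "q < 0 \<Longrightarrow> v$2 \<noteq> 0" using less.prems(3,4) unfolding in_EE by blast+
      show "mono2 ((p, q, c), (p', q', c')) v w =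
        (-1) * mono2 ((p + 5, q, d), (p', q', c')) v w + (-1) * mono2 ((p, q + 5, d), (p', q', c')) v w"
        by (simp add: mono2_def mon3_def c power_add fer[OF *(1)] shift[OF *(2)] shift[OF *(3)] algebra_simps)
    qed
  next
    case 3
    define d where "d = c' - 5"
    have c: "c' = d + 5" using 3 by (simp add: d_def)
    have "mono2 ((p, q, c), (p' + 5, q', d)) \<in> LS x y x' y' i j"
      "mono2 ((p, q, c), (p', q' + 5, d)) \<in> LS x y x' y' i j"
      by (rule less.hyps; use less.prems c in force)+
    hence "(\<lambda>v w. (-1) * mono2 ((p, q, c), (p' + 5, q', d)) v w + (-1) * mono2 ((p, q, c), (p', q' + 5, d)) v w) \<in> LS x y x' y' i j"
      by (intro LS_add LS_cmult)
    thus ?thesis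
    proof (rule LS_cong)
      fix v w assume "(pt v, pt w) \<in> EE x y x' y'"
      hence *: "w \<in> fcone" "p' < 0 \<Longrightarrow> w$1 \<noteq> 0" "q' < 0 \<Longrightarrow> w$2 \<noteq> 0" using less.prems(5,6) unfolding in_EE by blast+
      show "mono2 ((p, q, c), (p', q', c')) v w =
        (-1) * mono2 ((p, q, c), (p' + 5, q', d)) v w + (-1) * mono2 ((p, q, c), (p', q' + 5, d)) v w"
        by (simp add: mono2_def mon3_def c power_add fer[OF *(1)] shift[OF *(2)] shift[OF *(3)] algebra_simps)
    qed
  qed
qed

text \<open>On an affine set a section is a polynomial divided by a power of the equation, which is
  itself a monomial; so the section is a combination of Laurent monomials, brought to normal form by
  \<open>LS_mono2\<close>. Each factor needs a True flag for the set to be affine.\<close>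

lemma section_expansion:
  assumes xy: "x \<or> y" "x' \<or> y'" and s: "s \<in> O_sect i j (EE x y x' y')"
  obtains \<kappa> where "fsupp \<kappa> (Idx x y x' y' i j)" "\<And>v w. (pt v, pt w) \<in> EE x y x' y' \<Longrightarrow> s v w = Lau \<kappa> v w"
proof -
  have pos: "0 < (of_bool x + of_bool y :: nat)" "0 < (of_bool x' + of_bool y' :: nat)" using xy by auto
  obtain N p m n where p: "p \<in> bihom m n" "int m = i + int (N * (of_bool x + of_bool y))"
    "int n = j + int (N * (of_bool x' + of_bool y'))"
    "\<And>v w. v \<in> fcone \<Longrightarrow> w \<in> fcone \<Longrightarrow> s v w * ee x y x' y' v w ^ N = p v w"
  proof (rule O_sect_affine[OF s[unfolded EE_def] ee_bihom pos], goal_cases)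
    case (1 N p m n)
    show ?case by (rule 1(1)[OF 1(3-6)])
  qed
  from p(1) obtain c where
    c: "p = (\<lambda>v w. \<Sum>\<alpha>\<in>exps m. \<Sum>\<beta>\<in>exps n. c \<alpha> \<beta> * monom3 \<alpha> v * monom3 \<beta> w)"
    unfolding bihom_def by auto
  \<comment> \<open>Division by the N-th power of the equation subtracts N from exactly those
    exponents whose coordinate is inverted.\<close>
  define \<nu> where "\<nu> \<alpha> \<beta> = ((int (\<alpha> 1) - int (N * of_bool x), int (\<alpha> 2) - int (N * of_bool y), \<alpha> 3),
     (int (\<beta> 1) - int (N * of_bool x'), int (\<beta> 2) - int (N * of_bool y'), \<beta> 3))" for \<alpha> \<beta> :: "3 \<Rightarrow> nat"
  have "mono2 (\<nu> \<alpha> \<beta>) \<in> LS x y x' y' i j" if "\<alpha> \<in> exps m" "\<beta> \<in> exps n" for \<alpha> \<beta>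
    unfolding \<nu>_def
  proof (rule LS_mono2)
    have neg: "b" if "int a - int (N * of_bool b) < 0" for a b using that by (cases b) auto
    show "int (\<alpha> 1) - int (N * of_bool x) < 0 \<Longrightarrow> x" "int (\<alpha> 2) - int (N * of_bool y) < 0 \<Longrightarrow> y"
      "int (\<beta> 1) - int (N * of_bool x') < 0 \<Longrightarrow> x'" "int (\<beta> 2) - int (N * of_bool y') < 0 \<Longrightarrow> y'"
      by (erule neg)+
  qed (use that p(2,3) in \<open>auto simp: exps_def sum_3 algebra_simps\<close>)
  hence "(\<lambda>v w. \<Sum>\<alpha>\<in>exps m. \<Sum>\<beta>\<in>exps n. c \<alpha> \<beta> * mono2 (\<nu> \<alpha> \<beta>) v w) \<in> LS x y x' y' i j"
    by (intro LS_sum LS_cmult)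
  hence "s \<in> LS x y x' y' i j"
  proof (rule LS_cong)
    fix v w assume "(pt v, pt w) \<in> EE x y x' y'"
    hence *: "v \<in> fcone" "w \<in> fcone" "x \<Longrightarrow> v$1 \<noteq> 0" "y \<Longrightarrow> v$2 \<noteq> 0" "x' \<Longrightarrow> w$1 \<noteq> 0" "y' \<Longrightarrow> w$2 \<noteq> 0"
      unfolding in_EE by blast+
    have e0: "ee x y x' y' v w \<noteq> 0" using * by (auto simp: ee_def)
    have pw: "z powi (int a - int (N * of_bool b)) = z ^ a / (if b then z else 1) ^ N" if "b \<Longrightarrow> z \<noteq> 0" for z :: complex and a b
      using that by (cases b) (simp_all add: power_int_diff)
    have pws: "v$1 powi (int a - int (N * of_bool x)) = (v$1) ^ a / (if x then v$1 else 1) ^ N"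
      "v$2 powi (int a - int (N * of_bool y)) = (v$2) ^ a / (if y then v$2 else 1) ^ N"
      "w$1 powi (int a - int (N * of_bool x')) = (w$1) ^ a / (if x' then w$1 else 1) ^ N"
      "w$2 powi (int a - int (N * of_bool y')) = (w$2) ^ a / (if y' then w$2 else 1) ^ N" for a
      by (rule pw, erule *)+
    have "c \<alpha> \<beta> * mono2 (\<nu> \<alpha> \<beta>) v w = c \<alpha> \<beta> * monom3 \<alpha> v * monom3 \<beta> w / ee x y x' y' v w ^ N" for \<alpha> \<beta>
      unfolding mono2_def mon3_def \<nu>_def ee_def monom3_3 prod.case fst_conv snd_conv
        pws power_mult_distrib by simp
    hence "(\<Sum>\<alpha>\<in>exps m. \<Sum>\<beta>\<in>exps n. c \<alpha> \<beta> * mono2 (\<nu> \<alpha> \<beta>) v w) = p v w / ee x y x' y' v w ^ N"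
      unfolding c by (simp add: sum_divide_distrib)
    also have "\<dots> = s v w" using p(4)[OF *(1,2)] e0 by (simp add: field_simps)
    finally show "s v w = (\<Sum>\<alpha>\<in>exps m. \<Sum>\<beta>\<in>exps n. c \<alpha> \<beta> * mono2 (\<nu> \<alpha> \<beta>) v w)" by simp
  qed
  thus ?thesis using that unfolding LS_def by blast
qed

subsection \<open>Linear independence of the monomials\<close>

text \<open>The geometric sum over the powers of a fifth root of unity other than 1 vanishes. The
  summand 5 keeps c - c0 a natural number without changing the power of \<zeta>.\<close>

lemma root_filter:
  assumes "primitive_root5 \<zeta>" "c \<le> 4" "c0 \<le> 4"
  shows "(\<Sum>l<5. (\<zeta> ^ l) ^ (c + 5 - c0)) = (if c = c0 then 5 else 0)"
proof -
  have z: "\<zeta> ^ 5 = 1" "\<And>k. k \<in> {1..<5} \<Longrightarrow> \<zeta> ^ k \<noteq> 1" using assms by (auto simp: primitive_root5_def)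
  have e: "(\<Sum>l<5. (\<zeta> ^ l) ^ (c + 5 - c0)) = (\<Sum>l<5. (\<zeta> ^ (c + 5 - c0)) ^ l)"
    by (simp add: power_mult[symmetric] mult.commute)
  show ?thesis
  proof (cases "c = c0")
    case True
    thus ?thesis unfolding e by (simp add: z)
  next
    case False
    have "\<zeta> ^ (c + 5 - c0) \<noteq> 1"
    proof (cases "c < c0")
      case True
      thus ?thesis using assms by (intro z(2)) auto
    next
      case F: False
      hence "\<zeta> ^ (c + 5 - c0) = \<zeta> ^ (c - c0) * \<zeta> ^ 5" by (simp add: power_add[symmetric])
      also have "\<dots> \<noteq> 1" using z(1) z(2)[of "c - c0"] F False assms(2) by (simp add: Suc_le_eq)
      finally show ?thesis .
    qed
    moreover have "(\<zeta> ^ (c + 5 - c0)) ^ 5 = 1"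
      using z(1) by (simp add: power_mult[symmetric] mult.commute[of _ 5] power_mult)
    ultimately show ?thesis unfolding e using False by (simp add: sum_gp_strict)
  qed
qed

text \<open>Over a fixed ratio t = Y/X the curve has five points, permuted by multiplying Z by
  \<zeta>. Averaging over them isolates the terms with exponent c0 of Z. What remains is a Laurent
  polynomial in t with infinitely many zeros; its exponent q together with c0 and the degree i
  determines the monomial.\<close>

lemma mon3_independent:
  assumes \<zeta>: "primitive_root5 \<zeta>" and F: "finite F" "F \<subseteq> idx1 True True i"
    and z: "\<And>v. v \<in> fcone \<Longrightarrow> v$1 \<noteq> 0 \<Longrightarrow> v$2 \<noteq> 0 \<Longrightarrow> (\<Sum>\<mu>\<in>F. a \<mu> * mon3 \<mu> v) = 0"
    and \<mu>0: "\<mu>0 \<in> F"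
  shows "a \<mu>0 = 0"
proof -
  obtain p0 q0 c0 where e0: "\<mu>0 = (p0, q0, c0)" by (cases \<mu>0)
  define S where "S = {\<mu>\<in>F. snd (snd \<mu>) = c0}"
  have fS: "finite S" using F(1) by (simp add: S_def)
  have c4: "snd (snd \<mu>) \<le> 4" if "\<mu> \<in> F" for \<mu> using that F(2) by (auto simp: idx1_def)
  have rel: "(\<Sum>\<mu>\<in>S. a \<mu> * t powi fst (snd \<mu>)) = 0" if t: "t \<noteq> 0" "1 + t ^ 5 \<noteq> 0" for t :: complex
  proof -
    \<comment> \<open>The points used are (1 : t : r \<zeta>^l) for l < 5; here a fifth root for the
      third coordinate is found.\<close>
    have "\<exists>r::complex. r ^ 5 = - (1 + t ^ 5)"
    proof
      have "exp (Ln (- (1 + t ^ 5)) / 5) ^ 5 = exp (of_nat 5 * (Ln (- (1 + t ^ 5)) / 5))"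
        by (rule exp_of_nat_mult[symmetric])
      also have "\<dots> = exp (Ln (- (1 + t ^ 5)))" by simp
      also have "\<dots> = - (1 + t ^ 5)" by (rule exp_Ln) (use t in \<open>simp only: neg_equal_0_iff_equal not_False_eq_True\<close>)
      finally show "exp (Ln (- (1 + t ^ 5)) / 5) ^ 5 = - (1 + t ^ 5)" .
    qed
    then obtain r where r: "r ^ 5 = - (1 + t ^ 5)" by blast
    have r0: "r \<noteq> 0" using r t(2) by (metis neg_0_equal_iff_equal power_zero_numeral neg_equal_iff_equal)
    have l: "(\<Sum>\<mu>\<in>F. a \<mu> * (t powi fst (snd \<mu>) * (r * \<zeta> ^ l) ^ snd (snd \<mu>))) = 0" for l
    proof -
      define v :: "complex^3" where "v = vector [1, t, r * \<zeta> ^ l]"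
      have "(\<zeta> ^ l) ^ 5 = 1" using \<zeta> by (simp add: primitive_root5_def power_mult[symmetric] mult.commute[of _ 5] power_mult)
      hence "v \<in> fcone" unfolding fcone_def v_def vec_eq_iff forall_3 by (simp add: power_mult_distrib r)
      from z[OF this] t(1) show ?thesis by (simp add: v_def mon3_def split_beta)
    qed
    \<comment> \<open>Fourier inversion over the five points, selecting the exponent c0.\<close>
    have "0 = (\<Sum>l<5. (\<zeta> ^ l) ^ (5 - c0) * (\<Sum>\<mu>\<in>F. a \<mu> * (t powi fst (snd \<mu>) * (r * \<zeta> ^ l) ^ snd (snd \<mu>))))"
      by (simp add: l)
    also have "\<dots> = (\<Sum>\<mu>\<in>F. a \<mu> * t powi fst (snd \<mu>) * r ^ snd (snd \<mu>) * (\<Sum>l<5. (\<zeta> ^ l) ^ (snd (snd \<mu>) + 5 - c0)))"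
      unfolding sum_distrib_left
    proof (subst sum.swap, intro sum.cong refl)
      fix \<mu> and l :: nat assume "\<mu> \<in> F"
      have "snd (snd \<mu>) + 5 - c0 = (5 - c0) + snd (snd \<mu>)" using c4[OF \<mu>0] by (simp add: e0)
      thus "(\<zeta> ^ l) ^ (5 - c0) * (a \<mu> * (t powi fst (snd \<mu>) * (r * \<zeta> ^ l) ^ snd (snd \<mu>))) =
         a \<mu> * t powi fst (snd \<mu>) * r ^ snd (snd \<mu>) * (\<zeta> ^ l) ^ (snd (snd \<mu>) + 5 - c0)"
        by (simp add: power_add power_mult_distrib mult_ac)
    qed
    also have "\<dots> = (\<Sum>\<mu>\<in>F. if snd (snd \<mu>) = c0 then a \<mu> * t powi fst (snd \<mu>) * r ^ c0 * 5 else 0)"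
      using root_filter[OF \<zeta> c4] c4[OF \<mu>0] by (intro sum.cong refl) (auto simp: e0)
    also have "\<dots> = (\<Sum>\<mu>\<in>S. a \<mu> * t powi fst (snd \<mu>)) * (r ^ c0 * 5)"
      unfolding S_def sum_distrib_right using F(1) by (simp add: sum.If_cases Int_def mult.assoc)
    finally show ?thesis using r0 by simp
  qed
  \<comment> \<open>A shift that makes all exponents of t nonnegative, so that polynomial root
    counting applies.\<close>
  define Q where "Q = (\<Sum>\<mu>\<in>S. \<bar>fst (snd \<mu>)\<bar>)"
  have Q: "0 \<le> fst (snd \<mu>) + Q" if "\<mu> \<in> S" for \<mu>
    using member_le_sum[OF that, of "\<lambda>\<mu>. \<bar>fst (snd \<mu>)\<bar>"] fS by (simp add: Q_def)
  define h where "h = (\<Sum>\<mu>\<in>S. monom (a \<mu>) (nat (fst (snd \<mu>) + Q)))"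
  \<comment> \<open>Positive integers serve as the infinitely many test values: they satisfy t
    \<noteq> 0 and 1 + t^5 \<noteq> 0.\<close>
  have "poly h (of_nat (Suc n)) = 0" for n
  proof -
    let ?t = "of_nat (Suc n) :: complex"
    have t: "?t \<noteq> 0" by (simp del: of_nat_Suc)
    have "1 + ?t ^ 5 = of_nat (1 + Suc n ^ 5)" by (simp only: of_nat_add of_nat_power of_nat_1)
    hence t': "1 + ?t ^ 5 \<noteq> 0" by (simp del: of_nat_Suc of_nat_add of_nat_power)
    have "poly h ?t = (\<Sum>\<mu>\<in>S. a \<mu> * (?t powi fst (snd \<mu>) * ?t powi Q))"
      unfolding h_def poly_sum poly_monom
    proof (intro sum.cong refl)
      fix \<mu> assume "\<mu> \<in> S"
      hence "?t ^ nat (fst (snd \<mu>) + Q) = ?t powi (fst (snd \<mu>) + Q)" using Q by (simp add: power_int_def del: of_nat_Suc)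
      thus "a \<mu> * ?t ^ nat (fst (snd \<mu>) + Q) = a \<mu> * (?t powi fst (snd \<mu>) * ?t powi Q)"
        using t by (simp add: power_int_add del: of_nat_Suc)
    qed
    also have "\<dots> = (\<Sum>\<mu>\<in>S. a \<mu> * ?t powi fst (snd \<mu>)) * ?t powi Q"
      by (simp add: sum_distrib_right mult.assoc del: of_nat_Suc)
    finally show ?thesis unfolding rel[OF t t'] by simp
  qed
  hence "range (\<lambda>n. of_nat (Suc n)) \<subseteq> {t. poly h t = 0}" by auto
  moreover have "infinite (range (\<lambda>n. of_nat (Suc n) :: complex))"
    by (intro range_inj_infinite injI) (simp del: of_nat_Suc)
  ultimately have "infinite {t. poly h t = 0}" by (rule infinite_super)
  hence "h = 0" using poly_roots_finite by blast
  hence "0 = coeff h (nat (q0 + Q))" by simp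
  also have "\<dots> = (\<Sum>\<mu>\<in>S. if \<mu> = \<mu>0 then a \<mu> else 0)"
    unfolding h_def coeff_sum coeff_monom
  proof (intro sum.cong refl)
    fix \<mu> assume \<mu>: "\<mu> \<in> S"
    have \<mu>0S: "\<mu>0 \<in> S" using \<mu>0 by (simp add: S_def e0)
    obtain p q c where e: "\<mu> = (p, q, c)" by (cases \<mu>)
    have "nat (fst (snd \<mu>) + Q) = nat (q0 + Q) \<longleftrightarrow> \<mu> = \<mu>0"
    proof
      assume "nat (fst (snd \<mu>) + Q) = nat (q0 + Q)"
      hence "q = q0" using Q[OF \<mu>] Q[OF \<mu>0S] by (simp add: e e0 eq_nat_nat_iff)
      moreover have "c = c0" using \<mu> by (simp add: S_def e)
      moreover have "p + q + int c = i" "p0 + q0 + int c0 = i" using \<mu> \<mu>0 F(2) by (auto simp: S_def e e0 idx1_def)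
      ultimately show "\<mu> = \<mu>0" by (simp add: e e0)
    qed (simp add: e0)
    thus "(if nat (fst (snd \<mu>) + Q) = nat (q0 + Q) then a \<mu> else 0) = (if \<mu> = \<mu>0 then a \<mu> else 0)" by simp
  qed
  also have "\<dots> = a \<mu>0" using fS \<mu>0 by (simp add: S_def e0)
  finally show ?thesis by simp
qed

text \<open>Independence on a product. For a fixed w, independence on the first factor annihilates
  the coefficient functions of each first monomial; these are combinations of second monomials in w,
  and independence on the second factor annihilates their coefficients.\<close>

lemma Lau_eq_0:
  assumes \<zeta>: "primitive_root5 \<zeta>" and \<kappa>: "fsupp \<kappa> (Idx True True True True i j)"
    and z: "\<And>v w. (pt v, pt w) \<in> EE True True True True \<Longrightarrow> Lau \<kappa> v w = 0"
  shows "\<kappa> \<mu> = 0"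
proof -
  define F1 F2 where "F1 = fst ` {\<mu>. \<kappa> \<mu> \<noteq> 0}" and "F2 = snd ` {\<mu>. \<kappa> \<mu> \<noteq> 0}"
  have F: "finite F1" "finite F2" "F1 \<subseteq> idx1 True True i" "F2 \<subseteq> idx1 True True j"
    using \<kappa> by (auto simp: F1_def F2_def fsupp_def Idx_def)
  have sub: "{\<mu>. \<kappa> \<mu> \<noteq> 0} \<subseteq> F1 \<times> F2" by (force simp: F1_def F2_def)
  have "\<kappa> (m, n) = 0" if mn: "m \<in> F1" "n \<in> F2" for m n
  proof (rule mon3_independent[OF \<zeta> F(2,4) _ mn(2), of "\<lambda>n. \<kappa> (m, n)"])
    fix w assume w: "w \<in> fcone" "w$1 \<noteq> 0" "w$2 \<noteq> 0"
    show "(\<Sum>n\<in>F2. \<kappa> (m, n) * mon3 n w) = 0"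
    proof (rule mon3_independent[OF \<zeta> F(1,3) _ mn(1), of "\<lambda>m. \<Sum>n\<in>F2. \<kappa> (m, n) * mon3 n w"])
      fix v assume v: "v \<in> fcone" "v$1 \<noteq> 0" "v$2 \<noteq> 0"
      have "0 = Lau \<kappa> v w" by (rule z[symmetric]) (use v w in \<open>simp add: in_EE\<close>)
      also have "\<dots> = (\<Sum>\<mu>\<in>F1 \<times> F2. \<kappa> \<mu> * mono2 \<mu> v w)" by (rule Lau_eq_sum) (use F sub in auto)
      also have "\<dots> = (\<Sum>m\<in>F1. (\<Sum>n\<in>F2. \<kappa> (m, n) * mon3 n w) * mon3 m v)"
        unfolding sum.cartesian_product' by (simp add: mono2_def sum_distrib_left sum_distrib_right mult_ac)
      finally show "(\<Sum>m\<in>F1. (\<Sum>n\<in>F2. \<kappa> (m, n) * mon3 n w) * mon3 m v) = 0" by simp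
    qed
  qed
  thus ?thesis using sub by (cases \<mu>) auto
qed

lemma Idx_mono: "Idx x y x' y' i j \<subseteq> Idx True True True True i j"
  by (auto simp: Idx_def idx1_def)

lemma Lau_unique:
  assumes \<zeta>: "primitive_root5 \<zeta>" and "fsupp \<kappa> (Idx True True True True i j)" "fsupp \<kappa>' (Idx True True True True i j)"
    and "\<And>v w. (pt v, pt w) \<in> EE True True True True \<Longrightarrow> Lau \<kappa> v w = Lau \<kappa>' v w"
  shows "\<kappa> \<mu> = \<kappa>' \<mu>"
  using Lau_eq_0[OF \<zeta> fsupp_diff[OF assms(2,3)], of \<mu>] assms(4) Lau_diff[OF assms(2,3)] by simp

subsection \<open>Weights\<close>

text \<open>The coefficients are the characters of the coordinates: [1,0] and [0,1] for X and Y,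
  [2,1] and [4,3] for X' and Y', trivial for the third coordinates.\<close>

definition wt :: "index \<Rightarrow> 5 \<times> 5" where
  "wt = (\<lambda>((p, q, c), (p', q', c')). (of_int (p + 2 * p' + 4 * q'), of_int (q + p' + 3 * q')))"

lemma rpow_power: "primitive_root5 \<zeta> \<Longrightarrow> rpow \<zeta> x ^ n = rpow \<zeta> (of_nat n * x)"
  by (induction n) (auto simp: rpow_add distrib_right)

lemma rpow_minus: "primitive_root5 \<zeta> \<Longrightarrow> rpow \<zeta> (- x) = inverse (rpow \<zeta> x)"
proof -
  assume z: "primitive_root5 \<zeta>"
  have "rpow \<zeta> x * rpow \<zeta> (- x) = 1" using rpow_add[OF z, of x "- x"] by simp
  thus ?thesis by (simp add: inverse_unique)
qed

lemma rpow_powi: "primitive_root5 \<zeta> \<Longrightarrow> rpow \<zeta> x powi p = rpow \<zeta> (of_int p * x)"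
proof (cases "p \<ge> 0")
  case True
  assume z: "primitive_root5 \<zeta>"
  obtain n where "p = int n" using True by (metis nonneg_int_cases)
  thus ?thesis by (simp add: rpow_power[OF z])
next
  case False
  assume z: "primitive_root5 \<zeta>"
  define n where "n = nat (- p)"
  have "p = - int n" using False by (simp add: n_def)
  thus ?thesis by (simp add: power_int_minus rpow_power[OF z] rpow_minus[OF z])
qed

lemma chr_apply: "chr \<zeta> x g = rpow \<zeta> (fst x * fst g + snd x * snd g)"
  by (simp add: chr_def split_beta)

lemma chr_nonzero: "primitive_root5 \<zeta> \<Longrightarrow> chr \<zeta> x g \<noteq> 0"
  by (simp add: chr_apply rpow_nonzero)

lemma chr_add: "primitive_root5 \<zeta> \<Longrightarrow> chr \<zeta> x (g + h) = chr \<zeta> x g * chr \<zeta> x h"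
  by (simp add: chr_apply rpow_add[symmetric] algebra_simps)

lemma mono2_act:
  assumes z: "primitive_root5 \<zeta>"
  shows "mono2 \<mu> (act1 \<zeta> g v) (act2 \<zeta> g w) = chr \<zeta> (wt \<mu>) g * mono2 \<mu> v w"
proof -
  obtain p q c p' q' c' where e: "\<mu> = ((p, q, c), (p', q', c'))" by (metis surj_pair)
  obtain a b where g: "g = (a, b)" by (cases g)
  have "chr \<zeta> (wt \<mu>) g = rpow \<zeta> (of_int p * a + of_int q * b + (of_int p' * (2 * a + b) + of_int q' * (4 * a + 3 * b)))"
    by (simp add: chr_apply wt_def e g algebra_simps)
  also have "\<dots> = rpow \<zeta> a powi p * rpow \<zeta> b powi q * (rpow \<zeta> (2 * a + b) powi p' * rpow \<zeta> (4 * a + 3 * b) powi q')"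
    by (simp only: rpow_powi[OF z] rpow_add[OF z, symmetric])
  finally show ?thesis unfolding mono2_def mon3_def e g
    by (simp add: power_int_mult_distrib mult_ac)
qed

text \<open>Eigenfunctions for the untwisted pullback. The twist of the line bundle is accounted for
  later, by dividing the character by \<open>twist_chr\<close>.\<close>

definition eig :: "complex \<Rightarrow> (grp \<Rightarrow> complex) \<Rightarrow> cfun \<Rightarrow> bool" where
  "eig \<zeta> \<theta> s \<longleftrightarrow> (\<forall>g v w. s (act1 \<zeta> g v) (act2 \<zeta> g w) = \<theta> g * s v w)"

lemma Lau_act:
  assumes z: "primitive_root5 \<zeta>" and \<kappa>: "fsupp \<kappa> S"
  shows "Lau \<kappa> (act1 \<zeta> g v) (act2 \<zeta> g w) = Lau (\<lambda>\<mu>. chr \<zeta> (wt \<mu>) g * \<kappa> \<mu>) v w"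
proof -
  have F: "finite {\<mu>. \<kappa> \<mu> \<noteq> 0}" using \<kappa> by (simp add: fsupp_def)
  have "Lau \<kappa> (act1 \<zeta> g v) (act2 \<zeta> g w) = (\<Sum>\<mu> | \<kappa> \<mu> \<noteq> 0. \<kappa> \<mu> * mono2 \<mu> (act1 \<zeta> g v) (act2 \<zeta> g w))"
    by (rule Lau_eq_sum[OF F]) simp
  also have "\<dots> = (\<Sum>\<mu> | \<kappa> \<mu> \<noteq> 0. (chr \<zeta> (wt \<mu>) g * \<kappa> \<mu>) * mono2 \<mu> v w)"
    by (simp add: mono2_act[OF z] mult_ac)
  also have "\<dots> = Lau (\<lambda>\<mu>. chr \<zeta> (wt \<mu>) g * \<kappa> \<mu>) v w"
    by (rule Lau_eq_sum[OF F, symmetric]) auto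
  finally show ?thesis .
qed

text \<open>The expansion is unique, so the coefficients of the pullback by g and of \<theta> g
  times the section can be compared: a coefficient is zero unless its monomial has the character
  \<theta>.\<close>

lemma eig_expansion:
  assumes z: "primitive_root5 \<zeta>" and xy: "x \<or> y" "x' \<or> y'"
    and s: "s \<in> O_sect i j (EE x y x' y')" "eig \<zeta> \<theta> s"
  obtains \<kappa> where "fsupp \<kappa> {\<mu> \<in> Idx x y x' y' i j. chr \<zeta> (wt \<mu>) = \<theta>}"
    "\<And>v w. (pt v, pt w) \<in> EE x y x' y' \<Longrightarrow> s v w = Lau \<kappa> v w"
proof -
  from section_expansion[OF xy s(1)] obtain \<kappa> where \<kappa>: "fsupp \<kappa> (Idx x y x' y' i j)"
    "\<And>v w. (pt v, pt w) \<in> EE x y x' y' \<Longrightarrow> s v w = Lau \<kappa> v w" by blast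
  have \<kappa>T: "fsupp \<kappa> (Idx True True True True i j)" by (rule fsupp_mono[OF \<kappa>(1) Idx_mono])
  have "chr \<zeta> (wt \<mu>) g * \<kappa> \<mu> = \<theta> g * \<kappa> \<mu>" for \<mu> g
  proof (rule Lau_unique[OF z fsupp_mult[OF \<kappa>T] fsupp_mult[OF \<kappa>T]])
    fix v w assume vw: "(pt v, pt w) \<in> EE True True True True"
    hence in1: "(pt v, pt w) \<in> EE x y x' y'" by (simp add: in_EE)
    have in2: "(pt (act1 \<zeta> g v), pt (act2 \<zeta> g w)) \<in> EE x y x' y'"
      using vw by (simp add: in_EE act1_cone[OF z] act2_cone[OF z] rpow_nonzero[OF z])
    have "Lau (\<lambda>\<mu>. chr \<zeta> (wt \<mu>) g * \<kappa> \<mu>) v w = s (act1 \<zeta> g v) (act2 \<zeta> g w)"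
      using \<kappa>(2)[OF in2] Lau_act[OF z \<kappa>T] by simp
    also have "\<dots> = \<theta> g * s v w" by (rule s(2)[unfolded eig_def, rule_format])
    also have "\<dots> = Lau (\<lambda>\<mu>. \<theta> g * \<kappa> \<mu>) v w" using \<kappa>(2)[OF in1] Lau_cmult[OF \<kappa>T] by simp
    finally show "Lau (\<lambda>\<mu>. chr \<zeta> (wt \<mu>) g * \<kappa> \<mu>) v w = Lau (\<lambda>\<mu>. \<theta> g * \<kappa> \<mu>) v w" .
  qed
  hence "\<kappa> \<mu> = 0 \<or> chr \<zeta> (wt \<mu>) g = \<theta> g" for \<mu> g unfolding mult_cancel_right by blast
  hence "chr \<zeta> (wt \<mu>) = \<theta>" if "\<kappa> \<mu> \<noteq> 0" for \<mu> using that by (intro ext) blast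
  hence "fsupp \<kappa> {\<mu> \<in> Idx x y x' y' i j. chr \<zeta> (wt \<mu>) = \<theta>}" using \<kappa>(1) by (auto simp: fsupp_def)
  thus ?thesis using \<kappa>(2) that by blast
qed

definition invar :: "complex \<Rightarrow> point set \<Rightarrow> bool" where
  "invar \<zeta> U \<longleftrightarrow> (\<forall>g. actT \<zeta> g ` U = U)"

lemma invar_EE: "primitive_root5 \<zeta> \<Longrightarrow> invar \<zeta> (EE x y x' y')"
  by (simp add: invar_def EE_act)

lemma invar_T: "primitive_root5 \<zeta> \<Longrightarrow> invar \<zeta> T"
  using invar_EE[of \<zeta> False False False False] by (simp add: EE_def ee_def D_one)

lemma in_actT_image_pt:
  assumes z: "primitive_root5 \<zeta>"
  shows "(pt (act1 \<zeta> g v), pt (act2 \<zeta> g w)) \<in> actT \<zeta> g ` U \<longleftrightarrow> (pt v, pt w) \<in> U"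
  by (simp add: in_actT_image[OF z] act1_add[OF z] act2_add[OF z])

lemma in_invar:
  assumes "primitive_root5 \<zeta>" "invar \<zeta> U"
  shows "(pt (act1 \<zeta> g v), pt (act2 \<zeta> g w)) \<in> U \<longleftrightarrow> (pt v, pt w) \<in> U"
  using in_actT_image_pt[OF assms(1), of g v w U] assms(2)[unfolded invar_def, rule_format, of g] by simp

lemma Lau_eig:
  assumes z: "primitive_root5 \<zeta>" and U: "invar \<zeta> U" and \<kappa>: "fsupp \<kappa> {\<mu> \<in> S. chr \<zeta> (wt \<mu>) = \<theta>}"
  shows "eig \<zeta> \<theta> (restr U (Lau \<kappa>))"
proof -
  have "chr \<zeta> (wt \<mu>) = \<theta> \<or> \<kappa> \<mu> = 0" for \<mu> using \<kappa> unfolding fsupp_def by blast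
  hence "chr \<zeta> (wt \<mu>) g * \<kappa> \<mu> = \<theta> g * \<kappa> \<mu>" for g \<mu> by (metis mult_zero_right)
  hence "(\<lambda>\<mu>. chr \<zeta> (wt \<mu>) g * \<kappa> \<mu>) = (\<lambda>\<mu>. \<theta> g * \<kappa> \<mu>)" for g by blast
  thus ?thesis unfolding eig_def by (auto simp: restr_def in_invar[OF z U] Lau_act[OF z \<kappa>] Lau_cmult[OF \<kappa>])
qed

text \<open>A monomial on one curve with p, q \<ge> 0 is regular on both charts and gives a class in
  H^0. With p, q < 0 it is regular only on the overlap and gives a class in H^1. With mixed signs it
  is regular on the overlap and on exactly one chart, so its two-term complex is an
  isomorphism.\<close>

definition same_sign :: "int \<times> int \<times> nat \<Rightarrow> bool" where
  "same_sign = (\<lambda>(p, q, c). (p \<ge> 0 \<longleftrightarrow> q \<ge> 0))"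

definition no_weight :: "complex \<Rightarrow> int \<Rightarrow> int \<Rightarrow> (grp \<Rightarrow> complex) \<Rightarrow> bool" where
  "no_weight \<zeta> i j \<theta> \<longleftrightarrow> (\<forall>\<mu>\<in>Idx True True True True i j. chr \<zeta> (wt \<mu>) = \<theta> \<longrightarrow> \<not> (same_sign (fst \<mu>) \<and> same_sign (snd \<mu>)))"

text \<open>The sections of the line bundle over the intersections of the four sets \<open>EE a (\<not> a) b (\<not> b)\<close> form the
  tensor product of two two-term complexes.  It decomposes over the monomials, and a monomial
  contributes an exact complex unless both of its halves satisfy \<open>same_sign\<close>.\<close>

locale eigen =
  fixes \<zeta> :: complex and i j :: int and \<theta> :: "grp \<Rightarrow> complex"
  assumes prim: "primitive_root5 \<zeta>"
begin

definition OE :: "point set \<Rightarrow> cfun set" where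
  "OE U = {s \<in> O_sect i j U. eig \<zeta> \<theta> s}"

definition IdxE :: "bool \<Rightarrow> bool \<Rightarrow> bool \<Rightarrow> bool \<Rightarrow> index set" where
  "IdxE x y x' y' = {\<mu> \<in> Idx x y x' y' i j. chr \<zeta> (wt \<mu>) = \<theta>}"

lemma OE_expand:
  assumes "x \<or> y" "x' \<or> y'" "s \<in> OE (EE x y x' y')"
  shows "\<exists>\<kappa>. fsupp \<kappa> (IdxE x y x' y') \<and> (\<forall>v w. (pt v, pt w) \<in> EE x y x' y' \<longrightarrow> s v w = Lau \<kappa> v w)"
proof -
  from assms(3) have "s \<in> O_sect i j (EE x y x' y')" "eig \<zeta> \<theta> s" by (auto simp: OE_def)
  thus ?thesis unfolding IdxE_def
  proof (rule eig_expansion[OF prim assms(1,2)], goal_cases)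
    case (1 \<kappa>)
    thus ?case by (intro exI[of _ \<kappa>]) auto
  qed
qed

lemma Lau_OE:
  assumes "fsupp \<kappa> (IdxE x y x' y')"
  shows "restr (EE x y x' y') (Lau \<kappa>) \<in> OE (EE x y x' y')"
  unfolding OE_def
proof (intro CollectI conjI)
  have "fsupp \<kappa> (Idx x y x' y' i j)" by (rule fsupp_mono[OF assms]) (auto simp: IdxE_def)
  thus "restr (EE x y x' y') (Lau \<kappa>) \<in> O_sect i j (EE x y x' y')"
    by (intro Lau_section EE_open) auto
  show "eig \<zeta> \<theta> (restr (EE x y x' y') (Lau \<kappa>))"
    using assms unfolding IdxE_def by (intro Lau_eig[OF prim invar_EE[OF prim]])
qed

lemma IdxE_T: "fsupp \<kappa> (IdxE x y x' y') \<Longrightarrow> fsupp \<kappa> (Idx True True True True i j)"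
  by (erule fsupp_mono) (use Idx_mono[of x y x' y' i j] in \<open>auto simp: IdxE_def\<close>)

lemma IdxE_iff: "((p, q, c), (p', q', c')) \<in> IdxE x y x' y' \<longleftrightarrow>
    ((p, q, c), (p', q', c')) \<in> IdxE True True True True \<and> (p < 0 \<longrightarrow> x) \<and> (q < 0 \<longrightarrow> y) \<and> (p' < 0 \<longrightarrow> x') \<and> (q' < 0 \<longrightarrow> y')"
  by (auto simp: IdxE_def Idx_def idx1_def)

context
  assumes noW: "no_weight \<zeta> i j \<theta>"
begin

lemma not_same_sign: "\<mu> \<in> IdxE x y x' y' \<Longrightarrow> \<not> (same_sign (fst \<mu>) \<and> same_sign (snd \<mu>))"
  using noW Idx_mono[of x y x' y' i j] unfolding no_weight_def IdxE_def by blast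

text \<open>A global section has the same coefficients on all four charts. A monomial regular on all
  of them has nonnegative exponents only, hence has the same sign in both factors, which is
  excluded.\<close>

lemma K_H0:
  assumes s: "s \<in> OE T"
  shows "s = (\<lambda>v w. 0)"
proof -
  have s': "restr (EE a (\<not> a) b (\<not> b)) s \<in> OE (EE a (\<not> a) b (\<not> b))" for a b
    using s by (auto simp: OE_def eig_def restr_def in_invar[OF prim invar_EE[OF prim]]
        intro: O_sect_restrict[OF _ EE_open EE_subset_T, unfolded restr_def])
  have "\<exists>\<kappa>. fsupp \<kappa> (IdxE a (\<not> a) b (\<not> b)) \<and> (\<forall>v w. (pt v, pt w) \<in> EE a (\<not> a) b (\<not> b) \<longrightarrow> s v w = Lau \<kappa> v w)" for a b
    using OE_expand[OF _ _ s'[of a b]] by auto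
  then obtain \<kappa> where \<kappa>: "\<And>a b. fsupp (\<kappa> a b) (IdxE a (\<not> a) b (\<not> b))"
    "\<And>a b v w. (pt v, pt w) \<in> EE a (\<not> a) b (\<not> b) \<Longrightarrow> s v w = Lau (\<kappa> a b) v w" by metis
  have eq: "\<kappa> a b \<mu> = \<kappa> a' b' \<mu>" for a b a' b' \<mu>
  proof (rule Lau_unique[OF prim IdxE_T[OF \<kappa>(1)] IdxE_T[OF \<kappa>(1)]])
    fix v w assume "(pt v, pt w) \<in> EE True True True True"
    hence "(pt v, pt w) \<in> EE a (\<not> a) b (\<not> b)" "(pt v, pt w) \<in> EE a' (\<not> a') b' (\<not> b')" by (auto simp: in_EE)
    from \<kappa>(2)[OF this(1)] \<kappa>(2)[OF this(2)] show "Lau (\<kappa> a b) v w = Lau (\<kappa> a' b') v w" by simp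
  qed
  have "\<kappa> a b \<mu> = 0" for a b \<mu>
  proof (rule ccontr)
    assume nz: "\<kappa> a b \<mu> \<noteq> 0"
    have "\<mu> \<in> IdxE a' (\<not> a') b' (\<not> b')" for a' b'
      using \<kappa>(1)[of a' b'] nz eq[of a b \<mu> a' b'] by (auto simp: fsupp_def)
    from this[of True True] this[of False False] not_same_sign[OF this[of True True]] show False
      by (cases \<mu>) (auto simp: IdxE_def Idx_def idx1_def same_sign_def)
  qed
  hence z: "\<kappa> a b = (\<lambda>\<mu>. 0)" for a b by auto
  have "s v w = 0" for v w
  proof (cases "(pt v, pt w) \<in> T")
    case True
    hence "v \<in> fcone" "w \<in> fcone" by (auto simp: in_T)
    hence "(pt v, pt w) \<in> EE (v$1 \<noteq> 0) (\<not> (v$1 \<noteq> 0)) (w$1 \<noteq> 0) (\<not> (w$1 \<noteq> 0))"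
      using fcone_coord[of v] fcone_coord[of w] unfolding in_EE by blast
    from \<kappa>(2)[OF this] z show ?thesis by simp
  next
    case False
    thus ?thesis using s O_sect_outside by (auto simp: OE_def)
  qed
  thus ?thesis by auto
qed

text \<open>Exactness in the middle of the tensor complex, proved one monomial at a time: each
  monomial has mixed signs in some factor, and the isomorphism of that factor inverts the
  differential.\<close>

lemma K_H1:
  assumes u: "\<And>b. u b \<in> OE (EE True True b (\<not> b))" and v: "\<And>a. v a \<in> OE (EE a (\<not> a) True True)"
    and uv: "\<And>x y. (pt x, pt y) \<in> EE True True True True \<Longrightarrow> u True x y - u False x y = v True x y - v False x y"
  shows "\<exists>w. (\<forall>a b. w a b \<in> OE (EE a (\<not> a) b (\<not> b))) \<and>
    (\<forall>b x y. (pt x, pt y) \<in> EE True True b (\<not> b) \<longrightarrow> u b x y = w True b x y - w False b x y) \<and>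
    (\<forall>a x y. (pt x, pt y) \<in> EE a (\<not> a) True True \<longrightarrow> v a x y = w a True x y - w a False x y)"
proof -
  have "\<exists>\<kappa>. fsupp \<kappa> (IdxE True True b (\<not> b)) \<and> (\<forall>x y. (pt x, pt y) \<in> EE True True b (\<not> b) \<longrightarrow> u b x y = Lau \<kappa> x y)" for b
    by (rule OE_expand[OF _ _ u]) auto
  then obtain \<kappa>u where \<kappa>u: "\<And>b. fsupp (\<kappa>u b) (IdxE True True b (\<not> b))"
    "\<And>b x y. (pt x, pt y) \<in> EE True True b (\<not> b) \<Longrightarrow> u b x y = Lau (\<kappa>u b) x y" by metis
  have "\<exists>\<kappa>. fsupp \<kappa> (IdxE a (\<not> a) True True) \<and> (\<forall>x y. (pt x, pt y) \<in> EE a (\<not> a) True True \<longrightarrow> v a x y = Lau \<kappa> x y)" for a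
    by (rule OE_expand[OF _ _ v]) auto
  then obtain \<kappa>v where \<kappa>v: "\<And>a. fsupp (\<kappa>v a) (IdxE a (\<not> a) True True)"
    "\<And>a x y. (pt x, pt y) \<in> EE a (\<not> a) True True \<Longrightarrow> v a x y = Lau (\<kappa>v a) x y" by metis
  note Tu = IdxE_T[OF \<kappa>u(1)] and Tv = IdxE_T[OF \<kappa>v(1)]
  have eq: "\<kappa>u True \<mu> - \<kappa>u False \<mu> = \<kappa>v True \<mu> - \<kappa>v False \<mu>" for \<mu>
  proof (rule Lau_unique[OF prim fsupp_diff[OF Tu Tu] fsupp_diff[OF Tv Tv]])
    fix x y assume xy: "(pt x, pt y) \<in> EE True True True True"
    hence "(pt x, pt y) \<in> EE True True b (\<not> b)" "(pt x, pt y) \<in> EE a (\<not> a) True True" for a b by (auto simp: in_EE)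
    from \<kappa>u(2)[OF this(1)] \<kappa>v(2)[OF this(2)] uv[OF xy]
    show "Lau (\<lambda>\<mu>. \<kappa>u True \<mu> - \<kappa>u False \<mu>) x y = Lau (\<lambda>\<mu>. \<kappa>v True \<mu> - \<kappa>v False \<mu>) x y"
      by (simp add: Lau_diff[OF Tu Tu] Lau_diff[OF Tv Tv])
  qed
  \<comment> \<open>The first two branches treat mixed signs in the first factor: the monomial is
    regular on just one value of a, and that chart must carry the coefficient of u alone. The last
    two branches do the same in the second factor with the coefficient of v. The sign compensates
    for the chart False being subtracted.\<close>
  define S where "S a b = (\<lambda>\<mu>. case \<mu> of ((p, q, c), (p', q', c')) \<Rightarrow>
     if p < 0 \<and> q \<ge> 0 then (if a then \<kappa>u b \<mu> else 0)
     else if q < 0 \<and> p \<ge> 0 then (if a then 0 else - \<kappa>u b \<mu>)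
     else if p' < 0 then (if b then \<kappa>v a \<mu> else 0)
     else (if b then 0 else - \<kappa>v a \<mu>))" for a b
  have key: "(S a b \<mu> \<noteq> 0 \<longrightarrow> \<mu> \<in> IdxE a (\<not> a) b (\<not> b)) \<and> S True b \<mu> - S False b \<mu> = \<kappa>u b \<mu> \<and>
     S a True \<mu> - S a False \<mu> = \<kappa>v a \<mu>" for a b \<mu>
  proof -
    obtain p q c p' q' c' where e: "\<mu> = ((p, q, c), (p', q', c'))" by (metis surj_pair)
    have hu: "\<mu> \<in> IdxE True True True True \<and> (p' < 0 \<longrightarrow> b) \<and> (q' < 0 \<longrightarrow> \<not> b)" if "\<kappa>u b \<mu> \<noteq> 0" for b
    proof -
      have "\<mu> \<in> IdxE True True b (\<not> b)" using \<kappa>u(1)[of b] that unfolding fsupp_def by blast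
      thus ?thesis unfolding e using IdxE_iff[of p q c p' q' c' True True b "\<not> b"] by blast
    qed
    have hv: "\<mu> \<in> IdxE True True True True \<and> (p < 0 \<longrightarrow> a) \<and> (q < 0 \<longrightarrow> \<not> a)" if "\<kappa>v a \<mu> \<noteq> 0" for a
    proof -
      have "\<mu> \<in> IdxE a (\<not> a) True True" using \<kappa>v(1)[of a] that unfolding fsupp_def by blast
      thus ?thesis unfolding e using IdxE_iff[of p q c p' q' c' a "\<not> a" True True] by blast
    qed
    have ns: "\<mu> \<in> IdxE True True True True \<Longrightarrow> (p \<ge> 0 \<longleftrightarrow> q < 0) \<or> (p' \<ge> 0 \<longleftrightarrow> q' < 0)"
      using not_same_sign[of \<mu> True True True True] by (auto simp: e same_sign_def)
    let ?I = "\<mu> \<in> IdxE True True True True"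
    have hu': "\<kappa>u True \<mu> \<noteq> 0 \<Longrightarrow> ?I \<and> q' \<ge> 0" "\<kappa>u False \<mu> \<noteq> 0 \<Longrightarrow> ?I \<and> p' \<ge> 0"
      using hu[of True] hu[of False] by auto
    have hv': "\<kappa>v True \<mu> \<noteq> 0 \<Longrightarrow> ?I \<and> q \<ge> 0" "\<kappa>v False \<mu> \<noteq> 0 \<Longrightarrow> ?I \<and> p \<ge> 0"
      using hv[of True] hv[of False] by auto
    have I: "\<mu> \<in> IdxE a (\<not> a) b (\<not> b) \<longleftrightarrow> ?I \<and> (p < 0 \<longrightarrow> a) \<and> (q < 0 \<longrightarrow> \<not> a) \<and> (p' < 0 \<longrightarrow> b) \<and> (q' < 0 \<longrightarrow> \<not> b)"
      unfolding e by (subst IdxE_iff) simp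
    have Sd: "S a b \<mu> = (if p < 0 \<and> q \<ge> 0 then (if a then \<kappa>u b \<mu> else 0)
     else if q < 0 \<and> p \<ge> 0 then (if a then 0 else - \<kappa>u b \<mu>)
     else if p' < 0 then (if b then \<kappa>v a \<mu> else 0)
     else (if b then 0 else - \<kappa>v a \<mu>))" for a b by (simp add: S_def e)
    show ?thesis
    proof (cases ?I)
      case False
      hence "\<kappa>u b \<mu> = 0" "\<kappa>v a \<mu> = 0" for a b using hu hv by blast+
      thus ?thesis by (simp add: Sd)
    next
      case True
      note eq' = eq[of \<mu>, unfolded diff_eq_eq]
      from ns[OF True] consider (A) "p < 0" "q \<ge> 0" | (B) "q < 0" "p \<ge> 0"
        | (C) "(p < 0) = (q < 0)" "p' < 0" "q' \<ge> 0" | (D) "(p < 0) = (q < 0)" "q' < 0" "p' \<ge> 0" by linarith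
      thus ?thesis
      proof cases
        case A
        hence "\<kappa>v False \<mu> = 0" using hv'(2) by force
        thus ?thesis using A hu'[THEN conjunct2] eq' unfolding I Sd by (cases a; cases b; auto simp: True)
      next
        case B
        hence "\<kappa>v True \<mu> = 0" using hv'(1) by force
        thus ?thesis using B hu'[THEN conjunct2] eq' unfolding I Sd by (cases a; cases b; auto simp: True)
      next
        case C
        hence "\<kappa>u False \<mu> = 0" using hu'(2) by force
        thus ?thesis using C hv'[THEN conjunct2] eq' unfolding I Sd by (cases a; cases b; auto simp: True)
      next
        case D
        hence z: "\<kappa>u True \<mu> = 0" using hu'(1) by force
        hence "\<kappa>u False \<mu> = \<kappa>v False \<mu> - \<kappa>v True \<mu>" using eq[of \<mu>] by algebra
        thus ?thesis using D z hv'[THEN conjunct2] unfolding I Sd by (cases a; cases b; auto simp: True)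
      qed
    qed
  qed
  have S: "fsupp (S a b) (IdxE a (\<not> a) b (\<not> b))" for a b
  proof -
    have "{\<mu>. S a b \<mu> \<noteq> 0} \<subseteq> {\<mu>. \<kappa>u b \<mu> \<noteq> 0} \<union> {\<mu>. \<kappa>v a \<mu> \<noteq> 0}"
      by (auto simp: S_def split: if_splits)
    hence "finite {\<mu>. S a b \<mu> \<noteq> 0}" by (rule finite_subset) (use \<kappa>u(1) \<kappa>v(1) in \<open>auto simp: fsupp_def\<close>)
    thus ?thesis using key by (auto simp: fsupp_def)
  qed
  define w where "w a b = restr (EE a (\<not> a) b (\<not> b)) (Lau (S a b))" for a b
  show ?thesis
  proof (intro exI[of _ w] conjI allI impI)
    show "w a b \<in> OE (EE a (\<not> a) b (\<not> b))" for a b unfolding w_def by (rule Lau_OE[OF S])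
  next
    fix b x y assume xy: "(pt x, pt y) \<in> EE True True b (\<not> b)"
    hence "(pt x, pt y) \<in> EE a (\<not> a) b (\<not> b)" for a by (auto simp: in_EE)
    hence "w a b x y = Lau (S a b) x y" for a unfolding w_def by (rule restr_in)
    hence "w True b x y - w False b x y = Lau (S True b) x y - Lau (S False b) x y" by simp
    also have "\<dots> = Lau (\<kappa>u b) x y" by (simp add: Lau_diff[OF S S, symmetric] key)
    finally show "u b x y = w True b x y - w False b x y" using \<kappa>u(2)[OF xy] by simp
  next
    fix a x y assume xy: "(pt x, pt y) \<in> EE a (\<not> a) True True"
    hence "(pt x, pt y) \<in> EE a (\<not> a) b (\<not> b)" for b by (auto simp: in_EE)
    hence "w a b x y = Lau (S a b) x y" for b unfolding w_def by (rule restr_in)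
    hence "w a True x y - w a False x y = Lau (S a True) x y - Lau (S a False) x y" by simp
    also have "\<dots> = Lau (\<kappa>v a) x y" by (simp add: Lau_diff[OF S S, symmetric] key)
    finally show "v a x y = w a True x y - w a False x y" using \<kappa>v(2)[OF xy] by simp
  qed
qed

text \<open>Surjectivity at the end of the tensor complex. A monomial with mixed signs in the first
  factor extends to one chart of the first curve and goes into t; otherwise its second factor has
  mixed signs and it goes into r.\<close>

lemma K_H2:
  assumes m: "m \<in> OE (EE True True True True)"
  shows "\<exists>t r. (\<forall>a. t a \<in> OE (EE a (\<not> a) True True)) \<and> (\<forall>b. r b \<in> OE (EE True True b (\<not> b))) \<and>
    (\<forall>x y. (pt x, pt y) \<in> EE True True True True \<longrightarrow> m x y = t True x y - t False x y - (r True x y - r False x y))"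
proof -
  obtain \<kappa> where \<kappa>: "fsupp \<kappa> (IdxE True True True True)"
    "\<And>x y. (pt x, pt y) \<in> EE True True True True \<Longrightarrow> m x y = Lau \<kappa> x y"
    using OE_expand[OF _ _ m] by auto
  define A where "A a = (\<lambda>\<mu>. case \<mu> of ((p, q, c), (p', q', c')) \<Rightarrow>
     if p < 0 \<and> q \<ge> 0 then (if a then \<kappa> \<mu> else 0) else if q < 0 \<and> p \<ge> 0 then (if a then 0 else - \<kappa> \<mu>) else 0)" for a
  define B where "B b = (\<lambda>\<mu>. case \<mu> of ((p, q, c), (p', q', c')) \<Rightarrow>
     if (p < 0) \<noteq> (q < 0) then 0 else if p' < 0 then (if b then - \<kappa> \<mu> else 0) else (if b then 0 else \<kappa> \<mu>))" for b
  have key: "(A a \<mu> \<noteq> 0 \<longrightarrow> \<mu> \<in> IdxE a (\<not> a) True True) \<and> (B b \<mu> \<noteq> 0 \<longrightarrow> \<mu> \<in> IdxE True True b (\<not> b)) \<and>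
     (A True \<mu> - A False \<mu>) - (B True \<mu> - B False \<mu>) = \<kappa> \<mu>" for a b \<mu>
  proof -
    obtain p q c p' q' c' where e: "\<mu> = ((p, q, c), (p', q', c'))" by (metis surj_pair)
    let ?I = "\<mu> \<in> IdxE True True True True"
    have h: "\<kappa> \<mu> \<noteq> 0 \<Longrightarrow> ?I" using \<kappa>(1) by (auto simp: fsupp_def)
    have ns: "?I \<Longrightarrow> (p \<ge> 0 \<longleftrightarrow> q < 0) \<or> (p' \<ge> 0 \<longleftrightarrow> q' < 0)"
      using not_same_sign[of \<mu> True True True True] by (auto simp: e same_sign_def)
    have I: "\<mu> \<in> IdxE a (\<not> a) True True \<longleftrightarrow> ?I \<and> (p < 0 \<longrightarrow> a) \<and> (q < 0 \<longrightarrow> \<not> a)"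
      "\<mu> \<in> IdxE True True b (\<not> b) \<longleftrightarrow> ?I \<and> (p' < 0 \<longrightarrow> b) \<and> (q' < 0 \<longrightarrow> \<not> b)"
      unfolding e by (subst IdxE_iff, simp)+
    show ?thesis unfolding I using h ns
      by (cases a; cases b; cases "?I"; cases "p \<ge> 0"; cases "q \<ge> 0"; cases "p' \<ge> 0"; cases "q' \<ge> 0")
         (auto simp: A_def B_def e)
  qed
  have sub: "{\<mu>. A a \<mu> \<noteq> 0} \<subseteq> {\<mu>. \<kappa> \<mu> \<noteq> 0}" "{\<mu>. B b \<mu> \<noteq> 0} \<subseteq> {\<mu>. \<kappa> \<mu> \<noteq> 0}" for a b
    by (auto simp: A_def B_def split: if_splits)
  have fin: "finite {\<mu>. \<kappa> \<mu> \<noteq> 0}" using \<kappa>(1) by (simp add: fsupp_def)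
  have A: "fsupp (A a) (IdxE a (\<not> a) True True)" for a
    unfolding fsupp_def using finite_subset[OF sub(1) fin] key by auto
  have B: "fsupp (B b) (IdxE True True b (\<not> b))" for b
    unfolding fsupp_def using finite_subset[OF sub(2) fin] key by auto
  define t where "t a = restr (EE a (\<not> a) True True) (Lau (A a))" for a
  define r where "r b = restr (EE True True b (\<not> b)) (Lau (B b))" for b
  show ?thesis
  proof (rule exI[of _ t], rule exI[of _ r], intro conjI allI impI)
    show "t a \<in> OE (EE a (\<not> a) True True)" for a unfolding t_def by (rule Lau_OE[OF A])
    show "r b \<in> OE (EE True True b (\<not> b))" for b unfolding r_def by (rule Lau_OE[OF B])
  next
    fix x y assume xy: "(pt x, pt y) \<in> EE True True True True"
    hence "(pt x, pt y) \<in> EE True True b (\<not> b)" "(pt x, pt y) \<in> EE a (\<not> a) True True" for a b by (auto simp: in_EE)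
    hence *: "t a x y = Lau (A a) x y" "r b x y = Lau (B b) x y" for a b by (simp_all add: t_def r_def)
    note TA = IdxE_T[OF A] and TB = IdxE_T[OF B]
    have "t True x y - t False x y - (r True x y - r False x y) =
      Lau (\<lambda>\<mu>. (A True \<mu> - A False \<mu>) - (B True \<mu> - B False \<mu>)) x y"
      unfolding * Lau_diff[OF fsupp_diff[OF TA TA] fsupp_diff[OF TB TB]] Lau_diff[OF A A] Lau_diff[OF B B] ..
    also have "\<dots> = Lau \<kappa> x y" by (simp add: key)
    finally show "m x y = t True x y - t False x y - (r True x y - r False x y)" using \<kappa>(2)[OF xy] by simp
  qed
qed

end

end

subsection \<open>Equivariant cochains\<close>

declare split_paired_All [simp del]

text \<open>The group permutes the members of W, so it acts on cochains by moving the simplices.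
  Each member lies in one of the four affine sets, which provides the contraction in the other
  direction of the double complex.\<close>

locale eq_cover = affine_cover W + eigen \<zeta> i j \<theta> for W \<zeta> i j \<theta> +
  assumes W_inv: "U \<in> W \<Longrightarrow> actT \<zeta> g ` U \<in> W"
    and W_sub: "U \<in> W \<Longrightarrow> \<exists>a b. U \<subseteq> EE a (\<not> a) b (\<not> b)"
    and \<theta>_add: "\<theta> (g + h) = \<theta> g * \<theta> h" and \<theta>_nonzero: "\<theta> g \<noteq> 0"
begin

abbreviation gs :: "grp \<Rightarrow> point set \<Rightarrow> point set" where
  "gs g U \<equiv> actT \<zeta> g ` U"

definition eqv :: "nat \<Rightarrow> cochain \<Rightarrow> bool" where
  "eqv k c \<longleftrightarrow> (\<forall>xs\<in>simplices W k. \<forall>g v w. c (map (gs g) xs) (act1 \<zeta> g v) (act2 \<zeta> g w) = \<theta> g * c xs v w)"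

definition CC :: "point set \<Rightarrow> nat \<Rightarrow> cochain set" where
  "CC E k = {c \<in> cch i j W E k. eqv k c}"

definition ZZ :: "point set \<Rightarrow> nat \<Rightarrow> cochain set" where
  "ZZ E k = {c \<in> CC E k. closedc W E k c}"

definition okE :: "point set \<Rightarrow> bool" where
  "okE E \<longleftrightarrow> zopen E \<and> invar \<zeta> E"

lemma okE_EE: "okE (EE x y x' y')"
  by (simp add: okE_def EE_open invar_EE[OF prim])

lemma okE_T: "okE T"
  by (simp add: okE_def zopen_T invar_T[OF prim])

lemma simplices_gs: "xs \<in> simplices W k \<Longrightarrow> map (gs g) xs \<in> simplices W k"
  by (simp add: simplices_def image_subset_iff) (meson W_inv subsetD)

lemma in_gs_Inter:
  "(pt (act1 \<zeta> g v), pt (act2 \<zeta> g w)) \<in> \<Inter>(set (map (gs g) xs)) \<longleftrightarrow> (pt v, pt w) \<in> \<Inter>(set xs)"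
  by (auto simp: in_actT_image_pt[OF prim])

lemma in_gs:
  "okE E \<Longrightarrow> (pt (act1 \<zeta> g v), pt (act2 \<zeta> g w)) \<in> \<Inter>(set (map (gs g) xs)) \<inter> E \<longleftrightarrow> (pt v, pt w) \<in> \<Inter>(set xs) \<inter> E"
  unfolding Int_iff in_gs_Inter by (simp add: okE_def in_invar[OF prim])

lemma open_simplex: "okE E \<Longrightarrow> xs \<in> simplices W k \<Longrightarrow> zopen (\<Inter>(set xs) \<inter> E)"
  using simplices_open[OF W_open] by (auto simp: okE_def intro: zopen_Int)

text \<open>Sections are extended by 0, so a cochain defined by a formula is cut off before it can
  belong to \<open>O_sect\<close>.\<close>

definition rs :: "point set \<Rightarrow> cochain \<Rightarrow> cochain" where
  "rs E c xs = restr (\<Inter>(set xs) \<inter> E) (c xs)"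

lemma rs_in: "(pt v, pt w) \<in> \<Inter>(set xs) \<inter> E \<Longrightarrow> rs E c xs v w = c xs v w"
  by (simp add: rs_def)

lemma CC_I:
  assumes E: "okE E"
    and sec: "\<And>xs. xs \<in> simplices W k \<Longrightarrow> restr (\<Inter>(set xs) \<inter> E) (c xs) \<in> O_sect i j (\<Inter>(set xs) \<inter> E)"
    and eq: "\<And>xs g v w. xs \<in> simplices W k \<Longrightarrow> (pt v, pt w) \<in> \<Inter>(set xs) \<inter> E \<Longrightarrow>
       c (map (gs g) xs) (act1 \<zeta> g v) (act2 \<zeta> g w) = \<theta> g * c xs v w"
  shows "rs E c \<in> CC E k"
proof -
  have "rs E c (map (gs g) xs) (act1 \<zeta> g v) (act2 \<zeta> g w) = \<theta> g * rs E c xs v w"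
    if xs: "xs \<in> simplices W k" for xs g v w
    unfolding rs_def restr_def in_gs[OF E] using eq[OF xs, of v w g] by simp
  with sec show ?thesis unfolding CC_def cch_def eqv_def rs_def by blast
qed

lemma CC_sect: "c \<in> CC E k \<Longrightarrow> xs \<in> simplices W k \<Longrightarrow> c xs \<in> O_sect i j (\<Inter>(set xs) \<inter> E)"
  by (simp add: CC_def cch_def)

lemma CC_eqv: "c \<in> CC E k \<Longrightarrow> xs \<in> simplices W k \<Longrightarrow>
    c (map (gs g) xs) (act1 \<zeta> g v) (act2 \<zeta> g w) = \<theta> g * c xs v w"
  unfolding CC_def eqv_def by blast

lemma CC_restr_sect:
  assumes "c \<in> CC E' k" "okE E" "xs \<in> simplices W k" "\<Inter>(set xs) \<inter> E \<subseteq> E'"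
  shows "restr (\<Inter>(set xs) \<inter> E) (c xs) \<in> O_sect i j (\<Inter>(set xs) \<inter> E)"
  by (rule O_sect_restrict[OF CC_sect[OF assms(1,3)] open_simplex[OF assms(2,3)]]) (use assms(4) in blast)

lemma CC_diff:
  assumes "c \<in> CC E1 k" "d \<in> CC E2 k" "okE E" "E \<subseteq> E1" "E \<subseteq> E2"
  shows "rs E (\<lambda>xs v w. c xs v w - d xs v w) \<in> CC E k"
proof (rule CC_I[OF assms(3)])
  fix xs assume xs: "xs \<in> simplices W k"
  have sub: "\<Inter>(set xs) \<inter> E \<subseteq> E1" "\<Inter>(set xs) \<inter> E \<subseteq> E2" using assms(4,5) by blast+
  show "restr (\<Inter>(set xs) \<inter> E) (\<lambda>v w. c xs v w - d xs v w) \<in> O_sect i j (\<Inter>(set xs) \<inter> E)"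
    unfolding restr_diff
    by (intro O_sect_diff CC_restr_sect[OF assms(1,3) xs sub(1)] CC_restr_sect[OF assms(2,3) xs sub(2)])
qed (use assms in \<open>simp add: CC_eqv[OF assms(1)] CC_eqv[OF assms(2)] right_diff_distrib\<close>)

lemma closedc_cong:
  assumes "\<And>xs v w. xs \<in> simplices W k \<Longrightarrow> (pt v, pt w) \<in> \<Inter>(set xs) \<inter> E \<Longrightarrow> c xs v w = d xs v w"
  shows "closedc W E k c \<longleftrightarrow> closedc W E k d"
proof -
  have "alt (\<lambda>ys. c ys v w) xs = alt (\<lambda>ys. d ys v w) xs"
    if xs: "xs \<in> simplices W (Suc k)" and vw: "(pt v, pt w) \<in> \<Inter>(set xs) \<inter> E" for xs v w
    by (rule alt_cong, rule assms, rule simplices_face[OF xs]) (use vw in auto)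
  thus ?thesis unfolding closedc_def by simp
qed

lemma alt_rs:
  assumes "xs \<in> simplices W (Suc k)" "(pt v, pt w) \<in> \<Inter>(set xs) \<inter> E"
  shows "alt (\<lambda>ys. rs E c ys v w) xs = alt (\<lambda>ys. c ys v w) xs"
  by (rule alt_cong) (use assms(2) in \<open>auto intro!: rs_in\<close>)

lemma closedc_rs: "closedc W E k (rs E c) \<longleftrightarrow> closedc W E k c"
  by (rule closedc_cong) (simp add: rs_in)

lemma closedc_mono: "closedc W E' k c \<Longrightarrow> E \<subseteq> E' \<Longrightarrow> closedc W E k c"
  unfolding closedc_def by blast

lemma CC_zero: "okE E \<Longrightarrow> rs E (\<lambda>xs v w. 0) \<in> CC E k"
  by (rule CC_I) (auto intro: O_sect_zero open_simplex)

lemma ZZ_zero: "okE E \<Longrightarrow> rs E (\<lambda>xs v w. 0) \<in> ZZ E k"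
  using CC_zero[of E k] unfolding ZZ_def mem_Collect_eq closedc_rs by (simp add: closedc_def)

lemma ZZ_restr:
  assumes "c \<in> ZZ E1 k" "okE E" "E \<subseteq> E1"
  shows "rs E c \<in> ZZ E k"
proof -
  have "rs E c \<in> CC E k"
  proof (rule CC_I[OF assms(2)])
    fix xs assume xs: "xs \<in> simplices W k"
    show "restr (\<Inter>(set xs) \<inter> E) (c xs) \<in> O_sect i j (\<Inter>(set xs) \<inter> E)"
      by (rule CC_restr_sect[OF _ assms(2) xs]) (use assms in \<open>auto simp: ZZ_def\<close>)
  qed (use assms(1) in \<open>simp add: ZZ_def CC_eqv[of c E1 k]\<close>)
  thus ?thesis using assms closedc_mono[OF _ assms(3)] by (simp add: ZZ_def closedc_rs)
qed

definition dE :: "cochain \<Rightarrow> cochain" where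
  "dE c xs = (\<lambda>v w. alt (\<lambda>ys. c ys v w) xs)"

lemma alt_eqv:
  assumes "c \<in> CC E k" "xs \<in> simplices W (Suc k)"
  shows "alt (\<lambda>ys. c ys (act1 \<zeta> g v) (act2 \<zeta> g w)) (map (gs g) xs) = \<theta> g * alt (\<lambda>ys. c ys v w) xs"
proof -
  have "alt (\<lambda>ys. c ys (act1 \<zeta> g v) (act2 \<zeta> g w)) (map (gs g) xs) =
      alt (\<lambda>ys. c (map (gs g) ys) (act1 \<zeta> g v) (act2 \<zeta> g w)) xs"
    by (rule alt_map[symmetric])
  also have "\<dots> = alt (\<lambda>ys. \<theta> g * c ys v w) xs"
    by (rule alt_cong, rule CC_eqv[OF assms(1)], rule simplices_face[OF assms(2)])
  also have "\<dots> = \<theta> g * alt (\<lambda>ys. c ys v w) xs" by (rule alt_cmult)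
  finally show ?thesis .
qed

lemma dE_ZZ:
  assumes c: "c \<in> CC E k" and E: "okE E"
  shows "rs E (dE c) \<in> ZZ E (Suc k)"
proof -
  have "rs E (dE c) \<in> CC E (Suc k)"
  proof (rule CC_I[OF E])
    fix xs assume xs: "xs \<in> simplices W (Suc k)"
    show "restr (\<Inter>(set xs) \<inter> E) (dE c xs) \<in> O_sect i j (\<Inter>(set xs) \<inter> E)"
      unfolding dE_def
    proof (rule O_sect_alt[OF open_simplex[OF E xs]])
      fix ys assume ys: "Suc (length ys) = length xs" "set ys \<subseteq> set xs"
      hence "\<Inter>(set xs) \<inter> E \<subseteq> \<Inter>(set ys) \<inter> E" by auto
      thus "restr (\<Inter>(set xs) \<inter> E) (c ys) \<in> O_sect i j (\<Inter>(set xs) \<inter> E)"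
        by (intro O_sect_restrict[OF CC_sect[OF c simplices_face[OF xs ys]] open_simplex[OF E xs]])
    qed
  qed (simp add: dE_def alt_eqv[OF c])
  moreover have "closedc W E (Suc k) (dE c)"
    unfolding closedc_def dE_def by (simp add: alt_alt)
  ultimately show ?thesis by (simp add: ZZ_def closedc_rs)
qed

text \<open>The projection onto the \<theta>-isotypic component, with \<theta> (- g) in the role of
  the inverse of \<theta> g.\<close>

definition av :: "cochain \<Rightarrow> cochain" where
  "av b xs = (\<lambda>v w. (\<Sum>g\<in>UNIV. \<theta> (- g) * b (map (gs g) xs) (act1 \<zeta> g v) (act2 \<zeta> g w)) / of_nat CARD(grp))"

lemma \<theta>_0: "\<theta> 0 = 1"
  using \<theta>_add[of 0 0] \<theta>_nonzero[of 0] by simp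

lemma \<theta>_minus: "\<theta> (- g) * \<theta> g = 1"
  using \<theta>_add[of "- g" g] \<theta>_0 by simp

lemma av_cch:
  assumes b: "b \<in> cch i j W E k" and E: "okE E"
  shows "av b \<in> CC E k"
proof -
  have "av b xs \<in> O_sect i j (\<Inter>(set xs) \<inter> E)" if xs: "xs \<in> simplices W k" for xs
  proof -
    have "(\<lambda>v w. \<Sum>g\<in>UNIV. \<theta> (- g) * b (map (gs g) xs) (act1 \<zeta> g v) (act2 \<zeta> g w)) \<in> O_sect i j (\<Inter>(set xs) \<inter> E)"
    proof (rule O_sect_sum[OF open_simplex[OF E xs]], rule O_sect_cmult)
      fix g :: grp
      have "b (map (gs g) xs) \<in> O_sect i j (\<Inter>(set (map (gs g) xs)) \<inter> E)"
        using b simplices_gs[OF xs] unfolding cch_def by blast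
      from O_sect_act[OF prim this, of g]
      have "(\<lambda>v w. b (map (gs g) xs) (act1 \<zeta> g v) (act2 \<zeta> g w)) \<in>
          O_sect i j (actT \<zeta> (- g) ` (\<Inter>(set (map (gs g) xs)) \<inter> E))" .
      also have "actT \<zeta> (- g) ` (\<Inter>(set (map (gs g) xs)) \<inter> E) = \<Inter>(set xs) \<inter> E"
      proof (rule T_subset_eqI)
        have "zopen (\<Inter>(set (map (gs g) xs)) \<inter> E)" by (rule open_simplex[OF E simplices_gs[OF xs]])
        from zopen_subset_T[OF zopen_act[OF prim this]]
        show "actT \<zeta> (- g) ` (\<Inter>(set (map (gs g) xs)) \<inter> E) \<subseteq> T" .
        show "\<Inter>(set xs) \<inter> E \<subseteq> T" by (rule zopen_subset_T[OF open_simplex[OF E xs]])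
      qed (simp only: in_actT_image[OF prim] minus_minus actT_pt in_gs[OF E])
      finally show "(\<lambda>v w. b (map (gs g) xs) (act1 \<zeta> g v) (act2 \<zeta> g w)) \<in> O_sect i j (\<Inter>(set xs) \<inter> E)" .
    qed
    from O_sect_cmult[OF this, of "1 / of_nat CARD(grp)"] show ?thesis by (simp add: av_def)
  qed
  moreover have "av b (map (gs h) xs) (act1 \<zeta> h v) (act2 \<zeta> h w) = \<theta> h * av b xs v w" for xs h v w
  proof -
    have gg: "gs g (gs h U) = gs (g + h) U" for g U by (simp add: image_image actT_add[OF prim])
    have "(\<Sum>g\<in>UNIV. \<theta> (- g) * b (map (gs g) (map (gs h) xs)) (act1 \<zeta> g (act1 \<zeta> h v)) (act2 \<zeta> g (act2 \<zeta> h w))) =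
      (\<Sum>g\<in>UNIV. \<theta> h * (\<theta> (- (g + h)) * b (map (gs (g + h)) xs) (act1 \<zeta> (g + h) v) (act2 \<zeta> (g + h) w)))"
    proof (rule sum.cong[OF refl])
      fix g :: grp
      have "\<theta> (- g) = \<theta> h * \<theta> (- (g + h))" using \<theta>_add[of h "- (g + h)"] by simp
      moreover have "map (gs g) (map (gs h) xs) = map (gs (g + h)) xs" unfolding map_map by (rule map_cong[OF refl]) (simp only: comp_apply gg)
      ultimately show "\<theta> (- g) * b (map (gs g) (map (gs h) xs)) (act1 \<zeta> g (act1 \<zeta> h v)) (act2 \<zeta> g (act2 \<zeta> h w)) =
         \<theta> h * (\<theta> (- (g + h)) * b (map (gs (g + h)) xs) (act1 \<zeta> (g + h) v) (act2 \<zeta> (g + h) w))"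
        by (simp only: act1_add[OF prim] act2_add[OF prim] mult.assoc)
    qed
    also have "\<dots> = \<theta> h * (\<Sum>g\<in>UNIV. \<theta> (- (g + h)) * b (map (gs (g + h)) xs) (act1 \<zeta> (g + h) v) (act2 \<zeta> (g + h) w))"
      by (simp add: sum_distrib_left)
    also have "(\<Sum>g\<in>UNIV. \<theta> (- (g + h)) * b (map (gs (g + h)) xs) (act1 \<zeta> (g + h) v) (act2 \<zeta> (g + h) w)) =
        (\<Sum>g\<in>UNIV. \<theta> (- g) * b (map (gs g) xs) (act1 \<zeta> g v) (act2 \<zeta> g w))"
      by (rule sum.reindex_bij_betw[of "\<lambda>g. g + h" UNIV UNIV]) (rule bij_betw_byWitness[of _ "\<lambda>g. g - h"]; auto)
    finally show ?thesis by (simp add: av_def)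
  qed
  ultimately show ?thesis unfolding CC_def cch_def eqv_def by blast
qed

text \<open>Averaging commutes with the Cech differential and fixes the equivariant c; so the
  average of a primitive from \<open>row_exact\<close> is an equivariant primitive.\<close>

lemma row_exact_eqv:
  assumes xy: "x \<or> y" "x' \<or> y'" and c: "c \<in> ZZ (EE x y x' y') (Suc k)"
  shows "\<exists>b\<in>CC (EE x y x' y') k. bounds W (EE x y x' y') (Suc k) b c"
proof -
  let ?E = "EE x y x' y'"
  have pos: "0 < (of_bool x + of_bool y :: nat)" "0 < (of_bool x' + of_bool y' :: nat)" using xy by auto
  from c have "c \<in> cch i j W (D (ee x y x' y')) (Suc k)" "closedc W (D (ee x y x' y')) (Suc k) c"
    by (auto simp: ZZ_def CC_def EE_def)
  from row_exact[OF ee_bihom pos this] obtain b where b: "b \<in> cch i j W ?E k" "bounds W ?E (Suc k) b c"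
    unfolding EE_def by blast
  have "bounds W ?E (Suc k) (av b) c" unfolding bounds_def
  proof (intro ballI allI impI)
    fix xs v w assume xs: "xs \<in> simplices W (Suc k)" and vw: "(pt v, pt w) \<in> \<Inter>(set xs) \<inter> ?E"
    have *: "\<theta> (- g) * alt (\<lambda>ys. b (map (gs g) ys) (act1 \<zeta> g v) (act2 \<zeta> g w)) xs = c xs v w" for g
    proof -
      have "alt (\<lambda>ys. b (map (gs g) ys) (act1 \<zeta> g v) (act2 \<zeta> g w)) xs =
          alt (\<lambda>ys. b ys (act1 \<zeta> g v) (act2 \<zeta> g w)) (map (gs g) xs)" by (rule alt_map)
      also have "\<dots> = c (map (gs g) xs) (act1 \<zeta> g v) (act2 \<zeta> g w)"
        using b(2) simplices_gs[OF xs, of g] vw[folded in_gs[OF okE_EE, of g v w]] unfolding bounds_def by metis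
      also have "\<dots> = \<theta> g * c xs v w" using c xs by (simp add: ZZ_def CC_eqv[of c ?E "Suc k"])
      finally show ?thesis using \<theta>_minus[of g] by (simp add: mult.assoc[symmetric])
    qed
    have "alt (\<lambda>ys. av b ys v w) xs = alt (\<lambda>ys. (1 / of_nat CARD(grp)) *
       (\<Sum>g\<in>UNIV. \<theta> (- g) * b (map (gs g) ys) (act1 \<zeta> g v) (act2 \<zeta> g w))) xs"
      by (simp add: av_def)
    also have "\<dots> = (1 / of_nat CARD(grp)) * (\<Sum>g\<in>(UNIV :: grp set). c xs v w)"
      unfolding alt_cmult alt_sum * ..
    also have "\<dots> = c xs v w" by simp
    finally show "c xs v w = alt (\<lambda>ys. av b ys v w) xs" by simp
  qed
  with av_cch[OF b(1) okE_EE] show ?thesis by blast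
qed

text \<open>Together with \<open>section_ZZ0\<close> this identifies the closed equivariant
  0-cochains over E with the eigensections over E. The eigenvalue equation at a point is checked by
  passing from a member U to its translate.\<close>

lemma ZZ0_section:
  assumes E: "okE E" and c: "c \<in> ZZ E 0"
  obtains s where "s \<in> OE E" "\<And>U v w. U \<in> W \<Longrightarrow> (pt v, pt w) \<in> U \<inter> E \<Longrightarrow> c [U] v w = s v w"
proof -
  have ET: "E \<subseteq> T" using E zopen_subset_T by (simp add: okE_def)
  from c have "c \<in> cch i j W E 0" "closedc W E 0 c" by (auto simp: ZZ_def CC_def)
  then obtain s where s: "s \<in> O_sect i j E" "\<And>U v w. U \<in> W \<Longrightarrow> (pt v, pt w) \<in> U \<inter> E \<Longrightarrow> c [U] v w = s v w"
    using row_zero[OF ET] by metis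
  have "s (act1 \<zeta> g v) (act2 \<zeta> g w) = \<theta> g * s v w" for g v w
  proof (cases "(pt v, pt w) \<in> E")
    case True
    then obtain U where U: "U \<in> W" "(pt v, pt w) \<in> U" using ET cov by blast
    have "(pt (act1 \<zeta> g v), pt (act2 \<zeta> g w)) \<in> \<Inter>(set (map (gs g) [U])) \<inter> E"
      unfolding in_gs[OF E] using U True by simp
    hence "(pt (act1 \<zeta> g v), pt (act2 \<zeta> g w)) \<in> gs g U \<inter> E" by simp
    from s(2)[OF W_inv[OF U(1)] this]
    have "s (act1 \<zeta> g v) (act2 \<zeta> g w) = c (map (gs g) [U]) (act1 \<zeta> g v) (act2 \<zeta> g w)" by simp
    also have "\<dots> = \<theta> g * c [U] v w"
      using c U by (intro CC_eqv[of c E 0]) (auto simp: ZZ_def simplices_def)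
    finally show ?thesis using s(2)[OF U(1)] U True by simp
  next
    case False
    hence "(pt (act1 \<zeta> g v), pt (act2 \<zeta> g w)) \<notin> E" using E by (simp add: okE_def in_invar[OF prim])
    with False show ?thesis by (simp add: O_sect_outside[OF s(1)])
  qed
  hence "s \<in> OE E" using s(1) unfolding OE_def eig_def by blast
  thus ?thesis using that s(2) by blast
qed

lemma section_ZZ0:
  assumes E: "okE E" and s: "s \<in> OE E"
  shows "rs E (\<lambda>xs. s) \<in> ZZ E 0"
proof -
  have "rs E (\<lambda>xs. s) \<in> CC E 0"
  proof (rule CC_I[OF E])
    fix xs assume xs: "xs \<in> simplices W 0"
    show "restr (\<Inter>(set xs) \<inter> E) s \<in> O_sect i j (\<Inter>(set xs) \<inter> E)"
      by (rule O_sect_restrict[OF _ open_simplex[OF E xs]]) (use s in \<open>auto simp: OE_def\<close>)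
  qed (use s in \<open>simp add: OE_def eig_def\<close>)
  moreover have "closedc W E 0 (\<lambda>xs. s)"
    unfolding closedc_def by (auto simp: simplices_def length_Suc_conv)
  ultimately show ?thesis by (simp add: ZZ_def closedc_rs)
qed

definition diffc :: "cochain \<Rightarrow> cochain \<Rightarrow> cochain" where
  "diffc c d = (\<lambda>xs v w. c xs v w - d xs v w)"

definition eqon :: "point set \<Rightarrow> nat \<Rightarrow> cochain \<Rightarrow> cochain \<Rightarrow> bool" where
  "eqon E k c d \<longleftrightarrow> (\<forall>xs\<in>simplices W k. \<forall>v w. (pt v, pt w) \<in> \<Inter>(set xs) \<inter> E \<longrightarrow> c xs v w = d xs v w)"

lemma eqonI: "(\<And>xs v w. xs \<in> simplices W k \<Longrightarrow> (pt v, pt w) \<in> \<Inter>(set xs) \<inter> E \<Longrightarrow> c xs v w = d xs v w) \<Longrightarrow> eqon E k c d"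
  unfolding eqon_def by blast

lemma eqonD: "eqon E k c d \<Longrightarrow> xs \<in> simplices W k \<Longrightarrow> (pt v, pt w) \<in> \<Inter>(set xs) \<inter> E \<Longrightarrow> c xs v w = d xs v w"
  unfolding eqon_def by blast

lemma boundsD: "bounds W E k b c \<Longrightarrow> xs \<in> simplices W k \<Longrightarrow> (pt v, pt w) \<in> \<Inter>(set xs) \<inter> E \<Longrightarrow>
    c xs v w = alt (\<lambda>ys. b ys v w) xs"
  unfolding bounds_def by blast

text \<open>The terms of the tensor product complex: \<open>Ew a b\<close> in degree 0,
  \<open>Eu b\<close> and \<open>Ev a\<close> in degree 1, \<open>E4\<close> in degree 2. In
  \<open>Eu b\<close> the two charts of the first curve are intersected, in \<open>Ev a\<close>
  those of the second.\<close>

abbreviation E4 :: "point set" where "E4 \<equiv> EE True True True True"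
abbreviation Ev :: "bool \<Rightarrow> point set" where "Ev a \<equiv> EE a (\<not> a) True True"
abbreviation Eu :: "bool \<Rightarrow> point set" where "Eu b \<equiv> EE True True b (\<not> b)"
abbreviation Ew :: "bool \<Rightarrow> bool \<Rightarrow> point set" where "Ew a b \<equiv> EE a (\<not> a) b (\<not> b)"

lemma E_sub: "E4 \<subseteq> Ev a" "E4 \<subseteq> Eu b" "E4 \<subseteq> Ew a b" "Ev a \<subseteq> Ew a b" "Eu b \<subseteq> Ew a b"
  "EE x y x' y' \<subseteq> T"
proof -
  have sub: "EE a b c d \<subseteq> EE a' b' c' d'" if "a' \<longrightarrow> a" "b' \<longrightarrow> b" "c' \<longrightarrow> c" "d' \<longrightarrow> d" for a b c d a' b' c' d'
  proof
    fix x assume x: "x \<in> EE a b c d"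
    hence "x \<in> T" using EE_subset_T by blast
    then obtain v w where vw: "x = (pt v, pt w)" by (rule T_cases)
    show "x \<in> EE a' b' c' d'" using x that unfolding vw in_EE by blast
  qed
  show "E4 \<subseteq> Ev a" "E4 \<subseteq> Eu b" "E4 \<subseteq> Ew a b" "Ev a \<subseteq> Ew a b" "Eu b \<subseteq> Ew a b" by (rule sub; simp)+
  show "EE x y x' y' \<subseteq> T" by (rule EE_subset_T)
qed

text \<open>The set \<open>hd xs\<close> lies in one of the four sets \<open>Ew a b\<close>, which makes the complex of the groups of cochains
  over the \<open>Ew a b\<close> contractible.\<close>

definition selX :: "point set list \<Rightarrow> bool" where
  "selX xs \<longleftrightarrow> hd xs \<subseteq> EE True False False False"

definition selY :: "point set list \<Rightarrow> bool" where
  "selY xs \<longleftrightarrow> hd xs \<subseteq> EE False False True False"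

text \<open>The charts are stable under the group, so the selected chart does not change along an
  orbit. This keeps the contraction inside the equivariant cochains.\<close>

lemma sel_gs:
  assumes "xs \<in> simplices W k"
  shows "selX (map (gs g) xs) = selX xs" "selY (map (gs g) xs) = selY xs"
proof -
  have ne: "xs \<noteq> []" using assms by (auto simp: simplices_def)
  have "gs g U \<subseteq> EE x y x' y' \<longleftrightarrow> U \<subseteq> EE x y x' y'" for U x y x' y'
  proof -
    have inj: "inj (actT \<zeta> g)" by (rule injI) (metis actT_add[OF prim] add.left_inverse actT_0)
    have "gs g U \<subseteq> EE x y x' y' \<longleftrightarrow> gs g U \<subseteq> gs g (EE x y x' y')" by (simp add: EE_act[OF prim])
    thus ?thesis by (simp add: inj_image_subset_iff[OF inj])
  qed
  thus "selX (map (gs g) xs) = selX xs" "selY (map (gs g) xs) = selY xs"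
    by (simp_all add: selX_def selY_def hd_map[OF ne])
qed

lemma sel_coord:
  assumes xs: "xs \<in> simplices W k" and vw: "(pt v, pt w) \<in> \<Inter>(set xs)"
  shows "selX xs \<Longrightarrow> v$1 \<noteq> 0" "\<not> selX xs \<Longrightarrow> v$2 \<noteq> 0" "selY xs \<Longrightarrow> w$1 \<noteq> 0" "\<not> selY xs \<Longrightarrow> w$2 \<noteq> 0"
proof -
  have h: "hd xs \<in> W" "(pt v, pt w) \<in> hd xs" using xs vw by (cases xs; auto simp: simplices_def)+
  obtain a b where ab: "hd xs \<subseteq> Ew a b" using W_sub[OF h(1)] by blast
  hence in1: "(pt v, pt w) \<in> Ew a b" using h by blast
  have 1: "selX xs" if a
  proof -
    have "Ew a b \<subseteq> EE True False False False"
    proof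
      fix x assume x: "x \<in> Ew a b"
      hence "x \<in> T" using EE_subset_T by blast
      then obtain v w where vw: "x = (pt v, pt w)" by (rule T_cases)
      show "x \<in> EE True False False False" using x that unfolding vw in_EE by blast
    qed
    thus ?thesis using ab by (auto simp: selX_def)
  qed
  have 2: "selY xs" if b
  proof -
    have "Ew a b \<subseteq> EE False False True False"
    proof
      fix x assume x: "x \<in> Ew a b"
      hence "x \<in> T" using EE_subset_T by blast
      then obtain v w where vw: "x = (pt v, pt w)" by (rule T_cases)
      show "x \<in> EE False False True False" using x that unfolding vw in_EE by blast
    qed
    thus ?thesis using ab by (auto simp: selY_def)
  qed
  show "selX xs \<Longrightarrow> v$1 \<noteq> 0" using h(2) unfolding selX_def by (auto simp: in_EE dest!: subsetD)
  show "selY xs \<Longrightarrow> w$1 \<noteq> 0" using h(2) unfolding selY_def by (auto simp: in_EE dest!: subsetD)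
  show "\<not> selX xs \<Longrightarrow> v$2 \<noteq> 0" using 1 in1 unfolding in_EE by blast
  show "\<not> selY xs \<Longrightarrow> w$2 \<noteq> 0" using 2 in1 unfolding in_EE by blast
qed

text \<open>Over the intersection of xs the selected coordinate is already nonzero. On the opposite
  chart this intersection is contained in \<open>E4\<close>, so \<open>m xs\<close> itself is a
  section there; on the selected chart 0 is taken.\<close>

lemma C_H2:
  assumes m: "m \<in> CC E4 k"
  shows "\<exists>t. (\<forall>a. t a \<in> CC (Ev a) k) \<and> eqon E4 k m (diffc (t True) (t False))"
proof -
  define t where "t a xs = (if a = selX xs then (\<lambda>v w. 0) else if a then m xs else (\<lambda>v w. - m xs v w))" for a xs
  have "rs (Ev a) (t a) \<in> CC (Ev a) k" for a
  proof (rule CC_I[OF okE_EE])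
    fix xs assume xs: "xs \<in> simplices W k"
    let ?V = "\<Inter>(set xs) \<inter> Ev a"
    have op: "zopen ?V" by (rule open_simplex[OF okE_EE xs])
    show "restr ?V (t a xs) \<in> O_sect i j ?V"
    proof (cases "a = selX xs")
      case True
      thus ?thesis using O_sect_zero[OF op] by (simp add: t_def)
    next
      case False
      have "?V \<subseteq> E4"
      proof
        fix x assume x: "x \<in> ?V"
        then obtain v w where vw: "x = (pt v, pt w)" using E_sub(6) T_cases by (metis IntD2 subsetD)
        show "x \<in> E4" using x False sel_coord[OF xs, of v w] unfolding vw Int_iff in_EE by blast
      qed
      from CC_restr_sect[OF m okE_EE xs this] have r: "restr ?V (m xs) \<in> O_sect i j ?V" .
      moreover have "restr ?V (\<lambda>v w. - m xs v w) = (\<lambda>v w. - restr ?V (m xs) v w)" by (auto simp: restr_def fun_eq_iff)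
      moreover have "t a xs = m xs \<or> t a xs = (\<lambda>v w. - m xs v w)" using False by (cases a) (auto simp: t_def)
      ultimately show ?thesis using O_sect_uminus[OF r] by (elim disjE) (simp_all only:)
    qed
  next
    fix xs g v w assume xs: "xs \<in> simplices W k"
    show "t a (map (gs g) xs) (act1 \<zeta> g v) (act2 \<zeta> g w) = \<theta> g * t a xs v w"
      unfolding t_def sel_gs[OF xs] using CC_eqv[OF m xs, of g v w] by simp
  qed
  moreover have "eqon E4 k m (diffc (rs (Ev True) (t True)) (rs (Ev False) (t False)))"
  proof (rule eqonI)
    fix xs v w assume vw: "(pt v, pt w) \<in> \<Inter>(set xs) \<inter> E4"
    hence "(pt v, pt w) \<in> \<Inter>(set xs) \<inter> Ev a" for a using E_sub(1)[of a] by blast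
    from this[of True] this[of False] show "m xs v w = diffc (rs (Ev True) (t True)) (rs (Ev False) (t False)) xs v w"
      unfolding diffc_def by (cases "selX xs") (simp_all add: rs_in t_def del: Int_iff)
  qed
  ultimately show ?thesis by (intro exI[of _ "\<lambda>a. rs (Ev a) (t a)"]) auto
qed

text \<open>The part built from u solves the equations for u. The part built from v uses only the
  selected chart of the first curve, so it is independent of a and leaves those equations intact.
  The equations for v then hold on the selected chart by construction and on the other one by the
  compatibility \<open>uv\<close>.\<close>

lemma C_H1:
  assumes u: "\<And>b. u b \<in> CC (Eu b) k" and v: "\<And>a. v a \<in> CC (Ev a) k"
    and uv: "eqon E4 k (diffc (u True) (u False)) (diffc (v True) (v False))"
  shows "\<exists>w. (\<forall>a b. w a b \<in> CC (Ew a b) k) \<and> (\<forall>b. eqon (Eu b) k (u b) (diffc (w True b) (w False b))) \<and>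
    (\<forall>a. eqon (Ev a) k (v a) (diffc (w a True) (w a False)))"
proof -
  define wv where "wv xs a b = (if b = selY xs then (\<lambda>x y. 0) else if b then v (selX xs) xs else (\<lambda>x y. - v (selX xs) xs x y))"
    for xs and a b :: bool
  define wu where "wu xs a b = (if a = selX xs then (\<lambda>x y. 0) else if a then u b xs else (\<lambda>x y. - u b xs x y))"
    for xs a b
  define w where "w a b xs = (\<lambda>x y. wv xs a b x y - (- wu xs a b x y))" for a b xs
  have W: "rs (Ew a b) (w a b) \<in> CC (Ew a b) k" for a b
  proof (rule CC_I[OF okE_EE])
    fix xs assume xs: "xs \<in> simplices W k"
    let ?V = "\<Inter>(set xs) \<inter> Ew a b"
    have op: "zopen ?V" by (rule open_simplex[OF okE_EE xs])
    have neg: "restr ?V (\<lambda>v w. - f v w) = (\<lambda>v w. - restr ?V f v w)" for f by (auto simp: restr_def fun_eq_iff)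
    have 1: "restr ?V (wv xs a b) \<in> O_sect i j ?V"
    proof (cases "b = selY xs")
      case True
      thus ?thesis using O_sect_zero[OF op] by (simp add: wv_def)
    next
      case False
      have "?V \<subseteq> Ev (selX xs)"
      proof
        fix x assume x: "x \<in> ?V"
        then obtain v w where vw: "x = (pt v, pt w)" using E_sub(6) T_cases by (metis IntD2 subsetD)
        show "x \<in> Ev (selX xs)" using x False sel_coord[OF xs, of v w] unfolding vw Int_iff in_EE by blast
      qed
      from CC_restr_sect[OF v okE_EE xs this] have r: "restr ?V (v (selX xs) xs) \<in> O_sect i j ?V" .
      moreover have "wv xs a b = v (selX xs) xs \<or> wv xs a b = (\<lambda>x y. - v (selX xs) xs x y)"
        using False by (cases b) (auto simp: wv_def)
      ultimately show ?thesis using O_sect_uminus[OF r] by (elim disjE) (simp_all only: neg)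
    qed
    have 2: "restr ?V (wu xs a b) \<in> O_sect i j ?V"
    proof (cases "a = selX xs")
      case True
      thus ?thesis using O_sect_zero[OF op] by (simp add: wu_def)
    next
      case False
      have "?V \<subseteq> Eu b"
      proof
        fix x assume x: "x \<in> ?V"
        then obtain v w where vw: "x = (pt v, pt w)" using E_sub(6) T_cases by (metis IntD2 subsetD)
        show "x \<in> Eu b" using x False sel_coord[OF xs, of v w] unfolding vw Int_iff in_EE by blast
      qed
      from CC_restr_sect[OF u okE_EE xs this] have r: "restr ?V (u b xs) \<in> O_sect i j ?V" .
      moreover have "wu xs a b = u b xs \<or> wu xs a b = (\<lambda>x y. - u b xs x y)"
        using False by (cases a) (auto simp: wu_def)
      ultimately show ?thesis using O_sect_uminus[OF r] by (elim disjE) (simp_all only: neg)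
    qed
    show "restr ?V (w a b xs) \<in> O_sect i j ?V"
      unfolding w_def restr_diff neg by (intro O_sect_diff O_sect_uminus 1 2)
  next
    fix xs g x y assume xs: "xs \<in> simplices W k"
    show "w a b (map (gs g) xs) (act1 \<zeta> g x) (act2 \<zeta> g y) = \<theta> g * w a b xs x y"
      unfolding w_def wv_def wu_def sel_gs[OF xs]
      by (simp add: CC_eqv[OF u xs] CC_eqv[OF v xs] distrib_left right_diff_distrib)
  qed
  have key: "u b xs x y = w True b xs x y - w False b xs x y" if xs: "xs \<in> simplices W k" and xy: "(pt x, pt y) \<in> \<Inter>(set xs) \<inter> Eu b" for xs x y b
    by (cases "selX xs"; cases "b = selY xs") (simp_all add: w_def wv_def wu_def)
  have key2: "v a xs x y = w a True xs x y - w a False xs x y" if xs: "xs \<in> simplices W k" and xy: "(pt x, pt y) \<in> \<Inter>(set xs) \<inter> Ev a" for xs x y a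
  proof (cases "a = selX xs")
    case True
    thus ?thesis by (cases "selY xs") (simp_all add: w_def wv_def wu_def)
  next
    case False
    have "(pt x, pt y) \<in> \<Inter>(set xs) \<inter> E4" using xy False sel_coord[OF xs, of x y] unfolding Int_iff in_EE by blast
    from eqonD[OF uv xs this] have "u True xs x y - u False xs x y = v True xs x y - v False xs x y" by (simp add: diffc_def)
    thus ?thesis using False by (cases "selX xs"; cases "selY xs") (auto simp: w_def wv_def wu_def algebra_simps)
  qed
  have "eqon (Eu b) k (u b) (diffc (rs (Ew True b) (w True b)) (rs (Ew False b) (w False b)))" for b
  proof (rule eqonI)
    fix xs x y assume xs: "xs \<in> simplices W k" and xy: "(pt x, pt y) \<in> \<Inter>(set xs) \<inter> Eu b"
    hence "(pt x, pt y) \<in> \<Inter>(set xs) \<inter> Ew a b" for a using E_sub(5)[of b a] by blast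
    thus "u b xs x y = diffc (rs (Ew True b) (w True b)) (rs (Ew False b) (w False b)) xs x y"
      using key[OF xs xy] by (simp only: diffc_def rs_in)
  qed
  moreover have "eqon (Ev a) k (v a) (diffc (rs (Ew a True) (w a True)) (rs (Ew a False) (w a False)))" for a
  proof (rule eqonI)
    fix xs x y assume xs: "xs \<in> simplices W k" and xy: "(pt x, pt y) \<in> \<Inter>(set xs) \<inter> Ev a"
    hence "(pt x, pt y) \<in> \<Inter>(set xs) \<inter> Ew a b" for b using E_sub(4)[of a b] by blast
    thus "v a xs x y = diffc (rs (Ew a True) (w a True)) (rs (Ew a False) (w a False)) xs x y"
      using key2[OF xs xy] by (simp only: diffc_def rs_in)
  qed
  ultimately show ?thesis using W by (intro exI[of _ "\<lambda>a b. rs (Ew a b) (w a b)"]) blast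
qed

end

section \<open>The double complex\<close>

context eq_cover
begin

lemma ZZ_CC: "c \<in> ZZ E k \<Longrightarrow> c \<in> CC E k"
  by (simp add: ZZ_def)

lemma ZZ_closed: "c \<in> ZZ E k \<Longrightarrow> xs \<in> simplices W (Suc k) \<Longrightarrow> (pt v, pt w) \<in> \<Inter>(set xs) \<inter> E \<Longrightarrow>
    alt (\<lambda>ys. c ys v w) xs = 0"
  unfolding ZZ_def closedc_def by blast

lemma face_in:
  assumes "xs \<in> simplices W (Suc k)" "(pt v, pt w) \<in> \<Inter>(set xs) \<inter> E" "Suc (length ys) = length xs" "set ys \<subseteq> set xs"
  shows "ys \<in> simplices W k" "(pt v, pt w) \<in> \<Inter>(set ys) \<inter> E"
  using simplices_face[OF assms(1,3,4)] assms(2,4) by auto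

lemma alt_eqon:
  assumes "eqon E k c d" "xs \<in> simplices W (Suc k)" "(pt v, pt w) \<in> \<Inter>(set xs) \<inter> E"
  shows "alt (\<lambda>ys. c ys v w) xs = alt (\<lambda>ys. d ys v w) xs"
  by (rule alt_cong, rule eqonD[OF assms(1)]) (use face_in[OF assms(2,3)] in blast)+

lemma rs_diff_CC:
  "c \<in> CC E1 k \<Longrightarrow> d \<in> CC E2 k \<Longrightarrow> okE E \<Longrightarrow> E \<subseteq> E1 \<Longrightarrow> E \<subseteq> E2 \<Longrightarrow> rs E (diffc c d) \<in> CC E k"
  unfolding diffc_def by (fact CC_diff)

lemma simplex0: "xs \<in> simplices W 0 \<Longrightarrow> \<exists>U. U \<in> W \<and> xs = [U]"
  by (auto simp: simplices_def length_Suc_conv)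

lemma sub_in: "(pt x, pt y) \<in> A \<inter> E \<Longrightarrow> E \<subseteq> E' \<Longrightarrow> (pt x, pt y) \<in> A \<inter> E'"
  by blast

text \<open>Surjectivity for closed cochains. In degree 0 these are sections, and
  \<open>K_H2\<close> applies. In higher degree a primitive is taken over \<open>E4\<close>,
  distributed over the charts by \<open>C_H2\<close>, where no closedness is required, and
  differentiated again.\<close>

lemma claim_H2:
  assumes noW: "no_weight \<zeta> i j \<theta>" and m: "m \<in> ZZ E4 r"
  shows "\<exists>t s. (\<forall>a. t a \<in> ZZ (Ev a) r) \<and> (\<forall>b. s b \<in> ZZ (Eu b) r) \<and>
    eqon E4 r m (diffc (diffc (t True) (t False)) (diffc (s True) (s False)))"
proof (cases r)
  case 0
  obtain m0 where m0: "m0 \<in> OE E4" "\<And>U v w. U \<in> W \<Longrightarrow> (pt v, pt w) \<in> U \<inter> E4 \<Longrightarrow> m [U] v w = m0 v w"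
    by (rule ZZ0_section[OF okE_EE m[unfolded 0]]) (rule that; blast)
  from K_H2[OF noW m0(1)] obtain t s where ts: "\<And>a. t a \<in> OE (Ev a)" "\<And>b. s b \<in> OE (Eu b)"
    "\<And>x y. (pt x, pt y) \<in> E4 \<Longrightarrow> m0 x y = t True x y - t False x y - (s True x y - s False x y)" by blast
  have "eqon E4 0 m (diffc (diffc (rs (Ev True) (\<lambda>xs. t True)) (rs (Ev False) (\<lambda>xs. t False)))
      (diffc (rs (Eu True) (\<lambda>xs. s True)) (rs (Eu False) (\<lambda>xs. s False))))"
  proof (rule eqonI)
    fix xs x y assume xs: "xs \<in> simplices W 0" and xy: "(pt x, pt y) \<in> \<Inter>(set xs) \<inter> E4"
    obtain U where U: "U \<in> W" "xs = [U]" using simplex0[OF xs] by blast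
    have "m xs x y = m0 x y" unfolding U(2) by (rule m0(2)[OF U(1)]) (use xy U in simp)
    also have "\<dots> = t True x y - t False x y - (s True x y - s False x y)" using ts(3) xy by blast
    finally show "m xs x y = diffc (diffc (rs (Ev True) (\<lambda>xs. t True)) (rs (Ev False) (\<lambda>xs. t False)))
      (diffc (rs (Eu True) (\<lambda>xs. s True)) (rs (Eu False) (\<lambda>xs. s False))) xs x y"
      unfolding diffc_def rs_in[OF sub_in[OF xy E_sub(1)]] rs_in[OF sub_in[OF xy E_sub(2)]] .
  qed
  thus ?thesis unfolding 0
    using section_ZZ0[OF okE_EE ts(1)] section_ZZ0[OF okE_EE ts(2)]
    by (intro exI[of _ "\<lambda>a. rs (Ev a) (\<lambda>xs. t a)"] exI[of _ "\<lambda>b. rs (Eu b) (\<lambda>xs. s b)"]) blast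
next
  case (Suc k)
  have "\<exists>b\<in>CC E4 k. bounds W E4 (Suc k) b m" by (rule row_exact_eqv) (use m Suc in auto)
  then obtain m' where m': "m' \<in> CC E4 k" "bounds W E4 (Suc k) m' m" by blast
  from C_H2[OF m'(1)] obtain t where t: "\<And>a. t a \<in> CC (Ev a) k" "eqon E4 k m' (diffc (t True) (t False))" by blast
  have "eqon E4 (Suc k) m (diffc (diffc (rs (Ev True) (dE (t True))) (rs (Ev False) (dE (t False))))
      (diffc (rs (Eu True) (\<lambda>xs v w. 0)) (rs (Eu False) (\<lambda>xs v w. 0))))"
  proof (rule eqonI)
    fix xs x y assume xs: "xs \<in> simplices W (Suc k)" and xy: "(pt x, pt y) \<in> \<Inter>(set xs) \<inter> E4"
    have "m xs x y = alt (\<lambda>ys. m' ys x y) xs" by (rule boundsD[OF m'(2) xs xy])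
    also have "\<dots> = alt (\<lambda>ys. diffc (t True) (t False) ys x y) xs" by (rule alt_eqon[OF t(2) xs xy])
    also have "\<dots> = dE (t True) xs x y - dE (t False) xs x y" by (simp add: diffc_def alt_diff dE_def)
    finally show "m xs x y = diffc (diffc (rs (Ev True) (dE (t True))) (rs (Ev False) (dE (t False))))
      (diffc (rs (Eu True) (\<lambda>xs v w. 0)) (rs (Eu False) (\<lambda>xs v w. 0))) xs x y"
      unfolding diffc_def rs_in[OF sub_in[OF xy E_sub(1)]] rs_in[OF sub_in[OF xy E_sub(2)]] by simp
  qed
  moreover have "\<And>a. rs (Ev a) (dE (t a)) \<in> ZZ (Ev a) (Suc k)" by (rule dE_ZZ[OF t(1) okE_EE])
  moreover have "\<And>b. rs (Eu b) (\<lambda>xs v w. 0) \<in> ZZ (Eu b) (Suc k)" by (rule ZZ_zero[OF okE_EE])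
  ultimately show ?thesis unfolding Suc
    by (intro exI[of _ "\<lambda>a. rs (Ev a) (dE (t a))"] exI[of _ "\<lambda>b. rs (Eu b) (\<lambda>xs v w. 0)"]) blast
qed

text \<open>Middle exactness for closed cochains. In degree 0 this is \<open>K_H1\<close>. In higher
  degree primitives of u and v are taken; they are compatible only up to a closed cochain on
  \<open>E4\<close>, which \<open>claim_H2\<close> removes, and then \<open>C_H1\<close> and the
  differential finish.\<close>

lemma claim_H1:
  assumes noW: "no_weight \<zeta> i j \<theta>"
    and u: "\<And>b. u b \<in> ZZ (Eu b) q" and v: "\<And>a. v a \<in> ZZ (Ev a) q"
    and uv: "eqon E4 q (diffc (u True) (u False)) (diffc (v True) (v False))"
  shows "\<exists>w. (\<forall>a b. w a b \<in> ZZ (Ew a b) q) \<and> (\<forall>b. eqon (Eu b) q (u b) (diffc (w True b) (w False b))) \<and>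
    (\<forall>a. eqon (Ev a) q (v a) (diffc (w a True) (w a False)))"
proof (cases q)
  case 0
  have "\<exists>s. s \<in> OE (Eu b) \<and> (\<forall>U x y. U \<in> W \<longrightarrow> (pt x, pt y) \<in> U \<inter> Eu b \<longrightarrow> u b [U] x y = s x y)" for b
    by (rule ZZ0_section[OF okE_EE u[of b, unfolded 0]]) blast
  then obtain su where su: "\<And>b. su b \<in> OE (Eu b)"
    "\<And>b U x y. U \<in> W \<Longrightarrow> (pt x, pt y) \<in> U \<inter> Eu b \<Longrightarrow> u b [U] x y = su b x y" by metis
  have "\<exists>s. s \<in> OE (Ev a) \<and> (\<forall>U x y. U \<in> W \<longrightarrow> (pt x, pt y) \<in> U \<inter> Ev a \<longrightarrow> v a [U] x y = s x y)" for a
    by (rule ZZ0_section[OF okE_EE v[of a, unfolded 0]]) blast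
  then obtain sv where sv: "\<And>a. sv a \<in> OE (Ev a)"
    "\<And>a U x y. U \<in> W \<Longrightarrow> (pt x, pt y) \<in> U \<inter> Ev a \<Longrightarrow> v a [U] x y = sv a x y" by metis
  have "su True x y - su False x y = sv True x y - sv False x y" if xy: "(pt x, pt y) \<in> E4" for x y
  proof -
    obtain U where U: "U \<in> W" "(pt x, pt y) \<in> U" using xy EE_subset_T cov by blast
    have "[U] \<in> simplices W 0" "(pt x, pt y) \<in> \<Inter>(set [U]) \<inter> E4" using U xy by (auto simp: simplices_def)
    from eqonD[OF uv[unfolded 0] this] have "u True [U] x y - u False [U] x y = v True [U] x y - v False [U] x y"
      by (simp add: diffc_def)
    moreover have "u b [U] x y = su b x y" for b
      by (rule su(2)[OF U(1)]) (use U xy E_sub(2)[of b] in blast)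
    moreover have "v a [U] x y = sv a x y" for a
      by (rule sv(2)[OF U(1)]) (use U xy E_sub(1)[of a] in blast)
    ultimately show ?thesis by simp
  qed
  from K_H1[OF noW su(1) sv(1) this] obtain w where w: "\<And>a b. w a b \<in> OE (Ew a b)"
    "\<And>b x y. (pt x, pt y) \<in> Eu b \<Longrightarrow> su b x y = w True b x y - w False b x y"
    "\<And>a x y. (pt x, pt y) \<in> Ev a \<Longrightarrow> sv a x y = w a True x y - w a False x y" by blast
  define w' where "w' a b = rs (Ew a b) (\<lambda>xs. w a b)" for a b
  have "\<And>a b. w' a b \<in> ZZ (Ew a b) 0" unfolding w'_def by (rule section_ZZ0[OF okE_EE w(1)])
  moreover have "eqon (Eu b) 0 (u b) (diffc (w' True b) (w' False b))" for b
  proof (rule eqonI)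
    fix xs x y assume xs: "xs \<in> simplices W 0" and xy: "(pt x, pt y) \<in> \<Inter>(set xs) \<inter> Eu b"
    obtain U where U: "U \<in> W" "xs = [U]" using simplex0[OF xs] by blast
    have "u b xs x y = su b x y" unfolding U(2) by (rule su(2)[OF U(1)]) (use xy U in simp)
    also have "\<dots> = w True b x y - w False b x y" using w(2) xy by blast
    finally show "u b xs x y = diffc (w' True b) (w' False b) xs x y"
      unfolding diffc_def w'_def rs_in[OF sub_in[OF xy E_sub(5)]] .
  qed
  moreover have "eqon (Ev a) 0 (v a) (diffc (w' a True) (w' a False))" for a
  proof (rule eqonI)
    fix xs x y assume xs: "xs \<in> simplices W 0" and xy: "(pt x, pt y) \<in> \<Inter>(set xs) \<inter> Ev a"
    obtain U where U: "U \<in> W" "xs = [U]" using simplex0[OF xs] by blast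
    have "v a xs x y = sv a x y" unfolding U(2) by (rule sv(2)[OF U(1)]) (use xy U in simp)
    also have "\<dots> = w a True x y - w a False x y" using w(3) xy by blast
    finally show "v a xs x y = diffc (w' a True) (w' a False) xs x y"
      unfolding diffc_def w'_def rs_in[OF sub_in[OF xy E_sub(4)]] .
  qed
  ultimately show ?thesis unfolding 0 by blast
next
  case (Suc k)
  have "\<exists>c. c \<in> CC (Eu b) k \<and> bounds W (Eu b) (Suc k) c (u b)" for b
    using row_exact_eqv[of True True b "\<not> b" "u b" k] u[of b] Suc by auto
  then obtain u' where u': "\<And>b. u' b \<in> CC (Eu b) k" "\<And>b. bounds W (Eu b) (Suc k) (u' b) (u b)" by metis
  have "\<exists>c. c \<in> CC (Ev a) k \<and> bounds W (Ev a) (Suc k) c (v a)" for a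
    using row_exact_eqv[of a "\<not> a" True True "v a" k] v[of a] Suc by auto
  then obtain v' where v': "\<And>a. v' a \<in> CC (Ev a) k" "\<And>a. bounds W (Ev a) (Suc k) (v' a) (v a)" by metis
  \<comment> \<open>The failure of the primitives to be compatible on \<open>E4\<close>. It is
    closed because u and v themselves are compatible.\<close>
  define m where "m = rs E4 (diffc (rs E4 (diffc (v' True) (v' False))) (rs E4 (diffc (u' True) (u' False))))"
  have m_in: "m xs x y = (v' True xs x y - v' False xs x y) - (u' True xs x y - u' False xs x y)"
    if "(pt x, pt y) \<in> \<Inter>(set xs) \<inter> E4" for xs x y
    unfolding m_def rs_in[OF that] diffc_def ..
  have mCC: "m \<in> CC E4 k" unfolding m_def
    by (intro rs_diff_CC[where ?E1.0 = E4 and ?E2.0 = E4] rs_diff_CC[OF v'(1) v'(1)] rs_diff_CC[OF u'(1) u'(1)] okE_EE E_sub order_refl)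
  have "closedc W E4 k m" unfolding closedc_def
  proof (intro ballI allI impI)
    fix xs x y assume xs: "xs \<in> simplices W (Suc k)" and xy: "(pt x, pt y) \<in> \<Inter>(set xs) \<inter> E4"
    have "alt (\<lambda>ys. m ys x y) xs = alt (\<lambda>ys. (v' True ys x y - v' False ys x y) - (u' True ys x y - u' False ys x y)) xs"
      by (rule alt_cong, rule m_in) (rule face_in(2)[OF xs xy])
    also have "\<dots> = (v True xs x y - v False xs x y) - (u True xs x y - u False xs x y)"
      unfolding alt_diff boundsD[OF v'(2) xs sub_in[OF xy E_sub(1)]] boundsD[OF u'(2) xs sub_in[OF xy E_sub(2)]] ..
    also have "\<dots> = 0" using eqonD[OF uv[unfolded Suc] xs xy] by (simp add: diffc_def)
    finally show "alt (\<lambda>ys. m ys x y) xs = 0" .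
  qed
  hence "m \<in> ZZ E4 k" using mCC by (simp add: ZZ_def)
  from claim_H2[OF noW this] obtain t s where ts: "\<And>a. t a \<in> ZZ (Ev a) k" "\<And>b. s b \<in> ZZ (Eu b) k"
    "eqon E4 k m (diffc (diffc (t True) (t False)) (diffc (s True) (s False)))" by blast
  \<comment> \<open>The corrections s and t are closed, so the corrected cochains remain primitives
    of u and v.\<close>
  define u'' where "u'' b = rs (Eu b) (diffc (u' b) (s b))" for b
  define v'' where "v'' a = rs (Ev a) (diffc (v' a) (t a))" for a
  have u'': "u'' b \<in> CC (Eu b) k" for b unfolding u''_def by (rule rs_diff_CC[OF u'(1) ZZ_CC[OF ts(2)] okE_EE order_refl order_refl])
  have v'': "v'' a \<in> CC (Ev a) k" for a unfolding v''_def by (rule rs_diff_CC[OF v'(1) ZZ_CC[OF ts(1)] okE_EE order_refl order_refl])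
  have "eqon E4 k (diffc (u'' True) (u'' False)) (diffc (v'' True) (v'' False))"
  proof (rule eqonI)
    fix xs x y assume xs: "xs \<in> simplices W k" and xy: "(pt x, pt y) \<in> \<Inter>(set xs) \<inter> E4"
    have "(v' True xs x y - v' False xs x y) - (u' True xs x y - u' False xs x y) =
       (t True xs x y - t False xs x y) - (s True xs x y - s False xs x y)"
      using eqonD[OF ts(3) xs xy] m_in[OF xy] by (simp add: diffc_def)
    thus "diffc (u'' True) (u'' False) xs x y = diffc (v'' True) (v'' False) xs x y"
      unfolding diffc_def u''_def v''_def rs_in[OF sub_in[OF xy E_sub(1)]] rs_in[OF sub_in[OF xy E_sub(2)]]
      by algebra
  qed
  from C_H1[OF u'' v'' this] obtain w where w: "\<And>a b. w a b \<in> CC (Ew a b) k"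
    "\<And>b. eqon (Eu b) k (u'' b) (diffc (w True b) (w False b))"
    "\<And>a. eqon (Ev a) k (v'' a) (diffc (w a True) (w a False))" by blast
  define w' where "w' a b = rs (Ew a b) (dE (w a b))" for a b
  have "\<And>a b. w' a b \<in> ZZ (Ew a b) (Suc k)" unfolding w'_def by (rule dE_ZZ[OF w(1) okE_EE])
  moreover have "eqon (Eu b) (Suc k) (u b) (diffc (w' True b) (w' False b))" for b
  proof (rule eqonI)
    fix xs x y assume xs: "xs \<in> simplices W (Suc k)" and xy: "(pt x, pt y) \<in> \<Inter>(set xs) \<inter> Eu b"
    have "diffc (w' True b) (w' False b) xs x y = alt (\<lambda>ys. diffc (w True b) (w False b) ys x y) xs"
      unfolding diffc_def w'_def rs_in[OF sub_in[OF xy E_sub(5)]] dE_def alt_diff ..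
    also have "\<dots> = alt (\<lambda>ys. u'' b ys x y) xs" by (rule alt_eqon[OF w(2) xs xy, symmetric])
    also have "\<dots> = alt (\<lambda>ys. diffc (u' b) (s b) ys x y) xs" unfolding u''_def by (rule alt_rs[OF xs xy])
    also have "\<dots> = u b xs x y" unfolding diffc_def alt_diff boundsD[OF u'(2) xs xy] ZZ_closed[OF ts(2) xs xy] by simp
    finally show "u b xs x y = diffc (w' True b) (w' False b) xs x y" by simp
  qed
  moreover have "eqon (Ev a) (Suc k) (v a) (diffc (w' a True) (w' a False))" for a
  proof (rule eqonI)
    fix xs x y assume xs: "xs \<in> simplices W (Suc k)" and xy: "(pt x, pt y) \<in> \<Inter>(set xs) \<inter> Ev a"
    have "diffc (w' a True) (w' a False) xs x y = alt (\<lambda>ys. diffc (w a True) (w a False) ys x y) xs"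
      unfolding diffc_def w'_def rs_in[OF sub_in[OF xy E_sub(4)]] dE_def alt_diff ..
    also have "\<dots> = alt (\<lambda>ys. v'' a ys x y) xs" by (rule alt_eqon[OF w(3) xs xy, symmetric])
    also have "\<dots> = alt (\<lambda>ys. diffc (v' a) (t a) ys x y) xs" unfolding v''_def by (rule alt_rs[OF xs xy])
    also have "\<dots> = v a xs x y" unfolding diffc_def alt_diff boundsD[OF v'(2) xs xy] ZZ_closed[OF ts(1) xs xy] by simp
    finally show "v a xs x y = diffc (w' a True) (w' a False) xs x y" by simp
  qed
  ultimately show ?thesis unfolding Suc by blast
qed

text \<open>A double complex argument for the complex of the four sets \<open>Ew a b\<close> and the cochains of \<open>W\<close>.\<close>

theorem equivariant_vanishing:
  assumes noW: "no_weight \<zeta> i j \<theta>" and c: "c \<in> ZZ T (Suc k)"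
  shows "\<exists>b\<in>cch i j W T k. bounds W T (Suc k) b c"
proof -
  have "\<exists>B. B \<in> CC (Ew a b) k \<and> bounds W (Ew a b) (Suc k) B c" for a b
  proof -
    have "rs (Ew a b) c \<in> ZZ (Ew a b) (Suc k)" by (rule ZZ_restr[OF c okE_EE E_sub(6)])
    hence "\<exists>B\<in>CC (Ew a b) k. bounds W (Ew a b) (Suc k) B (rs (Ew a b) c)" by (intro row_exact_eqv) auto
    then obtain B where B: "B \<in> CC (Ew a b) k" "bounds W (Ew a b) (Suc k) B (rs (Ew a b) c)" by blast
    from B(2) have "bounds W (Ew a b) (Suc k) B c" unfolding bounds_def using rs_in[of _ _ _ "Ew a b" c] by metis
    with B(1) show ?thesis by blast
  qed
  then obtain B where B: "\<And>a b. B a b \<in> CC (Ew a b) k" "\<And>a b. bounds W (Ew a b) (Suc k) (B a b) c" by metis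
  \<comment> \<open>Differences of local primitives of the same cocycle c; they are closed, and
    compatible on \<open>E4\<close> because both double differences involve the same four
    primitives.\<close>
  define u where "u b = rs (Eu b) (diffc (B True b) (B False b))" for b
  define v where "v a = rs (Ev a) (diffc (B a True) (B a False))" for a
  have u: "u b \<in> ZZ (Eu b) k" for b
  proof -
    have "u b \<in> CC (Eu b) k" unfolding u_def by (rule rs_diff_CC[OF B(1) B(1) okE_EE E_sub(5) E_sub(5)])
    moreover have "closedc W (Eu b) k (u b)" unfolding u_def closedc_rs unfolding closedc_def diffc_def
    proof (intro ballI allI impI)
      fix xs x y assume xs: "xs \<in> simplices W (Suc k)" and xy: "(pt x, pt y) \<in> \<Inter>(set xs) \<inter> Eu b"
      show "alt (\<lambda>ys. B True b ys x y - B False b ys x y) xs = 0"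
        unfolding alt_diff boundsD[OF B(2) xs sub_in[OF xy E_sub(5)], symmetric] by simp
    qed
    ultimately show ?thesis by (simp add: ZZ_def)
  qed
  have v: "v a \<in> ZZ (Ev a) k" for a
  proof -
    have "v a \<in> CC (Ev a) k" unfolding v_def by (rule rs_diff_CC[OF B(1) B(1) okE_EE E_sub(4) E_sub(4)])
    moreover have "closedc W (Ev a) k (v a)" unfolding v_def closedc_rs unfolding closedc_def diffc_def
    proof (intro ballI allI impI)
      fix xs x y assume xs: "xs \<in> simplices W (Suc k)" and xy: "(pt x, pt y) \<in> \<Inter>(set xs) \<inter> Ev a"
      show "alt (\<lambda>ys. B a True ys x y - B a False ys x y) xs = 0"
        unfolding alt_diff boundsD[OF B(2) xs sub_in[OF xy E_sub(4)], symmetric] by simp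
    qed
    ultimately show ?thesis by (simp add: ZZ_def)
  qed
  have "eqon E4 k (diffc (u True) (u False)) (diffc (v True) (v False))"
  proof (rule eqonI)
    fix xs x y assume xs: "xs \<in> simplices W k" and xy: "(pt x, pt y) \<in> \<Inter>(set xs) \<inter> E4"
    show "diffc (u True) (u False) xs x y = diffc (v True) (v False) xs x y"
      unfolding diffc_def u_def v_def rs_in[OF sub_in[OF xy E_sub(1)]] rs_in[OF sub_in[OF xy E_sub(2)]] by simp
  qed
  from claim_H1[OF noW u v this] obtain w where w: "\<And>a b. w a b \<in> ZZ (Ew a b) k"
    "\<And>b. eqon (Eu b) k (u b) (diffc (w True b) (w False b))"
    "\<And>a. eqon (Ev a) k (v a) (diffc (w a True) (w a False))" by blast
  \<comment> \<open>Subtracting the closed w leaves primitives of c that agree on the overlaps of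
    the four sets.\<close>
  define C where "C a b = rs (Ew a b) (diffc (B a b) (w a b))" for a b
  have C: "C a b \<in> CC (Ew a b) k" for a b
    unfolding C_def by (rule rs_diff_CC[OF B(1) ZZ_CC[OF w(1)] okE_EE order_refl order_refl])
  have C_in: "C a b xs x y = B a b xs x y - w a b xs x y" if "(pt x, pt y) \<in> \<Inter>(set xs) \<inter> Ew a b" for a b xs x y
    unfolding C_def rs_in[OF that] diffc_def ..
  have Cu: "C True b xs x y = C False b xs x y" if xs: "xs \<in> simplices W k" and xy: "(pt x, pt y) \<in> \<Inter>(set xs) \<inter> Eu b" for b xs x y
    using eqonD[OF w(2) xs xy] unfolding u_def rs_in[OF xy] C_in[OF sub_in[OF xy E_sub(5)]] diffc_def by algebra
  have Cv: "C a True xs x y = C a False xs x y" if xs: "xs \<in> simplices W k" and xy: "(pt x, pt y) \<in> \<Inter>(set xs) \<inter> Ev a" for a xs x y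
    using eqonD[OF w(3) xs xy] unfolding v_def rs_in[OF xy] C_in[OF sub_in[OF xy E_sub(4)]] diffc_def by algebra
  \<comment> \<open>The primitives are glued pointwise: at each point the chart is selected by
    whether the first coordinates vanish.\<close>
  define R where "R xs = restr (\<Inter>(set xs)) (\<lambda>x y. C (x$1 \<noteq> 0) (y$1 \<noteq> 0) xs x y)" for xs
  have R_eq: "R xs x y = C a b xs x y" if xs: "xs \<in> simplices W k" and xy: "(pt x, pt y) \<in> \<Inter>(set xs) \<inter> Ew a b" for a b xs x y
  proof -
    have c: "x \<in> fcone" "y \<in> fcone" "a \<Longrightarrow> x$1 \<noteq> 0" "\<not> a \<Longrightarrow> x$2 \<noteq> 0" "b \<Longrightarrow> y$1 \<noteq> 0" "\<not> b \<Longrightarrow> y$2 \<noteq> 0"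
      using xy unfolding Int_iff in_EE by blast+
    have X: "(pt x, pt y) \<in> \<Inter>(set xs)" using xy by blast
    have "C (x$1 \<noteq> 0) b' xs x y = C a b' xs x y" if b': "b' \<longrightarrow> y$1 \<noteq> 0" "\<not> b' \<longrightarrow> y$2 \<noteq> 0" for b'
    proof (cases "a = (x$1 \<noteq> 0)")
      case False
      hence "x$1 \<noteq> 0" "x$2 \<noteq> 0" "\<not> a" using c by auto
      hence "(pt x, pt y) \<in> \<Inter>(set xs) \<inter> Eu b'" using X c(1,2) b' unfolding Int_iff in_EE by blast
      from Cu[OF xs this] show ?thesis using False \<open>\<not> a\<close> by simp
    qed simp
    moreover have "C a (y$1 \<noteq> 0) xs x y = C a b xs x y"
    proof (cases "b = (y$1 \<noteq> 0)")
      case False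
      hence "y$1 \<noteq> 0" "y$2 \<noteq> 0" "\<not> b" using c by auto
      hence "(pt x, pt y) \<in> \<Inter>(set xs) \<inter> Ev a" using X c(1-4) unfolding Int_iff in_EE by blast
      from Cv[OF xs this] show ?thesis using False \<open>\<not> b\<close> by simp
    qed simp
    moreover have "y$1 \<noteq> 0 \<or> y$2 \<noteq> 0" using fcone_coord c by blast
    ultimately show ?thesis using X by (simp add: R_def)
  qed
  have cover4: "\<exists>a b. (pt x, pt y) \<in> Ew a b" if "(pt x, pt y) \<in> T" for x y
  proof -
    have "x \<in> fcone" "y \<in> fcone" using that by (auto simp: in_T)
    hence "(pt x, pt y) \<in> Ew (x$1 \<noteq> 0) (y$1 \<noteq> 0)" unfolding in_EE using fcone_coord by blast
    thus ?thesis by blast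
  qed
  have "R \<in> cch i j W T k" unfolding cch_def
  proof (intro CollectI ballI)
    fix xs assume xs: "xs \<in> simplices W k"
    have op: "zopen (\<Inter>(set xs))" by (rule simplices_open[OF W_open xs])
    show "R xs \<in> O_sect i j (\<Inter>(set xs) \<inter> T)"
    proof (rule O_sect_local)
      fix v w assume "(pt v, pt w) \<notin> \<Inter>(set xs) \<inter> T"
      hence "(pt v, pt w) \<notin> \<Inter>(set xs)" using zopen_subset_T[OF op] by blast
      thus "R xs v w = 0" by (simp add: R_def)
    next
      fix p assume p: "p \<in> \<Inter>(set xs) \<inter> T"
      then obtain x y where xy: "p = (pt x, pt y)" using T_cases by (metis IntD2)
      obtain a b where ab: "(pt x, pt y) \<in> Ew a b" using cover4 p xy by blast
      show "\<exists>V s'. p \<in> V \<and> V \<subseteq> \<Inter>(set xs) \<inter> T \<and> s' \<in> O_sect i j V \<and>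
          (\<forall>v w. (pt v, pt w) \<in> V \<longrightarrow> R xs v w = s' v w)"
        using CC_sect[OF C xs, of a b] R_eq[OF xs, of _ _ a b] ab p EE_subset_T unfolding xy
        by (intro exI[of _ "\<Inter>(set xs) \<inter> Ew a b"] exI[of _ "C a b xs"]) blast
    qed
  qed
  moreover have "bounds W T (Suc k) R c" unfolding bounds_def
  proof (intro ballI allI impI)
    fix xs x y assume xs: "xs \<in> simplices W (Suc k)" and xy: "(pt x, pt y) \<in> \<Inter>(set xs) \<inter> T"
    obtain a b where "(pt x, pt y) \<in> Ew a b" using cover4 xy by blast
    hence xy': "(pt x, pt y) \<in> \<Inter>(set xs) \<inter> Ew a b" using xy by blast
    have "alt (\<lambda>ys. R ys x y) xs = alt (\<lambda>ys. B a b ys x y - w a b ys x y) xs"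
    proof (rule alt_cong)
      fix ys assume ys: "Suc (length ys) = length xs" "set ys \<subseteq> set xs"
      note f = face_in[OF xs xy' ys]
      show "R ys x y = B a b ys x y - w a b ys x y" unfolding R_eq[OF f] C_in[OF f(2)] ..
    qed
    also have "\<dots> = c xs x y"
      unfolding alt_diff boundsD[OF B(2) xs xy', symmetric] ZZ_closed[OF w(1) xs xy'] by simp
    finally show "c xs x y = alt (\<lambda>ys. R ys x y) xs" by simp
  qed
  ultimately show ?thesis by blast
qed

lemma equivariant_vanishing_0:
  assumes noW: "no_weight \<zeta> i j \<theta>" and c: "c \<in> ZZ T 0" and xs: "xs \<in> simplices W 0"
  shows "c xs = (\<lambda>v w. 0)"
proof -
  obtain s where s: "s \<in> OE T" "\<And>U v w. U \<in> W \<Longrightarrow> (pt v, pt w) \<in> U \<inter> T \<Longrightarrow> c [U] v w = s v w"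
    by (rule ZZ0_section[OF okE_T c]) (rule that; blast)
  have s0: "s = (\<lambda>v w. 0)" by (rule K_H0[OF noW s(1)])
  obtain U where U: "U \<in> W" "xs = [U]" using simplex0[OF xs] by blast
  have "c xs v w = 0" for v w
  proof (cases "(pt v, pt w) \<in> \<Inter>(set xs) \<inter> T")
    case True
    thus ?thesis using s(2)[OF U(1)] U s0 by simp
  next
    case False
    thus ?thesis by (rule O_sect_outside[OF CC_sect[OF ZZ_CC[OF c] xs]])
  qed
  thus ?thesis by auto
qed

end

subsection \<open>Refinements\<close>

text \<open>Compactness from \<open>power_combination\<close>: on each of the four affine sets a
  power of its equation is a combination of finitely many equations of the cover, and these cannot
  all vanish there.\<close>

lemma finite_subcover:
  assumes F: "\<And>U. U \<in> F \<Longrightarrow> \<exists>f a b. f \<in> bihom a b \<and> U = D f" and cov: "T \<subseteq> \<Union>F"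
  shows "\<exists>G. finite G \<and> G \<subseteq> F \<and> T \<subseteq> \<Union>G"
proof -
  define fs where "fs = {f. (\<exists>a b. f \<in> bihom a b) \<and> D f \<in> F}"
  have "\<forall>f. \<exists>a b. f \<in> fs \<longrightarrow> f \<in> bihom a b" by (auto simp: fs_def)
  then obtain dm dn where d: "\<And>f. f \<in> fs \<Longrightarrow> f \<in> bihom (dm f) (dn f)" unfolding choice_iff by blast
  have c: "\<exists>f\<in>fs. f v w \<noteq> 0" if vw: "v \<in> fcone" "w \<in> fcone" for v w
  proof -
    obtain U where U: "U \<in> F" "(pt v, pt w) \<in> U" using cov vw in_T by blast
    obtain f a b where f: "f \<in> bihom a b" "U = D f" using F[OF U(1)] by blast
    hence "f v w \<noteq> 0" using U(2) by (simp add: in_D)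
    moreover have "f \<in> fs" using f U(1) by (auto simp: fs_def)
    ultimately show ?thesis by blast
  qed
  have "\<exists>G. finite G \<and> G \<subseteq> fs \<and> (\<forall>v\<in>fcone. \<forall>w\<in>fcone. ee a (\<not> a) b (\<not> b) v w \<noteq> 0 \<longrightarrow> (\<exists>h\<in>G. h v w \<noteq> 0))" for a b
  proof -
    have pos: "0 < (of_bool a + of_bool (\<not> a) :: nat)" "0 < (of_bool b + of_bool (\<not> b) :: nat)" by auto
    show ?thesis
    proof (rule power_combination[of fs dm dn, OF d ee_bihom pos c], goal_cases)
      case (4 N G g)
      have "\<exists>h\<in>G. h v w \<noteq> 0" if "v \<in> fcone" "w \<in> fcone" "ee a (\<not> a) b (\<not> b) v w \<noteq> 0" for v w
      proof (rule ccontr)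
        assume "\<not> ?thesis"
        hence "(\<Sum>h\<in>G. g h v w * h v w) = 0" by (intro sum.neutral) auto
        hence "ee a (\<not> a) b (\<not> b) v w ^ N = 0" using 4(4)[OF that(1,2)] by simp
        with that(3) show False by simp
      qed
      with 4(1,2) show ?case by blast
    qed auto
  qed
  then obtain G where G: "\<And>a b. finite (G a b)" "\<And>a b. G a b \<subseteq> fs"
    "\<And>a b v w. v \<in> fcone \<Longrightarrow> w \<in> fcone \<Longrightarrow> ee a (\<not> a) b (\<not> b) v w \<noteq> 0 \<Longrightarrow> \<exists>h\<in>G a b. h v w \<noteq> 0" by metis
  define H where "H = D ` (\<Union>a. \<Union>b. G a b)"
  have "finite H" using G(1) by (simp add: H_def)
  moreover have "H \<subseteq> F" using G(2) by (auto simp: H_def fs_def)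
  moreover have "T \<subseteq> \<Union>H"
  proof
    fix x assume "x \<in> T"
    then obtain v w where vw: "x = (pt v, pt w)" "v \<in> fcone" "w \<in> fcone" by (rule T_cases)
    have "ee (v$1 \<noteq> 0) (\<not> (v$1 \<noteq> 0)) (w$1 \<noteq> 0) (\<not> (w$1 \<noteq> 0)) v w \<noteq> 0"
      using fcone_coord[OF vw(2)] fcone_coord[OF vw(3)] by (auto simp: ee_def)
    then obtain h where h: "h \<in> G (v$1 \<noteq> 0) (w$1 \<noteq> 0)" "h v w \<noteq> 0" using G(3)[OF vw(2,3)] by blast
    hence "x \<in> D h" using vw by (auto simp: D_def)
    thus "x \<in> \<Union>H" using h(1) by (auto simp: H_def)
  qed
  ultimately show ?thesis by blast
qed

text \<open>Consider the principal sets inside one of the four sets for which every translate fits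
  into a member of each given cover. This family covers \<open>T\<close> and is stable under the
  group. A finite subcover can therefore be closed up under the finite group without leaving the
  family.\<close>

lemma invariant_refinement:
  assumes z: "primitive_root5 \<zeta>" and C: "finite C" "\<And>V. V \<in> C \<Longrightarrow> open_cover V"
  obtains W where "affine_cover W" "\<And>U g. U \<in> W \<Longrightarrow> actT \<zeta> g ` U \<in> W"
    "\<And>U. U \<in> W \<Longrightarrow> \<exists>a b. U \<subseteq> EE a (\<not> a) b (\<not> b)" "\<And>U V. U \<in> W \<Longrightarrow> V \<in> C \<Longrightarrow> \<exists>Y\<in>V. U \<subseteq> Y"
proof -
  define F where "F = {U. (\<exists>f a b. f \<in> bihom a b \<and> a > 0 \<and> b > 0 \<and> U = D f) \<and> (\<exists>a b. U \<subseteq> EE a (\<not> a) b (\<not> b)) \<and>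
     (\<forall>V\<in>C. \<forall>g. \<exists>Y\<in>V. actT \<zeta> g ` U \<subseteq> Y)}"
  have act_act: "actT \<zeta> g ` actT \<zeta> h ` U = actT \<zeta> (g + h) ` U" for g h U
    by (simp add: image_image actT_add[OF z])
  have F_inv: "actT \<zeta> h ` U \<in> F" if U: "U \<in> F" for U h
  proof -
    obtain f a b where f: "f \<in> bihom a b" "a > 0" "b > 0" "U = D f" using U by (auto simp: F_def)
    obtain c d where "U \<subseteq> EE c (\<not> c) d (\<not> d)" using U unfolding F_def by blast
    hence "actT \<zeta> h ` U \<subseteq> actT \<zeta> h ` EE c (\<not> c) d (\<not> d)" by (rule image_mono)
    hence "actT \<zeta> h ` U \<subseteq> EE c (\<not> c) d (\<not> d)" by (simp only: EE_act[OF z])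
    moreover have "\<exists>f a b. f \<in> bihom a b \<and> a > 0 \<and> b > 0 \<and> actT \<zeta> h ` U = D f"
      using D_act[OF z f(1), of h] bihom_act[OF f(1), of \<zeta> "- h"] f(2-4) by blast
    moreover have "\<forall>V\<in>C. \<forall>g. \<exists>Y\<in>V. actT \<zeta> g ` actT \<zeta> h ` U \<subseteq> Y"
      unfolding act_act using U unfolding F_def by blast
    ultimately show ?thesis unfolding F_def by blast
  qed
  have "T \<subseteq> \<Union>F"
  proof
    fix x assume x: "x \<in> T"
    then obtain v w where vw: "x = (pt v, pt w)" "v \<in> fcone" "w \<in> fcone" by (rule T_cases)
    let ?E = "EE (v$1 \<noteq> 0) (\<not> (v$1 \<noteq> 0)) (w$1 \<noteq> 0) (\<not> (w$1 \<noteq> 0))"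
    have xE: "x \<in> ?E" unfolding vw in_EE using vw fcone_coord by blast
    have "\<exists>Y. Y \<in> V \<and> actT \<zeta> g x \<in> Y" if V: "V \<in> C" for V g
    proof -
      have "actT \<zeta> g x \<in> T" using vw by (simp add: in_T act1_cone[OF z] act2_cone[OF z])
      thus ?thesis using C(2)[OF V] unfolding open_cover_def by blast
    qed
    then obtain Y where Y: "\<And>V g. V \<in> C \<Longrightarrow> Y V g \<in> V \<and> actT \<zeta> g x \<in> Y V g" by metis
    \<comment> \<open>A neighbourhood of x every translate of which fits into the members found; it
      is open because the group and the set of covers are finite.\<close>
    define N where "N = \<Inter>(insert ?E ((\<lambda>(V, g). actT \<zeta> (- g) ` Y V g) ` (C \<times> UNIV)))"
    have "zopen N" unfolding N_def
    proof (rule zopen_Inter)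
      show "finite (insert ?E ((\<lambda>(V, g). actT \<zeta> (- g) ` Y V g) ` (C \<times> UNIV)))" using C(1) by simp
      fix U assume "U \<in> insert ?E ((\<lambda>(V, g). actT \<zeta> (- g) ` Y V g) ` (C \<times> UNIV))"
      then consider "U = ?E" | V g where "V \<in> C" "U = actT \<zeta> (- g) ` Y V g" by auto
      thus "zopen U"
      proof cases
        case 1
        show ?thesis unfolding 1 by (rule EE_open)
      next
        case 2
        have "zopen (Y V g)" using Y[OF 2(1), of g] C(2)[OF 2(1)] by (auto simp: open_cover_def)
        thus ?thesis unfolding 2(2) by (rule zopen_act[OF z])
      qed
    qed simp
    moreover have "x \<in> N"
    proof -
      have "x \<in> actT \<zeta> (- g) ` Y V g" if "V \<in> C" for V g
        using Y[OF that, of g] by (simp add: in_actT_image[OF z])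
      thus ?thesis using xE by (auto simp: N_def)
    qed
    ultimately obtain f m n where f: "f \<in> bihom m n" "x \<in> D f" "D f \<subseteq> N" by (rule zopen_nbhd)
    let ?e = "ee (v$1 \<noteq> 0) (\<not> (v$1 \<noteq> 0)) (w$1 \<noteq> 0) (\<not> (w$1 \<noteq> 0))"
    let ?U = "D (\<lambda>v w. f v w * ?e v w)"
    have U: "?U = D f \<inter> ?E" unfolding EE_def by (rule D_mult[OF f(1) ee_bihom])
    have "?U \<in> F" unfolding F_def mem_Collect_eq
    proof (intro conjI ballI allI)
      show "\<exists>f a b. f \<in> bihom a b \<and> a > 0 \<and> b > 0 \<and> ?U = D f"
        using bihom_mult[OF f(1) ee_bihom[of "v$1 \<noteq> 0" "\<not> (v$1 \<noteq> 0)" "w$1 \<noteq> 0" "\<not> (w$1 \<noteq> 0)"]]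
        by (intro exI conjI) (assumption, auto)
      show "\<exists>a b. ?U \<subseteq> EE a (\<not> a) b (\<not> b)" unfolding U by blast
      fix V g assume V: "V \<in> C"
      have "?U \<subseteq> actT \<zeta> (- g) ` Y V g" using f(3) V unfolding U N_def by blast
      hence "actT \<zeta> g ` ?U \<subseteq> actT \<zeta> g ` actT \<zeta> (- g) ` Y V g" by (rule image_mono)
      hence "actT \<zeta> g ` ?U \<subseteq> Y V g" by (simp only: act_act) simp
      thus "\<exists>Y\<in>V. actT \<zeta> g ` ?U \<subseteq> Y" using Y[OF V] by blast
    qed
    moreover have "x \<in> ?U" unfolding U using f(2) xE by blast
    ultimately show "x \<in> \<Union>F" by blast
  qed
  moreover have "\<And>U. U \<in> F \<Longrightarrow> \<exists>f a b. f \<in> bihom a b \<and> U = D f" by (auto simp: F_def)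
  ultimately obtain G where G: "finite G" "G \<subseteq> F" "T \<subseteq> \<Union>G" using finite_subcover[of F] by blast
  \<comment> \<open>All translates of the finite subcover.\<close>
  define W where "W = (\<lambda>(g, U). actT \<zeta> g ` U) ` (UNIV \<times> G)"
  have WF: "W \<subseteq> F" using G(2) F_inv by (auto simp: W_def)
  show ?thesis
  proof (rule that[of W])
    show "affine_cover W"
    proof
      show "finite W" using G(1) by (simp add: W_def)
      have "U \<in> W" if "U \<in> G" for U unfolding W_def using that by (auto intro!: image_eqI[of _ _ "(0, U)"])
      moreover have "U \<subseteq> T" if UW: "U \<in> W" for U
      proof -
        obtain f where "U = D f" using WF UW unfolding F_def by blast
        thus ?thesis using D_subset_T by simp
      qed
      ultimately show "\<Union>W = T" using G(3) by blast
      show "\<exists>f a b. f \<in> bihom a b \<and> a > 0 \<and> b > 0 \<and> U = D f" if "U \<in> W" for U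
        using WF that unfolding F_def by blast
    qed
    show "actT \<zeta> g ` U \<in> W" if U: "U \<in> W" for U g
    proof -
      obtain h U' where "U' \<in> G" "U = actT \<zeta> h ` U'" using U by (auto simp: W_def)
      thus ?thesis unfolding W_def by (auto simp only: act_act intro!: image_eqI[of _ _ "(g + h, U')"])
    qed
    show "\<exists>a b. U \<subseteq> EE a (\<not> a) b (\<not> b)" if "U \<in> W" for U using WF that unfolding F_def by blast
    show "\<exists>Y\<in>V. U \<subseteq> Y" if "U \<in> W" "V \<in> C" for U V
    proof -
      have "\<exists>Y\<in>V. actT \<zeta> 0 ` U \<subseteq> Y" using WF that unfolding F_def by blast
      thus ?thesis by simp
    qed
  qed
qed

section \<open>Cech classes of the line bundles under refinement and pullback\<close>

lemma sect_K: "sect (K \<zeta> i j) = O_sect i j"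
  by (simp add: K_def twist_def O_bundle_def)

definition twist_chr :: "complex \<Rightarrow> int \<Rightarrow> int \<Rightarrow> grp \<Rightarrow> complex" where
  "twist_chr \<zeta> i j = chr \<zeta> (of_int (3*i + 3*j), of_int (3*i + 2*j))"

lemma pull_K: "pull (K \<zeta> i j) g s v w = twist_chr \<zeta> i j g * s (act1 \<zeta> g v) (act2 \<zeta> g w)"
  by (simp add: K_def twist_def O_bundle_def twist_chr_def)

locale line_bundle =
  fixes \<zeta> :: complex and i j :: int
  assumes prim: "primitive_root5 \<zeta>"
begin

abbreviation "L \<equiv> K \<zeta> i j"

lemma cochainsD: "c \<in> cochains L U k \<Longrightarrow> xs \<in> simplices U k \<Longrightarrow> c xs \<in> O_sect i j (\<Inter>(set xs))"
  by (simp add: cochains_def sect_K)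

lemma cochainsI: "(\<And>xs. xs \<in> simplices U k \<Longrightarrow> c xs \<in> O_sect i j (\<Inter>(set xs))) \<Longrightarrow> c \<in> cochains L U k"
  by (simp add: cochains_def sect_K)

lemma simplex_open: "open_cover U \<Longrightarrow> xs \<in> simplices U k \<Longrightarrow> zopen (\<Inter>(set xs))"
  by (rule simplices_open) (auto simp: open_cover_def)

lemma simplex_T: "open_cover U \<Longrightarrow> xs \<in> simplices U k \<Longrightarrow> \<Inter>(set xs) \<inter> T = \<Inter>(set xs)"
  using zopen_subset_T[OF simplex_open] by blast

lemma cochains_cch: "open_cover U \<Longrightarrow> cochains L U k = cch i j U T k"
  by (auto simp: cochains_def cch_def sect_K simplex_T)

lemma cocycle_iff: "open_cover U \<Longrightarrow> c \<in> cocycles L U k \<longleftrightarrow> c \<in> cch i j U T k \<and> closedc U T k c"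
proof -
  assume U: "open_cover U"
  have "delta c xs = (\<lambda>v w. 0) \<longleftrightarrow> (\<forall>v w. (pt v, pt w) \<in> \<Inter>(set xs) \<inter> T \<longrightarrow> alt (\<lambda>ys. c ys v w) xs = 0)"
    if "xs \<in> simplices U (Suc k)" for xs
    unfolding delta_alt simplex_T[OF U that] fun_eq_iff restr_def by auto
  thus ?thesis unfolding cocycles_def closedc_def mem_Collect_eq cochains_cch[OF U] by blast
qed

lemma cocycle_alt: "c \<in> cocycles L U k \<Longrightarrow> xs \<in> simplices U (Suc k) \<Longrightarrow> (pt v, pt w) \<in> \<Inter>(set xs) \<Longrightarrow>
    alt (\<lambda>ys. c ys v w) xs = 0"
proof -
  assume c: "c \<in> cocycles L U k" "xs \<in> simplices U (Suc k)" and vw: "(pt v, pt w) \<in> \<Inter>(set xs)"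
  have "delta c xs v w = 0" using c by (simp add: cocycles_def)
  thus ?thesis unfolding delta_alt restr_in[OF vw] .
qed

lemma coboundaries_0: "c \<in> coboundaries L W 0 \<longleftrightarrow> (\<forall>xs\<in>simplices W 0. c xs = (\<lambda>v w. 0))"
  by (simp add: coboundaries_def)

lemma coboundaries_Suc: "c \<in> coboundaries L W (Suc k) \<longleftrightarrow> (\<exists>b\<in>cochains L W k. \<forall>xs\<in>simplices W (Suc k). c xs = delta b xs)"
  by (simp add: coboundaries_def)

lemma coboundary_cong:
  "c \<in> coboundaries L W k \<Longrightarrow> (\<And>xs. xs \<in> simplices W k \<Longrightarrow> d xs = c xs) \<Longrightarrow> d \<in> coboundaries L W k"
  by (cases k) (auto simp: coboundaries_0 coboundaries_Suc)

lemma coboundary_zero: "open_cover W \<Longrightarrow> (\<lambda>xs v w. 0) \<in> coboundaries L W k"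
  by (cases k) (auto simp: coboundaries_0 coboundaries_Suc delta_alt
    intro!: bexI[of _ "\<lambda>xs v w. 0"] cochainsI O_sect_zero simplex_open)

lemma coboundary_add:
  assumes "c \<in> coboundaries L W k" "d \<in> coboundaries L W k"
  shows "(\<lambda>xs v w. c xs v w + d xs v w) \<in> coboundaries L W k"
proof (cases k)
  case 0
  thus ?thesis using assms by (simp add: coboundaries_0)
next
  case (Suc m)
  obtain a b where ab: "a \<in> cochains L W m" "b \<in> cochains L W m"
    "\<And>xs. xs \<in> simplices W (Suc m) \<Longrightarrow> c xs = delta a xs" "\<And>xs. xs \<in> simplices W (Suc m) \<Longrightarrow> d xs = delta b xs"
    using assms unfolding Suc coboundaries_Suc by blast
  have "(\<lambda>xs v w. a xs v w + b xs v w) \<in> cochains L W m"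
    by (rule cochainsI) (intro O_sect_add cochainsD[OF ab(1)] cochainsD[OF ab(2)])
  moreover have "(\<lambda>v w. c xs v w + d xs v w) = delta (\<lambda>xs v w. a xs v w + b xs v w) xs" if "xs \<in> simplices W (Suc m)" for xs
    unfolding ab(3)[OF that] ab(4)[OF that] delta_alt alt_add by (auto simp: restr_def fun_eq_iff)
  ultimately show ?thesis unfolding Suc coboundaries_Suc by blast
qed

lemma coboundary_cmult:
  assumes "c \<in> coboundaries L W k"
  shows "(\<lambda>xs v w. a * c xs v w) \<in> coboundaries L W k"
proof (cases k)
  case 0
  thus ?thesis using assms by (simp add: coboundaries_0)
next
  case (Suc m)
  obtain b where b: "b \<in> cochains L W m" "\<And>xs. xs \<in> simplices W (Suc m) \<Longrightarrow> c xs = delta b xs"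
    using assms unfolding Suc coboundaries_Suc by blast
  have "(\<lambda>xs v w. a * b xs v w) \<in> cochains L W m"
    by (rule cochainsI) (intro O_sect_cmult cochainsD[OF b(1)])
  moreover have "(\<lambda>v w. a * c xs v w) = delta (\<lambda>xs v w. a * b xs v w) xs" if "xs \<in> simplices W (Suc m)" for xs
    unfolding b(2)[OF that] delta_alt alt_cmult by (auto simp: restr_def fun_eq_iff)
  ultimately show ?thesis unfolding Suc coboundaries_Suc by blast
qed

lemma coboundary_sum:
  "open_cover W \<Longrightarrow> (\<And>x. x \<in> X \<Longrightarrow> c x \<in> coboundaries L W k) \<Longrightarrow> (\<lambda>xs v w. \<Sum>x\<in>X. c x xs v w) \<in> coboundaries L W k"
  by (induction X rule: infinite_finite_induct) (auto intro: coboundary_zero coboundary_add)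

lemma refine_Inter: "refinement W U \<tau> \<Longrightarrow> xs \<in> simplices W k \<Longrightarrow> \<Inter>(set xs) \<subseteq> \<Inter>(set (map \<tau> xs))"
  unfolding refinement_def simplices_def by fastforce

lemma refine_simplex: "refinement W U \<tau> \<Longrightarrow> xs \<in> simplices W k \<Longrightarrow> map \<tau> xs \<in> simplices U k"
  unfolding refinement_def simplices_def by auto

lemma refine_at: "(pt v, pt w) \<in> \<Inter>(set xs) \<Longrightarrow> refine \<tau> c xs v w = c (map \<tau> xs) v w"
  by (simp add: refine_def)

lemma refine_cochain:
  assumes "c \<in> cochains L U k" "open_cover W" "refinement W U \<tau>"
  shows "refine \<tau> c \<in> cochains L W k"
  by (rule cochainsI, unfold refine_def)
     (rule O_sect_restrict[OF cochainsD[OF assms(1) refine_simplex[OF assms(3)]] simplex_open[OF assms(2)] refine_Inter[OF assms(3)]])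

lemma alt_refine:
  assumes "(pt v, pt w) \<in> \<Inter>(set xs)"
  shows "alt (\<lambda>ys. refine \<tau> c ys v w) xs = alt (\<lambda>ys. c ys v w) (map \<tau> xs)"
proof -
  have "alt (\<lambda>ys. refine \<tau> c ys v w) xs = alt (\<lambda>ys. c (map \<tau> ys) v w) xs"
    by (rule alt_cong, rule refine_at) (use assms in auto)
  also have "\<dots> = alt (\<lambda>ys. c ys v w) (map \<tau> xs)" by (rule alt_map)
  finally show ?thesis .
qed

lemma refine_cocycle:
  assumes c: "c \<in> cocycles L U k" and W: "open_cover W" "refinement W U \<tau>"
  shows "refine \<tau> c \<in> cocycles L W k"
proof -
  have "refine \<tau> c \<in> cochains L W k" by (rule refine_cochain[OF _ W]) (use c in \<open>simp add: cocycles_def\<close>)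
  moreover have "delta (refine \<tau> c) xs = (\<lambda>v w. 0)" if xs: "xs \<in> simplices W (Suc k)" for xs
  proof (intro ext)
    fix v w
    show "delta (refine \<tau> c) xs v w = 0"
    proof (cases "(pt v, pt w) \<in> \<Inter>(set xs)")
      case True
      hence "(pt v, pt w) \<in> \<Inter>(set (map \<tau> xs))" using refine_Inter[OF W(2) xs] by blast
      thus ?thesis unfolding delta_alt restr_in[OF True] alt_refine[OF True]
        by (rule cocycle_alt[OF c refine_simplex[OF W(2) xs]])
    qed (simp add: delta_alt)
  qed
  ultimately show ?thesis by (simp add: cocycles_def)
qed

lemma refine_coboundary:
  assumes c: "c \<in> coboundaries L U k" and W: "open_cover W" "refinement W U \<tau>"
  shows "refine \<tau> c \<in> coboundaries L W k"
proof (cases k)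
  case 0
  have "refine \<tau> c xs = (\<lambda>v w. 0)" if "xs \<in> simplices W 0" for xs
    using c refine_simplex[OF W(2) that] unfolding 0 coboundaries_0 refine_def by simp
  thus ?thesis by (simp add: 0 coboundaries_0)
next
  case (Suc m)
  obtain b where b: "b \<in> cochains L U m" "\<And>xs. xs \<in> simplices U (Suc m) \<Longrightarrow> c xs = delta b xs"
    using c unfolding Suc coboundaries_Suc by blast
  have "refine \<tau> c xs = delta (refine \<tau> b) xs" if xs: "xs \<in> simplices W (Suc m)" for xs
  proof (intro ext)
    fix v w
    show "refine \<tau> c xs v w = delta (refine \<tau> b) xs v w"
    proof (cases "(pt v, pt w) \<in> \<Inter>(set xs)")
      case True
      hence T': "(pt v, pt w) \<in> \<Inter>(set (map \<tau> xs))" using refine_Inter[OF W(2) xs] by blast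
      show ?thesis unfolding delta_alt restr_in[OF True] alt_refine[OF True] refine_at[OF True] b(2)[OF refine_simplex[OF W(2) xs]]
        by (rule restr_in[OF T'])
    qed (simp add: delta_alt refine_def)
  qed
  thus ?thesis using refine_cochain[OF b(1) W] unfolding Suc coboundaries_Suc by blast
qed

text \<open>The prism operator applied to c. It is defined because every member in a mixed list
  contains some member of xs, so its intersection contains that of xs; the other half of the
  homotopy formula vanishes by closedness.\<close>

lemma refine_homotopy:
  assumes c: "c \<in> cocycles L U k" and W: "open_cover W" "refinement W U \<sigma>" "refinement W U \<tau>"
  shows "(\<lambda>xs v w. refine \<tau> c xs v w - refine \<sigma> c xs v w) \<in> coboundaries L W k"
proof -
  have cc: "c \<in> cochains L U k" using c by (simp add: cocycles_def)
  have mixed: "ys \<in> simplices U n \<and> \<Inter>(set xs) \<subseteq> \<Inter>(set ys)"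
    if "xs \<in> simplices W m" "length ys = Suc n" "set ys \<subseteq> \<sigma> ` set xs \<union> \<tau> ` set xs" for xs ys m n
  proof
    have xs: "set xs \<subseteq> W" using that by (simp add: simplices_def)
    show "ys \<in> simplices U n" using that(2,3) xs W(2,3) unfolding simplices_def refinement_def by blast
    show "\<Inter>(set xs) \<subseteq> \<Inter>(set ys)" using that(3) xs W(2,3) unfolding refinement_def by blast
  qed
  define h where "h xs = restr (\<Inter>(set xs)) (\<lambda>v w. prism \<sigma> \<tau> (\<lambda>ys. c ys v w) xs)" for xs
  have main: "refine \<tau> c xs v w - refine \<sigma> c xs v w = alt (\<lambda>ys. h ys v w) xs"
    if xs: "xs \<in> simplices W k" and vw: "(pt v, pt w) \<in> \<Inter>(set xs)" for xs v w
  proof -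
    have "alt (\<lambda>ys. h ys v w) xs = alt (prism \<sigma> \<tau> (\<lambda>ys. c ys v w)) xs"
      by (rule alt_cong) (use vw in \<open>auto simp: h_def intro!: restr_in\<close>)
    moreover have "prism \<sigma> \<tau> (alt (\<lambda>ys. c ys v w)) xs = 0"
    proof (rule prism_eq_0)
      fix ys assume ys: "length ys = Suc (length xs)" "set ys \<subseteq> \<sigma> ` set xs \<union> \<tau> ` set xs"
      have "length ys = Suc (Suc k)" using ys(1) xs by (simp add: simplices_def)
      from mixed[OF xs this ys(2)] vw show "alt (\<lambda>ys. c ys v w) ys = 0"
        by (intro cocycle_alt[OF c]) blast+
    qed
    moreover have "alt (prism \<sigma> \<tau> (\<lambda>ys. c ys v w)) xs + prism \<sigma> \<tau> (alt (\<lambda>ys. c ys v w)) xs =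
        c (map \<tau> xs) v w - c (map \<sigma> xs) v w" by (rule prism_homotopy)
    ultimately show ?thesis unfolding refine_at[OF vw] by simp
  qed
  show ?thesis
  proof (cases k)
    case 0
    \<comment> \<open>In degree 0 only the zero cochain is a coboundary; the homotopy is then
      evaluated on the empty list, where the prism is 0.\<close>
    have "refine \<tau> c xs v w - refine \<sigma> c xs v w = 0" if xs: "xs \<in> simplices W 0" for xs v w
    proof (cases "(pt v, pt w) \<in> \<Inter>(set xs)")
      case True
      obtain U where "xs = [U]" using xs by (auto simp: simplices_def length_Suc_conv)
      thus ?thesis using main[unfolded 0, OF xs True] by (simp add: h_def restr_def)
    qed (simp add: refine_def)
    thus ?thesis unfolding 0 coboundaries_0 by auto
  next
    case (Suc m)
    have "h \<in> cochains L W m"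
    proof (rule cochainsI)
      fix xs assume xs: "xs \<in> simplices W m"
      have op: "zopen (\<Inter>(set xs))" by (rule simplex_open[OF W(1) xs])
      show "h xs \<in> O_sect i j (\<Inter>(set xs))" unfolding h_def
      proof (rule O_sect_prism[OF op])
        fix ys assume ys: "length ys = Suc (length xs)" "set ys \<subseteq> \<sigma> ` set xs \<union> \<tau> ` set xs"
        have "length ys = Suc k" using ys(1) xs by (simp add: simplices_def Suc)
        from mixed[OF xs this ys(2)] show "restr (\<Inter>(set xs)) (c ys) \<in> O_sect i j (\<Inter>(set xs))"
          by (intro O_sect_restrict[OF cochainsD[OF cc] op]) blast+
      qed
    qed
    moreover have "(\<lambda>v w. refine \<tau> c xs v w - refine \<sigma> c xs v w) = delta h xs" if xs: "xs \<in> simplices W (Suc m)" for xs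
    proof (intro ext)
      fix v w
      show "refine \<tau> c xs v w - refine \<sigma> c xs v w = delta h xs v w"
        using main[OF xs[folded Suc], of v w] unfolding delta_alt
        by (cases "(pt v, pt w) \<in> \<Inter>(set xs)") (simp_all add: refine_def)
    qed
    ultimately show ?thesis unfolding Suc coboundaries_Suc by blast
  qed
qed

lemma pull_cocycle:
  assumes c: "c \<in> cocycles L U k" and U: "open_cover U"
  shows "pull_cochain \<zeta> L g c \<in> cocycles L (pull_cover \<zeta> g U) k"
proof -
  have act_inv: "actT \<zeta> g ` actT \<zeta> (- g) ` V = V" for V by (simp add: image_image actT_add[OF prim])
  have smp: "map ((`) (actT \<zeta> g)) xs \<in> simplices U n" if "xs \<in> simplices (pull_cover \<zeta> g U) n" for xs n
    using that act_inv by (fastforce simp: simplices_def pull_cover_def)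
  have inI: "(pt (act1 \<zeta> g v), pt (act2 \<zeta> g w)) \<in> \<Inter>(set (map ((`) (actT \<zeta> g)) xs)) \<longleftrightarrow> (pt v, pt w) \<in> \<Inter>(set xs)" for xs v w
    by (auto simp: in_actT_image_pt[OF prim])
  have "pull_cochain \<zeta> L g c \<in> cochains L (pull_cover \<zeta> g U) k"
  proof (rule cochainsI)
    fix xs assume xs: "xs \<in> simplices (pull_cover \<zeta> g U) k"
    let ?ys = "map ((`) (actT \<zeta> g)) xs"
    have "c ?ys \<in> O_sect i j (\<Inter>(set ?ys))" by (rule cochainsD[OF _ smp[OF xs]]) (use c in \<open>simp add: cocycles_def\<close>)
    from O_sect_cmult[OF O_sect_act[OF prim this, of g], of "twist_chr \<zeta> i j g"]
    have "pull_cochain \<zeta> L g c xs \<in> O_sect i j (actT \<zeta> (- g) ` \<Inter>(set ?ys))"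
      unfolding pull_cochain_def pull_K[abs_def] .
    also have "actT \<zeta> (- g) ` \<Inter>(set ?ys) = \<Inter>(set xs)"
    proof (rule T_subset_eqI)
      have op: "zopen (\<Inter>(set ?ys))" by (rule simplex_open[OF U smp[OF xs]])
      show "actT \<zeta> (- g) ` \<Inter>(set ?ys) \<subseteq> T" by (rule zopen_subset_T[OF zopen_act[OF prim op]])
      have "zopen V" if "V \<in> pull_cover \<zeta> g U" for V
        using that U by (auto simp: pull_cover_def open_cover_def intro: zopen_act[OF prim])
      from simplices_open[OF this xs] show "\<Inter>(set xs) \<subseteq> T" by (rule zopen_subset_T)
    qed (simp only: in_actT_image[OF prim] minus_minus actT_pt inI)
    finally show "pull_cochain \<zeta> L g c xs \<in> O_sect i j (\<Inter>(set xs))" .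
  qed
  moreover have "delta (pull_cochain \<zeta> L g c) xs = (\<lambda>v w. 0)" if xs: "xs \<in> simplices (pull_cover \<zeta> g U) (Suc k)" for xs
  proof (intro ext)
    fix v w
    show "delta (pull_cochain \<zeta> L g c) xs v w = 0"
    proof (cases "(pt v, pt w) \<in> \<Inter>(set xs)")
      case True
      have "alt (\<lambda>ys. c (map ((`) (actT \<zeta> g)) ys) (act1 \<zeta> g v) (act2 \<zeta> g w)) xs = 0"
        unfolding alt_map[of "\<lambda>ys. c ys (act1 \<zeta> g v) (act2 \<zeta> g w)"]
        by (rule cocycle_alt[OF c smp[OF xs]]) (use True inI in blast)
      thus ?thesis unfolding delta_alt restr_in[OF True] by (simp add: pull_cochain_def pull_K alt_cmult)
    qed (simp add: delta_alt)
  qed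
  ultimately show ?thesis by (simp add: cocycles_def)
qed

end

section \<open>Characters that do not occur\<close>

context line_bundle
begin

lemma affine_open_cover: "affine_cover W \<Longrightarrow> open_cover W"
  unfolding open_cover_def using affine_cover.W_open affine_cover.cov by blast

lemma refinement_exists: "(\<And>U. U \<in> W \<Longrightarrow> \<exists>Y\<in>V. U \<subseteq> Y) \<Longrightarrow> \<exists>\<rho>. refinement W V \<rho>"
  unfolding refinement_def by metis

lemma refinement_comp: "refinement W' W \<rho> \<Longrightarrow> refinement W V \<sigma> \<Longrightarrow> refinement W' V (\<sigma> \<circ> \<rho>)"
  unfolding refinement_def by fastforce

lemma refine_comp:
  assumes "refinement W' W \<rho>" "xs \<in> simplices W' k"
  shows "refine \<rho> (\<lambda>xs v w. refine \<sigma> c xs v w - refine \<tau> d xs v w) xs v w =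
    refine (\<sigma> \<circ> \<rho>) c xs v w - refine (\<tau> \<circ> \<rho>) d xs v w"
proof (cases "(pt v, pt w) \<in> \<Inter>(set xs)")
  case True
  hence "(pt v, pt w) \<in> \<Inter>(set (map \<rho> xs))" using refine_Inter[OF assms] by blast
  with True show ?thesis by (simp only: refine_at map_map)
qed (simp add: refine_def)

text \<open>The eigenvalue equation of a class holds only up to coboundaries, on a different
  refinement for each g. All of these are transported to one group-stable affine cover W. There
  averaging replaces the cocycle by a cohomologous one that is equivariant on the nose, to which
  \<open>equivariant_vanishing\<close> applies.\<close>

theorem not_occurs:
  assumes \<psi>: "\<psi> \<in> characters" and noW: "no_weight \<zeta> i j (\<lambda>g. \<psi> g / twist_chr \<zeta> i j g)"
  shows "\<not> occurs \<zeta> L k \<psi>"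
proof
  assume "occurs \<zeta> L k \<psi>"
  then obtain U c where U: "open_cover U" and c: "c \<in> cocycles L U k"
    and ns: "\<not> same_class L k U c U (\<lambda>xs v w. 0)"
    and eg: "\<And>g. same_class L k (pull_cover \<zeta> g U) (pull_cochain \<zeta> L g c) U (\<lambda>xs v w. \<psi> g * c xs v w)"
    unfolding occurs_def by blast
  have "\<forall>g. \<exists>V \<sigma> \<tau>. open_cover V \<and> refinement V (pull_cover \<zeta> g U) \<sigma> \<and> refinement V U \<tau> \<and>
     (\<lambda>xs v w. refine \<sigma> (pull_cochain \<zeta> L g c) xs v w - refine \<tau> (\<lambda>xs v w. \<psi> g * c xs v w) xs v w) \<in> coboundaries L V k"
    using eg unfolding same_class_def by blast
  hence "\<exists>V \<sigma> \<tau>. \<forall>g. open_cover (V g) \<and> refinement (V g) (pull_cover \<zeta> g U) (\<sigma> g) \<and> refinement (V g) U (\<tau> g) \<and>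
     (\<lambda>xs v w. refine (\<sigma> g) (pull_cochain \<zeta> L g c) xs v w - refine (\<tau> g) (\<lambda>xs v w. \<psi> g * c xs v w) xs v w) \<in> coboundaries L (V g) k"
    unfolding choice_iff .
  then obtain V \<sigma> \<tau> where V: "\<And>g. open_cover (V g)" "\<And>g. refinement (V g) (pull_cover \<zeta> g U) (\<sigma> g)"
    "\<And>g. refinement (V g) U (\<tau> g)"
    "\<And>g. (\<lambda>xs v w. refine (\<sigma> g) (pull_cochain \<zeta> L g c) xs v w - refine (\<tau> g) (\<lambda>xs v w. \<psi> g * c xs v w) xs v w) \<in> coboundaries L (V g) k"
    by blast
  have fC: "finite (insert U (range V))" by simp
  have oC: "\<And>Y. Y \<in> insert U (range V) \<Longrightarrow> open_cover Y" using U V(1) by blast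
  obtain W where W: "affine_cover W" "\<And>U g. U \<in> W \<Longrightarrow> actT \<zeta> g ` U \<in> W"
    "\<And>U. U \<in> W \<Longrightarrow> \<exists>a b. U \<subseteq> EE a (\<not> a) b (\<not> b)"
    "\<And>A Y. A \<in> W \<Longrightarrow> Y \<in> insert U (range V) \<Longrightarrow> \<exists>X\<in>Y. A \<subseteq> X"
  proof (rule invariant_refinement[OF prim fC oC], goal_cases)
    case (2 W)
    show ?case by (rule 2(1)[OF 2(2-5)])
  qed
  \<comment> \<open>The pullback of the line bundle contains the twist, so an eigenclass for \<psi>
    corresponds to untwisted eigenfunctions for this quotient.\<close>
  define \<theta> where "\<theta> = (\<lambda>g. \<psi> g / twist_chr \<zeta> i j g)"
  have \<psi>_add: "\<psi> (g + h) = \<psi> g * \<psi> h" and \<psi>_nz: "\<psi> g \<noteq> 0" for g h using \<psi> unfolding characters_def by blast+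
  have \<chi>_add: "twist_chr \<zeta> i j (g + h) = twist_chr \<zeta> i j g * twist_chr \<zeta> i j h" and \<chi>_nz: "twist_chr \<zeta> i j g \<noteq> 0" for g h
    unfolding twist_chr_def by (rule chr_add[OF prim], rule chr_nonzero[OF prim])
  interpret affine_cover W by (rule W(1))
  interpret eq_cover W \<zeta> i j \<theta>
  proof
    show "\<theta> (g + h) = \<theta> g * \<theta> h" "\<theta> g \<noteq> 0" for g h
      unfolding \<theta>_def using \<psi>_add \<psi>_nz \<chi>_add \<chi>_nz by simp_all
  qed (use W prim in auto)
  have oW: "open_cover W" by (rule affine_open_cover[OF W(1)])
  obtain \<rho>0 where \<rho>0: "refinement W U \<rho>0" using refinement_exists[of W U] W(4) by blast
  have "\<exists>\<rho>. refinement W (V g) \<rho>" for g by (rule refinement_exists) (use W(4) in blast)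
  then obtain \<rho> where \<rho>: "\<And>g. refinement W (V g) (\<rho> g)" by metis
  define cW where "cW = refine \<rho>0 c"
  have cW: "cW \<in> cocycles L W k" unfolding cW_def by (rule refine_cocycle[OF c oW \<rho>0])
  have claim: "(\<lambda>xs v w. \<psi> g * cW xs v w - pull_cochain \<zeta> L g cW xs v w) \<in> coboundaries L W k" for g
  proof -
    let ?gc = "pull_cochain \<zeta> L g c" and ?pc = "\<lambda>xs v w. \<psi> g * c xs v w"
    \<comment> \<open>The refinement map \<open>\<rho>0\<close> conjugated by g. With this choice,
      pulling back by g commutes exactly with refining to W.\<close>
    define \<alpha> where "\<alpha> Y = actT \<zeta> (- g) ` \<rho>0 (actT \<zeta> g ` Y)" for Y
    have act_inv: "actT \<zeta> g ` actT \<zeta> (- g) ` Y = Y" "actT \<zeta> (- g) ` actT \<zeta> g ` Y = Y" for Y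
      by (simp_all add: image_image actT_add[OF prim])
    have ra: "refinement W (pull_cover \<zeta> g U) \<alpha>" unfolding refinement_def
    proof (intro ballI conjI)
      fix Y assume "Y \<in> W"
      hence Y: "actT \<zeta> g ` Y \<in> W" by (rule W(2))
      note r = conjunct1[OF bspec[OF \<rho>0[unfolded refinement_def] Y]] conjunct2[OF bspec[OF \<rho>0[unfolded refinement_def] Y]]
      show "\<alpha> Y \<in> pull_cover \<zeta> g U" unfolding \<alpha>_def pull_cover_def by (rule image_eqI[OF refl r(1)])
      have "actT \<zeta> (- g) ` actT \<zeta> g ` Y \<subseteq> \<alpha> Y" unfolding \<alpha>_def by (rule image_mono[OF r(2)])
      thus "Y \<subseteq> \<alpha> Y" unfolding act_inv .
    qed
    have A: "pull_cochain \<zeta> L g cW xs v w = refine \<alpha> ?gc xs v w" for xs v w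
    proof -
      have m: "map ((`) (actT \<zeta> g)) (map \<alpha> xs) = map \<rho>0 (map ((`) (actT \<zeta> g)) xs)"
        unfolding map_map by (rule map_cong[OF refl]) (simp only: comp_apply \<alpha>_def act_inv)
      show ?thesis unfolding pull_cochain_def cW_def refine_def restr_def pull_K in_gs_Inter m
        by (cases "(pt v, pt w) \<in> \<Inter>(set xs)") (simp_all only: if_True if_False mult_zero_right)
    qed
    have gc: "?gc \<in> cocycles L (pull_cover \<zeta> g U) k" by (rule pull_cocycle[OF c U])
    have B1: "(\<lambda>xs v w. refine (\<sigma> g \<circ> \<rho> g) ?gc xs v w - refine \<alpha> ?gc xs v w) \<in> coboundaries L W k"
      by (rule refine_homotopy[OF gc oW ra refinement_comp[OF \<rho> V(2)]])
    have B2: "refine (\<rho> g) (\<lambda>xs v w. refine (\<sigma> g) ?gc xs v w - refine (\<tau> g) ?pc xs v w) \<in> coboundaries L W k"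
      by (rule refine_coboundary[OF V(4) oW \<rho>])
    have B3: "(\<lambda>xs v w. refine \<rho>0 c xs v w - refine (\<tau> g \<circ> \<rho> g) c xs v w) \<in> coboundaries L W k"
      by (rule refine_homotopy[OF c oW refinement_comp[OF \<rho> V(3)] \<rho>0])
    have pc: "refine \<kappa> ?pc xs v w = \<psi> g * refine \<kappa> c xs v w" for \<kappa> xs v w by (simp add: refine_def restr_def)
    \<comment> \<open>The terms telescope: change of refinement map for c, then the eigenvalue
      equation on \<open>V g\<close>, then change of refinement map for the pullback.\<close>
    have "(\<lambda>xs v w. (\<psi> g * (refine \<rho>0 c xs v w - refine (\<tau> g \<circ> \<rho> g) c xs v w) +
        (-1) * refine (\<rho> g) (\<lambda>xs v w. refine (\<sigma> g) ?gc xs v w - refine (\<tau> g) ?pc xs v w) xs v w) +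
        (refine (\<sigma> g \<circ> \<rho> g) ?gc xs v w - refine \<alpha> ?gc xs v w)) \<in> coboundaries L W k"
      by (intro coboundary_add[OF coboundary_add[OF coboundary_cmult[OF B3] coboundary_cmult[OF B2]] B1])
    thus ?thesis
    proof (rule coboundary_cong, intro ext)
      fix xs v w assume xs: "xs \<in> simplices W k"
      show "\<psi> g * cW xs v w - pull_cochain \<zeta> L g cW xs v w = (\<psi> g * (refine \<rho>0 c xs v w - refine (\<tau> g \<circ> \<rho> g) c xs v w) +
        (-1) * refine (\<rho> g) (\<lambda>xs v w. refine (\<sigma> g) ?gc xs v w - refine (\<tau> g) ?pc xs v w) xs v w) +
        (refine (\<sigma> g \<circ> \<rho> g) ?gc xs v w - refine \<alpha> ?gc xs v w)"
        unfolding refine_comp[OF \<rho> xs] unfolding pc unfolding A unfolding cW_def by (simp add: algebra_simps)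
    qed
  qed
  \<comment> \<open>The difference is the average over g of \<psi> (- g) times the coboundaries in
    \<open>claim\<close>.\<close>
  have d1: "(\<lambda>xs v w. cW xs v w - av cW xs v w) \<in> coboundaries L W k"
  proof -
    have "(\<lambda>xs v w. (1 / of_nat CARD(grp)) * (\<Sum>g\<in>UNIV. \<psi> (- g) * (\<psi> g * cW xs v w - pull_cochain \<zeta> L g cW xs v w))) \<in> coboundaries L W k"
      by (intro coboundary_cmult coboundary_sum[OF oW] claim)
    thus ?thesis
    proof (rule coboundary_cong, intro ext)
      fix xs v w
      have "\<psi> (- g) * (\<psi> g * cW xs v w - pull_cochain \<zeta> L g cW xs v w) =
          cW xs v w - \<theta> (- g) * cW (map (gs g) xs) (act1 \<zeta> g v) (act2 \<zeta> g w)" for g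
      proof -
        have "\<psi> (- g) * \<psi> g = 1" using \<psi>_add[of "- g" g] \<psi>_add[of 0 0] \<psi>_nz[of 0] by simp
        moreover have "twist_chr \<zeta> i j (- g) * twist_chr \<zeta> i j g = 1"
          using \<chi>_add[of "- g" g] \<chi>_add[of 0 0] \<chi>_nz[of 0] by simp
        hence "\<psi> (- g) * twist_chr \<zeta> i j g = \<theta> (- g)" unfolding \<theta>_def using \<chi>_nz[of "- g"]
          by (simp add: field_simps)
        ultimately show ?thesis by (simp add: pull_cochain_def pull_K right_diff_distrib mult.assoc[symmetric])
      qed
      thus "cW xs v w - av cW xs v w = (1 / of_nat CARD(grp)) * (\<Sum>g\<in>UNIV. \<psi> (- g) * (\<psi> g * cW xs v w - pull_cochain \<zeta> L g cW xs v w))"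
        by (simp add: av_def sum_subtractf diff_divide_distrib)
    qed
  qed
  have cch: "cW \<in> cch i j W T k" "closedc W T k cW" using cW by (simp_all add: cocycle_iff[OF oW])
  have "closedc W T k (av cW)" unfolding closedc_def
  proof (intro ballI allI impI)
    fix xs v w assume xs: "xs \<in> simplices W (Suc k)" and vw: "(pt v, pt w) \<in> \<Inter>(set xs) \<inter> T"
    have "alt (\<lambda>ys. cW (map (gs g) ys) (act1 \<zeta> g v) (act2 \<zeta> g w)) xs = 0" for g
      unfolding alt_map[of "\<lambda>ys. cW ys (act1 \<zeta> g v) (act2 \<zeta> g w)"]
      using cch(2)[unfolded closedc_def, rule_format, OF simplices_gs[OF xs]] vw[folded in_gs[OF okE_T, of g v w]] by blast
    moreover have "alt (\<lambda>ys. av cW ys v w) xs = alt (\<lambda>ys. (1 / of_nat CARD(grp)) *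
       (\<Sum>g\<in>UNIV. \<theta> (- g) * cW (map (gs g) ys) (act1 \<zeta> g v) (act2 \<zeta> g w))) xs"
      by (simp add: av_def)
    ultimately show "alt (\<lambda>ys. av cW ys v w) xs = 0" unfolding alt_cmult alt_sum by simp
  qed
  hence ZZ: "av cW \<in> ZZ T k" using av_cch[OF cch(1) okE_T] by (simp add: ZZ_def)
  have d2: "av cW \<in> coboundaries L W k"
  proof (cases k)
    case 0
    show ?thesis unfolding 0 coboundaries_0
      using equivariant_vanishing_0[OF noW[folded \<theta>_def] ZZ[unfolded 0]] by blast
  next
    case (Suc m)
    obtain b where b: "b \<in> cch i j W T m" "bounds W T (Suc m) b (av cW)"
      using equivariant_vanishing[OF noW[folded \<theta>_def] ZZ[unfolded Suc]] by blast
    have "av cW xs = delta b xs" if xs: "xs \<in> simplices W (Suc m)" for xs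
    proof (intro ext)
      fix v w
      have s: "av cW xs \<in> O_sect i j (\<Inter>(set xs) \<inter> T)" by (rule CC_sect[OF ZZ_CC[OF ZZ[unfolded Suc]] xs])
      show "av cW xs v w = delta b xs v w"
      proof (cases "(pt v, pt w) \<in> \<Inter>(set xs)")
        case True
        hence T': "(pt v, pt w) \<in> \<Inter>(set xs) \<inter> T" unfolding simplex_T[OF oW xs] .
        show ?thesis unfolding delta_alt restr_in[OF True] by (rule boundsD[OF b(2) xs T'])
      next
        case False
        thus ?thesis using O_sect_outside[OF s, of v w] by (simp add: delta_alt)
      qed
    qed
    thus ?thesis unfolding Suc coboundaries_Suc using b(1) cochains_cch[OF oW] by blast
  qed
  have "(\<lambda>xs v w. (cW xs v w - av cW xs v w) + av cW xs v w) \<in> coboundaries L W k"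
    by (rule coboundary_add[OF d1 d2])
  hence "(\<lambda>xs v w. refine \<rho>0 c xs v w - refine \<rho>0 (\<lambda>xs v w. 0) xs v w) \<in> coboundaries L W k"
    by (rule coboundary_cong) (simp add: cW_def refine_def)
  hence "same_class L k U c U (\<lambda>xs v w. 0)" unfolding same_class_def using oW \<rho>0 by blast
  with ns show False by blast
qed

subsection \<open>Classes of monomials\<close>

definition B4 :: "point set set" where
  "B4 = (\<lambda>(a, b). EE a (\<not> a) b (\<not> b)) ` UNIV"

lemma B4_I: "EE a (\<not> a) b (\<not> b) \<in> B4"
  unfolding B4_def by (rule image_eqI[of _ _ "(a, b)"]) auto

lemma B4_E: "U \<in> B4 \<Longrightarrow> \<exists>a b. U = EE a (\<not> a) b (\<not> b)"
  by (auto simp: B4_def)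

lemma B4_cover: "open_cover B4"
  unfolding open_cover_def
proof
  show "\<forall>U\<in>B4. zopen U" using EE_open by (auto simp: B4_def)
  show "\<Union>B4 = T"
  proof
    show "\<Union>B4 \<subseteq> T" unfolding B4_def using EE_subset_T by blast
    show "T \<subseteq> \<Union>B4"
    proof
      fix x assume "x \<in> T"
      then obtain v w where vw: "x = (pt v, pt w)" "v \<in> fcone" "w \<in> fcone" by (rule T_cases)
      have "x \<in> EE (v$1 \<noteq> 0) (\<not> (v$1 \<noteq> 0)) (w$1 \<noteq> 0) (\<not> (w$1 \<noteq> 0))"
        unfolding vw(1) in_EE using vw(2,3) fcone_coord by blast
      thus "x \<in> \<Union>B4" using B4_I by blast
    qed
  qed
qed

text \<open>The cocycle is a scalar cocycle \<alpha> times the monomial. The four sets are stable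
  under the group, so the eigenvalue equation holds exactly on the cover itself. A class that is
  zero in the colimit is a coboundary on some cover and hence on an affine refinement of it, so
  nontriviality is tested on affine covers only.\<close>

lemma monomial_class_occurs:
  assumes \<mu>: "\<mu> \<in> Idx x x y y i j"
    and sup: "\<And>xs. xs \<in> simplices B4 k \<Longrightarrow> \<alpha> xs \<noteq> 0 \<Longrightarrow> \<Inter>(set xs) \<subseteq> EE x x y y"
    and cl: "\<And>xs. xs \<in> simplices B4 (Suc k) \<Longrightarrow> alt \<alpha> xs = 0"
    and nontriv: "\<And>W \<rho>. affine_cover W \<Longrightarrow> refinement W B4 \<rho> \<Longrightarrow>
      (\<lambda>xs. restr (\<Inter>(set xs)) (\<lambda>v w. \<alpha> (map \<rho> xs) * mono2 \<mu> v w)) \<in> coboundaries L W k \<Longrightarrow> False"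
  shows "occurs \<zeta> L k (\<lambda>g. twist_chr \<zeta> i j g * chr \<zeta> (wt \<mu>) g)"
proof -
  define c where "c xs = restr (\<Inter>(set xs)) (\<lambda>v w. \<alpha> xs * mono2 \<mu> v w)" for xs
  have cc: "c \<in> cochains L B4 k"
  proof (rule cochainsI)
    fix xs assume xs: "xs \<in> simplices B4 k"
    have op: "zopen (\<Inter>(set xs))" by (rule simplex_open[OF B4_cover xs])
    show "c xs \<in> O_sect i j (\<Inter>(set xs))"
    proof (cases "\<alpha> xs = 0")
      case True
      thus ?thesis using O_sect_zero[OF op] by (simp add: c_def)
    next
      case False
      have "(\<lambda>v w. \<alpha> xs * restr (\<Inter>(set xs)) (mono2 \<mu>) v w) \<in> O_sect i j (\<Inter>(set xs))"
        by (rule O_sect_cmult[OF mono2_section[OF op sup[OF xs False] \<mu>]])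
      also have "(\<lambda>v w. \<alpha> xs * restr (\<Inter>(set xs)) (mono2 \<mu>) v w) = c xs" by (auto simp: c_def restr_def fun_eq_iff)
      finally show ?thesis .
    qed
  qed
  have "delta c xs = (\<lambda>v w. 0)" if xs: "xs \<in> simplices B4 (Suc k)" for xs
  proof (intro ext)
    fix v w
    show "delta c xs v w = 0"
    proof (cases "(pt v, pt w) \<in> \<Inter>(set xs)")
      case True
      have "alt (\<lambda>ys. c ys v w) xs = alt (\<lambda>ys. mono2 \<mu> v w * \<alpha> ys) xs"
        by (rule alt_cong) (use True in \<open>auto simp: c_def restr_def\<close>)
      also have "\<dots> = 0" unfolding alt_cmult cl[OF xs] by simp
      finally show ?thesis unfolding delta_alt restr_in[OF True] .
    qed (simp add: delta_alt)
  qed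
  hence c: "c \<in> cocycles L B4 k" using cc by (simp add: cocycles_def)
  have B_inv: "actT \<zeta> g ` U = U" if "U \<in> B4" for g U
  proof -
    obtain a b where "U = EE a (\<not> a) b (\<not> b)" using B4_E[OF \<open>U \<in> B4\<close>] by blast
    thus ?thesis by (simp only: EE_act[OF prim])
  qed
  have refl: "refinement B4 B4 (\<lambda>U. U)" by (simp add: refinement_def)
  have "same_class L k (pull_cover \<zeta> g B4) (pull_cochain \<zeta> L g c) B4 (\<lambda>xs v w. (twist_chr \<zeta> i j g * chr \<zeta> (wt \<mu>) g) * c xs v w)" for g
  proof -
    have pc: "pull_cover \<zeta> g B4 = B4" unfolding pull_cover_def using B_inv by (auto simp: image_iff)
    have "(\<lambda>v w. refine (\<lambda>U. U) (pull_cochain \<zeta> L g c) xs v w -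
        refine (\<lambda>U. U) (\<lambda>xs v w. (twist_chr \<zeta> i j g * chr \<zeta> (wt \<mu>) g) * c xs v w) xs v w) = (\<lambda>v w. 0)"
      if xs: "xs \<in> simplices B4 k" for xs
    proof (intro ext)
      fix v w
      have m: "map ((`) (actT \<zeta> g)) xs = xs" by (rule map_idI, rule B_inv) (use xs in \<open>auto simp: simplices_def\<close>)
      have "(pt (act1 \<zeta> g v), pt (act2 \<zeta> g w)) \<in> \<Inter>(set (map ((`) (actT \<zeta> g)) xs)) \<longleftrightarrow> (pt v, pt w) \<in> \<Inter>(set xs)"
        by (auto simp: in_actT_image_pt[OF prim])
      hence hi: "(pt (act1 \<zeta> g v), pt (act2 \<zeta> g w)) \<in> \<Inter>(set xs) \<longleftrightarrow> (pt v, pt w) \<in> \<Inter>(set xs)" unfolding m .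
      thus "refine (\<lambda>U. U) (pull_cochain \<zeta> L g c) xs v w -
        refine (\<lambda>U. U) (\<lambda>xs v w. (twist_chr \<zeta> i j g * chr \<zeta> (wt \<mu>) g) * c xs v w) xs v w = 0"
        unfolding refine_def pull_cochain_def pull_K list.map_ident
        unfolding m c_def restr_def hi by (simp add: mono2_act[OF prim])
    qed
    hence "(\<lambda>xs v w. refine (\<lambda>U. U) (pull_cochain \<zeta> L g c) xs v w -
        refine (\<lambda>U. U) (\<lambda>xs v w. (twist_chr \<zeta> i j g * chr \<zeta> (wt \<mu>) g) * c xs v w) xs v w) \<in> coboundaries L B4 k"
      by (intro coboundary_cong[OF coboundary_zero[OF B4_cover]])
    thus ?thesis unfolding same_class_def pc using B4_cover refl by blast
  qed
  moreover have "\<not> same_class L k B4 c B4 (\<lambda>xs v w. 0)"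
  proof
    assume "same_class L k B4 c B4 (\<lambda>xs v w. 0)"
    then obtain V \<sigma> \<tau> where V: "open_cover V" "refinement V B4 \<sigma>"
      "(\<lambda>xs v w. refine \<sigma> c xs v w - refine \<tau> (\<lambda>xs v w. 0) xs v w) \<in> coboundaries L V k"
      unfolding same_class_def by blast
    have fin: "finite {V}" and op: "\<And>Y. Y \<in> {V} \<Longrightarrow> open_cover Y" using V(1) by auto
    obtain W where W: "affine_cover W" "\<And>A Y. A \<in> W \<Longrightarrow> Y \<in> {V} \<Longrightarrow> \<exists>X\<in>Y. A \<subseteq> X"
    proof (rule invariant_refinement[OF prim fin op], goal_cases)
      case (2 W)
      show ?case by (rule 2(1)[OF 2(2,5)])
    qed
    have oW: "open_cover W" by (rule affine_open_cover[OF W(1)])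
    obtain \<rho> where \<rho>: "refinement W V \<rho>" using refinement_exists[of W V] W(2) by blast
    have "refine \<rho> (\<lambda>xs v w. refine \<sigma> c xs v w - refine \<tau> (\<lambda>xs v w. 0) xs v w) \<in> coboundaries L W k"
      by (rule refine_coboundary[OF V(3) oW \<rho>])
    hence "(\<lambda>xs. restr (\<Inter>(set xs)) (\<lambda>v w. \<alpha> (map (\<sigma> \<circ> \<rho>) xs) * mono2 \<mu> v w)) \<in> coboundaries L W k"
    proof (rule coboundary_cong, intro ext)
      fix xs v w assume xs: "xs \<in> simplices W k"
      show "restr (\<Inter>(set xs)) (\<lambda>v w. \<alpha> (map (\<sigma> \<circ> \<rho>) xs) * mono2 \<mu> v w) v w =
        refine \<rho> (\<lambda>xs v w. refine \<sigma> c xs v w - refine \<tau> (\<lambda>xs v w. 0) xs v w) xs v w"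
        unfolding refine_comp[OF \<rho> xs]
        using refine_Inter[OF refinement_comp[OF \<rho> V(2)] xs]
        by (cases "(pt v, pt w) \<in> \<Inter>(set xs)") (auto simp: refine_def c_def restr_def)
    qed
    with nontriv[OF W(1) refinement_comp[OF \<rho> V(2)]] show False by blast
  qed
  ultimately show ?thesis unfolding occurs_def using B4_cover c by blast
qed

text \<open>The coefficient of \<mu> vanishes. Linear independence of the monomials makes this a
  meaningful condition, and it is the invariant that detects the monomial classes.\<close>

definition avoids :: "index \<Rightarrow> cfun \<Rightarrow> bool" where
  "avoids \<mu> f \<longleftrightarrow> (\<exists>\<kappa>. fsupp \<kappa> (Idx True True True True i j) \<and> \<kappa> \<mu> = 0 \<and>
     (\<forall>v w. (pt v, pt w) \<in> EE True True True True \<longrightarrow> f v w = Lau \<kappa> v w))"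

lemma avoids_diff:
  assumes "avoids \<mu> f" "avoids \<mu> g"
  shows "avoids \<mu> (\<lambda>v w. f v w - g v w)"
proof -
  obtain \<kappa> \<kappa>' where *: "fsupp \<kappa> (Idx True True True True i j)" "\<kappa> \<mu> = 0"
    "\<forall>v w. (pt v, pt w) \<in> EE True True True True \<longrightarrow> f v w = Lau \<kappa> v w"
    "fsupp \<kappa>' (Idx True True True True i j)" "\<kappa>' \<mu> = 0"
    "\<forall>v w. (pt v, pt w) \<in> EE True True True True \<longrightarrow> g v w = Lau \<kappa>' v w"
    using assms unfolding avoids_def by blast
  show ?thesis unfolding avoids_def
    by (rule exI[of _ "\<lambda>\<mu>. \<kappa> \<mu> - \<kappa>' \<mu>"]) (use * in \<open>simp add: fsupp_diff Lau_diff[OF *(1,4)]\<close>)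
qed

text \<open>The expansion over a larger set uses only the monomials that are regular there, and by
  uniqueness it is also the expansion over the smaller set.\<close>

lemma avoids_section:
  assumes s: "s \<in> O_sect i j U" and sub: "\<And>v w. (pt v, pt w) \<in> EE x y x' y' \<Longrightarrow> (pt v, pt w) \<in> U"
    and xy: "x \<or> y" "x' \<or> y'" and \<mu>: "\<mu> \<notin> Idx x y x' y' i j"
  shows "avoids \<mu> s"
proof -
  have "EE x y x' y' \<subseteq> U"
  proof
    fix z assume z: "z \<in> EE x y x' y'"
    hence "z \<in> T" using EE_subset_T by blast
    then obtain v w where "z = (pt v, pt w)" by (rule T_cases)
    thus "z \<in> U" using sub z by blast
  qed
  hence r: "restr (EE x y x' y') s \<in> O_sect i j (EE x y x' y')" by (rule O_sect_restrict[OF s EE_open])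
  show ?thesis
  proof (rule section_expansion[OF xy r])
    fix \<kappa> assume \<kappa>: "fsupp \<kappa> (Idx x y x' y' i j)" "\<And>v w. (pt v, pt w) \<in> EE x y x' y' \<Longrightarrow> restr (EE x y x' y') s v w = Lau \<kappa> v w"
    have "\<kappa> \<mu> = 0" using \<kappa>(1) \<mu> unfolding fsupp_def by blast
    moreover have "s v w = Lau \<kappa> v w" if "(pt v, pt w) \<in> EE True True True True" for v w
    proof -
      have "(pt v, pt w) \<in> EE x y x' y'" using that unfolding in_EE by blast
      thus ?thesis using \<kappa>(2) by simp
    qed
    ultimately show ?thesis unfolding avoids_def using fsupp_mono[OF \<kappa>(1) Idx_mono] by blast
  qed
qed

text \<open>By uniqueness of the expansion: the coefficient of \<mu> would have to be both 1 and
  0.\<close>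

lemma not_avoids_mono2:
  assumes \<mu>: "\<mu> \<in> Idx True True True True i j" and f: "avoids \<mu> f"
    and eq: "\<And>v w. (pt v, pt w) \<in> EE True True True True \<Longrightarrow> mono2 \<mu> v w = f v w"
  shows False
proof -
  obtain \<kappa> where \<kappa>: "fsupp \<kappa> (Idx True True True True i j)" "\<kappa> \<mu> = 0"
    "\<And>v w. (pt v, pt w) \<in> EE True True True True \<Longrightarrow> f v w = Lau \<kappa> v w"
    using f unfolding avoids_def by blast
  let ?\<delta> = "\<lambda>\<nu>. if \<nu> = \<mu> then 1 else 0 :: complex"
  have "fsupp ?\<delta> (Idx True True True True i j)" using \<mu> by (auto simp: fsupp_def)
  from Lau_unique[OF prim this \<kappa>(1), of \<mu>] eq \<kappa>(2,3) show False by (simp add: Lau_single)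
qed

end

section \<open>Nontrivial monomial classes from the two charts of each curve\<close>

context line_bundle
begin

text \<open>A 0-cochain of constants. Its coboundary on a pair of members can be nonzero only if one
  of them lies in X \<noteq> 0 and the other in Y \<noteq> 0, that is, where a monomial with poles
  along both is regular.\<close>

definition eX :: "point set \<Rightarrow> complex" where
  "eX U = (if U \<subseteq> EE True False False False then 0 else 1)"

definition eY :: "point set \<Rightarrow> complex" where
  "eY U = (if U \<subseteq> EE False False True False then 0 else 1)"

lemma EE_sub: "(a' \<longrightarrow> a) \<Longrightarrow> (b' \<longrightarrow> b) \<Longrightarrow> (c' \<longrightarrow> c) \<Longrightarrow> (d' \<longrightarrow> d) \<Longrightarrow> EE a b c d \<subseteq> EE a' b' c' d'"
proof
  fix z assume *: "a' \<longrightarrow> a" "b' \<longrightarrow> b" "c' \<longrightarrow> c" "d' \<longrightarrow> d" and z: "z \<in> EE a b c d"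
  hence "z \<in> T" using EE_subset_T by blast
  then obtain v w where vw: "z = (pt v, pt w)" by (rule T_cases)
  show "z \<in> EE a' b' c' d'" using z * unfolding vw in_EE by blast
qed

lemma EE_Int_sub:
  assumes "a' \<longrightarrow> a1 \<or> a2" "b' \<longrightarrow> b1 \<or> b2" "c' \<longrightarrow> c1 \<or> c2" "d' \<longrightarrow> d1 \<or> d2"
  shows "EE a1 b1 c1 d1 \<inter> EE a2 b2 c2 d2 \<subseteq> EE a' b' c' d'"
proof
  fix z assume z: "z \<in> EE a1 b1 c1 d1 \<inter> EE a2 b2 c2 d2"
  hence "z \<in> T" using EE_subset_T by blast
  then obtain v w where vw: "z = (pt v, pt w)" by (rule T_cases)
  show "z \<in> EE a' b' c' d'" using z assms unfolding vw Int_iff in_EE by blast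
qed

lemma eXY:
  assumes "U \<in> B4"
  shows "eX U \<noteq> 1 \<Longrightarrow> U \<subseteq> EE True False False False" "eX U \<noteq> 0 \<Longrightarrow> U \<subseteq> EE False True False False"
    "eY U \<noteq> 1 \<Longrightarrow> U \<subseteq> EE False False True False" "eY U \<noteq> 0 \<Longrightarrow> U \<subseteq> EE False False False True"
    "eX U = 0 \<or> eX U = 1" "eY U = 0 \<or> eY U = 1"
proof -
  obtain a b where U: "U = EE a (\<not> a) b (\<not> b)" using B4_E[OF assms] by blast
  show "eX U \<noteq> 1 \<Longrightarrow> U \<subseteq> EE True False False False" "eY U \<noteq> 1 \<Longrightarrow> U \<subseteq> EE False False True False"
    by (auto simp: eX_def eY_def split: if_splits)
  show "eX U \<noteq> 0 \<Longrightarrow> U \<subseteq> EE False True False False"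
  proof (cases a)
    case True
    hence "U \<subseteq> EE True False False False" unfolding U by (intro EE_sub) auto
    thus "eX U \<noteq> 0 \<Longrightarrow> ?thesis" by (simp add: eX_def)
  next
    case False
    thus ?thesis unfolding U by (intro EE_sub) auto
  qed
  show "eY U \<noteq> 0 \<Longrightarrow> U \<subseteq> EE False False False True"
  proof (cases b)
    case True
    hence "U \<subseteq> EE False False True False" unfolding U by (intro EE_sub) auto
    thus "eY U \<noteq> 0 \<Longrightarrow> ?thesis" by (simp add: eY_def)
  next
    case False
    thus ?thesis unfolding U by (intro EE_sub) auto
  qed
  show "eX U = 0 \<or> eX U = 1" "eY U = 0 \<or> eY U = 1" by (auto simp: eX_def eY_def)
qed

lemma simplex1: "xs \<in> simplices W 0 \<longleftrightarrow> (\<exists>U. xs = [U] \<and> U \<in> W)"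
  by (auto simp: simplices_def length_Suc_conv)

lemma simplex2: "xs \<in> simplices W (Suc 0) \<longleftrightarrow> (\<exists>U0 U1. xs = [U0, U1] \<and> U0 \<in> W \<and> U1 \<in> W)"
  by (auto simp: simplices_def length_Suc_conv)

lemma simplex3: "xs \<in> simplices W (Suc (Suc 0)) \<longleftrightarrow> (\<exists>U0 U1 U2. xs = [U0, U1, U2] \<and> U0 \<in> W \<and> U1 \<in> W \<and> U2 \<in> W)"
  by (auto simp: simplices_def length_Suc_conv)

lemma simplex4: "xs \<in> simplices W (Suc (Suc (Suc 0))) \<longleftrightarrow>
    (\<exists>U0 U1 U2 U3. xs = [U0, U1, U2, U3] \<and> U0 \<in> W \<and> U1 \<in> W \<and> U2 \<in> W \<and> U3 \<in> W)"
  by (auto simp: simplices_def length_Suc_conv)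

text \<open>The 0-cochain b fails to be closed by the coboundary of e times m, so subtracting (e -
  \<eta>) m closes it. The constant \<eta> does not affect the coboundary; it is the value of e on
  those members where m may have poles over E.\<close>

lemma glue_shifted:
  assumes W: "affine_cover W" and E: "zopen E" and b: "b \<in> cch i j W E 0"
    and m: "\<And>V. zopen V \<Longrightarrow> V \<subseteq> E' \<Longrightarrow> restr V m \<in> O_sect i j V"
    and sub: "\<And>U. U \<in> W \<Longrightarrow> e U \<noteq> \<eta> \<Longrightarrow> U \<inter> E \<subseteq> E'"
    and eq: "\<And>U0 U1 v w. U0 \<in> W \<Longrightarrow> U1 \<in> W \<Longrightarrow> (pt v, pt w) \<in> U0 \<inter> U1 \<inter> E \<Longrightarrow>
      b [U1] v w - b [U0] v w = (e U1 - e U0) * m v w"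
  shows "\<exists>s. s \<in> O_sect i j E \<and> (\<forall>U v w. U \<in> W \<longrightarrow> (pt v, pt w) \<in> U \<inter> E \<longrightarrow> s v w = b [U] v w - (e U - \<eta>) * m v w)"
proof -
  interpret affine_cover W by (rule W)
  define d where "d xs = restr (\<Inter>(set xs) \<inter> E) (\<lambda>v w. b xs v w - (e (hd xs) - \<eta>) * m v w)" for xs
  have d_in: "d [U] v w = b [U] v w - (e U - \<eta>) * m v w" if "(pt v, pt w) \<in> U \<inter> E" for U v w
    using that by (simp add: d_def)
  have "d \<in> cch i j W E 0" unfolding cch_def
  proof (intro CollectI ballI)
    fix xs assume "xs \<in> simplices W 0"
    then obtain U where U: "xs = [U]" "U \<in> W" unfolding simplex1 by blast
    have op: "zopen (U \<inter> E)" by (rule zopen_Int[OF W_open[OF U(2)] E])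
    have "[U] \<in> simplices W 0" using U(2) by (simp add: simplices_def)
    hence "b [U] \<in> O_sect i j (\<Inter>(set [U]) \<inter> E)" using b unfolding cch_def by blast
    hence bU: "b [U] \<in> O_sect i j (U \<inter> E)" by simp
    have "(\<lambda>v w. (e U - \<eta>) * restr (U \<inter> E) m v w) \<in> O_sect i j (U \<inter> E)"
    proof (cases "e U = \<eta>")
      case True
      thus ?thesis using O_sect_zero[OF op] by simp
    next
      case False
      show ?thesis by (rule O_sect_cmult[OF m[OF op sub[OF U(2) False]]])
    qed
    from O_sect_diff[OF bU this]
    have "(\<lambda>v w. b [U] v w - (e U - \<eta>) * restr (U \<inter> E) m v w) \<in> O_sect i j (U \<inter> E)" .
    also have "(\<lambda>v w. b [U] v w - (e U - \<eta>) * restr (U \<inter> E) m v w) = d xs"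
      using O_sect_outside[OF bU] unfolding U(1) by (auto simp: d_def restr_def fun_eq_iff)
    finally show "d xs \<in> O_sect i j (\<Inter>(set xs) \<inter> E)" by (simp add: U(1))
  qed
  moreover have "closedc W E 0 d" unfolding closedc_def
  proof (intro ballI allI impI)
    fix xs v w assume "xs \<in> simplices W (Suc 0)" and vw: "(pt v, pt w) \<in> \<Inter>(set xs) \<inter> E"
    then obtain U0 U1 where U: "xs = [U0, U1]" "U0 \<in> W" "U1 \<in> W" unfolding simplex2 by blast
    have "(pt v, pt w) \<in> U0 \<inter> U1 \<inter> E" using vw U(1) by auto
    from eq[OF U(2,3) this] this show "alt (\<lambda>ys. d ys v w) xs = 0"
      by (simp add: U(1) d_in algebra_simps)
  qed
  ultimately show ?thesis
  proof (rule row_zero[OF zopen_subset_T[OF E]], goal_cases)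
    case (1 s)
    have "s v w = b [U] v w - (e U - \<eta>) * m v w" if "U \<in> W" "(pt v, pt w) \<in> U \<inter> E" for U v w
      using 1(2)[OF that] d_in[OF that(2)] by simp
    with 1(1) show ?case by blast
  qed
qed

lemma cch_restr:
  assumes W: "affine_cover W" and E: "zopen E" and b: "b \<in> cch i j W E' k" and sub: "E \<subseteq> E'"
  shows "(\<lambda>xs. restr (\<Inter>(set xs) \<inter> E) (b xs)) \<in> cch i j W E k"
  unfolding cch_def
proof (intro CollectI ballI)
  fix xs assume xs: "xs \<in> simplices W k"
  have "b xs \<in> O_sect i j (\<Inter>(set xs) \<inter> E')" using b xs unfolding cch_def by blast
  moreover have "zopen (\<Inter>(set xs) \<inter> E)"
    by (rule zopen_Int[OF simplices_open[OF affine_cover.W_open[OF W] xs] E])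
  ultimately show "restr (\<Inter>(set xs) \<inter> E) (b xs) \<in> O_sect i j (\<Inter>(set xs) \<inter> E)"
    by (rule O_sect_restrict) (use sub in blast)
qed

lemma cch_diff:
  assumes "b \<in> cch i j W E k" "c \<in> cch i j W E k"
  shows "(\<lambda>xs v w. b xs v w - c xs v w) \<in> cch i j W E k"
  using assms unfolding cch_def by (auto intro: O_sect_diff)

lemma coboundary_point:
  assumes W: "affine_cover W" and c: "(\<lambda>xs. restr (\<Inter>(set xs)) (f xs)) \<in> coboundaries L W (Suc k)"
  shows "\<exists>b\<in>cch i j W T k. \<forall>xs\<in>simplices W (Suc k). \<forall>v w. (pt v, pt w) \<in> \<Inter>(set xs) \<longrightarrow>
     f xs v w = alt (\<lambda>ys. b ys v w) xs"
proof -
  obtain b where b: "b \<in> cochains L W k" "\<And>xs. xs \<in> simplices W (Suc k) \<Longrightarrow> restr (\<Inter>(set xs)) (f xs) = delta b xs"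
    using c unfolding coboundaries_Suc by blast
  have "f xs v w = alt (\<lambda>ys. b ys v w) xs" if "xs \<in> simplices W (Suc k)" "(pt v, pt w) \<in> \<Inter>(set xs)" for xs v w
    using fun_cong[OF fun_cong[OF b(2)[OF that(1)]], of v w] unfolding delta_alt restr_in[OF that(2)] .
  thus ?thesis using b(1) unfolding cochains_cch[OF affine_open_cover[OF W]] by blast
qed

text \<open>The functions \<open>eX\<close> and \<open>eY\<close> on the cover, with values in \<open>{0, 1}\<close>, have scalar coboundaries that turn a
  monomial with negative exponents into a cocycle.\<close>

lemma connecting:
  assumes W: "affine_cover W" and b: "b \<in> cch i j W T 0"
    and E1: "E1 = EE a1 b1 c1 d1" and E2: "E2 = EE a2 b2 c2 d2"
    and e: "\<And>U. U \<in> W \<Longrightarrow> e U \<noteq> 1 \<Longrightarrow> U \<subseteq> E1" "\<And>U. U \<in> W \<Longrightarrow> e U \<noteq> (0::complex) \<Longrightarrow> U \<subseteq> E2"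
    and m: "\<And>V. zopen V \<Longrightarrow> V \<subseteq> E1 \<inter> E2 \<Longrightarrow> restr V m \<in> O_sect i j V"
    and eq: "\<And>U0 U1 v w. U0 \<in> W \<Longrightarrow> U1 \<in> W \<Longrightarrow> (pt v, pt w) \<in> U0 \<inter> U1 \<Longrightarrow>
      (e U1 - e U0) * m v w = b [U1] v w - b [U0] v w"
  shows "\<exists>s1 s2. s1 \<in> O_sect i j E1 \<and> s2 \<in> O_sect i j E2 \<and>
    (\<forall>v w. (pt v, pt w) \<in> E1 \<inter> E2 \<longrightarrow> m v w = s2 v w - s1 v w)"
proof -
  have op: "zopen E1" "zopen E2" unfolding E1 E2 by (rule EE_open)+
  have sT: "E1 \<subseteq> T" "E2 \<subseteq> T" by (rule zopen_subset_T[OF op(1)], rule zopen_subset_T[OF op(2)])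
  have r: "\<exists>s. s \<in> O_sect i j E \<and> (\<forall>U v w. U \<in> W \<longrightarrow> (pt v, pt w) \<in> U \<inter> E \<longrightarrow> s v w = b [U] v w - (e U - \<eta>) * m v w)"
    if E: "zopen E" and sub: "\<And>U. U \<in> W \<Longrightarrow> e U \<noteq> \<eta> \<Longrightarrow> U \<inter> E \<subseteq> E1 \<inter> E2" for E \<eta>
  proof -
    have bE: "(\<lambda>xs. restr (\<Inter>(set xs) \<inter> E) (b xs)) \<in> cch i j W E 0"
      by (rule cch_restr[OF W E b zopen_subset_T[OF E]])
    have "\<exists>s. s \<in> O_sect i j E \<and> (\<forall>U v w. U \<in> W \<longrightarrow> (pt v, pt w) \<in> U \<inter> E \<longrightarrow>
        s v w = restr (\<Inter>(set [U]) \<inter> E) (b [U]) v w - (e U - \<eta>) * m v w)"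
    proof (rule glue_shifted[OF W E bE m sub])
      fix U0 U1 v w assume "U0 \<in> W" "U1 \<in> W" "(pt v, pt w) \<in> U0 \<inter> U1 \<inter> E"
      thus "restr (\<Inter>(set [U1]) \<inter> E) (b [U1]) v w - restr (\<Inter>(set [U0]) \<inter> E) (b [U0]) v w = (e U1 - e U0) * m v w"
        using eq[of U0 U1 v w] by simp
    qed
    then obtain s where s: "s \<in> O_sect i j E" "\<And>U v w. U \<in> W \<Longrightarrow> (pt v, pt w) \<in> U \<inter> E \<Longrightarrow>
        s v w = restr (\<Inter>(set [U]) \<inter> E) (b [U]) v w - (e U - \<eta>) * m v w" by blast
    have "s v w = b [U] v w - (e U - \<eta>) * m v w" if "U \<in> W" "(pt v, pt w) \<in> U \<inter> E" for U v w
      using s(2)[OF that] that by simp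
    thus ?thesis using s(1) by blast
  qed
  \<comment> \<open>The same 0-cochain is glued twice, with the shift 0 over E1 and the shift 1 over
    E2; on the overlap the two results differ by exactly m.\<close>
  obtain s1 where s1: "s1 \<in> O_sect i j E1" "\<And>U v w. U \<in> W \<Longrightarrow> (pt v, pt w) \<in> U \<inter> E1 \<Longrightarrow> s1 v w = b [U] v w - (e U - 0) * m v w"
    using r[OF op(1), of 0] e(2) by blast
  obtain s2 where s2: "s2 \<in> O_sect i j E2" "\<And>U v w. U \<in> W \<Longrightarrow> (pt v, pt w) \<in> U \<inter> E2 \<Longrightarrow> s2 v w = b [U] v w - (e U - 1) * m v w"
    using r[OF op(2), of 1] e(1) by blast
  have "m v w = s2 v w - s1 v w" if vw: "(pt v, pt w) \<in> E1 \<inter> E2" for v w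
  proof -
    obtain U where U: "U \<in> W" "(pt v, pt w) \<in> U" using vw sT affine_cover.cov[OF W] by blast
    have "s1 v w = b [U] v w - (e U - 0) * m v w" "s2 v w = b [U] v w - (e U - 1) * m v w"
      using vw U by (intro s1(2)[OF U(1)] s2(2)[OF U(1)]; blast)+
    thus ?thesis by algebra
  qed
  with s1(1) s2(1) show ?thesis by blast
qed

text \<open>Nonnegative exponents in both factors: the monomial is a nonzero global section, with
  the constant scalar cocycle 1.\<close>

lemma occurs_00:
  assumes \<mu>: "\<mu> \<in> Idx False False False False i j"
  shows "occurs \<zeta> L 0 (\<lambda>g. twist_chr \<zeta> i j g * chr \<zeta> (wt \<mu>) g)"
proof (rule monomial_class_occurs[OF \<mu>, where \<alpha> = "\<lambda>_. 1"])
  fix xs assume "xs \<in> simplices B4 0"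
  then obtain U where U: "xs = [U]" "U \<in> B4" unfolding simplex1 by blast
  obtain a b where V: "U = EE a (\<not> a) b (\<not> b)" using B4_E[OF U(2)] by blast
  have "U \<subseteq> EE False False False False" unfolding V by (rule EE_sub) auto
  thus "\<Inter>(set xs) \<subseteq> EE False False False False" unfolding U(1) by simp
next
  fix xs assume "xs \<in> simplices B4 (Suc 0)"
  then obtain U0 U1 where "xs = [U0, U1]" unfolding simplex2 by blast
  thus "alt (\<lambda>_. 1) xs = 0" by simp
next
  fix W \<rho> assume W: "affine_cover W" and c: "(\<lambda>xs. restr (\<Inter>(set xs)) (\<lambda>v w. 1 * mono2 \<mu> v w)) \<in> coboundaries L W 0"
  have z: "mono2 \<mu> v w = (\<lambda>v w. 0) v w" if vw: "(pt v, pt w) \<in> EE True True True True" for v w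
  proof -
    obtain U where U: "U \<in> W" "(pt v, pt w) \<in> U" using vw EE_subset_T affine_cover.cov[OF W] by blast
    hence "[U] \<in> simplices W 0" by (simp add: simplices_def)
    hence "restr (\<Inter>(set [U])) (\<lambda>v w. 1 * mono2 \<mu> v w) = (\<lambda>v w. 0)" using c unfolding coboundaries_0 by blast
    from fun_cong[OF fun_cong[OF this], of v w] U show ?thesis by simp
  qed
  have \<mu>': "\<mu> \<in> Idx True True True True i j" using \<mu> Idx_mono by blast
  have "avoids \<mu> (\<lambda>v w. 0)" unfolding avoids_def by (intro exI[of _ "\<lambda>_. 0"]) (simp add: fsupp_zero)
  from not_avoids_mono2[OF \<mu>' this z] show False .
qed

text \<open>The product of an H^1 class on the first curve and a global section on the second. A
  primitive would write the monomial as a difference of a section over Y \<noteq> 0 and a section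
  over X \<noteq> 0; the former admits no negative q-dual pole p < 0, the latter no q < 0, so
  neither contains \<mu>.\<close>

lemma occurs_10:
  assumes \<mu>: "\<mu> \<in> Idx True True False False i j" and neg: "fst (fst \<mu>) < 0" "fst (snd (fst \<mu>)) < 0"
  shows "occurs \<zeta> L (Suc 0) (\<lambda>g. twist_chr \<zeta> i j g * chr \<zeta> (wt \<mu>) g)"
proof (rule monomial_class_occurs[OF \<mu>, where \<alpha> = "\<lambda>xs. eX (xs ! 1) - eX (xs ! 0)"])
  fix xs assume "xs \<in> simplices B4 (Suc 0)" and nz: "eX (xs ! 1) - eX (xs ! 0) \<noteq> 0"
  then obtain U0 U1 where U: "xs = [U0, U1]" "U0 \<in> B4" "U1 \<in> B4" unfolding simplex2 by blast
  have "\<Inter>(set xs) \<subseteq> EE True False False False \<inter> EE False True False False"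
    using nz eXY[OF U(2)] eXY[OF U(3)] unfolding U(1) by auto
  also have "\<dots> \<subseteq> EE True True False False" by (rule EE_Int_sub) auto
  finally show "\<Inter>(set xs) \<subseteq> EE True True False False" .
next
  fix xs assume "xs \<in> simplices B4 (Suc (Suc 0))"
  then obtain U0 U1 U2 where "xs = [U0, U1, U2]" unfolding simplex3 by blast
  thus "alt (\<lambda>xs. eX (xs ! 1) - eX (xs ! 0)) xs = 0" by simp
next
  fix W \<rho> assume W: "affine_cover W" and \<rho>: "refinement W B4 \<rho>"
    and c: "(\<lambda>xs. restr (\<Inter>(set xs)) (\<lambda>v w. (eX (map \<rho> xs ! 1) - eX (map \<rho> xs ! 0)) * mono2 \<mu> v w)) \<in> coboundaries L W (Suc 0)"
  let ?E1 = "EE True False False False" and ?E2 = "EE False True False False"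
  obtain b where b: "b \<in> cch i j W T 0" "\<And>xs v w. xs \<in> simplices W (Suc 0) \<Longrightarrow> (pt v, pt w) \<in> \<Inter>(set xs) \<Longrightarrow>
     (eX (map \<rho> xs ! 1) - eX (map \<rho> xs ! 0)) * mono2 \<mu> v w = alt (\<lambda>ys. b ys v w) xs"
    using coboundary_point[OF W c] by blast
  have \<rho>': "\<rho> U \<in> B4" "U \<subseteq> \<rho> U" if "U \<in> W" for U using \<rho> that unfolding refinement_def by blast+
  have "\<exists>s1 s2. s1 \<in> O_sect i j ?E1 \<and> s2 \<in> O_sect i j ?E2 \<and>
    (\<forall>v w. (pt v, pt w) \<in> ?E1 \<inter> ?E2 \<longrightarrow> mono2 \<mu> v w = s2 v w - s1 v w)"
  proof (rule connecting[OF W b(1) refl refl, where e = "\<lambda>U. eX (\<rho> U)"])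
    show "U \<subseteq> ?E1" if "U \<in> W" "eX (\<rho> U) \<noteq> 1" for U using \<rho>'[OF that(1)] eXY(1)[OF \<rho>'(1)[OF that(1)] that(2)] by blast
    show "U \<subseteq> ?E2" if "U \<in> W" "eX (\<rho> U) \<noteq> 0" for U using \<rho>'[OF that(1)] eXY(2)[OF \<rho>'(1)[OF that(1)] that(2)] by blast
    show "restr V (mono2 \<mu>) \<in> O_sect i j V" if "zopen V" "V \<subseteq> ?E1 \<inter> ?E2" for V
    proof (rule mono2_section[OF that(1) _ \<mu>])
      have "?E1 \<inter> ?E2 \<subseteq> EE True True False False" by (rule EE_Int_sub) auto
      thus "V \<subseteq> EE True True False False" using that(2) by blast
    qed
    show "(eX (\<rho> U1) - eX (\<rho> U0)) * mono2 \<mu> v w = b [U1] v w - b [U0] v w"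
      if "U0 \<in> W" "U1 \<in> W" "(pt v, pt w) \<in> U0 \<inter> U1" for U0 U1 v w
      using b(2)[of "[U0, U1]" v w] that by (simp add: simplices_def)
  qed
  then obtain s1 s2 where s: "s1 \<in> O_sect i j ?E1" "s2 \<in> O_sect i j ?E2"
    "\<And>v w. (pt v, pt w) \<in> ?E1 \<inter> ?E2 \<Longrightarrow> mono2 \<mu> v w = s2 v w - s1 v w" by blast
  have n: "\<mu> \<notin> Idx True False True True i j" "\<mu> \<notin> Idx False True True True i j"
    using neg by (auto simp: Idx_def idx1_def)
  have "avoids \<mu> s1" by (rule avoids_section[OF s(1) _ _ _ n(1)]) (auto simp: in_EE)
  moreover have "avoids \<mu> s2" by (rule avoids_section[OF s(2) _ _ _ n(2)]) (auto simp: in_EE)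
  ultimately have av: "avoids \<mu> (\<lambda>v w. s2 v w - s1 v w)" by (intro avoids_diff)
  have \<mu>': "\<mu> \<in> Idx True True True True i j" using \<mu> Idx_mono by blast
  show False by (rule not_avoids_mono2[OF \<mu>' av], rule s(3)) (simp add: in_EE)
qed

lemma occurs_01:
  assumes \<mu>: "\<mu> \<in> Idx False False True True i j" and neg: "fst (snd \<mu>) < 0" "fst (snd (snd \<mu>)) < 0"
  shows "occurs \<zeta> L (Suc 0) (\<lambda>g. twist_chr \<zeta> i j g * chr \<zeta> (wt \<mu>) g)"
proof (rule monomial_class_occurs[OF \<mu>, where \<alpha> = "\<lambda>xs. eY (xs ! 1) - eY (xs ! 0)"])
  fix xs assume "xs \<in> simplices B4 (Suc 0)" and nz: "eY (xs ! 1) - eY (xs ! 0) \<noteq> 0"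
  then obtain U0 U1 where U: "xs = [U0, U1]" "U0 \<in> B4" "U1 \<in> B4" unfolding simplex2 by blast
  have "\<Inter>(set xs) \<subseteq> EE False False True False \<inter> EE False False False True"
    using nz eXY[OF U(2)] eXY[OF U(3)] unfolding U(1) by auto
  also have "\<dots> \<subseteq> EE False False True True" by (rule EE_Int_sub) auto
  finally show "\<Inter>(set xs) \<subseteq> EE False False True True" .
next
  fix xs assume "xs \<in> simplices B4 (Suc (Suc 0))"
  then obtain U0 U1 U2 where "xs = [U0, U1, U2]" unfolding simplex3 by blast
  thus "alt (\<lambda>xs. eY (xs ! 1) - eY (xs ! 0)) xs = 0" by simp
next
  fix W \<rho> assume W: "affine_cover W" and \<rho>: "refinement W B4 \<rho>"
    and c: "(\<lambda>xs. restr (\<Inter>(set xs)) (\<lambda>v w. (eY (map \<rho> xs ! 1) - eY (map \<rho> xs ! 0)) * mono2 \<mu> v w)) \<in> coboundaries L W (Suc 0)"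
  let ?E1 = "EE False False True False" and ?E2 = "EE False False False True"
  obtain b where b: "b \<in> cch i j W T 0" "\<And>xs v w. xs \<in> simplices W (Suc 0) \<Longrightarrow> (pt v, pt w) \<in> \<Inter>(set xs) \<Longrightarrow>
     (eY (map \<rho> xs ! 1) - eY (map \<rho> xs ! 0)) * mono2 \<mu> v w = alt (\<lambda>ys. b ys v w) xs"
    using coboundary_point[OF W c] by blast
  have \<rho>': "\<rho> U \<in> B4" "U \<subseteq> \<rho> U" if "U \<in> W" for U using \<rho> that unfolding refinement_def by blast+
  have "\<exists>s1 s2. s1 \<in> O_sect i j ?E1 \<and> s2 \<in> O_sect i j ?E2 \<and>
    (\<forall>v w. (pt v, pt w) \<in> ?E1 \<inter> ?E2 \<longrightarrow> mono2 \<mu> v w = s2 v w - s1 v w)"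
  proof (rule connecting[OF W b(1) refl refl, where e = "\<lambda>U. eY (\<rho> U)"])
    show "U \<subseteq> ?E1" if "U \<in> W" "eY (\<rho> U) \<noteq> 1" for U using \<rho>'[OF that(1)] eXY(3)[OF \<rho>'(1)[OF that(1)] that(2)] by blast
    show "U \<subseteq> ?E2" if "U \<in> W" "eY (\<rho> U) \<noteq> 0" for U using \<rho>'[OF that(1)] eXY(4)[OF \<rho>'(1)[OF that(1)] that(2)] by blast
    show "restr V (mono2 \<mu>) \<in> O_sect i j V" if "zopen V" "V \<subseteq> ?E1 \<inter> ?E2" for V
    proof (rule mono2_section[OF that(1) _ \<mu>])
      have "?E1 \<inter> ?E2 \<subseteq> EE False False True True" by (rule EE_Int_sub) auto
      thus "V \<subseteq> EE False False True True" using that(2) by blast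
    qed
    show "(eY (\<rho> U1) - eY (\<rho> U0)) * mono2 \<mu> v w = b [U1] v w - b [U0] v w"
      if "U0 \<in> W" "U1 \<in> W" "(pt v, pt w) \<in> U0 \<inter> U1" for U0 U1 v w
      using b(2)[of "[U0, U1]" v w] that by (simp add: simplices_def)
  qed
  then obtain s1 s2 where s: "s1 \<in> O_sect i j ?E1" "s2 \<in> O_sect i j ?E2"
    "\<And>v w. (pt v, pt w) \<in> ?E1 \<inter> ?E2 \<Longrightarrow> mono2 \<mu> v w = s2 v w - s1 v w" by blast
  have n: "\<mu> \<notin> Idx True True True False i j" "\<mu> \<notin> Idx True True False True i j"
    using neg by (auto simp: Idx_def idx1_def)
  have "avoids \<mu> s1" by (rule avoids_section[OF s(1) _ _ _ n(1)]) (auto simp: in_EE)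
  moreover have "avoids \<mu> s2" by (rule avoids_section[OF s(2) _ _ _ n(2)]) (auto simp: in_EE)
  ultimately have av: "avoids \<mu> (\<lambda>v w. s2 v w - s1 v w)" by (intro avoids_diff)
  have \<mu>': "\<mu> \<in> Idx True True True True i j" using \<mu> Idx_mono by blast
  show False by (rule not_avoids_mono2[OF \<mu>' av], rule s(3)) (simp add: in_EE)
qed

text \<open>The scalar cocycle is the cup product of the coboundaries of \<open>eX\<close> and
  \<open>eY\<close>. A primitive on a fine cover is traced back through the double complex: over
  each of the four sets the cocycle acquires a primitive of its own, and comparing everything on the
  overlaps writes the monomial as a combination of sections over the sets \<open>?Ev a\<close> and
  \<open>?Eu b'\<close>, none of which can contain it.\<close>

lemma occurs_11:
  assumes \<mu>: "\<mu> \<in> Idx True True True True i j" and neg: "fst (fst \<mu>) < 0" "fst (snd (fst \<mu>)) < 0"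
    "fst (snd \<mu>) < 0" "fst (snd (snd \<mu>)) < 0"
  shows "occurs \<zeta> L (Suc (Suc 0)) (\<lambda>g. twist_chr \<zeta> i j g * chr \<zeta> (wt \<mu>) g)"
proof (rule monomial_class_occurs[OF \<mu>, where \<alpha> = "\<lambda>xs. (eX (xs ! 1) - eX (xs ! 0)) * (eY (xs ! 2) - eY (xs ! 1))"])
  fix xs assume "xs \<in> simplices B4 (Suc (Suc 0))" and nz: "(eX (xs ! 1) - eX (xs ! 0)) * (eY (xs ! 2) - eY (xs ! 1)) \<noteq> 0"
  then obtain U0 U1 U2 where U: "xs = [U0, U1, U2]" "U0 \<in> B4" "U1 \<in> B4" "U2 \<in> B4" unfolding simplex3 by blast
  have "\<Inter>(set xs) \<subseteq> EE True False False False \<inter> EE False True False False"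
    using nz eXY[OF U(2)] eXY[OF U(3)] unfolding U(1) by auto
  moreover have "\<Inter>(set xs) \<subseteq> EE False False True False \<inter> EE False False False True"
    using nz eXY[OF U(3)] eXY[OF U(4)] unfolding U(1) by (auto simp: numeral_2_eq_2)
  moreover have "EE True False False False \<inter> EE False True False False \<subseteq> EE True True False False"
    "EE False False True False \<inter> EE False False False True \<subseteq> EE False False True True"
    "EE True True False False \<inter> EE False False True True \<subseteq> EE True True True True" by (rule EE_Int_sub; simp)+
  ultimately show "\<Inter>(set xs) \<subseteq> EE True True True True" by blast
next
  fix xs assume "xs \<in> simplices B4 (Suc (Suc (Suc 0)))"
  then obtain U0 U1 U2 U3 where "xs = [U0, U1, U2, U3]" unfolding simplex4 by blast
  thus "alt (\<lambda>xs. (eX (xs ! 1) - eX (xs ! 0)) * (eY (xs ! 2) - eY (xs ! 1))) xs = 0"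
    by (simp add: numeral_2_eq_2 algebra_simps)
next
  fix W \<rho> assume W: "affine_cover W" and \<rho>: "refinement W B4 \<rho>"
    and c: "(\<lambda>xs. restr (\<Inter>(set xs)) (\<lambda>v w. ((eX (map \<rho> xs ! 1) - eX (map \<rho> xs ! 0)) *
       (eY (map \<rho> xs ! 2) - eY (map \<rho> xs ! 1))) * mono2 \<mu> v w)) \<in> coboundaries L W (Suc (Suc 0))"
  interpret affine_cover W by (rule W)
  obtain b where b: "b \<in> cch i j W T (Suc 0)" "\<And>xs v w. xs \<in> simplices W (Suc (Suc 0)) \<Longrightarrow> (pt v, pt w) \<in> \<Inter>(set xs) \<Longrightarrow>
     ((eX (map \<rho> xs ! 1) - eX (map \<rho> xs ! 0)) * (eY (map \<rho> xs ! 2) - eY (map \<rho> xs ! 1))) * mono2 \<mu> v w = alt (\<lambda>ys. b ys v w) xs"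
    using coboundary_point[OF W c] by blast
  have \<rho>': "\<rho> U \<in> B4" "U \<subseteq> \<rho> U" if "U \<in> W" for U using \<rho> that unfolding refinement_def by blast+
  let ?E4 = "EE True True True True" and ?Ew = "\<lambda>a b. EE a (\<not> a) b (\<not> b)"
  let ?Ev = "\<lambda>a. EE a (\<not> a) True True" and ?Eu = "\<lambda>b. EE True True b (\<not> b)"
  define e1 where "e1 U = eX (\<rho> U)" for U
  define e2 where "e2 U = eY (\<rho> U)" for U
  have e1: "e1 U \<noteq> 1 \<Longrightarrow> U \<subseteq> EE True False False False" "e1 U \<noteq> 0 \<Longrightarrow> U \<subseteq> EE False True False False"
    and e2: "e2 U \<noteq> 1 \<Longrightarrow> U \<subseteq> EE False False True False" "e2 U \<noteq> 0 \<Longrightarrow> U \<subseteq> EE False False False True"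
    and e01: "e1 U = 0 \<or> e1 U = 1" if "U \<in> W" for U
    using \<rho>'(2)[OF that] eXY[OF \<rho>'(1)[OF that]] unfolding e1_def e2_def by blast+
  have b_alt: "b [U1, U2] v w - b [U0, U2] v w + b [U0, U1] v w = (e1 U1 - e1 U0) * (e2 U2 - e2 U1) * mono2 \<mu> v w"
    if "U0 \<in> W" "U1 \<in> W" "U2 \<in> W" "(pt v, pt w) \<in> U0 \<inter> U1 \<inter> U2" for U0 U1 U2 v w
    using b(2)[of "[U0, U1, U2]" v w] that by (simp add: simplices_def e1_def e2_def numeral_2_eq_2)
  \<comment> \<open>The value of \<open>e2\<close> that a member may take without lying in the
    opposite chart of the second curve.\<close>
  define \<epsilon> where "\<epsilon> b = (if b then 0 else 1 :: complex)" for b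
  \<comment> \<open>The added term has coboundary opposite to that of b, so d is closed. Where its
    scalar factor is nonzero, both coordinates of both curves are nonzero on the intersection with
    the chart, so the monomial is regular there.\<close>
  define d where "d a b' xs = restr (\<Inter>(set xs) \<inter> ?Ew a b')
      (\<lambda>v w. b xs v w + (e1 (xs ! 1) - e1 (xs ! 0)) * (e2 (xs ! 1) - \<epsilon> b') * mono2 \<mu> v w)" for a b' xs
  have d_in: "d a b' [U0, U1] v w = b [U0, U1] v w + (e1 U1 - e1 U0) * (e2 U1 - \<epsilon> b') * mono2 \<mu> v w"
    if "(pt v, pt w) \<in> U0 \<inter> U1 \<inter> ?Ew a b'" for a b' U0 U1 v w
    using that by (simp add: d_def)
  have "\<exists>f. f \<in> cch i j W (?Ew a b') 0 \<and> bounds W (?Ew a b') (Suc 0) f (d a b')" for a b'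
  proof -
    have "d a b' \<in> cch i j W (?Ew a b') (Suc 0)" unfolding cch_def
    proof (intro CollectI ballI)
      fix xs assume xs: "xs \<in> simplices W (Suc 0)"
      then obtain U0 U1 where U: "xs = [U0, U1]" "U0 \<in> W" "U1 \<in> W" unfolding simplex2 by blast
      let ?V = "\<Inter>(set xs) \<inter> ?Ew a b'"
      have op: "zopen ?V" by (rule zopen_Int[OF simplices_open[OF W_open xs] EE_open])
      have 1: "restr ?V (b xs) \<in> O_sect i j ?V"
        using cch_restr[OF W EE_open b(1) EE_subset_T, of a "\<not> a" b' "\<not> b'"] xs unfolding cch_def by blast
      have 2: "(\<lambda>v w. ((e1 U1 - e1 U0) * (e2 U1 - \<epsilon> b')) * restr ?V (mono2 \<mu>) v w) \<in> O_sect i j ?V"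
      proof (cases "(e1 U1 - e1 U0) * (e2 U1 - \<epsilon> b') = 0")
        case True
        show ?thesis unfolding True mult_zero_left by (rule O_sect_zero[OF op])
      next
        case False
        have "U0 \<inter> U1 \<subseteq> EE True False False False \<inter> EE False True False False"
          using False e1[OF U(2)] e1[OF U(3)] e01[OF U(2)] e01[OF U(3)] by auto
        moreover have "EE True False False False \<inter> EE False True False False \<subseteq> EE True True False False"
          by (rule EE_Int_sub) auto
        moreover have "U1 \<inter> ?Ew a b' \<subseteq> EE False False True True"
        proof (cases b')
          case True
          hence "U1 \<subseteq> EE False False False True" using False e2(2)[OF U(3)] by (auto simp: \<epsilon>_def)
          moreover have "EE False False False True \<inter> ?Ew a b' \<subseteq> EE False False True True" using True by (intro EE_Int_sub) auto
          ultimately show ?thesis by blast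
        next
          case F: False
          hence "U1 \<subseteq> EE False False True False" using False e2(1)[OF U(3)] by (auto simp: \<epsilon>_def)
          moreover have "EE False False True False \<inter> ?Ew a b' \<subseteq> EE False False True True" using F by (intro EE_Int_sub) auto
          ultimately show ?thesis by blast
        qed
        moreover have "EE True True False False \<inter> EE False False True True \<subseteq> ?E4" by (rule EE_Int_sub) auto
        moreover have "?V = U0 \<inter> U1 \<inter> ?Ew a b'" unfolding U(1) by simp
        ultimately have "?V \<subseteq> ?E4" by blast
        from O_sect_cmult[OF mono2_section[OF op this \<mu>]] show ?thesis .
      qed
      from O_sect_add[OF 1 2] show "d a b' xs \<in> O_sect i j ?V"
        by (rule back_subst[of "\<lambda>f. f \<in> O_sect i j ?V"]) (auto simp: d_def U(1) restr_def fun_eq_iff)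
    qed
    hence dc: "d a b' \<in> cch i j W (D (ee a (\<not> a) b' (\<not> b'))) (Suc 0)" unfolding EE_def .
    have "closedc W (?Ew a b') (Suc 0) (d a b')" unfolding closedc_def
    proof (intro ballI allI impI)
      fix xs v w assume "xs \<in> simplices W (Suc (Suc 0))" and vw: "(pt v, pt w) \<in> \<Inter>(set xs) \<inter> ?Ew a b'"
      then obtain U0 U1 U2 where U: "xs = [U0, U1, U2]" "U0 \<in> W" "U1 \<in> W" "U2 \<in> W" unfolding simplex3 by blast
      have "(pt v, pt w) \<in> U0 \<inter> U1 \<inter> U2" using vw U(1) by auto
      note * = b_alt[OF U(2-4) this]
      have "d a b' [U1, U2] v w - d a b' [U0, U2] v w + d a b' [U0, U1] v w = 0"
      proof (subst (1 2 3) d_in)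
        show "(pt v, pt w) \<in> U0 \<inter> U1 \<inter> ?Ew a b'" "(pt v, pt w) \<in> U0 \<inter> U2 \<inter> ?Ew a b'" "(pt v, pt w) \<in> U1 \<inter> U2 \<inter> ?Ew a b'"
          using vw U(1) by auto
        show "b [U1, U2] v w + (e1 U2 - e1 U1) * (e2 U2 - \<epsilon> b') * mono2 \<mu> v w -
          (b [U0, U2] v w + (e1 U2 - e1 U0) * (e2 U2 - \<epsilon> b') * mono2 \<mu> v w) +
          (b [U0, U1] v w + (e1 U1 - e1 U0) * (e2 U1 - \<epsilon> b') * mono2 \<mu> v w) = 0"
          using * by algebra
      qed
      moreover have "alt (\<lambda>ys. d a b' ys v w) xs = d a b' [U1, U2] v w - d a b' [U0, U2] v w + d a b' [U0, U1] v w"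
        by (simp add: U(1))
      ultimately show "alt (\<lambda>ys. d a b' ys v w) xs = 0" by (simp only:)
    qed
    hence cl: "closedc W (D (ee a (\<not> a) b' (\<not> b'))) (Suc 0) (d a b')" unfolding EE_def .
    have pos: "0 < (of_bool a + of_bool (\<not> a) :: nat)" "0 < (of_bool b' + of_bool (\<not> b') :: nat)" by auto
    show ?thesis using row_exact[OF ee_bihom pos dc cl] unfolding EE_def by blast
  qed
  then obtain f where f: "\<And>a b'. f a b' \<in> cch i j W (?Ew a b') 0" "\<And>a b'. bounds W (?Ew a b') (Suc 0) (f a b') (d a b')"
    by metis
  have f_diff: "f a b' [U1] v w - f a b' [U0] v w = b [U0, U1] v w + (e1 U1 - e1 U0) * (e2 U1 - \<epsilon> b') * mono2 \<mu> v w"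
    if U: "U0 \<in> W" "U1 \<in> W" and vw: "(pt v, pt w) \<in> U0 \<inter> U1 \<inter> ?Ew a b'" for a b' U0 U1 v w
  proof -
    have "[U0, U1] \<in> simplices W (Suc 0)" "(pt v, pt w) \<in> \<Inter>(set [U0, U1]) \<inter> ?Ew a b'" using U vw by (auto simp: simplices_def)
    with f(2)[of a b'] have "d a b' [U0, U1] v w = alt (\<lambda>ys. f a b' ys v w) [U0, U1]" unfolding bounds_def by blast
    thus ?thesis using d_in[OF vw] by simp
  qed
  have mV: "restr V (mono2 \<mu>) \<in> O_sect i j V" if "zopen V" "V \<subseteq> ?E4" for V
    by (rule mono2_section[OF that \<mu>])
  have subs: "?Ev a \<subseteq> ?Ew a b'" "?Eu b' \<subseteq> ?Ew a b'" for a b' by (rule EE_sub; simp)+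
  \<comment> \<open>Subtracting the primitives for the two values of b' cancels b and leaves the
    coboundary of \<open>e1\<close> times the monomial, because
    \<open>\<epsilon> False - \<epsilon> True\<close> is 1.\<close>
  have "\<exists>s. s \<in> O_sect i j (?Ev a) \<and> (\<forall>U v w. U \<in> W \<longrightarrow> (pt v, pt w) \<in> U \<inter> ?Ev a \<longrightarrow>
      s v w = (f a True [U] v w - f a False [U] v w) - (e1 U - \<epsilon> a) * mono2 \<mu> v w)" for a
  proof -
    define h where "h xs v w = restr (\<Inter>(set xs) \<inter> ?Ev a) (f a True xs) v w - restr (\<Inter>(set xs) \<inter> ?Ev a) (f a False xs) v w" for xs v w
    have h_in: "h [U] v w = f a True [U] v w - f a False [U] v w" if "(pt v, pt w) \<in> U \<inter> ?Ev a" for U v w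
      using that by (simp add: h_def)
    have h: "h \<in> cch i j W (?Ev a) 0" unfolding h_def[abs_def]
      by (intro cch_diff cch_restr[OF W EE_open f(1) subs(1)])
    have "\<exists>s. s \<in> O_sect i j (?Ev a) \<and> (\<forall>U v w. U \<in> W \<longrightarrow> (pt v, pt w) \<in> U \<inter> ?Ev a \<longrightarrow>
      s v w = h [U] v w - (e1 U - \<epsilon> a) * mono2 \<mu> v w)"
    proof (rule glue_shifted[OF W EE_open h mV])
      fix U assume U: "U \<in> W" "e1 U \<noteq> \<epsilon> a"
      show "U \<inter> ?Ev a \<subseteq> ?E4"
      proof (cases a)
        case True
        hence "U \<subseteq> EE False True False False" using U e1(2)[OF U(1)] by (simp add: \<epsilon>_def)
        moreover have "EE False True False False \<inter> ?Ev a \<subseteq> ?E4" using True by (intro EE_Int_sub) auto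
        ultimately show ?thesis by blast
      next
        case False
        hence "U \<subseteq> EE True False False False" using U e1(1)[OF U(1)] by (simp add: \<epsilon>_def)
        moreover have "EE True False False False \<inter> ?Ev a \<subseteq> ?E4" using False by (intro EE_Int_sub) auto
        ultimately show ?thesis by blast
      qed
    next
      fix U0 U1 v w assume U: "U0 \<in> W" "U1 \<in> W" and vw: "(pt v, pt w) \<in> U0 \<inter> U1 \<inter> ?Ev a"
      hence *: "(pt v, pt w) \<in> U0 \<inter> U1 \<inter> ?Ew a b'" for b' using subs(1)[of a b'] by blast
      have "h [U1] v w - h [U0] v w = (f a True [U1] v w - f a True [U0] v w) - (f a False [U1] v w - f a False [U0] v w)"
        using vw h_in[of v w U0] h_in[of v w U1] by simp
      also have "\<dots> = (e1 U1 - e1 U0) * mono2 \<mu> v w"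
        unfolding f_diff[OF U *] by (simp add: \<epsilon>_def algebra_simps)
      finally show "h [U1] v w - h [U0] v w = (e1 U1 - e1 U0) * mono2 \<mu> v w" .
    qed
    thus ?thesis using h_in by auto
  qed
  then obtain s where s: "\<And>a. s a \<in> O_sect i j (?Ev a)" "\<And>a U v w. U \<in> W \<Longrightarrow> (pt v, pt w) \<in> U \<inter> ?Ev a \<Longrightarrow>
      s a v w = (f a True [U] v w - f a False [U] v w) - (e1 U - \<epsilon> a) * mono2 \<mu> v w" by metis
  \<comment> \<open>The correction term in d has the same formula for both values of a, so these
    differences are closed and glue with no shift; hence the zero function in place of e.\<close>
  have "\<exists>t. t \<in> O_sect i j (?Eu b') \<and> (\<forall>U v w. U \<in> W \<longrightarrow> (pt v, pt w) \<in> U \<inter> ?Eu b' \<longrightarrow>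
      t v w = f True b' [U] v w - f False b' [U] v w)" for b'
  proof -
    define h where "h xs v w = restr (\<Inter>(set xs) \<inter> ?Eu b') (f True b' xs) v w - restr (\<Inter>(set xs) \<inter> ?Eu b') (f False b' xs) v w" for xs v w
    have h_in: "h [U] v w = f True b' [U] v w - f False b' [U] v w" if "(pt v, pt w) \<in> U \<inter> ?Eu b'" for U v w
      using that by (simp add: h_def)
    have h: "h \<in> cch i j W (?Eu b') 0" unfolding h_def[abs_def]
      by (intro cch_diff cch_restr[OF W EE_open f(1) subs(2)])
    have "\<exists>s. s \<in> O_sect i j (?Eu b') \<and> (\<forall>U v w. U \<in> W \<longrightarrow> (pt v, pt w) \<in> U \<inter> ?Eu b' \<longrightarrow>
      s v w = h [U] v w - ((\<lambda>U. 0) U - 0) * mono2 \<mu> v w)"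
    proof (rule glue_shifted[OF W EE_open h mV])
      fix U0 U1 v w assume U: "U0 \<in> W" "U1 \<in> W" and vw: "(pt v, pt w) \<in> U0 \<inter> U1 \<inter> ?Eu b'"
      hence *: "(pt v, pt w) \<in> U0 \<inter> U1 \<inter> ?Ew a b'" for a using subs(2)[of b' a] by blast
      have "h [U1] v w - h [U0] v w = (f True b' [U1] v w - f True b' [U0] v w) - (f False b' [U1] v w - f False b' [U0] v w)"
        using vw h_in[of v w U0] h_in[of v w U1] by simp
      also have "\<dots> = ((\<lambda>U. 0) U1 - (\<lambda>U. 0) U0) * mono2 \<mu> v w" unfolding f_diff[OF U *] by simp
      finally show "h [U1] v w - h [U0] v w = (0 - 0) * mono2 \<mu> v w" .
    qed auto
    thus ?thesis using h_in by auto
  qed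
  then obtain t where t: "\<And>b'. t b' \<in> O_sect i j (?Eu b')" "\<And>b' U v w. U \<in> W \<Longrightarrow> (pt v, pt w) \<in> U \<inter> ?Eu b' \<Longrightarrow>
      t b' v w = f True b' [U] v w - f False b' [U] v w" by metis
  \<comment> \<open>The eight values of f cancel, and so do the terms with \<open>e1\<close>; only
    \<open>\<epsilon> False - \<epsilon> True\<close> = 1 times the monomial remains.\<close>
  have main: "mono2 \<mu> v w = (t True v w - t False v w) - (s True v w - s False v w)" if vw: "(pt v, pt w) \<in> ?E4" for v w
  proof -
    obtain U where U: "U \<in> W" "(pt v, pt w) \<in> U" using vw EE_subset_T cov by blast
    have "?E4 \<subseteq> ?Ev a" "?E4 \<subseteq> ?Eu a" for a by (rule EE_sub; simp)+
    hence *: "(pt v, pt w) \<in> U \<inter> ?Ev a" "(pt v, pt w) \<in> U \<inter> ?Eu a" for a using vw U(2) by blast+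
    show ?thesis unfolding s(2)[OF U(1) *(1)] t(2)[OF U(1) *(2)] by (simp add: \<epsilon>_def algebra_simps)
  qed
  have n: "\<mu> \<notin> Idx a (\<not> a) True True i j" "\<mu> \<notin> Idx True True a (\<not> a) i j" for a
    using neg by (auto simp: Idx_def idx1_def)
  have "avoids \<mu> (s a)" for a by (rule avoids_section[OF s(1) _ _ _ n(1)]) auto
  moreover have "avoids \<mu> (t a)" for a by (rule avoids_section[OF t(1) _ _ _ n(2)]) auto
  ultimately have "avoids \<mu> (\<lambda>v w. (t True v w - t False v w) - (s True v w - s False v w))" by (intro avoids_diff)
  from not_avoids_mono2[OF \<mu> this main] show False .
qed

text \<open>The cohomological degree is the number of factors in which the exponents are
  negative.\<close>

lemma same_sign_occurs:
  assumes \<mu>: "\<mu> \<in> Idx True True True True i j" "same_sign (fst \<mu>)" "same_sign (snd \<mu>)"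
  shows "\<exists>k. occurs \<zeta> L k (\<lambda>g. twist_chr \<zeta> i j g * chr \<zeta> (wt \<mu>) g)"
proof -
  obtain p q c p' q' c' where e: "\<mu> = ((p, q, c), (p', q', c'))" by (metis surj_pair)
  have s: "p < 0 \<longleftrightarrow> q < 0" "p' < 0 \<longleftrightarrow> q' < 0" using \<mu>(2,3) by (auto simp: e same_sign_def)
  have I: "\<mu> \<in> Idx (p < 0) (p < 0) (p' < 0) (p' < 0) i j" using \<mu>(1) s by (auto simp: e Idx_def idx1_def)
  show ?thesis
    using occurs_00[of \<mu>] occurs_10[of \<mu>] occurs_01[of \<mu>] occurs_11[of \<mu>] I s
    by (cases "p < 0"; cases "p' < 0") (auto simp: e)
qed

end

subsection \<open>Characters\<close>

lemma Rep5_of_int: "Rep_bit1 (of_int z :: 5) = z mod 5"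
  using bit1.of_int_eq[where 'a = 2, of z] bit1.Rep_Abs_mod[where 'a = 2, of z] by simp

lemma of_int5_eq_iff: "(of_int a :: 5) = of_int b \<longleftrightarrow> a mod 5 = b mod 5"
  unfolding Rep_bit1_inject[symmetric] Rep5_of_int ..

lemma rpow_of_int: "primitive_root5 \<zeta> \<Longrightarrow> rpow \<zeta> (of_int z) = \<zeta> ^ nat (z mod 5)"
  by (simp add: rpow_def Rep5_of_int)

lemma root_powers_inj:
  assumes z: "primitive_root5 \<zeta>" and m: "m < 5" "n < 5" and e: "\<zeta> ^ m = \<zeta> ^ n"
  shows "m = n"
proof -
  have z0: "\<zeta> \<noteq> 0" using z by (auto simp: primitive_root5_def)
  have *: "m = n" if "m \<le> n" "n < 5" "\<zeta> ^ m = \<zeta> ^ n" for m n :: nat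
  proof (rule ccontr)
    assume "m \<noteq> n"
    with that have "n - m \<in> {1..<5}" by auto
    hence "\<zeta> ^ (n - m) \<noteq> 1" using z by (auto simp: primitive_root5_def)
    moreover have "\<zeta> ^ n = \<zeta> ^ (n - m) * \<zeta> ^ m" using that(1) by (simp add: power_add[symmetric])
    ultimately show False using that(3) z0 by simp
  qed
  show ?thesis using *[of m n] *[of n m] m e by (cases "m \<le> n") auto
qed

lemma chr_eq_iff:
  assumes z: "primitive_root5 \<zeta>"
  shows "chr \<zeta> (of_int a, of_int b) = chr \<zeta> (of_int c, of_int d) \<longleftrightarrow> a mod 5 = c mod 5 \<and> b mod 5 = d mod 5"
proof
  have inj: "a mod 5 = c mod 5" if "rpow \<zeta> (of_int a) = rpow \<zeta> (of_int c)" for a c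
  proof -
    have "nat (a mod 5) = nat (c mod 5)"
      by (rule root_powers_inj[OF z]) (use that in \<open>simp_all add: rpow_of_int[OF z] nat_less_iff\<close>)
    thus ?thesis by (simp add: eq_nat_nat_iff)
  qed
  assume e: "chr \<zeta> (of_int a, of_int b) = chr \<zeta> (of_int c, of_int d)"
  have "rpow \<zeta> (of_int a) = rpow \<zeta> (of_int c)" using fun_cong[OF e, of "(1, 0)"] by (simp add: chr_def)
  moreover have "rpow \<zeta> (of_int b) = rpow \<zeta> (of_int d)" using fun_cong[OF e, of "(0, 1)"] by (simp add: chr_def)
  ultimately show "a mod 5 = c mod 5 \<and> b mod 5 = d mod 5" using inj by blast
next
  assume "a mod 5 = c mod 5 \<and> b mod 5 = d mod 5"
  thus "chr \<zeta> (of_int a, of_int b) = chr \<zeta> (of_int c, of_int d)" unfolding of_int5_eq_iff[symmetric] by simp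
qed

text \<open>The five powers of \<zeta> are distinct, and there are only five fifth roots of
  unity.\<close>

lemma fifth_root_power:
  assumes z: "primitive_root5 \<zeta>" and x: "x ^ 5 = 1"
  shows "\<exists>k<5. x = \<zeta> ^ k"
proof -
  have "inj_on (\<lambda>k. \<zeta> ^ k) {..<5}" by (intro inj_onI) (use root_powers_inj[OF z] in auto)
  hence c: "card ((\<lambda>k. \<zeta> ^ k) ` {..<5}) = 5" by (simp add: card_image)
  have r: "card {z::complex. z ^ 5 = 1} = 5" using card_roots_unity_eq[of 5] by simp
  hence fin: "finite {z::complex. z ^ 5 = 1}" by (intro card_ge_0_finite) simp
  have "(\<zeta> ^ k) ^ 5 = 1" for k
  proof -
    have "(\<zeta> ^ k) ^ 5 = (\<zeta> ^ 5) ^ k" by (simp only: power_mult[symmetric] mult.commute)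
    thus ?thesis using z by (simp add: primitive_root5_def)
  qed
  hence "(\<lambda>k. \<zeta> ^ k) ` {..<5} \<subseteq> {z. z ^ 5 = 1}" by blast
  from card_subset_eq[OF fin this] c r have "(\<lambda>k. \<zeta> ^ k) ` {..<5} = {z. z ^ 5 = 1}" by simp
  with x show ?thesis by blast
qed

lemma characters_chr:
  assumes z: "primitive_root5 \<zeta>" and \<psi>: "\<psi> \<in> characters"
  shows "\<exists>X\<in>{0..<5}. \<exists>Y\<in>{0..<5}. \<psi> = chr \<zeta> (of_int X, of_int Y)"
proof -
  have add: "\<psi> (g + h) = \<psi> g * \<psi> h" and nz: "\<psi> g \<noteq> 0" for g h using \<psi> unfolding characters_def by blast+
  have zero: "\<psi> 0 = 1" using add[of 0 0] nz[of 0] by simp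
  have pow: "\<psi> (of_nat n * a, of_nat n * b) = \<psi> (a, b) ^ n" for n a b
  proof (induction n)
    case 0
    thus ?case using zero by (simp add: zero_prod_def)
  next
    case (Suc n)
    have "\<psi> (of_nat (Suc n) * a, of_nat (Suc n) * b) = \<psi> ((a, b) + (of_nat n * a, of_nat n * b))"
      by (simp add: distrib_right)
    thus ?case unfolding add Suc by simp
  qed
  have five: "(of_nat 5 :: 5) = 0" using of_int5_eq_iff[of 5 0] by simp
  have root: "\<psi> (a, b) ^ 5 = 1" for a b
    using pow[of 5 a b] zero unfolding five by (simp add: zero_prod_def)
  obtain k where k: "k < 5" "\<psi> (1, 0) = \<zeta> ^ k" using fifth_root_power[OF z root] by blast
  obtain l where l: "l < 5" "\<psi> (0, 1) = \<zeta> ^ l" using fifth_root_power[OF z root] by blast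
  have r: "rpow \<zeta> (of_nat m * of_nat n) = (\<zeta> ^ m) ^ n" if "m < 5" for m n
  proof -
    have "\<zeta> ^ m = rpow \<zeta> (of_int (int m))" unfolding rpow_of_int[OF z] using that by simp
    hence "(\<zeta> ^ m) ^ n = rpow \<zeta> (of_nat n * of_nat m)" using rpow_power[OF z] by simp
    thus ?thesis by (simp add: mult.commute)
  qed
  have "\<psi> g = chr \<zeta> (of_int (int k), of_int (int l)) g" for g
  proof -
    have ex: "\<exists>n. (x :: 5) = of_nat n" for x
    proof (cases x rule: bit1_cases)
      case (of_int y)
      thus ?thesis by (intro exI[of _ "nat y"]) simp
    qed
    obtain m n where g: "g = (of_nat m, of_nat n)" using ex[of "fst g"] ex[of "snd g"] by (metis prod.collapse)
    have "\<psi> g = \<psi> ((of_nat m * 1, of_nat m * 0) + (of_nat n * 0, of_nat n * 1))" by (simp add: g)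
    also have "\<dots> = (\<zeta> ^ k) ^ m * (\<zeta> ^ l) ^ n" unfolding add pow k(2) l(2) ..
    also have "\<dots> = chr \<zeta> (of_int (int k), of_int (int l)) g"
      by (simp add: chr_apply g rpow_add[OF z] r[OF k(1)] r[OF l(1)])
    finally show ?thesis .
  qed
  thus ?thesis using k(1) l(1) by (intro bexI[of _ "int k"] bexI[of _ "int l"]) auto
qed

lemma chr_characters: "primitive_root5 \<zeta> \<Longrightarrow> chr \<zeta> x \<in> characters"
  unfolding characters_def by (auto simp: chr_nonzero chr_add)

subsection \<open>Occurring weights\<close>

text \<open>A nonnegative p with residue a is at least a, and a negative one is at most a - 5;
  likewise for q. With 0 \<le> c \<le> 4 this bounds i. Conversely, the free multiples of 5 and the
  five values of c reach every degree beyond these bounds.\<close>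

lemma same_sign_residues:
  assumes "0 \<le> a" "a < 5" "0 \<le> b" "b < (5::int)"
  shows "(\<exists>p q c. (p, q, c) \<in> idx1 True True i \<and> same_sign (p, q, c) \<and> p mod 5 = a \<and> q mod 5 = b) \<longleftrightarrow>
    a + b \<le> i \<or> i + 6 \<le> a + b"
proof
  assume "\<exists>p q c. (p, q, c) \<in> idx1 True True i \<and> same_sign (p, q, c) \<and> p mod 5 = a \<and> q mod 5 = b"
  then obtain p q c where *: "p + q + int c = i" "c \<le> 4" "p \<ge> 0 \<longleftrightarrow> q \<ge> 0" "p mod 5 = a" "q mod 5 = b"
    by (auto simp: idx1_def same_sign_def)
  show "a + b \<le> i \<or> i + 6 \<le> a + b"
  proof (cases "p \<ge> 0")
    case True
    have "p mod 5 \<le> p" "q mod 5 \<le> q" using True *(3) by presburger+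
    thus ?thesis using * by linarith
  next
    case False
    have "p \<le> p mod 5 - 5" "q \<le> q mod 5 - 5" using False *(3) by presburger+
    thus ?thesis using * by linarith
  qed
next
  \<comment> \<open>The exponent of the third coordinate is forced modulo 5 by the degree and the
    residues a, b; k counts the multiples of 5 left for p and q.\<close>
  define r where "r = (i - a - b) mod 5"
  have r: "0 \<le> r" "r < 5" by (simp_all add: r_def)
  define k where "k = (i - a - b) div 5"
  have k: "i = a + b + 5 * k + r" by (simp add: k_def r_def)
  assume "a + b \<le> i \<or> i + 6 \<le> a + b"
  thus "\<exists>p q c. (p, q, c) \<in> idx1 True True i \<and> same_sign (p, q, c) \<and> p mod 5 = a \<and> q mod 5 = b"
  proof
    assume "a + b \<le> i"
    hence "k \<ge> 0" using k r by linarith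
    hence "(a + 5 * k, b, nat r) \<in> idx1 True True i" "same_sign (a + 5 * k, b, nat r)"
      using assms r k by (simp_all add: idx1_def same_sign_def)
    moreover have "(a + 5 * k) mod 5 = a" "b mod 5 = b" using assms by (simp_all only: mod_mult_self2 mod_pos_pos_trivial)
    ultimately show ?thesis by blast
  next
    assume "i + 6 \<le> a + b"
    hence "k \<le> -2" using k r by linarith
    \<comment> \<open>One negative multiple of 5 goes to q to make it negative; k \<le> -2 leaves at
      least one for p.\<close>
    hence "(a + 5 * (k + 1), b - 5, nat r) \<in> idx1 True True i" "same_sign (a + 5 * (k + 1), b - 5, nat r)"
      using assms r k by (simp_all add: idx1_def same_sign_def)
    moreover have "(a + 5 * (k + 1)) mod 5 = a" "(b - 5) mod 5 = b"
      using assms mod_mult_self2[of b 5 "-1"] by (simp_all only: mod_mult_self2 mod_pos_pos_trivial) simp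
    ultimately show ?thesis by blast
  qed
qed

definition grid :: "(int \<times> int) list" where
  "grid = List.product [0, 1, 2, 3, 4] [0, 1, 2, 3, 4]"

text \<open>By \<open>same_sign_residues\<close> only the sums of the two exponents modulo 5 on each factor matter; these are the
  possible pairs of sums for the character \<open>[u, v]\<close> before twisting.\<close>

definition sum_pairs :: "int \<Rightarrow> int \<Rightarrow> (int \<times> int) list" where
  "sum_pairs u v = map (\<lambda>(a, b). ((u - 2 * a - 4 * b) mod 5 + (v - a - 3 * b) mod 5, a + b)) grid"

definition hits :: "int \<Rightarrow> int \<Rightarrow> int \<times> int \<Rightarrow> bool" where
  "hits i j = (\<lambda>(s, t). (s \<le> i \<or> i + 6 \<le> s) \<and> (t \<le> j \<or> j + 6 \<le> t))"

definition acyc :: "int \<Rightarrow> int \<Rightarrow> int \<times> int \<Rightarrow> bool" where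
  "acyc i j = (\<lambda>(X, Y). \<not> list_ex (hits i j) (sum_pairs ((X - 3 * i - 3 * j) mod 5) ((Y - 3 * i - 2 * j) mod 5)))"

lemma set_grid: "set grid = {0..<5} \<times> {0..<5}"
proof -
  have "{0, 1, 2, 3, 4} = {0..<5 :: int}" by auto
  thus ?thesis unfolding grid_def set_product by simp
qed

lemma set_sum_pairs: "set (sum_pairs u v) = {((u - 2 * a - 4 * b) mod 5 + (v - a - 3 * b) mod 5, a + b) | a b. 0 \<le> a \<and> a < 5 \<and> 0 \<le> b \<and> b < 5}"
  unfolding sum_pairs_def set_map set_grid by (auto simp: image_iff) (metis atLeastLessThan_iff)

text \<open>In the weight, p and q occur with coefficient 1, each in its own component. So the
  residues a, b of the second factor can be prescribed freely and determine those of the first, and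
  the two factors are then independent conditions.\<close>

lemma weight_iff:
  assumes "0 \<le> X" "X < 5" "0 \<le> Y" "Y < 5"
  shows "(\<exists>\<mu>\<in>Idx True True True True i j. same_sign (fst \<mu>) \<and> same_sign (snd \<mu>) \<and>
      (case \<mu> of ((p, q, c), (p', q', c')) \<Rightarrow> (p + 2 * p' + 4 * q' + 3 * i + 3 * j) mod 5 = X \<and> (q + p' + 3 * q' + 3 * i + 2 * j) mod 5 = Y))
    \<longleftrightarrow> \<not> acyc i j (X, Y)"
proof -
  let ?u = "X - 3 * i - 3 * j" and ?v = "Y - 3 * i - 2 * j"
  let ?A = "\<lambda>a b. (?u - 2 * a - 4 * b) mod 5" and ?B = "\<lambda>a b. (?v - a - 3 * b) mod 5"
  have eqs: "(p + 2 * p' + 4 * q' + 3 * i + 3 * j) mod 5 = X \<longleftrightarrow> p mod 5 = ?A (p' mod 5) (q' mod 5)"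
    "(q + p' + 3 * q' + 3 * i + 2 * j) mod 5 = Y \<longleftrightarrow> q mod 5 = ?B (p' mod 5) (q' mod 5)" for p q p' q'
  proof -
    have X: "X mod 5 = X" "Y mod 5 = Y" using assms by simp_all
    obtain k l where kl: "p' mod 5 = p' - 5 * k" "q' mod 5 = q' - 5 * l"
      using minus_mult_div_eq_mod[symmetric] by blast
    have A: "?A (p' mod 5) (q' mod 5) = (?u - 2 * p' - 4 * q') mod 5"
      unfolding mod_eq_dvd_iff by (intro dvdI[of _ _ "2 * k + 4 * l"]) (simp add: kl algebra_simps)
    have B: "?B (p' mod 5) (q' mod 5) = (?v - p' - 3 * q') mod 5"
      unfolding mod_eq_dvd_iff by (intro dvdI[of _ _ "k + 3 * l"]) (simp add: kl algebra_simps)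
    have "(p + 2 * p' + 4 * q' + 3 * i + 3 * j) mod 5 = X mod 5 \<longleftrightarrow> p mod 5 = (?u - 2 * p' - 4 * q') mod 5"
      "(q + p' + 3 * q' + 3 * i + 2 * j) mod 5 = Y mod 5 \<longleftrightarrow> q mod 5 = (?v - p' - 3 * q') mod 5"
      unfolding mod_eq_dvd_iff by (simp_all add: algebra_simps)
    thus "(p + 2 * p' + 4 * q' + 3 * i + 3 * j) mod 5 = X \<longleftrightarrow> p mod 5 = ?A (p' mod 5) (q' mod 5)"
      "(q + p' + 3 * q' + 3 * i + 2 * j) mod 5 = Y \<longleftrightarrow> q mod 5 = ?B (p' mod 5) (q' mod 5)" unfolding A B X .
  qed
  define A B where "A = ?A" and "B = ?B"
  define M where "M i p q c \<longleftrightarrow> (p, q, c) \<in> idx1 True True i \<and> same_sign (p, q, c)" for i p q c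
  have "(\<exists>\<mu>\<in>Idx True True True True i j. same_sign (fst \<mu>) \<and> same_sign (snd \<mu>) \<and>
      (case \<mu> of ((p, q, c), (p', q', c')) \<Rightarrow> (p + 2 * p' + 4 * q' + 3 * i + 3 * j) mod 5 = X \<and> (q + p' + 3 * q' + 3 * i + 2 * j) mod 5 = Y))
    \<longleftrightarrow> (\<exists>p q c p' q' c'. M i p q c \<and> M j p' q' c' \<and> p mod 5 = A (p' mod 5) (q' mod 5) \<and> q mod 5 = B (p' mod 5) (q' mod 5))"
    unfolding Idx_def A_def B_def M_def eqs[symmetric] Bex_def split_paired_Ex
    by (simp only: mem_Times_iff fst_conv snd_conv prod.case) blast
  also have "\<dots> \<longleftrightarrow> (\<exists>a b. (0 \<le> a \<and> a < 5 \<and> 0 \<le> b \<and> b < 5) \<and> (\<exists>p q c. M j p q c \<and> p mod 5 = a \<and> q mod 5 = b) \<and>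
      (\<exists>p q c. M i p q c \<and> p mod 5 = A a b \<and> q mod 5 = B a b))"
    (is "?L \<longleftrightarrow> ?R")
  proof
    assume ?L
    then obtain p q c p' q' c' where *: "M j p' q' c'" "M i p q c"
      "p mod 5 = A (p' mod 5) (q' mod 5)" "q mod 5 = B (p' mod 5) (q' mod 5)" by (elim exE conjE)
    show ?R
      by (rule exI[of _ "p' mod 5"], rule exI[of _ "q' mod 5"], intro conjI,
          simp, simp, simp, simp, use * in blast, use * in blast)
  next
    assume ?R
    then obtain a b p q c p' q' c' where *: "M j p' q' c'" "p' mod 5 = a" "q' mod 5 = b"
      "M i p q c" "p mod 5 = A a b" "q mod 5 = B a b" by (elim exE conjE)
    from *(1,4,5,6) show ?L unfolding *(2,3)[symmetric] by blast
  qed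
  also have "\<dots> \<longleftrightarrow> (\<exists>a b. (0 \<le> a \<and> a < 5 \<and> 0 \<le> b \<and> b < 5) \<and> hits i j (A a b + B a b, a + b))"
  proof (intro ex_cong1 conj_cong refl)
    fix a b :: int assume ab: "0 \<le> a \<and> a < 5 \<and> 0 \<le> b \<and> b < 5"
    have AB: "0 \<le> A a b" "A a b < 5" "0 \<le> B a b" "B a b < 5" by (simp_all add: A_def B_def)
    show "(\<exists>p q c. M j p q c \<and> p mod 5 = a \<and> q mod 5 = b) \<and> (\<exists>p q c. M i p q c \<and> p mod 5 = A a b \<and> q mod 5 = B a b)
      \<longleftrightarrow> hits i j (A a b + B a b, a + b)"
      using ab unfolding M_def conj_assoc same_sign_residues[OF AB, of i] hits_def
      by (subst same_sign_residues) auto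
  qed
  also have "\<dots> \<longleftrightarrow> \<not> acyc i j (X, Y)"
  proof -
    have "A a b = ((X - 3 * i - 3 * j) mod 5 - 2 * a - 4 * b) mod 5" "B a b = ((Y - 3 * i - 2 * j) mod 5 - a - 3 * b) mod 5" for a b
      unfolding A_def B_def by (metis mod_diff_left_eq)+
    thus ?thesis unfolding acyc_def list_ex_iff set_sum_pairs by auto
  qed
  finally show ?thesis .
qed

section \<open>Acyclic sets as a finite combinatorial condition\<close>

context line_bundle
begin

text \<open>The two halves of the cohomology computation meet here: \<open>same_sign_occurs\<close>
  turns a monomial into an occurring character, \<open>not_occurs\<close> turns the absence of
  monomials into acyclicity.\<close>

lemma chr_acyclic_iff:
  assumes XY: "0 \<le> X" "X < 5" "0 \<le> Y" "Y < 5"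
  shows "chr \<zeta> (of_int X, of_int Y) \<in> acyclic_set \<zeta> (K \<zeta> i j) \<longleftrightarrow> acyc i j (X, Y)"
proof -
  let ?\<psi> = "chr \<zeta> (of_int X, of_int Y)"
  have tw: "(\<lambda>g. twist_chr \<zeta> i j g * chr \<zeta> (wt \<mu>) g) = ?\<psi> \<longleftrightarrow>
     (case \<mu> of ((p, q, c), (p', q', c')) \<Rightarrow> (p + 2 * p' + 4 * q' + 3 * i + 3 * j) mod 5 = X \<and> (q + p' + 3 * q' + 3 * i + 2 * j) mod 5 = Y)" for \<mu>
  proof -
    obtain p q c p' q' c' where e: "\<mu> = ((p, q, c), (p', q', c'))" by (metis surj_pair)
    have *: "(\<lambda>g. twist_chr \<zeta> i j g * chr \<zeta> (wt \<mu>) g) =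
        chr \<zeta> (of_int (p + 2 * p' + 4 * q' + 3 * i + 3 * j), of_int (q + p' + 3 * q' + 3 * i + 2 * j))"
      by (rule ext) (simp add: twist_chr_def chr_apply e wt_def rpow_add[OF prim, symmetric] algebra_simps)
    show ?thesis unfolding * unfolding e prod.case chr_eq_iff[OF prim] using XY by simp
  qed
  have div: "(\<lambda>g. twist_chr \<zeta> i j g * chr \<zeta> (wt \<mu>) g) = ?\<psi> \<longleftrightarrow> chr \<zeta> (wt \<mu>) = (\<lambda>g. ?\<psi> g / twist_chr \<zeta> i j g)" for \<mu>
  proof -
    have "twist_chr \<zeta> i j g * chr \<zeta> (wt \<mu>) g = ?\<psi> g \<longleftrightarrow> chr \<zeta> (wt \<mu>) g = ?\<psi> g / twist_chr \<zeta> i j g" for g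
      using chr_nonzero[OF prim] by (auto simp: twist_chr_def field_simps)
    thus ?thesis unfolding fun_eq_iff by blast
  qed
  show ?thesis
  proof
    assume "?\<psi> \<in> acyclic_set \<zeta> (K \<zeta> i j)"
    hence no: "\<not> (\<exists>k. occurs \<zeta> (K \<zeta> i j) k ?\<psi>)" by (simp add: acyclic_set_def)
    show "acyc i j (X, Y)"
    proof (rule ccontr)
      assume "\<not> acyc i j (X, Y)"
      then obtain \<mu> where \<mu>: "\<mu> \<in> Idx True True True True i j" "same_sign (fst \<mu>)" "same_sign (snd \<mu>)"
        "(\<lambda>g. twist_chr \<zeta> i j g * chr \<zeta> (wt \<mu>) g) = ?\<psi>"
        unfolding weight_iff[OF XY, symmetric] tw by blast
      from same_sign_occurs[OF \<mu>(1-3)] no show False unfolding \<mu>(4) by blast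
    qed
  next
    assume ac: "acyc i j (X, Y)"
    have noW: "no_weight \<zeta> i j (\<lambda>g. ?\<psi> g / twist_chr \<zeta> i j g)"
      unfolding no_weight_def
    proof (intro ballI impI)
      fix \<mu> assume "\<mu> \<in> Idx True True True True i j" "chr \<zeta> (wt \<mu>) = (\<lambda>g. ?\<psi> g / twist_chr \<zeta> i j g)"
      thus "\<not> (same_sign (fst \<mu>) \<and> same_sign (snd \<mu>))"
        using ac weight_iff[OF XY, of i j] tw[of \<mu>] div[of \<mu>] by blast
    qed
    from not_occurs[OF chr_characters[OF prim] this] chr_characters[OF prim]
    show "?\<psi> \<in> acyclic_set \<zeta> (K \<zeta> i j)" by (simp add: acyclic_set_def)
  qed
qed

lemma acyclic_set_grid:
  "acyclic_set \<zeta> (K \<zeta> i j) = (\<lambda>(X, Y). chr \<zeta> (of_int X, of_int Y)) ` set (filter (acyc i j) grid)"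
proof -
  have "\<psi> \<in> acyclic_set \<zeta> (K \<zeta> i j) \<longleftrightarrow> (\<exists>X\<in>{0..<5}. \<exists>Y\<in>{0..<5}. acyc i j (X, Y) \<and> \<psi> = chr \<zeta> (of_int X, of_int Y))" for \<psi>
  proof
    assume \<psi>: "\<psi> \<in> acyclic_set \<zeta> (K \<zeta> i j)"
    hence "\<psi> \<in> characters" by (simp add: acyclic_set_def)
    from characters_chr[OF prim this] obtain X Y where "X \<in> {0..<5}" "Y \<in> {0..<5}" "\<psi> = chr \<zeta> (of_int X, of_int Y)" by blast
    moreover from this \<psi> chr_acyclic_iff[of X Y] have "acyc i j (X, Y)" by simp
    ultimately show "\<exists>X\<in>{0..<5}. \<exists>Y\<in>{0..<5}. acyc i j (X, Y) \<and> \<psi> = chr \<zeta> (of_int X, of_int Y)" by blast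
  qed (use chr_acyclic_iff in auto)
  thus ?thesis unfolding set_filter set_grid by auto
qed

end

text \<open>Sums of two residues lie between 0 and 8. If one degree is outside the window, the
  condition on that factor holds for all sums, and on the other factor one can reach the sum 0 or
  the sum 8, one of which always satisfies its condition.\<close>

lemma acyc_outside:
  assumes "acyc i j (X, Y)"
  shows "-5 \<le> i \<and> i \<le> 7 \<and> -5 \<le> j \<and> j \<le> 7"
proof (rule ccontr)
  assume out: "\<not> ?thesis"
  let ?u = "(X - 3 * i - 3 * j) mod 5" and ?v = "(Y - 3 * i - 2 * j) mod 5"
  have no: "\<not> hits i j ((?u - 2 * a - 4 * b) mod 5 + (?v - a - 3 * b) mod 5, a + b)" if "0 \<le> a" "a < 5" "0 \<le> b" "b < 5" for a b
    using assms that unfolding acyc_def list_ex_iff prod.case set_sum_pairs by blast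
  have bd: "0 \<le> (x::int) mod 5 \<and> x mod 5 \<le> 4" for x by presburger
  consider "i < -5 \<or> 7 < i" | "j < -5 \<or> 7 < j" using out by linarith
  thus False
  proof cases
    case 1
    have "hits i j ((?u - 2 * a - 4 * b) mod 5 + (?v - a - 3 * b) mod 5, a + b)" if "a + b \<le> j \<or> j + 6 \<le> a + b" for a b
      unfolding hits_def prod.case using 1 that bd[of "?u - 2 * a - 4 * b"] bd[of "?v - a - 3 * b"] by linarith
    \<comment> \<open>The sum 0 works for j \<ge> 0 and the sum 8 for j < 0.\<close>
    from this[of 0 0] this[of 4 4] no[of 0 0] no[of 4 4] show False by (cases "j \<ge> 0") auto
  next
    case 2
    \<comment> \<open>The common residue wanted for both exponents of the first factor, giving the
      sum 0 or 8.\<close>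
    define s where "s = (if i \<ge> 0 then 0 else 4 :: int)"
    \<comment> \<open>The solution modulo 5 of the system 2 a + 4 b = u - s and a + 3 b = v - s.
      Eliminating a gives -2 b = (u - s) - 2 (v - s), and 2 is the inverse of -2 modulo 5.\<close>
    define b where "b = (2 * ((?u - s) - 2 * (?v - s))) mod 5"
    define a where "a = ((?v - s) - 3 * b) mod 5"
    have ab: "0 \<le> a" "a < 5" "0 \<le> b" "b < 5" by (simp_all add: a_def b_def)
    obtain k l where kl: "a = ?v - s - 3 * b - 5 * k" "b = 2 * (?u - s - 2 * (?v - s)) - 5 * l"
      unfolding a_def b_def using minus_mult_div_eq_mod[symmetric] by blast
    have "?u - 2 * a - 4 * b - s = 5 * (?u - s - 2 * (?v - s) + 2 * k - 2 * l)" using kl by (simp add: algebra_simps)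
    moreover have "?v - a - 3 * b - s = 5 * k" using kl(1) by simp
    ultimately have "(?u - 2 * a - 4 * b) mod 5 = s mod 5" "(?v - a - 3 * b) mod 5 = s mod 5"
      unfolding mod_eq_dvd_iff dvd_def by blast+
    hence "(?u - 2 * a - 4 * b) mod 5 = s" "(?v - a - 3 * b) mod 5 = s" by (simp_all add: s_def)
    moreover have "s + s \<le> i \<or> i + 6 \<le> s + s" by (simp add: s_def)
    moreover have "a + b \<le> j \<or> j + 6 \<le> a + b" using 2 ab by linarith
    ultimately show False using no[OF ab] by (simp add: hits_def)
  qed
qed

definition listed :: "(int \<times> int) set" where
  "listed = {(1,-2),(1,-1),(1,0),(1,1),(1,2),(1,3),(1,4),(-1,1),(0,1),(2,1),(3,1)}"

definition row_hit :: "int \<Rightarrow> bool" where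
  "row_hit i \<longleftrightarrow> list_all (\<lambda>j. (i, j) \<in> listed \<or> list_all (\<lambda>x. \<not> acyc i j x) grid) [-5..7]"

lemma acyc_values:
  "filter (acyc 1 (-2)) grid = [(0,0)]"
  "filter (acyc 1 (-1)) grid = [(0,3),(2,0),(3,2)]"
  "filter (acyc 1 0) grid = [(0,0),(0,1),(0,2),(1,4),(2,3),(3,0),(4,0)]"
  "filter (acyc 1 1) grid = [(0,0),(1,2),(2,1),(2,2),(3,3),(3,4),(4,3)]"
  "filter (acyc 1 2) grid = [(0,0),(0,3),(0,4),(1,0),(2,0),(3,2),(4,1)]"
  "filter (acyc 1 3) grid = [(0,2),(2,3),(3,0)]"
  "filter (acyc 1 4) grid = [(0,0)]"
  "filter (acyc (-1) 1) grid = [(0,0)]"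
  "filter (acyc 0 1) grid = [(0,0),(3,3),(3,4),(4,3)]"
  "filter (acyc 2 1) grid = [(0,0),(1,2),(2,1),(2,2)]"
  "filter (acyc 3 1) grid = [(0,0)]"
  by code_simp+

lemma row_hit_window:
  "list_all row_hit [-5..-3]"
  "list_all row_hit [-2..0]"
  "list_all row_hit [1..3]"
  "list_all row_hit [4..7]"
  subgoal by code_simp
  subgoal by code_simp
  subgoal by code_simp
  subgoal by code_simp
  done

lemma acyc_listed:
  assumes "filter (acyc i j) grid \<noteq> []"
  shows "(i, j) \<in> listed"
proof -
  obtain X Y where XY: "(X, Y) \<in> set grid" "acyc i j (X, Y)"
    using assms unfolding filter_empty_conv by auto
  from acyc_outside[OF XY(2)] have i: "i \<in> {-5..-3} \<union> {-2..0} \<union> {1..3} \<union> {4..7}" and j: "j \<in> {-5..7}" by auto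
  from i have "row_hit i" using row_hit_window unfolding list_all_iff set_upto by blast
  with j XY show ?thesis unfolding row_hit_def list_all_iff set_upto by blast
qed

theorem lemma3p3:
  fixes \<zeta> :: complex
  assumes "primitive_root5 \<zeta>"
  shows "acyclic_set \<zeta> (K \<zeta> 1 (-2)) = chr \<zeta> ` {(0,0)}
    \<and> acyclic_set \<zeta> (K \<zeta> 1 (-1)) = chr \<zeta> ` {(0,3),(2,0),(3,2)}
    \<and> acyclic_set \<zeta> (K \<zeta> 1 0) = chr \<zeta> ` {(0,0),(0,1),(0,2),(1,4),(2,3),(3,0),(4,0)}
    \<and> acyclic_set \<zeta> (K \<zeta> 1 1) = chr \<zeta> ` {(0,0),(1,2),(2,1),(2,2),(3,3),(3,4),(4,3)}
    \<and> acyclic_set \<zeta> (K \<zeta> 1 2) = chr \<zeta> ` {(0,0),(0,3),(0,4),(1,0),(2,0),(3,2),(4,1)}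
    \<and> acyclic_set \<zeta> (K \<zeta> 1 3) = chr \<zeta> ` {(0,2),(2,3),(3,0)}
    \<and> acyclic_set \<zeta> (K \<zeta> 1 4) = chr \<zeta> ` {(0,0)}
    \<and> acyclic_set \<zeta> (K \<zeta> (-1) 1) = chr \<zeta> ` {(0,0)}
    \<and> acyclic_set \<zeta> (K \<zeta> 0 1) = chr \<zeta> ` {(0,0),(3,3),(3,4),(4,3)}
    \<and> acyclic_set \<zeta> (K \<zeta> 2 1) = chr \<zeta> ` {(0,0),(1,2),(2,1),(2,2)}
    \<and> acyclic_set \<zeta> (K \<zeta> 3 1) = chr \<zeta> ` {(0,0)}
    \<and> (\<forall>i j :: int. acyclic_set \<zeta> (K \<zeta> i j) \<noteq> {} \<longrightarrow>
        (i, j) \<in> {(1,-2),(1,-1),(1,0),(1,1),(1,2),(1,3),(1,4),(-1,1),(0,1),(2,1),(3,1)})"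
proof -
  have grid: "acyclic_set \<zeta> (K \<zeta> i j) = (\<lambda>(X, Y). chr \<zeta> (of_int X, of_int Y)) ` set (filter (acyc i j) grid)" for i j
    by (rule line_bundle.acyclic_set_grid[OF line_bundle.intro[OF assms]])
  have listed: "acyclic_set \<zeta> (K \<zeta> i j) \<noteq> {} \<longrightarrow> (i, j) \<in> listed" for i j
    using acyc_listed[of i j] unfolding grid by blast
  have val: "acyclic_set \<zeta> (K \<zeta> i j) = chr \<zeta> ` set (map (\<lambda>(X, Y). (of_int X, of_int Y)) xs)"
    if "filter (acyc i j) grid = xs" for i j xs
    unfolding grid that set_map image_image by (simp add: case_prod_unfold)
  note ev = list.map list.set prod.case of_int_numeral of_int_0 of_int_1
  show ?thesis
    by (intro conjI allI acyc_values[THEN val, unfolded ev] listed[unfolded listed_def])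
qed

end
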